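(* Assume the Unique Games Conjecture. Let $H$ be any fixed directed bipartite graph and let $\varepsilon>0$ be any fixed constant. Then there is no polynomial-time $(\alpha_H - \varepsilon)$-approximation algorithm for Directed Multicut$(H)$.
   Context: Directed Multicut: the input is a directed supply graph $G=(V,E)$ with nonnegative edge weights $w_e$ and a directed simple demand graph $H=(V_H,F)$ with $V_H \subseteq V$. A feasible solution is a set $E'\subseteq E$ such that for every $(s,t)\in F$ there is no directed path from $s$ to $t$ in $G-E'$; the goal is to minimize $\sum_{e\in E'} w_e$. Directed Multicut$(H)$ is the special case in which the demand graph is the fixed graph $H$ (its vertices mapped to vertices of an arbitrary supply graph $G$). The distance LP for an instance is: minimize $\sum_{e\in E} w_e x_e$ subject to $\sum_{e\in p} x_e \ge 1$ for every directed $s$-$t$ path $p$ in $G$ and every $(s,t)\in F$, and $x_e\ge 0$. The flow-cut gap $\alpha_H$ is the supremum, over all instances of Directed Multicut$(H)$, of the ratio between the optimum multicut weight and the optimum value of the distance LP. A directed bipartite graph is one whose vertex set is partitioned into two sets $S,T$ such that every edge goes from a vertex of $S$ to a vertex of $T$. An $\alpha$-approximation algorithm returns a feasible solution of weight at most $\alpha$ times the optimum.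
   Formalization: The Unique Games Conjecture is taken in its NP-hardness form and P ≠ NP is assumed explicitly (if P = NP the conjecture holds trivially and the claim fails); H is assumed to have at least one edge, since otherwise the flow-cut gap is undefined. *)

theory Defs
  imports
    Complex_Main
    "HOL-Library.FuncSet"
    "HOL-Library.Product_Lexorder"
    "HOL-Computational_Algebra.Polynomial"
    "Graph_Theory.Pair_Digraph"
begin

section \<open>Polynomial time\<close>

text \<open>
  Deterministic Turing machines with finitely many two-way infinite tapes.  States and tape
  symbols are initial segments of the naturals.  State 0 is initial and state 1 is halting;
  symbol 0 is blank, and symbols 1 and 2 stand for the input letters False and True.  A transition
  maps the current state and the list of scanned symbols to the next state and, for each tape, the
  symbol to be written and the head movement.
\<close>

record tm =
  tm_tapes :: nat
  tm_states :: nat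
  tm_symbols :: nat
  tm_delta :: "nat \<Rightarrow> nat list \<Rightarrow> nat \<times> (nat \<times> int) list"

definition tm_wf :: "tm \<Rightarrow> bool" where
  "tm_wf M \<longleftrightarrow> 1 \<le> tm_tapes M \<and> 2 \<le> tm_states M \<and> 3 \<le> tm_symbols M \<and>
    (\<forall>q < tm_states M. \<forall>rs. length rs = tm_tapes M \<and> set rs \<subseteq> {..<tm_symbols M} \<longrightarrow>
      fst (tm_delta M q rs) < tm_states M \<and>
      length (snd (tm_delta M q rs)) = tm_tapes M \<and>
      set (snd (tm_delta M q rs)) \<subseteq> {..<tm_symbols M} \<times> {-1, 0, 1})"

type_synonym tm_config = "nat \<times> ((int \<Rightarrow> nat) \<times> int) list"

definition tm_step :: "tm \<Rightarrow> tm_config \<Rightarrow> tm_config" where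
  "tm_step M = (\<lambda>(q, ts).
     if q = 1 then (q, ts)
     else let (q', as) = tm_delta M q (map (\<lambda>(t, h). t h) ts)
          in (q', map2 (\<lambda>(t, h) (s, d). (t(h := s), h + d)) ts as))"

definition letter :: "bool \<Rightarrow> nat" where
  "letter b = (if b then 2 else 1)"

definition word_tape :: "bool list \<Rightarrow> int \<Rightarrow> nat" where
  "word_tape x i = (if 0 \<le> i \<and> i < int (length x) then letter (x ! nat i) else 0)"

definition tm_init :: "tm \<Rightarrow> bool list \<Rightarrow> tm_config" where
  "tm_init M x = (0, (word_tape x, 0) # replicate (tm_tapes M - 1) (\<lambda>_. 0, 0))"

text \<open>The output is read off the first tape, from cell 0 up to the first blank.\<close>

definition tm_outputs :: "tm_config \<Rightarrow> bool list \<Rightarrow> bool" where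
  "tm_outputs c y \<longleftrightarrow> fst c = 1 \<and>
     (let t = fst (hd (snd c))
      in (\<forall>i < length y. t (int i) = letter (y ! i)) \<and> t (int (length y)) = 0)"

definition polytime :: "(bool list \<Rightarrow> bool list) \<Rightarrow> bool" where
  "polytime f \<longleftrightarrow> (\<exists>M (p :: nat poly). tm_wf M \<and>
     (\<forall>x. \<exists>n \<le> poly p (length x). tm_outputs ((tm_step M ^^ n) (tm_init M x)) (f x)))"


section \<open>Encoding of finite objects as words\<close>

text \<open>Numbers are written in binary; all encodings are self-delimiting.\<close>

fun nat_bits :: "nat \<Rightarrow> bool list" where
  "nat_bits n = (if n = 0 then [] else odd n # nat_bits (n div 2))"

declare nat_bits.simps [simp del]

definition enc_list :: "('a \<Rightarrow> bool list) \<Rightarrow> 'a list \<Rightarrow> bool list" where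
  "enc_list f xs = concat (map (\<lambda>x. True # f x) xs) @ [False]"

definition enc_word :: "bool list \<Rightarrow> bool list" where
  "enc_word = enc_list (\<lambda>b. [b])"

definition enc_nat :: "nat \<Rightarrow> bool list" where
  "enc_nat n = enc_word (nat_bits n)"

definition enc_arc :: "nat \<times> nat \<Rightarrow> bool list" where
  "enc_arc e = enc_nat (fst e) @ enc_nat (snd e)"

text \<open>For non-negative rationals only: numerator and denominator in lowest terms.\<close>

definition enc_rat :: "rat \<Rightarrow> bool list" where
  "enc_rat r = enc_nat (nat (fst (quotient_of r))) @ enc_nat (nat (snd (quotient_of r)))"

text \<open>A finite digraph on natural numbers whose arcs carry data encoded by \<open>f\<close>.\<close>

definition enc_digraph :: "(nat \<times> nat \<Rightarrow> bool list) \<Rightarrow> nat pair_pre_digraph \<Rightarrow> bool list" where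
  "enc_digraph f G =
     enc_list enc_nat (sorted_list_of_set (pverts G)) @
     enc_list (\<lambda>e. enc_arc e @ f e) (sorted_list_of_set (parcs G))"


section \<open>P, NP and NP-hardness of promise problems\<close>

definition class_P :: "bool list set set" where
  "class_P = {L. polytime (\<lambda>x. [x \<in> L])}"

definition class_NP :: "bool list set set" where
  "class_NP = {L. \<exists>R \<in> class_P. \<exists>p :: nat poly. \<forall>x.
     x \<in> L \<longleftrightarrow> (\<exists>y. length y \<le> poly p (length x) \<and> enc_word x @ y \<in> R)}"

definition NP_hard_to_distinguish :: "bool list set \<Rightarrow> bool list set \<Rightarrow> bool" where
  "NP_hard_to_distinguish Yes No \<longleftrightarrow> (\<forall>L \<in> class_NP. \<exists>f. polytime f \<and>
     (\<forall>x. (x \<in> L \<longrightarrow> f x \<in> Yes) \<and> (x \<notin> L \<longrightarrow> f x \<in> No)))"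


section \<open>The Unique Games Conjecture\<close>

definition ug_instance ::
    "nat \<Rightarrow> nat pair_pre_digraph \<Rightarrow> (nat \<times> nat \<Rightarrow> nat \<Rightarrow> nat) \<Rightarrow> bool" where
  "ug_instance k G \<pi> \<longleftrightarrow> 1 \<le> k \<and> pair_digraph G \<and> parcs G \<noteq> {} \<and>
     (\<forall>e \<in> parcs G. bij_betw (\<pi> e) {..<k} {..<k})"

definition ug_value ::
    "nat \<Rightarrow> nat pair_pre_digraph \<Rightarrow> (nat \<times> nat \<Rightarrow> nat \<Rightarrow> nat) \<Rightarrow> real" where
  "ug_value k G \<pi> =
     Max ((\<lambda>l. real (card {e \<in> parcs G. \<pi> e (l (fst e)) = l (snd e)}) / real (card (parcs G)))
          ` (pverts G \<rightarrow>\<^sub>E {..<k}))"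

definition ug_encode ::
    "nat \<Rightarrow> nat pair_pre_digraph \<Rightarrow> (nat \<times> nat \<Rightarrow> nat \<Rightarrow> nat) \<Rightarrow> bool list" where
  "ug_encode k G \<pi> = enc_digraph (\<lambda>e. enc_list enc_nat (map (\<pi> e) [0..<k])) G"

definition unique_games_conjecture :: bool where
  "unique_games_conjecture \<longleftrightarrow> (\<forall>\<zeta> > 0. \<forall>\<delta> > 0. \<exists>k.
     NP_hard_to_distinguish
       {ug_encode k G \<pi> |G \<pi>. ug_instance k G \<pi> \<and> ug_value k G \<pi> \<ge> 1 - \<zeta>}
       {ug_encode k G \<pi> |G \<pi>. ug_instance k G \<pi> \<and> ug_value k G \<pi> \<le> \<delta>})"


section \<open>Directed Multicut with a fixed demand graph\<close>

definition directed_bipartite :: "'a pair_pre_digraph \<Rightarrow> bool" where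
  "directed_bipartite H \<longleftrightarrow>
     (\<exists>S T. S \<union> T = pverts H \<and> S \<inter> T = {} \<and> parcs H \<subseteq> S \<times> T)"

definition multicut_instance ::
    "'a pair_pre_digraph \<Rightarrow> 'a pair_pre_digraph \<Rightarrow> ('a \<times> 'a \<Rightarrow> real) \<Rightarrow> bool" where
  "multicut_instance H G w \<longleftrightarrow>
     pair_fin_digraph G \<and> pverts H \<subseteq> pverts G \<and> (\<forall>e \<in> parcs G. 0 \<le> w e)"

definition multicut ::
    "'a pair_pre_digraph \<Rightarrow> 'a pair_pre_digraph \<Rightarrow> ('a \<times> 'a) set \<Rightarrow> bool" where
  "multicut H G E' \<longleftrightarrow> E' \<subseteq> parcs G \<and>
     (\<forall>(s, t) \<in> parcs H. \<not> (\<exists>p. pre_digraph.apath (G\<lparr>parcs := parcs G - E'\<rparr>) s p t))"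

definition multicut_opt ::
    "'a pair_pre_digraph \<Rightarrow> 'a pair_pre_digraph \<Rightarrow> ('a \<times> 'a \<Rightarrow> real) \<Rightarrow> real" where
  "multicut_opt H G w = Min (sum w ` {E'. multicut H G E'})"

definition lp_feasible ::
    "'a pair_pre_digraph \<Rightarrow> 'a pair_pre_digraph \<Rightarrow> ('a \<times> 'a \<Rightarrow> real) \<Rightarrow> bool" where
  "lp_feasible H G x \<longleftrightarrow> (\<forall>e \<in> parcs G. 0 \<le> x e) \<and>
     (\<forall>(s, t) \<in> parcs H. \<forall>p. pre_digraph.apath G s p t \<longrightarrow> (\<Sum>e\<leftarrow>p. x e) \<ge> 1)"

definition lp_opt ::
    "'a pair_pre_digraph \<Rightarrow> 'a pair_pre_digraph \<Rightarrow> ('a \<times> 'a \<Rightarrow> real) \<Rightarrow> real" where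
  "lp_opt H G w = Inf ((\<lambda>x. \<Sum>e\<in>parcs G. w e * x e) ` {x. lp_feasible H G x})"

text \<open>
  Cutting every demand pair separately by a minimum cut shows that the multicut optimum is at most
  the number of demand pairs times the LP optimum.  Hence the supremum is finite, and the only
  ratios left out by the condition on the LP optimum are of the form 0/0.
\<close>

definition flow_cut_gap :: "nat pair_pre_digraph \<Rightarrow> real" where
  "flow_cut_gap H =
     Sup {multicut_opt H G w / lp_opt H G w |G w. multicut_instance H G w \<and> lp_opt H G w > 0}"

text \<open>
  Inputs of algorithms have rational weights.  The algorithm may list the arcs of its solution in
  any order.
\<close>

definition multicut_approx_alg ::
    "nat pair_pre_digraph \<Rightarrow> real \<Rightarrow> (bool list \<Rightarrow> bool list) \<Rightarrow> bool" where
  "multicut_approx_alg H \<alpha> A \<longleftrightarrow>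
     (\<forall>G (w :: nat \<times> nat \<Rightarrow> rat). multicut_instance H G (\<lambda>e. of_rat (w e)) \<longrightarrow>
        (\<exists>es. A (enc_digraph (\<lambda>e. enc_rat (w e)) G) = enc_list enc_arc es \<and>
              multicut H G (set es) \<and>
              (\<Sum>e\<in>set es. of_rat (w e)) \<le> \<alpha> * multicut_opt H G (\<lambda>e. of_rat (w e))))"

end

theory Submission
  imports Defs "HOL-Library.Multiset" "HOL-Combinatorics.Permutations"
begin

text \<open>
  Pick a supply graph \<open>G0\<close> whose gap beats the approximation ratio and round its LP solution to
  lengths \<open>X e / D\<close> and integral weights \<open>W e\<close>.  A unique game is turned into a multicut instance:
  a center consists of a vertex \<open>u\<close> and \<open>t\<close> sampled constraints \<open>(u, v)\<close>, and every center carries,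
  for every arc \<open>e\<close> of \<open>G0\<close> and every \<open>y \<in> {0..D}\<^sup>k\<close>, arcs of weight \<open>W e\<close> that may be cut.  A point
  \<open>y\<close> records a distance from the source for each possible label, and \<open>D\<close> is a wildcard.  A good
  labeling yields a dictator cut, which costs about the LP value of \<open>G0\<close> per center.  Conversely, if
  a cut costs less than the integral optimum of \<open>G0\<close> at many centers, then at such a center one can
  walk along a demand path of \<open>G0\<close> with dense sets of points reachable at every step, until density
  is lost.  Two dense sets without a compatible pair share an influential coordinate (a junta theorem,
  proved by hypercontractivity and Russo's formula), so that the sampled constraints of the center
  agree on a label from short lists; random choices from the lists satisfy a constant fraction of the
  game.  Polynomial time is handled through a small language of stack programs that simulates Turing
  machines and compiles to them.
\<close>

text \<open>The wildcard shapes the proof. It is compatible with everything, so dense sets may be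
  replaced by monotone functions. Their averages are monotone in the wildcard probability, and the
  mean value theorem then finds a bias at which the total influence is bounded. All bounds are
  independent of the number \<open>k\<close> of labels; they have to be, since the conjecture
  supplies \<open>k\<close> only after the soundness error is fixed, and this error depends on the
  list length. The price is that a dictator cuts the fraction \<open>(X e + 1) / (D + 1)\<close> of
  the arcs instead of \<open>X e / D\<close>, which is negligible after scaling. A center has many
  slots because incompatibility yields a common label only between one slot and the set of points
  not reached. With more surviving slots than labels in the list of that set, two slots must agree
  on a label, and this is a statement about two constraints at the same vertex. Bipartiteness keeps
  sources and sinks apart, so that no walk passes through a terminal and gathers distances for the
  wrong demand. An approximate multicut of the constructed graph decides the game, so every language
  in NP would be in P.\<close>

section \<open>Averaging and noise on finite product spaces\<close>

text \<open>Source of Cauchy-Schwarz for \<open>EE\<close>. The cases \<open>c = 0\<close> and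
  \<open>c < 0\<close> are settled by a point at which the quadratic would be negative.\<close>

lemma discriminant_le:
 fixes a b c :: real
 assumes "!!t. 0 <= a + 2 * b * t + c * t\<^sup>2"
 shows "b\<^sup>2 <= a * c"
proof (cases "c = 0")
 case True
 have "b = 0"
 proof (rule ccontr)
  assume "b ~= 0"
  hence "a + 2 * b * (- (a + 1) / (2 * b)) + c * (- (a + 1) / (2 * b))\<^sup>2 = -1"
   using True by (simp add: field_simps)
  thus False using assms[of "- (a + 1) / (2 * b)"] by linarith
 qed
 thus ?thesis using True by simp
next
 case False
 have "0 <= c"
 proof (rule ccontr)
  assume c: "~ 0 <= c"
  define t where "t = max 1 ((\<bar>a\<bar> + 2 * \<bar>b\<bar> + 1) / (-c))"
  have t1: "1 <= t" by (simp add: t_def)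
  have "(\<bar>a\<bar> + 2 * \<bar>b\<bar> + 1) / (-c) <= t" by (simp add: t_def)
  hence "\<bar>a\<bar> + 2 * \<bar>b\<bar> + 1 <= - c * t" using c by (simp add: field_simps)
  hence "(\<bar>a\<bar> + 2 * \<bar>b\<bar> + 1) * t <= - c * t * t" using t1 by (intro mult_right_mono) auto
  moreover have "\<bar>a\<bar> * 1 <= \<bar>a\<bar> * t" using t1 by (intro mult_left_mono) auto
  moreover have "b * t <= \<bar>b\<bar> * t" using t1 by (intro mult_right_mono) auto
  moreover have "(\<bar>a\<bar> + 2 * \<bar>b\<bar> + 1) * t = \<bar>a\<bar> * t + 2 * (\<bar>b\<bar> * t) + t" by (simp add: algebra_simps)
  moreover have "c * t\<^sup>2 = c * t * t" by (simp add: power2_eq_square)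
  ultimately have "a + 2 * b * t + c * t\<^sup>2 < 0" using t1 by linarith
  thus False using assms[of t] by linarith
 qed
 hence c: "0 < c" using False by simp
 have "a + 2 * b * (- b / c) + c * (- b / c)\<^sup>2 = a - b\<^sup>2 / c"
  using c by (simp add: field_simps power2_eq_square)
 hence "b\<^sup>2 / c <= a" using assms[of "- b / c"] by linarith
 thus ?thesis using c by (simp add: field_simps)
qed

lemma sum_list_filter_le:
 fixes g :: "'a => real"
 assumes "!!x. 0 <= g x"
 shows "(\<Sum>x\<leftarrow>filter P xs. g x) <= (\<Sum>x\<leftarrow>xs. g x)"
 by (induction xs) (use assms in "auto intro: add_increasing")

type_synonym point = "nat => nat"
type_synonym pfun = "point => real"

definition indep :: "nat => pfun => bool" where
 "indep r F \<longleftrightarrow> (\<forall>z a. F (z(r := a)) = F z)"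

definition depends_on :: "nat set => (point => 'b) => bool" where
 "depends_on S F \<longleftrightarrow> (\<forall>z z'. (\<forall>r \<in> S. z r = z' r) --> F z = F z')"

definition wavg :: "nat => (nat => real) => nat => pfun => pfun" where
 "wavg D m r F = (%z. \<Sum>a\<le>D. m a * F (z(r := a)))"

text \<open>Averaging is an operator along a list of coordinates, not an integral. The result is
  still a function of the coordinates left out of \<open>rs\<close>, so conditional and full
  expectations are one notion.\<close>

definition wexp :: "nat => (nat => real) => nat list => pfun => pfun" where
 "wexp D m rs F = foldr (wavg D m) rs F"

text \<open>The event that coordinate \<open>r\<close> is pivotal; its average over all coordinates
  is the influence of \<open>r\<close>.\<close>

definition NC :: "nat => pfun => nat => pfun" where
 "NC D f r z = of_bool (\<exists>a\<le>D. \<exists>b\<le>D. f (z(r := a)) ~= f (z(r := b)))"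

text \<open>Points are arbitrary functions on the naturals, so the second condition makes
  \<open>f\<close> read every value above \<open>D\<close> as \<open>D\<close>.\<close>

definition boolean :: "nat => pfun => bool" where
 "boolean D f \<longleftrightarrow> (\<forall>z. f z : {0, 1}) & (\<forall>z r. f (z(r := min (z r) D)) = f z)"

locale finite_weights =
 fixes D :: nat and m :: "nat => real"
 assumes m_nonneg: "a <= D ==> 0 <= m a" and m_sum: "(\<Sum>a\<le>D. m a) = 1"
begin

abbreviation M :: "nat => pfun => pfun" where "M \<equiv> wavg D m"

abbreviation EE :: "nat list => pfun => pfun" where "EE \<equiv> wexp D m"

text \<open>With probability \<rho> the coordinate is kept, otherwise it is resampled;
  \<open>TT\<close> is the resulting product noise operator.\<close>

definition Tr :: "real => nat => pfun => pfun" where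
 "Tr \<rho> r F = (%z. \<rho> * F z + (1 - \<rho>) * M r F z)"

definition TT :: "real => nat list => pfun => pfun" where
 "TT \<rho> rs F = foldr (Tr \<rho>) rs F"

lemma EE_Nil [simp]: "EE [] F = F" and EE_Cons: "EE (r # rs) F = M r (EE rs F)"
 and EE_append: "EE (rs @ rs') F = EE rs (EE rs' F)"
 by (simp_all add: wexp_def)

lemma TT_Nil [simp]: "TT \<rho> [] F = F" and TT_Cons: "TT \<rho> (r # rs) F = Tr \<rho> r (TT \<rho> rs F)"
 by (simp_all add: TT_def)

lemma M_lin: "M r (%z. c * F z + d * G z) = (%z. c * M r F z + d * M r G z)"
 by (auto simp: wavg_def sum.distrib sum_distrib_left algebra_simps)

lemma M_const [simp]: "M r (%z. c) = (%z. c)"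
 using m_sum by (auto simp: wavg_def sum_distrib_right[symmetric])

lemma M_comm: "M r (M s F) = M s (M r F)"
proof (cases "r = s")
 case False
 show ?thesis
 proof
  fix z
  have "M r (M s F) z = (\<Sum>a\<le>D. \<Sum>b\<le>D. m a * m b * F (z(r := a, s := b)))"
   by (simp add: wavg_def sum_distrib_left mult.assoc)
  also have "... = (\<Sum>b\<le>D. \<Sum>a\<le>D. m a * m b * F (z(r := a, s := b)))" by (rule sum.swap)
  also have "... = M s (M r F) z"
   using False by (simp add: wavg_def sum_distrib_left mult.assoc mult.left_commute fun_upd_twist)
  finally show "M r (M s F) z = M s (M r F) z" .
 qed
qed simp

lemma M_indep: "indep r F ==> M r F = F"
 using m_sum by (auto simp: wavg_def indep_def sum_distrib_right[symmetric])

lemma indep_M [simp]: "indep r (M r F)"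
 by (auto simp: indep_def wavg_def)

lemma M_idem [simp]: "M r (M r F) = M r F"
 by (simp add: M_indep)

lemma indep_M': "indep s F ==> indep s (M r F)"
 unfolding indep_def wavg_def by (cases "r = s") (auto simp: fun_upd_twist)

lemma indep_EE: "indep s F ==> indep s (EE rs F)"
 by (induction rs) (auto simp: EE_Cons indep_M')

lemma M_mult_indep: "indep r F ==> M r (%z. F z * G z) = (%z. F z * M r G z)"
 by (auto simp: indep_def wavg_def sum_distrib_left mult.left_commute)

lemma M_mono: "(!!z. F z <= G z) ==> M r F z <= M r G z"
 by (auto simp: wavg_def intro!: sum_mono mult_left_mono m_nonneg)

lemma EE_lin: "EE rs (%z. c * F z + d * G z) = (%z. c * EE rs F z + d * EE rs G z)"
 by (induction rs) (auto simp: EE_Cons M_lin)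

lemma EE_const [simp]: "EE rs (%z. c) = (%z. c)"
 by (induction rs) (auto simp: EE_Cons)

lemma EE_mono: "(!!z. F z <= G z) ==> EE rs F z <= EE rs G z"
 by (induction rs arbitrary: z) (auto simp: EE_Cons intro: M_mono)

lemma EE_scale: "EE rs (%z. c * F z) = (%z. c * EE rs F z)"
 using EE_lin[of rs c F 0 F] by simp

lemma EE_add: "EE rs (%z. F z + G z) = (%z. EE rs F z + EE rs G z)"
 using EE_lin[of rs 1 F 1 G] by simp

lemma EE_diff: "EE rs (%z. F z - G z) = (%z. EE rs F z - EE rs G z)"
 using EE_lin[of rs 1 F "-1" G] by simp

lemma EE_sum: "finite I ==> EE rs (%z. \<Sum>i\<in>I. F i z) = (%z. \<Sum>i\<in>I. EE rs (F i) z)"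
 by (induction I rule: finite_induct) (auto simp: EE_add)

lemma M_diff: "M r (%z. F z - G z) = (%z. M r F z - M r G z)"
 using M_lin[of r 1 F "-1" G] by simp

lemma M_add: "M r (%z. F z + G z) = (%z. M r F z + M r G z)"
 using M_lin[of r 1 F 1 G] by simp

lemma EE_nonneg: "(!!z. 0 <= F z) ==> 0 <= EE rs F z"
 using EE_mono[of "%z. 0" F rs z] by simp

lemma EE_M_comm: "EE rs (M r F) = M r (EE rs F)"
 by (induction rs) (simp_all add: EE_Cons M_comm[of r])

lemma EE_M [simp]: "r : set rs ==> EE rs (M r F) = EE rs F"
 by (induction rs) (auto simp: EE_Cons EE_M_comm M_comm[of r] dest: arg_cong[where f = "M _"])

lemma EE_perm: "mset rs = mset rs' ==> EE rs F = EE rs' F"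
proof (induction rs arbitrary: rs')
 case (Cons r rs)
 hence "r : set rs'" by (metis list.set_intros(1) mset_eq_setD)
 then obtain as bs where rs': "rs' = as @ r # bs" by (meson split_list)
 hence "EE rs F = EE (as @ bs) F" using Cons by auto
 thus ?case by (simp add: rs' EE_Cons EE_append EE_M_comm)
qed simp

text \<open>Both sides equal the average of \<open>M r F z * M r G z\<close>.\<close>

lemma EE_selfadj_M: "r : set rs ==> EE rs (%z. F z * M r G z) = EE rs (%z. M r F z * G z)"
proof -
 assume r: "r : set rs"
 have "EE rs (%z. F z * M r G z) = EE rs (M r (%z. F z * M r G z))" using r by simp
 also have "M r (%z. F z * M r G z) = (%z. M r G z * M r F z)"
  using M_mult_indep[of r "M r G" F] by (simp add: mult.commute)
 also have "... = M r (%z. M r F z * G z)" using M_mult_indep[of r "M r F" G] by (simp add: mult.commute)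
 also have "EE rs ... = EE rs (%z. M r F z * G z)" using r by simp
 finally show ?thesis .
qed

lemma EE_selfadj_EE: "set ks <= set rs ==> EE rs (%z. F z * EE ks G z) = EE rs (%z. EE ks F z * G z)"
 by (induction ks arbitrary: F G) (auto simp: EE_Cons EE_selfadj_M EE_M_comm[symmetric])

lemma Tr_M: "Tr \<rho> r (M s F) = M s (Tr \<rho> r F)"
 by (simp add: Tr_def M_lin M_comm[of r s])

lemma TT_M: "TT \<rho> rs (M s F) = M s (TT \<rho> rs F)"
 by (induction rs) (simp_all add: TT_Cons Tr_M)

lemma Tr_lin: "Tr \<rho> r (%z. c * F z + d * G z) = (%z. c * Tr \<rho> r F z + d * Tr \<rho> r G z)"
 by (auto simp: Tr_def M_lin algebra_simps)

lemma TT_lin: "TT \<rho> rs (%z. c * F z + d * G z) = (%z. c * TT \<rho> rs F z + d * TT \<rho> rs G z)"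
 by (induction rs) (auto simp: TT_Cons Tr_lin)

lemma TT_diff: "TT \<rho> rs (%z. F z - G z) = (%z. TT \<rho> rs F z - TT \<rho> rs G z)"
 using TT_lin[of \<rho> rs 1 F "-1" G] by simp

lemma Tr_comm: "Tr \<rho> r (Tr \<rho>' s F) = Tr \<rho>' s (Tr \<rho> r F)"
 unfolding Tr_def M_lin by (rule ext) (simp only: M_comm[of r s], simp add: algebra_simps)

lemma Tr_TT_comm: "Tr \<rho> r (TT \<rho>' rs F) = TT \<rho>' rs (Tr \<rho> r F)"
 by (induction rs) (simp_all add: TT_Cons Tr_comm[of \<rho> r])

lemma Tr_Tr: "Tr \<rho> r (Tr \<rho> r F) = Tr (\<rho>\<^sup>2) r F"
 unfolding Tr_def M_lin M_idem by (rule ext) (simp add: algebra_simps power2_eq_square)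

lemma TT_TT: "TT \<rho> rs (TT \<rho> rs F) = TT (\<rho>\<^sup>2) rs F"
proof (induction rs arbitrary: F)
 case (Cons r rs)
 have "TT \<rho> (r # rs) (TT \<rho> (r # rs) F) = Tr \<rho> r (Tr \<rho> r (TT \<rho> rs (TT \<rho> rs F)))"
  by (simp add: TT_Cons Tr_TT_comm)
 thus ?case by (simp add: Tr_Tr Cons TT_Cons)
qed simp

lemma EE_Tr: "r : set rs ==> EE rs (Tr \<rho> r F) = EE rs F"
 unfolding Tr_def EE_lin by (rule ext) (simp add: algebra_simps)

lemma EE_TT: "set ks <= set rs ==> EE rs (TT \<rho> ks F) = EE rs F"
 by (induction ks) (auto simp: TT_Cons EE_Tr)

lemma EE_selfadj_Tr: "r : set rs ==> EE rs (%z. F z * Tr \<rho> r G z) = EE rs (%z. Tr \<rho> r F z * G z)"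
proof -
 assume r: "r : set rs"
 have "EE rs (%z. F z * Tr \<rho> r G z) = EE rs (%z. \<rho> * (F z * G z) + (1 - \<rho>) * (F z * M r G z))"
  by (simp add: Tr_def algebra_simps)
 also have "... = EE rs (%z. \<rho> * (F z * G z) + (1 - \<rho>) * (M r F z * G z))"
  by (simp only: EE_lin EE_selfadj_M[OF r])
 also have "... = EE rs (%z. Tr \<rho> r F z * G z)"
  by (simp add: Tr_def algebra_simps)
 finally show ?thesis .
qed

lemma EE_selfadj_TT: "set ks <= set rs ==> EE rs (%z. F z * TT \<rho> ks G z) = EE rs (%z. TT \<rho> ks F z * G z)"
 by (induction ks arbitrary: F G) (auto simp: TT_Cons EE_selfadj_Tr Tr_TT_comm)

lemma TT_mono:
 assumes "0 <= \<rho>" "\<rho> <= 1" "!!z. F z <= G z"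
 shows "TT \<rho> rs F z <= TT \<rho> rs G z"
 using assms(3)
 by (induction rs arbitrary: z)
  (use assms(1,2) in "auto simp: TT_Cons Tr_def intro!: add_mono mult_left_mono M_mono")

lemma TT_abs:
 assumes "0 <= \<rho>" "\<rho> <= 1"
 shows "\<bar>TT \<rho> rs F z\<bar> <= TT \<rho> rs (%z. \<bar>F z\<bar>) z"
proof -
 have "TT \<rho> rs F z <= TT \<rho> rs (%z. \<bar>F z\<bar>) z" by (rule TT_mono) (use assms in auto)
 moreover have "TT \<rho> rs (%z. (-1) * F z + 0 * F z) z <= TT \<rho> rs (%z. \<bar>F z\<bar>) z" by (rule TT_mono) (use assms in auto)
 ultimately show ?thesis unfolding TT_lin by simp
qed

lemma EE_CS: "(EE rs (%z. F z * G z) z)\<^sup>2 <= EE rs (%z. (F z)\<^sup>2) z * EE rs (%z. (G z)\<^sup>2) z"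
proof (rule discriminant_le)
 fix t
 have "0 <= EE rs (%z. (F z + t * G z)\<^sup>2) z" by (rule EE_nonneg) simp
 also have "(%z. (F z + t * G z)\<^sup>2) = (%z. 1 * (F z)\<^sup>2 + 1 * ((2 * t) * (F z * G z) + t\<^sup>2 * (G z)\<^sup>2))"
  by (auto simp: power2_eq_square algebra_simps)
 finally show "0 <= EE rs (%z. (F z)\<^sup>2) z + 2 * EE rs (%z. F z * G z) z * t + EE rs (%z. (G z)\<^sup>2) z * t\<^sup>2"
  unfolding EE_lin by (simp add: algebra_simps)
qed

lemma EE_square_le: "(EE rs F z)\<^sup>2 <= EE rs (%z. (F z)\<^sup>2) z"
 using EE_CS[of rs F "%_. 1" z] by simp

section \<open>Hypercontractivity\<close>

text \<open>AM-GM trades the cubic term of the expansion for even ones, which turns the coefficients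
  6 and 1 into 8 and 3. The linear term is kept because it averages to zero in
  \<open>hypercontractive\<close>.\<close>

lemma fourth_power_bound:
 fixes q x \<rho> :: real
 shows "(q + \<rho> * x) ^ 4 <= q ^ 4 + 4 * q ^ 3 * \<rho> * x + 8 * \<rho>\<^sup>2 * (q\<^sup>2 * x\<^sup>2) + 3 * \<rho> ^ 4 * x ^ 4"
proof -
 have "0 <= 2 * (\<rho> * x)\<^sup>2 * (q - \<rho> * x)\<^sup>2" by simp
 moreover have "q ^ 4 + 4 * q ^ 3 * \<rho> * x + 8 * \<rho>\<^sup>2 * (q\<^sup>2 * x\<^sup>2) + 3 * \<rho> ^ 4 * x ^ 4 - (q + \<rho> * x) ^ 4
   = 2 * (\<rho> * x)\<^sup>2 * (q - \<rho> * x)\<^sup>2"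
  by algebra
 ultimately show ?thesis by linarith
qed

text \<open>The (2,4)-inequality for a space whose atoms have mass at least \<open>lam\<close>, by
  induction on the coordinates. The noisy function splits into a part \<open>Q\<close> free of
  \<open>r\<close> and \<rho> times a part \<open>R\<close> with \<open>r\<close>-average zero. The
  induction hypothesis applies to both, since they are noisy versions of \<open>M r F\<close> and of
  \<open>F - M r F\<close>.\<close>

lemma hypercontractive:
 assumes lam: "0 < lam" "!!a. a <= D ==> lam <= m a" and \<rho>: "4 * \<rho>\<^sup>2 <= 1" "3 * \<rho> ^ 4 <= lam"
 shows "EE rs (%z. (TT \<rho> rs F z) ^ 4) z <= (EE rs (%z. (F z)\<^sup>2) z)\<^sup>2"
proof (induction rs arbitrary: F z)
 case Nil
 show ?case by (simp flip: power_mult)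
next
 case (Cons r rs)
 define G where "G = TT \<rho> rs F"
 define Q where "Q = M r G"
 define R where "R = (%z. G z - Q z)"
 define N where "N = (%z. F z - M r F z)"
 have Q_TT: "Q = TT \<rho> rs (M r F)" by (simp add: Q_def G_def TT_M)
 have R_TT: "R = TT \<rho> rs N" by (simp add: R_def N_def TT_diff G_def Q_def TT_M)
 have indQ: "indep r Q" by (simp add: Q_def)
 have T: "TT \<rho> (r # rs) F = (%z. Q z + \<rho> * R z)"
  by (auto simp: TT_Cons Tr_def R_def Q_def G_def algebra_simps)
 have MR: "M r R = (%z. 0)" by (simp add: R_def Q_def M_diff)
 have ptw: "M r (%z. (TT \<rho> (r # rs) F z) ^ 4) z <=
   (Q z) ^ 4 + (8 * \<rho>\<^sup>2 * M r (%z. (Q z)\<^sup>2 * (R z)\<^sup>2) z + 3 * \<rho> ^ 4 * M r (%z. (R z) ^ 4) z)" for z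
 proof -
  have "M r (%z. (TT \<rho> (r # rs) F z) ^ 4) z <= M r (%z. 1 * ((Q z) ^ 4 * 1 + (4 * (Q z) ^ 3 * \<rho>) * R z) +
    1 * ((8 * \<rho>\<^sup>2) * ((Q z)\<^sup>2 * (R z)\<^sup>2) + (3 * \<rho> ^ 4) * (R z) ^ 4)) z"
   using fourth_power_bound by (intro M_mono) (simp add: T add.assoc)
  also have "... = M r (%z. (Q z) ^ 4 * 1) z + M r (%z. (4 * (Q z) ^ 3 * \<rho>) * R z) z +
    ((8 * \<rho>\<^sup>2) * M r (%z. (Q z)\<^sup>2 * (R z)\<^sup>2) z + (3 * \<rho> ^ 4) * M r (%z. (R z) ^ 4) z)"
   unfolding M_lin M_add by simp
  also have "M r (%z. (4 * (Q z) ^ 3 * \<rho>) * R z) = (%z. (4 * (Q z) ^ 3 * \<rho>) * M r R z)"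
   using indQ by (intro M_mult_indep) (auto simp: indep_def)
  also have "M r (%z. (Q z) ^ 4 * 1) = (%z. (Q z) ^ 4 * M r (%_. 1) z)"
   using indQ by (intro M_mult_indep) (auto simp: indep_def)
  finally show ?thesis by (simp add: MR)
 qed
 define A where "A = EE rs (%z. (M r F z)\<^sup>2)"
 define x where "x = EE rs (%z. (N z)\<^sup>2)"
 define X where "X = M r x z"
 have x0: "0 <= x y" for y unfolding x_def by (rule EE_nonneg) simp
 have A0: "0 <= A y" for y unfolding A_def by (rule EE_nonneg) simp
 have X0: "0 <= X" unfolding X_def wavg_def by (intro sum_nonneg mult_nonneg_nonneg x0 m_nonneg) auto
 have indA: "indep r A" unfolding A_def by (rule indep_EE) (use indep_M[of r F] in "auto simp: indep_def")
 have Q4: "EE rs (%z. (Q z) ^ 4) y <= (A y)\<^sup>2" for y unfolding Q_TT A_def by (rule Cons.IH)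
 have R4: "EE rs (%z. (R z) ^ 4) y <= (x y)\<^sup>2" for y unfolding R_TT x_def by (rule Cons.IH)
 have QR: "EE rs (%z. (Q z)\<^sup>2 * (R z)\<^sup>2) y <= A y * x y" for y
 proof -
  have "(EE rs (%z. (Q z)\<^sup>2 * (R z)\<^sup>2) y)\<^sup>2 <= EE rs (%z. ((Q z)\<^sup>2)\<^sup>2) y * EE rs (%z. ((R z)\<^sup>2)\<^sup>2) y"
   by (rule EE_CS)
  also have "... <= (A y)\<^sup>2 * (x y)\<^sup>2"
   using Q4[of y] R4[of y] by (intro mult_mono) (auto simp flip: power_mult intro: EE_nonneg)
  finally have "(EE rs (%z. (Q z)\<^sup>2 * (R z)\<^sup>2) y)\<^sup>2 <= (A y * x y)\<^sup>2" by (simp add: power_mult_distrib)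
  thus ?thesis by (rule power2_le_imp_le) (simp add: A0 x0)
 qed
 have MQR: "M r (EE rs (%z. (Q z)\<^sup>2 * (R z)\<^sup>2)) z <= A z * X"
 proof -
  have "M r (EE rs (%z. (Q z)\<^sup>2 * (R z)\<^sup>2)) z <= M r (%z. A z * x z) z" by (rule M_mono) (rule QR)
  also have "... = A z * X" unfolding X_def using M_mult_indep[OF indA] by simp
  finally show ?thesis .
 qed
 \<comment> \<open>This is where the bound on the atoms enters: \<open>lam * x\<close> at a single
   atom is at most the whole average \<open>X\<close>.\<close>
 have MR4: "lam * M r (EE rs (%z. (R z) ^ 4)) z <= X\<^sup>2"
 proof -
  have "M r (EE rs (%z. (R z) ^ 4)) z <= M r (%z. (x z)\<^sup>2) z" by (rule M_mono) (rule R4)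
  hence "lam * M r (EE rs (%z. (R z) ^ 4)) z <= lam * M r (%z. (x z)\<^sup>2) z" using lam(1) by simp
  also have "... = (\<Sum>a\<le>D. m a * (lam * x (z(r := a))) * x (z(r := a)))"
   by (simp add: wavg_def sum_distrib_left power2_eq_square mult_ac)
  also have "... <= (\<Sum>a\<le>D. m a * X * x (z(r := a)))"
  proof (intro sum_mono mult_right_mono mult_left_mono x0 m_nonneg)
   fix a assume a: "a : {..D}"
   have "lam * x (z(r := a)) <= m a * x (z(r := a))" using a lam(2) x0 by (intro mult_right_mono) auto
   also have "... <= X" unfolding X_def wavg_def using a
    by (intro member_le_sum[where f = "%a. m a * x (z(r := a))"]) (auto intro!: mult_nonneg_nonneg m_nonneg x0)
   finally show "lam * x (z(r := a)) <= X" .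
  qed auto
  also have "... = X * X" by (simp add: X_def wavg_def sum_distrib_left mult_ac)
  finally show ?thesis by (simp add: power2_eq_square)
 qed
 have AX: "EE (r # rs) (%z. (F z)\<^sup>2) z = A z + X"
 proof -
  have "M r (%z. (F z)\<^sup>2) = (%z. (M r F z)\<^sup>2 + M r (%z. (N z)\<^sup>2) z)"
  proof -
   have "(%z. (N z)\<^sup>2) = (%z. 1 * (F z)\<^sup>2 + 1 * (M r F z * ((-2) * F z + 1 * M r F z)))"
    by (auto simp: N_def power2_eq_square algebra_simps)
   hence "M r (%z. (N z)\<^sup>2) = (%z. M r (%z. (F z)\<^sup>2) z + M r F z * ((-2) * M r F z + M r F z))"
    by (simp only: M_lin M_mult_indep[OF indep_M]) simp
   thus ?thesis by (auto simp: power2_eq_square algebra_simps)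
  qed
  hence "EE rs (M r (%z. (F z)\<^sup>2)) = (%z. A z + M r x z)"
   by (simp add: EE_add A_def x_def EE_M_comm)
  thus ?thesis by (simp add: EE_Cons EE_M_comm X_def)
 qed
 have "EE (r # rs) (%z. (TT \<rho> (r # rs) F z) ^ 4) z = EE rs (M r (%z. (TT \<rho> (r # rs) F z) ^ 4)) z"
  by (simp add: EE_Cons EE_M_comm)
 also have "... <= EE rs (%z. (Q z) ^ 4 + (8 * \<rho>\<^sup>2 * M r (%z. (Q z)\<^sup>2 * (R z)\<^sup>2) z + 3 * \<rho> ^ 4 * M r (%z. (R z) ^ 4) z)) z"
  by (rule EE_mono) (rule ptw)
 also have "... = EE rs (%z. (Q z) ^ 4) z + (8 * \<rho>\<^sup>2 * M r (EE rs (%z. (Q z)\<^sup>2 * (R z)\<^sup>2)) z +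
   3 * \<rho> ^ 4 * M r (EE rs (%z. (R z) ^ 4)) z)"
  by (simp only: EE_add EE_scale EE_M_comm)
 \<comment> \<open>The conditions on \<rho> reduce the coefficient 8 to 2 and the fourth moment of
   \<open>R\<close> to \<open>X\<^sup>2\<close>, which completes the square
   \<open>(A z + X)\<^sup>2\<close>.\<close>
 also have "... <= (A z)\<^sup>2 + (2 * (A z * X) + X\<^sup>2)"
 proof (intro add_mono Q4)
  have "8 * \<rho>\<^sup>2 * M r (EE rs (%z. (Q z)\<^sup>2 * (R z)\<^sup>2)) z <= 8 * \<rho>\<^sup>2 * (A z * X)"
   using MQR by (intro mult_left_mono) auto
  also have "... <= 2 * (A z * X)" using \<rho>(1) A0 X0 by (intro mult_right_mono) auto
  finally show "8 * \<rho>\<^sup>2 * M r (EE rs (%z. (Q z)\<^sup>2 * (R z)\<^sup>2)) z <= 2 * (A z * X)" .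
  have "0 <= M r (EE rs (%z. (R z) ^ 4)) z"
   unfolding EE_M_comm[symmetric] wavg_def by (intro EE_nonneg sum_nonneg mult_nonneg_nonneg m_nonneg) auto
  hence "3 * \<rho> ^ 4 * M r (EE rs (%z. (R z) ^ 4)) z <= lam * M r (EE rs (%z. (R z) ^ 4)) z"
   using \<rho>(2) by (intro mult_right_mono) auto
  thus "3 * \<rho> ^ 4 * M r (EE rs (%z. (R z) ^ 4)) z <= X\<^sup>2" using MR4 by linarith
 qed
 also have "... = (EE (r # rs) (%z. (F z)\<^sup>2) z)\<^sup>2" unfolding AX by (simp add: power2_eq_square algebra_simps)
 finally show ?case .
qed


section \<open>Influences and juntas\<close>

lemma boolean_cases: "boolean D f ==> f z = 0 | f z = 1"
 by (simp add: boolean_def)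

lemma boolean_bounds: "boolean D f ==> 0 <= f z" "boolean D f ==> f z <= 1" "boolean D f ==> f z * f z = f z"
 using boolean_cases[of f z] by auto

lemma NC_bounds: "0 <= NC D f r z" "NC D f r z <= 1" "NC D f r z * NC D f r z = NC D f r z"
 by (auto simp: NC_def)

lemma deviation_le_NC:
 assumes "boolean D f"
 shows "\<bar>f z - M r f z\<bar> <= NC D f r z"
proof (cases "\<exists>a\<le>D. \<exists>b\<le>D. f (z(r := a)) ~= f (z(r := b))")
 case True
 have "M r (%z. 0) z <= M r f z" "M r f z <= M r (%z. 1) z"
  by (intro M_mono boolean_bounds assms)+
 thus ?thesis using True boolean_bounds[OF assms, of z] by (auto simp: NC_def)
next
 case False
 have "f (z(r := a)) = f z" if "a <= D" for a
 proof -
  have "min (z r) D <= D" by simp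
  hence "f (z(r := a)) = f (z(r := min (z r) D))" using False that by blast
  thus ?thesis using assms by (simp add: boolean_def)
 qed
 hence "M r f z = (\<Sum>a\<le>D. m a * f z)" by (auto simp: wavg_def)
 thus ?thesis using m_sum by (simp add: NC_def sum_distrib_right[symmetric])
qed

text \<open>Let \<open>N\<close> be the noisy energy and \<open>P\<close> the influence.
  \<open>N\<close> is the correlation of \<open>g\<close> with \<open>h\<close>, which is
  \<open>g\<close> after two rounds of noise, and \<open>g\<close> is dominated by the pivotal
  event. Two applications of Cauchy-Schwarz and hypercontractivity for \<open>h\<close> give
  \<open>N ^ 4 <= P ^ 3 * N\<^sup>2\<close>. The exponent 3/2 instead of 1 is the gain for
  coordinates of small influence.\<close>

lemma influence_hypercontractive:
 assumes f: "boolean D f" and r: "r : set rs"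
  and lam: "0 < lam" "!!a. a <= D ==> lam <= m a" and \<rho>: "4 * \<rho>\<^sup>2 <= 1" "3 * \<rho> ^ 4 <= lam"
 shows "(EE rs (%z. (TT \<rho> rs (%z. f z - M r f z) z)\<^sup>2) z)\<^sup>2 <= (EE rs (NC D f r) z) ^ 3"
proof -
 define g where "g = (%z. f z - M r f z)"
 define Tg where "Tg = TT \<rho> rs g"
 define h where "h = TT \<rho> rs Tg"
 define N where "N = EE rs (%z. (Tg z)\<^sup>2) z"
 define P where "P = EE rs (NC D f r) z"
 define Y where "Y = EE rs (%z. NC D f r z * \<bar>h z\<bar>) z"
 have N0: "0 <= N" unfolding N_def by (rule EE_nonneg) simp
 have P0: "0 <= P" unfolding P_def by (rule EE_nonneg) (simp add: NC_bounds)
 have "N = EE rs (%z. g z * h z) z"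
  using EE_selfadj_TT[of rs rs g \<rho> Tg] by (simp add: N_def h_def Tg_def power2_eq_square)
 also have "... <= Y" unfolding Y_def
 proof (rule EE_mono)
  fix z
  have "g z * h z <= \<bar>g z\<bar> * \<bar>h z\<bar>" by (metis abs_ge_self abs_mult)
  also have "... <= NC D f r z * \<bar>h z\<bar>" unfolding g_def by (intro mult_right_mono deviation_le_NC f) auto
  finally show "g z * h z <= NC D f r z * \<bar>h z\<bar>" .
 qed
 finally have NY: "N <= Y" .
 have Y2: "Y\<^sup>2 <= P * EE rs (%z. NC D f r z * (h z)\<^sup>2) z"
 proof -
  have "Y = EE rs (%z. NC D f r z * (NC D f r z * \<bar>h z\<bar>)) z"
   by (simp add: Y_def NC_bounds mult.assoc[symmetric])
  hence "Y\<^sup>2 <= EE rs (%z. (NC D f r z)\<^sup>2) z * EE rs (%z. (NC D f r z * \<bar>h z\<bar>)\<^sup>2) z"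
   using EE_CS[of rs "NC D f r" "%z. NC D f r z * \<bar>h z\<bar>" z] by simp
  moreover have sq: "(%z. (NC D f r z)\<^sup>2) = NC D f r" by (rule ext) (simp add: power2_eq_square NC_bounds)
  moreover have "(%z. (NC D f r z * \<bar>h z\<bar>)\<^sup>2) = (%z. NC D f r z * (h z)\<^sup>2)"
   by (rule ext) (simp only: power_mult_distrib power2_abs fun_cong[OF sq])
  ultimately show ?thesis by (simp add: P_def)
 qed
 have E0: "0 <= EE rs (%z. NC D f r z * (h z)\<^sup>2) z" by (rule EE_nonneg) (simp add: NC_bounds)
 have "(EE rs (%z. NC D f r z * (h z)\<^sup>2) z)\<^sup>2 <= EE rs (%z. (NC D f r z)\<^sup>2) z * EE rs (%z. ((h z)\<^sup>2)\<^sup>2) z"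
  by (rule EE_CS)
 also have "... = P * EE rs (%z. h z ^ 4) z"
  by (simp add: P_def power2_eq_square NC_bounds power4_eq_xxxx mult.assoc)
 also have "... <= P * N\<^sup>2" unfolding N_def h_def
  by (intro mult_left_mono P0 hypercontractive[OF lam \<rho>])
 finally have E2: "(EE rs (%z. NC D f r z * (h z)\<^sup>2) z)\<^sup>2 <= P * N\<^sup>2" .
 have "N ^ 4 <= Y ^ 4" using NY N0 by (rule power_mono)
 also have "Y ^ 4 = (Y\<^sup>2)\<^sup>2" by simp
 also have "... <= (P * EE rs (%z. NC D f r z * (h z)\<^sup>2) z)\<^sup>2" using Y2 by (intro power_mono) auto
 also have "... = P\<^sup>2 * (EE rs (%z. NC D f r z * (h z)\<^sup>2) z)\<^sup>2" by (simp add: power_mult_distrib)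
 also have "... <= P\<^sup>2 * (P * N\<^sup>2)" using E2 by (intro mult_left_mono) auto
 finally have "N\<^sup>2 * N\<^sup>2 <= P ^ 3 * N\<^sup>2" by (simp add: power2_eq_square power4_eq_xxxx power3_eq_cube mult_ac)
 hence "N\<^sup>2 <= P ^ 3"
 proof (cases "N = 0")
  case False
  hence "0 < N\<^sup>2" by simp
  with \<open>N\<^sup>2 * N\<^sup>2 <= P ^ 3 * N\<^sup>2\<close> show ?thesis by (rule mult_right_le_imp_le)
 qed (use P0 in simp)
 thus ?thesis by (simp add: N_def P_def Tg_def g_def)
qed

text \<open>Passing from \<open>\<rho>\<close> to its square root costs only a Cauchy--Schwarz step, since the noise
 operators form a semigroup; this replaces hypercontractivity for noise rates close to one.\<close>

lemma influence_interpolate: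
 assumes f: "boolean D f" and r: "r : set rs"
  and lam: "0 < lam" "!!a. a <= D ==> lam <= m a" and \<rho>: "4 * \<rho>\<^sup>2 <= 1" "3 * \<rho> ^ 4 <= lam"
 shows "\<rho>' ^ (2 ^ j) = \<rho> ==>
  (EE rs (%z. (TT \<rho>' rs (%z. f z - M r f z) z)\<^sup>2) z) ^ (2 ^ Suc j) <= (EE rs (NC D f r) z) ^ (2 ^ Suc j + 1)"
proof (induction j arbitrary: \<rho>')
 case 0
 thus ?case using influence_hypercontractive[OF f r lam \<rho>, of z] by (simp add: numeral_3_eq_3 power2_eq_square)
next
 case (Suc j)
 define g where "g = (%z. f z - M r f z)"
 define P where "P = EE rs (NC D f r) z"
 define N where "N \<rho> = EE rs (%z. (TT \<rho> rs g z)\<^sup>2) z" for \<rho>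
 have P0: "0 <= P" unfolding P_def by (rule EE_nonneg) (simp add: NC_bounds)
 have N0: "0 <= N \<rho>" for \<rho> unfolding N_def by (rule EE_nonneg) simp
 have "(\<rho>'\<^sup>2) ^ (2 ^ j) = \<rho>" using Suc.prems by (simp flip: power_mult)
 from Suc.IH[OF this] have IH: "N (\<rho>'\<^sup>2) ^ (2 ^ Suc j) <= P ^ (2 ^ Suc j + 1)" by (simp add: N_def P_def g_def)
 have "N \<rho>' = EE rs (%z. g z * TT (\<rho>'\<^sup>2) rs g z) z"
  using EE_selfadj_TT[of rs rs g \<rho>' "TT \<rho>' rs g"] by (simp add: N_def TT_TT power2_eq_square)
 hence "(N \<rho>')\<^sup>2 <= EE rs (%z. (g z)\<^sup>2) z * N (\<rho>'\<^sup>2)" unfolding N_def using EE_CS by simp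
 also have "EE rs (%z. (g z)\<^sup>2) z <= P" unfolding P_def
 proof (rule EE_mono)
  fix z
  have "(g z)\<^sup>2 <= (NC D f r z)\<^sup>2" unfolding g_def using deviation_le_NC[OF f, of z r] by (intro abs_le_square_iff[THEN iffD1]) (simp add: NC_bounds)
  thus "(g z)\<^sup>2 <= NC D f r z" by (simp add: power2_eq_square NC_bounds)
 qed
 finally have *: "(N \<rho>')\<^sup>2 <= P * N (\<rho>'\<^sup>2)" using N0[of "\<rho>'\<^sup>2"] by (simp add: mult_right_mono)
 have "N \<rho>' ^ (2 ^ Suc (Suc j)) = ((N \<rho>')\<^sup>2) ^ (2 ^ Suc j)" by (simp flip: power_mult)
 also have "... <= (P * N (\<rho>'\<^sup>2)) ^ (2 ^ Suc j)" using * by (intro power_mono) auto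
 also have "... = P ^ (2 ^ Suc j) * N (\<rho>'\<^sup>2) ^ (2 ^ Suc j)" by (simp add: power_mult_distrib)
 also have "... <= P ^ (2 ^ Suc j) * P ^ (2 ^ Suc j + 1)" using IH P0 by (intro mult_left_mono) auto
 also have "... = P ^ (2 ^ Suc (Suc j) + 1)" by (simp flip: power_add add: mult_2)
 finally show ?case by (simp add: N_def P_def g_def)
qed

text \<open>On taking roots, the surplus factor \<open>P\<close> of
  \<open>influence_interpolate\<close> becomes the factor \<eta>.\<close>

lemma influence_small:
 assumes f: "boolean D f" and r: "r : set rs"
  and lam: "0 < lam" "!!a. a <= D ==> lam <= m a" and \<rho>: "4 * (\<rho>' ^ (2 ^ j))\<^sup>2 <= 1" "3 * (\<rho>' ^ (2 ^ j)) ^ 4 <= lam"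
  and P: "EE rs (NC D f r) z <= \<eta> ^ (2 ^ Suc j)" and \<eta>: "0 <= \<eta>"
 shows "EE rs (%z. (TT \<rho>' rs (%z. f z - M r f z) z)\<^sup>2) z <= \<eta> * EE rs (NC D f r) z"
proof -
 define N where "N = EE rs (%z. (TT \<rho>' rs (%z. f z - M r f z) z)\<^sup>2) z"
 define P where "P = EE rs (NC D f r) z"
 have P0: "0 <= P" unfolding P_def by (rule EE_nonneg) (simp add: NC_bounds)
 obtain n where n: "2 ^ Suc j = Suc n" by (metis not0_implies_Suc power_not_zero zero_neq_numeral)
 have "N ^ Suc n <= P ^ Suc n * P"
  using influence_interpolate[OF f r lam \<rho> refl, of z] by (simp add: N_def P_def n[symmetric] mult.commute)
 also have "... <= P ^ Suc n * \<eta> ^ Suc n" using assms(7) P0 by (intro mult_left_mono) (auto simp: P_def n[symmetric])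
 finally have "N ^ Suc n <= (\<eta> * P) ^ Suc n" by (simp add: power_mult_distrib mult_ac)
 hence "N <= \<eta> * P" by (rule power_le_imp_le_base) (use \<eta> P0 in simp)
 thus ?thesis by (simp add: N_def P_def)
qed

text \<open>Adding a coordinate \<open>r\<close> splits the deviation orthogonally into
  \<open>h - M r h\<close> and the \<open>r\<close>-average of the previous deviation, and averaging
  can only shrink the latter.\<close>

lemma efron_stein:
 "set ks <= set rs ==> EE rs (%z. (h z - EE ks h z)\<^sup>2) z <= (\<Sum>r\<leftarrow>ks. EE rs (%z. (h z - M r h z)\<^sup>2) z)"
proof (induction ks)
 case (Cons r ks)
 hence r: "r : set rs" by simp
 define w where "w = (%z. h z - EE ks h z)"
 define d where "d = (%z. h z - M r h z)"
 have Md: "M r d = (%z. 0)" by (simp add: d_def M_diff)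
 have orth: "EE rs (%z. d z * M r w z) = (%z. 0)" using EE_selfadj_M[OF r, of d w] by (simp add: Md)
 have "(%z. (h z - EE (r # ks) h z)\<^sup>2) = (%z. (d z)\<^sup>2 + (2 * (d z * M r w z) + 1 * (M r w z)\<^sup>2))"
  by (rule ext) (simp add: EE_Cons d_def w_def M_diff power2_eq_square algebra_simps)
 hence "EE rs (%z. (h z - EE (r # ks) h z)\<^sup>2) z = EE rs (%z. (d z)\<^sup>2) z + EE rs (%z. (M r w z)\<^sup>2) z"
  by (simp only: EE_add EE_scale orth)
 also have "EE rs (%z. (M r w z)\<^sup>2) z <= EE rs (M r (%z. (w z)\<^sup>2)) z"
  by (rule EE_mono) (use EE_square_le[of "[r]" w] in "simp add: EE_Cons")
 also have "... = EE rs (%z. (w z)\<^sup>2) z" using r by simp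
 also have "... <= (\<Sum>r\<leftarrow>ks. EE rs (%z. (h z - M r h z)\<^sup>2) z)" using Cons by (simp add: w_def)
 finally show ?case by (simp add: d_def)
qed simp

text \<open>Telescoping over the coordinates: switching on the noise at \<open>r\<close> changes the
  function by \<open>1 - \<rho>\<close> times a noisy copy of \<open>f - M r f\<close>, which is
  bounded by the pivotal event.\<close>

lemma noise_stability:
 assumes f: "boolean D f" and \<rho>: "0 <= \<rho>" "\<rho> <= 1"
 shows "set ks <= set rs ==>
  EE rs (%z. f z * (f z - TT \<rho> ks f z)) z <= (1 - \<rho>) * (\<Sum>r\<leftarrow>ks. EE rs (NC D f r) z)"
proof (induction ks)
 case (Cons r ks)
 have e: "f z - TT \<rho> (r # ks) f z = (f z - TT \<rho> ks f z) + (1 - \<rho>) * TT \<rho> ks (%z. f z - M r f z) z" for z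
  by (simp add: TT_Cons Tr_def TT_diff TT_M algebra_simps)
 have 1: "EE rs (%z. f z * (f z - TT \<rho> (r # ks) f z)) z =
   EE rs (%z. f z * (f z - TT \<rho> ks f z)) z + (1 - \<rho>) * EE rs (%z. f z * TT \<rho> ks (%z. f z - M r f z) z) z"
  unfolding e distrib_left mult.left_commute[of "f _" "1 - \<rho>"] EE_add EE_scale by simp
 have "EE rs (%z. f z * TT \<rho> ks (%z. f z - M r f z) z) z <= EE rs (TT \<rho> ks (NC D f r)) z"
 proof (rule EE_mono)
  fix z
  have "f z * TT \<rho> ks (%z. f z - M r f z) z <= 1 * \<bar>TT \<rho> ks (%z. f z - M r f z) z\<bar>"
   using boolean_cases[OF f, of z] by auto
  also have "... <= TT \<rho> ks (%z. \<bar>f z - M r f z\<bar>) z" using TT_abs[OF \<rho>] by simp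
  also have "... <= TT \<rho> ks (NC D f r) z" by (rule TT_mono[OF \<rho>]) (rule deviation_le_NC[OF f])
  finally show "f z * TT \<rho> ks (%z. f z - M r f z) z <= TT \<rho> ks (NC D f r) z" .
 qed
 moreover have "EE rs (TT \<rho> ks (NC D f r)) = EE rs (NC D f r)" by (rule EE_TT) (use Cons.prems in auto)
 ultimately have "(1 - \<rho>) * EE rs (%z. f z * TT \<rho> ks (%z. f z - M r f z) z) z <= (1 - \<rho>) * EE rs (NC D f r) z"
  using \<rho> by (intro mult_left_mono) auto
 moreover have "EE rs (%z. f z * (f z - TT \<rho> ks f z)) z <= (1 - \<rho>) * (\<Sum>r\<leftarrow>ks. EE rs (NC D f r) z)"
  using Cons by simp
 ultimately show ?case unfolding 1 by (simp add: distrib_left)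
qed simp

text \<open>A version of Friedgut's junta theorem: small total influence yields a restriction of boundedly
 many coordinates under which the density is close to one.\<close>

lemma junta_boost:
 assumes f: "boolean D f"
  and lam: "0 < lam" "!!a. a <= D ==> lam <= m a"
  and \<rho>: "4 * (\<rho> ^ (2 ^ j))\<^sup>2 <= 1" "3 * (\<rho> ^ (2 ^ j)) ^ 4 <= lam" "0 <= \<rho>" "\<rho> <= 1"
  and \<eta>: "0 <= \<eta>"
  and S: "(\<Sum>r\<leftarrow>rs. EE rs (NC D f r) z) <= S"
  and \<delta>: "(1 - \<rho>) * S + sqrt (\<eta> * S) < (1 - \<theta>) * EE rs f z"
 shows "\<exists>w. \<theta> <= EE (filter (%r. EE rs (NC D f r) z <= \<eta> ^ (2 ^ Suc j)) rs) f w"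
proof (rule ccontr)
 define ks where "ks = filter (%r. EE rs (NC D f r) z <= \<eta> ^ (2 ^ Suc j)) rs"
 assume "~ ?thesis"
 hence less: "EE ks f w <= \<theta>" for w unfolding ks_def[symmetric] by (metis less_imp_le not_le)
 have sub: "set ks <= set rs" by (auto simp: ks_def)
 define h where "h = TT \<rho> rs f"
 have NC0: "0 <= EE rs (NC D f r) z" for r by (rule EE_nonneg) (simp add: NC_bounds)
 have "0 <= (\<Sum>r\<leftarrow>rs. EE rs (NC D f r) z)" by (rule sum_list_nonneg) (auto simp: NC0)
 hence S0: "0 <= S" using S by linarith
 have h0: "0 <= h z" for z unfolding h_def using TT_mono[OF \<rho>(3,4), of "%_. 0" f rs z] boolean_bounds[OF f]
  TT_lin[of \<rho> rs 0 f 0 f] by simp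
 \<comment> \<open>Only coordinates of low influence are averaged out, so each Efron-Stein term is
   at most an \<eta> fraction of an influence.\<close>
 have gap: "EE rs (%z. (h z - EE ks h z)\<^sup>2) z <= \<eta> * S"
 proof -
  have "EE rs (%z. (h z - EE ks h z)\<^sup>2) z <= (\<Sum>r\<leftarrow>ks. EE rs (%z. (h z - M r h z)\<^sup>2) z)"
   by (rule efron_stein[OF sub])
  also have "... <= (\<Sum>r\<leftarrow>ks. \<eta> * EE rs (NC D f r) z)"
  proof (rule sum_list_mono)
   fix r assume r: "r : set ks"
   have "(%z. h z - M r h z) = TT \<rho> rs (%z. f z - M r f z)" by (simp add: h_def TT_diff TT_M)
   thus "EE rs (%z. (h z - M r h z)\<^sup>2) z <= \<eta> * EE rs (NC D f r) z"
    using influence_small[OF f _ lam \<rho>(1,2) _ \<eta>, of r rs z] r unfolding ks_def fun_eq_iff by simp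
  qed
  also have "... = \<eta> * (\<Sum>r\<leftarrow>ks. EE rs (NC D f r) z)" by (simp add: sum_list_const_mult)
  also have "(\<Sum>r\<leftarrow>ks. EE rs (NC D f r) z) <= (\<Sum>r\<leftarrow>rs. EE rs (NC D f r) z)"
   unfolding ks_def by (rule sum_list_filter_le) (rule NC0)
  finally show ?thesis using S \<eta> by (meson mult_left_mono order_trans)
 qed
 have "EE rs f z - EE rs (%z. f z * h z) z = EE rs (%z. f z * (f z - h z)) z"
  by (simp add: right_diff_distrib boolean_bounds[OF f] EE_diff)
 also have "... <= (1 - \<rho>) * (\<Sum>r\<leftarrow>rs. EE rs (NC D f r) z)" unfolding h_def by (rule noise_stability[OF f \<rho>(3,4)]) simp
 also have "... <= (1 - \<rho>) * S" using S \<rho> by (intro mult_left_mono) auto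
 finally have 1: "EE rs f z - EE rs (%z. f z * h z) z <= (1 - \<rho>) * S" .
 have "EE rs (%z. f z * h z) z - EE rs (%z. f z * EE ks h z) z = EE rs (%z. f z * (h z - EE ks h z)) z"
  by (simp add: right_diff_distrib EE_diff)
 also have "... <= EE rs (%z. \<bar>h z - EE ks h z\<bar>) z"
 proof (rule EE_mono)
  fix z show "f z * (h z - EE ks h z) <= \<bar>h z - EE ks h z\<bar>"
   using boolean_cases[OF f, of z] by auto
 qed
 also have "... <= sqrt (\<eta> * S)"
  using order_trans[OF EE_square_le[of rs "%z. \<bar>h z - EE ks h z\<bar>" z]] gap by (intro real_le_rsqrt) simp
 finally have 2: "EE rs (%z. f z * h z) z - EE rs (%z. f z * EE ks h z) z <= sqrt (\<eta> * S)" .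
 \<comment> \<open>The averaging over \<open>ks\<close> moves to the other factor, where it is at
   most \<theta> by assumption. So \<open>f\<close> would correlate with its smoothed version by at
   most a \<theta> fraction of its mean, against noise stability.\<close>
 have "EE rs (%z. f z * EE ks h z) z = EE rs (%z. EE ks f z * h z) z" by (simp add: EE_selfadj_EE[OF sub])
 also have "... <= EE rs (%z. \<theta> * h z) z" by (rule EE_mono) (intro mult_right_mono less h0)
 also have "... = \<theta> * EE rs f z" by (simp add: EE_scale h_def EE_TT)
 finally show False using 1 2 \<delta> by (simp add: algebra_simps)
qed

end

section \<open>Restricting coordinates at the cost of conditional influences\<close>

context finite_weights
begin

text \<open>A single assignment of the coordinates \<open>fs\<close> has mass at least
  \<open>lam ^ length fs\<close>. Read backwards: a small average remains small after a few
  coordinates have been fixed.\<close>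

lemma wexp_fix_lower:
 assumes lam: "0 < lam" "!!a. a <= D ==> lam <= m a" and G: "!!z. 0 <= G z"
 shows "(!!r. r ~: set fs ==> w r = z r) ==> (!!r. r : set fs ==> w r <= D) ==>
  lam ^ length fs * G w <= EE fs G z"
proof (induction fs arbitrary: z)
 case Nil
 hence "w = z" by auto
 thus ?case by simp
next
 case (Cons r fs)
 have E0: "0 <= EE fs G y" for y by (rule EE_nonneg) (rule G)
 have "lam ^ length fs * G w <= EE fs G (z(r := w r))" using Cons.prems by (intro Cons.IH) auto
 hence "lam ^ length (r # fs) * G w <= lam * EE fs G (z(r := w r))" using lam(1) by simp
 also have "... <= m (w r) * EE fs G (z(r := w r))" using lam(2) Cons.prems E0 by (intro mult_right_mono) auto
 also have "... <= EE (r # fs) G z" unfolding EE_Cons wavg_def using Cons.prems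
  by (intro member_le_sum[where f = "%a. m a * EE fs G (z(r := a))"]) (auto intro!: mult_nonneg_nonneg m_nonneg E0)
 finally show ?case .
qed

lemma wexp_upd: "r ~: set rs ==> EE rs F (z(r := a)) = EE rs (%z. F (z(r := a))) z"
proof (induction rs arbitrary: z)
 case (Cons s rs)
 hence tw: "z(r := a, s := b) = (z(s := b))(r := a)" for b by (intro fun_upd_twist) auto
 have "r ~: set rs" using Cons.prems by simp
 note IH = Cons.IH[OF this]
 show ?case unfolding EE_Cons wavg_def tw IH by (rule refl)
qed simp

lemma depends_on_wexp: "depends_on S F ==> depends_on (S - set rs) (EE rs F)"
proof (induction rs)
 case (Cons r rs)
 hence IH: "depends_on (S - set rs) (EE rs F)" by simp
 show ?case unfolding depends_on_def EE_Cons wavg_def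
 proof (intro allI impI sum.cong refl)
  fix z z' :: point and a assume eq: "\<forall>s \<in> S - set (r # rs). z s = z' s"
  have "EE rs F (z(r := a)) = EE rs F (z'(r := a))"
   using IH eq unfolding depends_on_def by (intro IH[unfolded depends_on_def, rule_format]) auto
  thus "m a * EE rs F (z(r := a)) = m a * EE rs F (z'(r := a))" by simp
 qed
qed simp

lemma NC_bound_diff: "boolean D f ==> a <= D ==> b <= D ==> f (z(r := a)) <= f (z(r := b)) + NC D f r z"
proof (cases "f (z(r := a)) = f (z(r := b))")
 case True
 thus ?thesis using NC_bounds(1)[of f r z] by simp
next
 case False
 assume *: "boolean D f" "a <= D" "b <= D"
 have "\<exists>a\<le>D. \<exists>b\<le>D. f (z(r := a)) ~= f (z(r := b))" using False * by blast
 hence "NC D f r z = 1" by (simp only: NC_def of_bool_eq)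
 thus ?thesis using boolean_bounds[OF *(1), of "z(r := a)"] boolean_bounds[OF *(1), of "z(r := b)"] by linarith
qed

text \<open>Fixing a coordinate changes \<open>f\<close> only where it is pivotal, so the loss is
  its conditional influence on what remains.\<close>

lemma wexp_fix_step:
 assumes f: "boolean D f" and r: "r ~: set rs" and c: "c <= D"
 shows "EE (r # rs) f w <= EE rs f (w(r := c)) + EE rs (NC D f r) w"
proof -
 have "EE (r # rs) f w = (\<Sum>a\<le>D. m a * EE rs f (w(r := a)))" by (simp add: EE_Cons wavg_def)
 also have "... <= (\<Sum>a\<le>D. m a * (EE rs f (w(r := c)) + EE rs (NC D f r) w))"
 proof (intro sum_mono mult_left_mono m_nonneg)
  fix a assume a: "a : {..D}"
  have "EE rs f (w(r := a)) = EE rs (%z. f (z(r := a))) w" by (rule wexp_upd[OF r])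
  also have "... <= EE rs (%z. f (z(r := c)) + NC D f r z) w"
   by (rule EE_mono) (use a c NC_bound_diff[OF f] in auto)
  also have "... = EE rs f (w(r := c)) + EE rs (NC D f r) w" by (simp add: EE_add wexp_upd[OF r])
  finally show "EE rs f (w(r := a)) <= EE rs f (w(r := c)) + EE rs (NC D f r) w" .
 qed auto
 also have "... = EE rs f (w(r := c)) + EE rs (NC D f r) w"
  using m_sum by (simp add: sum_distrib_right[symmetric])
 finally show ?thesis .
qed

text \<open>\<open>B\<close> bounds the conditional influences of the coordinates in \<open>ks\<close>.\<close>

lemma wexp_fix_many:
 assumes f: "boolean D f" and c: "!!r. c r <= D"
 shows "distinct ks ==> set ks Int set rs = {} ==>
  (!!as r bs. ks = as @ r # bs ==> EE (bs @ rs) (NC D f r) (%s. if s : set as then c s else w s) <= B) ==>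
  EE (ks @ rs) f w <= EE rs f (%s. if s : set ks then c s else w s) + real (length ks) * B"
proof (induction ks arbitrary: w)
 case (Cons r ks)
 have "EE ((r # ks) @ rs) f w <= EE (ks @ rs) f (w(r := c r)) + EE (ks @ rs) (NC D f r) w"
  using Cons.prems c by (simp) (intro wexp_fix_step[OF f], auto)
 also have "EE (ks @ rs) (NC D f r) w <= B" using Cons.prems(3)[of "[]" r ks] by simp
 also have "EE (ks @ rs) f (w(r := c r)) <= EE rs f (%s. if s : set ks then c s else (w(r := c r)) s) + real (length ks) * B"
 proof (rule Cons.IH)
  fix as s bs assume "ks = as @ s # bs"
  hence "EE (bs @ rs) (NC D f s) (%t. if t : set (r # as) then c t else w t) <= B"
   by (intro Cons.prems(3)) auto
  also have "(%t. if t : set (r # as) then c t else w t) = (%t. if t : set as then c t else (w(r := c r)) t)" by auto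
  finally show "EE (bs @ rs) (NC D f s) (%t. if t : set as then c t else (w(r := c r)) t) <= B" .
 qed (use Cons.prems in auto)
 also have "(%s. if s : set ks then c s else (w(r := c r)) s) = (%s. if s : set (r # ks) then c s else w s)" by auto
 finally show ?case by (simp add: algebra_simps)
qed simp

end

section \<open>Star-biased measures and Russo's formula\<close>

text \<open>The symbol \<open>D\<close> plays the role of a wildcard (star), which has probability \<open>p\<close>.\<close>

definition mu :: "nat => real => nat => real" where
 "mu D p a = (if a = D then p else (1 - p) / real D)"

lemma sum_mu: "(\<Sum>a\<le>D. mu D p a * g a) = p * g D + (1 - p) * (\<Sum>a<D. g a) / real D"
proof -
 have "{..D} = insert D {..<D}" by auto
 thus ?thesis by (simp add: mu_def sum_distrib_left sum_divide_distrib)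
qed

lemma finite_weights_mu:
 assumes "1 <= D" "0 <= p" "p <= 1"
 shows "finite_weights D (mu D p)"
proof
 show "(\<Sum>a\<le>D. mu D p a) = 1" using sum_mu[of D p "%_. 1"] assms by simp
qed (use assms in "auto simp: mu_def")

text \<open>The negative slope in \<open>p\<close> of averaging over \<open>r\<close>; by
  \<open>wavg_mu\<close> this average is affine in \<open>p\<close>.\<close>

definition star_diff :: "nat => nat => pfun => pfun" where
 "star_diff D r F z = wavg D (mu D 0) r F z - F (z(r := D))"

lemma wavg_mu: "wavg D (mu D p) r F z = wavg D (mu D 0) r F z - p * star_diff D r F z"
proof -
 define x where "x = (\<Sum>a<D. F (z(r := a))) / real D"
 have e: "wavg D (mu D p) r F z = p * F (z(r := D)) + (1 - p) * x" for p
  unfolding wavg_def sum_mu x_def by simp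
 show ?thesis unfolding star_diff_def e[of p] e[of 0] by (simp add: algebra_simps)
qed

lemma wavg_comm2:
 assumes "r ~= s"
 shows "wavg D m r (wavg D m' s F) = wavg D m' s (wavg D m r F)"
proof
 fix z
 have "wavg D m r (wavg D m' s F) z = (\<Sum>a\<le>D. \<Sum>b\<le>D. m a * m' b * F (z(r := a, s := b)))"
  by (simp add: wavg_def sum_distrib_left mult.assoc)
 also have "... = (\<Sum>b\<le>D. \<Sum>a\<le>D. m a * m' b * F (z(r := a, s := b)))" by (rule sum.swap)
 also have "... = wavg D m' s (wavg D m r F) z"
  using assms by (simp add: wavg_def sum_distrib_left mult.assoc mult.left_commute fun_upd_twist)
 finally show "wavg D m r (wavg D m' s F) z = wavg D m' s (wavg D m r F) z" .
qed

lemma star_diff_wavg: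
 assumes "r ~= s"
 shows "star_diff D r (wavg D m s F) = wavg D m s (star_diff D r F)"
proof
 fix z
 have "wavg D m s F (z(r := D)) = wavg D m s (%z. F (z(r := D))) z"
  using assms by (simp add: wavg_def fun_upd_twist)
 moreover have "wavg D m s (%z. wavg D (mu D 0) r F z - F (z(r := D))) z =
   wavg D m s (wavg D (mu D 0) r F) z - wavg D m s (%z. F (z(r := D))) z"
  by (simp add: wavg_def right_diff_distrib sum_subtractf)
 ultimately show "star_diff D r (wavg D m s F) z = wavg D m s (star_diff D r F) z"
  using wavg_comm2[OF assms] by (simp add: star_diff_def[abs_def])
qed

lemma star_diff_wexp: "r ~: set rs ==> star_diff D r (wexp D m rs F) = wexp D m rs (star_diff D r F)"
 by (induction rs) (auto simp: wexp_def star_diff_wavg)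

lemma indep_star_diff: "indep r (star_diff D r F)"
 by (auto simp: indep_def star_diff_def wavg_def)

lemma wavg_sum_list: "wavg D m r (%z. \<Sum>s\<leftarrow>ss. G s z) z = (\<Sum>s\<leftarrow>ss. wavg D m r (G s) z)"
 by (induction ss) (auto simp: wavg_def distrib_left sum.distrib)

text \<open>Induction on the list is the product rule; the sign of the derivative comes later, from
  \<open>downclosed\<close>.\<close>

lemma russo:
 assumes D: "1 <= D"
 shows "distinct rs ==> 0 <= p ==> p <= 1 ==>
  ((%p. wexp D (mu D p) rs F z) has_real_derivative - (\<Sum>r\<leftarrow>rs. wexp D (mu D p) rs (star_diff D r F) z)) (at p)"
proof (induction rs arbitrary: z)
 case (Cons r rs)
 interpret finite_weights D "mu D p" using Cons.prems D by (intro finite_weights_mu) auto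
 define G where "G = (%p. wexp D (mu D p) rs F)"
 define G' where "G' = (%y. - (\<Sum>s\<leftarrow>rs. wexp D (mu D p) rs (star_diff D s F) y))"
 have IH: "((%p. G p y) has_real_derivative G' y) (at p)" for y
  using Cons by (simp add: G_def G'_def)
 have U: "((%p. wavg D (mu D 0) r (G p) y) has_real_derivative wavg D (mu D 0) r G' y) (at p)" for y
  unfolding wavg_def by (intro DERIV_sum DERIV_cmult IH)
 have eq: "wexp D (mu D q) (r # rs) F z = wavg D (mu D 0) r (G q) z - q * (wavg D (mu D 0) r (G q) z - G q (z(r := D)))" for q
  using wavg_mu[of D q r "G q" z] by (simp add: wexp_def G_def star_diff_def)
 have "((%p. wexp D (mu D p) (r # rs) F z) has_real_derivative
   wavg D (mu D 0) r G' z - (1 * (wavg D (mu D 0) r (G p) z - G p (z(r := D))) +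
    (wavg D (mu D 0) r G' z - G' (z(r := D))) * p)) (at p)"
  unfolding eq by (intro DERIV_diff U DERIV_mult DERIV_ident IH)
 also have "wavg D (mu D 0) r G' z - (1 * (wavg D (mu D 0) r (G p) z - G p (z(r := D))) +
    (wavg D (mu D 0) r G' z - G' (z(r := D))) * p) = wavg D (mu D p) r G' z - star_diff D r (G p) z"
  using wavg_mu[of D p r G' z] by (simp add: star_diff_def algebra_simps)
 also have "wavg D (mu D p) r G' z = - (\<Sum>s\<leftarrow>rs. wexp D (mu D p) (r # rs) (star_diff D s F) z)"
 proof -
  have "wavg D (mu D p) r G' z = - wavg D (mu D p) r (%y. \<Sum>s\<leftarrow>rs. wexp D (mu D p) rs (star_diff D s F) y) z"
   by (simp add: wavg_def G'_def sum_negf)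
  thus ?thesis by (simp only: wavg_sum_list) (simp add: wexp_def)
 qed
 \<comment> \<open>The difference does not depend on \<open>r\<close>, so an average over
   \<open>r\<close> may be added to give it the form of the other summands.\<close>
 also have "star_diff D r (G p) z = wexp D (mu D p) (r # rs) (star_diff D r F) z"
  using Cons.prems star_diff_wexp[of r rs D "mu D p" F] M_indep[OF indep_star_diff[of r D F]]
  by (simp add: G_def EE_Cons EE_M_comm[symmetric])
 finally show ?case by (simp add: minus_diff_commute)
qed (simp add: wexp_def)

text \<open>Monotonicity for the order that puts the wildcard at the bottom of an otherwise
  unordered alphabet.\<close>

definition downclosed :: "nat => pfun => bool" where
 "downclosed D f \<longleftrightarrow> (\<forall>z r a. f (z(r := D)) <= f (z(r := a)))"

lemma downclosed_wexp:
 assumes "downclosed D f" "1 <= D" "0 <= p" "p <= 1"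
 shows "downclosed D (wexp D (mu D p) rs f)"
proof (induction rs)
 case Nil
 thus ?case using assms by (simp add: wexp_def)
next
 case (Cons r rs)
 interpret finite_weights D "mu D p" using assms by (intro finite_weights_mu) auto
 show ?case unfolding downclosed_def EE_Cons
 proof (intro allI)
  fix z s a
  show "M r (EE rs f) (z(s := D)) <= M r (EE rs f) (z(s := a))"
  proof (cases "r = s")
   case False
   thus ?thesis using Cons unfolding wavg_def downclosed_def
    by (intro sum_mono mult_left_mono m_nonneg) (auto simp: fun_upd_twist)
  qed (simp add: wavg_def)
 qed
qed

lemma wavg_mu_mono:
 assumes "downclosed D f" "1 <= D" "0 <= p"
 shows "wavg D (mu D p) r f z <= wavg D (mu D 0) r f z"
proof -
 have "real D * f (z(r := D)) = (\<Sum>a<D. f (z(r := D)))" by simp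
 also have "... <= (\<Sum>a<D. f (z(r := a)))" using assms(1) by (intro sum_mono) (auto simp: downclosed_def)
 finally have "0 <= star_diff D r f z" using assms(2) by (simp add: star_diff_def wavg_def sum_mu field_simps)
 thus ?thesis using assms(3) by (simp add: wavg_mu[of D p])
qed

lemma wexp_mu_mono:
 assumes "downclosed D f" "1 <= D" "0 <= p" "p <= 1"
 shows "wexp D (mu D p) rs f z <= wexp D (mu D 0) rs f z"
proof (induction rs arbitrary: z)
 case (Cons r rs)
 interpret z: finite_weights D "mu D 0" using assms by (intro finite_weights_mu) auto
 have "wexp D (mu D p) (r # rs) f z <= wavg D (mu D 0) r (wexp D (mu D p) rs f) z"
  using wavg_mu_mono[OF downclosed_wexp[OF assms] assms(2,3)] by (simp add: wexp_def)
 also have "... <= wavg D (mu D 0) r (wexp D (mu D 0) rs f) z" by (rule z.M_mono) (rule Cons)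
 finally show ?case by (simp add: wexp_def)
qed (simp add: wexp_def)

text \<open>If \<open>r\<close> is pivotal, \<open>f\<close> is 0 at the wildcard and 1 at one of
  the \<open>D\<close> other symbols, so the mean over these exceeds the wildcard value by at least
  \<open>1 / D\<close>.\<close>

lemma NC_le_star_diff:
 assumes f: "boolean D f" "downclosed D f" and D: "1 <= D"
 shows "NC D f r z <= real D * star_diff D r f z"
proof -
 have f01: "f y = 0 | f y = 1" for y using f(1) by (auto simp: boolean_def)
 have le: "f (z(r := D)) <= f (z(r := a))" for a using f(2) by (auto simp: downclosed_def)
 have e: "real D * star_diff D r f z = (\<Sum>a<D. f (z(r := a)) - f (z(r := D)))"
  using D by (simp add: star_diff_def wavg_def sum_mu sum_subtractf algebra_simps)
 show ?thesis
 proof (cases "\<exists>a\<le>D. \<exists>b\<le>D. f (z(r := a)) ~= f (z(r := b))")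
  case True
  then obtain a where a: "a <= D" "f (z(r := a)) ~= f (z(r := D))" by metis
  hence "a < D" by (cases "a = D") auto
  moreover have "1 <= f (z(r := a)) - f (z(r := D))" using a(2) le[of a] f01[of "z(r := a)"] f01[of "z(r := D)"] by auto
  moreover have "f (z(r := a)) - f (z(r := D)) <= (\<Sum>a<D. f (z(r := a)) - f (z(r := D)))"
   using \<open>a < D\<close> le by (intro member_le_sum[where f = "%a. f (z(r := a)) - f (z(r := D))"]) auto
  ultimately show ?thesis unfolding e by (simp add: NC_def of_bool_def) 
 next
  case False
  hence "NC D f r z = of_bool False" unfolding NC_def by (intro arg_cong[where f = of_bool]) blast
  thus ?thesis unfolding e using le by (simp add: sum_nonneg)
 qed
qed

text \<open>The average of \<open>f\<close> stays in the unit interval while \<open>p\<close> runs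
  from \<open>q / 2\<close> to \<open>q\<close>, so somewhere its slope is at most
  \<open>2 / q\<close> in size. Russo's formula and \<open>NC_le_star_diff\<close> convert the slope
  into influences. The bound is free of the number of coordinates, and staying above
  \<open>q / 2\<close> keeps the mass of the wildcard bounded below.\<close>

lemma small_total_influence:
 assumes f: "boolean D f" "downclosed D f" and D: "1 <= D" and q: "0 < q" "q <= 1" and rs: "distinct rs"
 shows "\<exists>p. q / 2 < p & p < q & (\<Sum>r\<leftarrow>rs. wexp D (mu D p) rs (NC D f r) z) <= 2 * real D / q"
proof -
 have "\<exists>p > q / 2. p < q & wexp D (mu D q) rs f z - wexp D (mu D (q / 2)) rs f z =
   (q - q / 2) * - (\<Sum>r\<leftarrow>rs. wexp D (mu D p) rs (star_diff D r f) z)"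
  by (rule MVT2) (use q in "auto intro!: russo D rs")
 then obtain p where p: "q / 2 < p" "p < q" "wexp D (mu D q) rs f z - wexp D (mu D (q / 2)) rs f z =
   (q / 2) * - (\<Sum>r\<leftarrow>rs. wexp D (mu D p) rs (star_diff D r f) z)" by auto
 interpret p: finite_weights D "mu D p" using D q p by (intro finite_weights_mu) auto
 interpret a: finite_weights D "mu D q" using D q p by (intro finite_weights_mu) auto
 interpret b: finite_weights D "mu D (q / 2)" using D q p by (intro finite_weights_mu) auto
 have "wexp D (mu D (q / 2)) rs f z <= 1" using b.EE_mono[of f "%_. 1" rs z] b.boolean_bounds[OF f(1)] by simp
 moreover have "0 <= wexp D (mu D q) rs f z" using a.EE_nonneg[of f rs z] b.boolean_bounds[OF f(1)] by simp
 ultimately have "(q / 2) * (\<Sum>r\<leftarrow>rs. wexp D (mu D p) rs (star_diff D r f) z) <= 1" using p(3) by linarith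
 hence *: "(\<Sum>r\<leftarrow>rs. wexp D (mu D p) rs (star_diff D r f) z) <= 2 / q" using q by (simp add: field_simps)
 have "(\<Sum>r\<leftarrow>rs. wexp D (mu D p) rs (NC D f r) z) <= (\<Sum>r\<leftarrow>rs. real D * wexp D (mu D p) rs (star_diff D r f) z)"
  using p.EE_mono[OF NC_le_star_diff[OF f D]] by (intro sum_list_mono) (simp add: p.EE_scale)
 also have "... <= real D * (2 / q)" unfolding sum_list_const_mult using * by (intro mult_left_mono) auto
 finally show ?thesis using p by (intro exI[of _ p]) (simp add: mult.commute)
qed


text \<open>First moment method for the wildcard-free measure.\<close>

lemma wexp_attained:
 assumes D: "1 <= D"
 shows "c <= wexp D (mu D 0) rs F w ==>
  \<exists>z. (\<forall>r. r ~: set rs --> z r = w r) & (\<forall>r \<in> set rs. z r < D) & c <= F z"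
proof (induction rs arbitrary: w)
 case (Cons r rs)
 have "c <= (\<Sum>a<D. wexp D (mu D 0) rs F (w(r := a))) / real D"
  using Cons.prems by (simp add: wexp_def wavg_def sum_mu)
 hence le: "(\<Sum>a<D. c) <= (\<Sum>a<D. wexp D (mu D 0) rs F (w(r := a)))" using D by (simp add: field_simps)
 have "\<exists>a<D. c <= wexp D (mu D 0) rs F (w(r := a))"
 proof (rule ccontr)
  assume "~ ?thesis"
  hence "(\<Sum>a<D. wexp D (mu D 0) rs F (w(r := a))) < (\<Sum>a<D. c)"
   using D by (intro sum_strict_mono) (auto simp: not_le lessThan_empty_iff)
  thus False using le by simp
 qed
 then obtain a where a: "a < D" "c <= wexp D (mu D 0) rs F (w(r := a))" by blast
 from Cons.IH[OF a(2)] obtain z where z: "\<forall>s. s ~: set rs --> z s = (w(r := a)) s" "\<forall>s \<in> set rs. z s < D" "c <= F z" by blast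
 show ?case
 proof (intro exI[of _ z] conjI allI ballI impI)
  fix s assume "s : set (r # rs)"
  thus "z s < D" using z(1,2) a(1) by (cases "s : set rs") auto
 qed (use z in auto)
qed (auto simp: wexp_def)

lemma mod_shift_back:
 fixes D :: nat
 assumes "0 < D"
 shows "(a + (D - X mod D) + X) mod D = a mod D"
proof -
 have "a + (D - X mod D) + X = a + D * (X div D + 1)"
  using mult_div_mod_eq[of D X] mod_less_divisor[OF assms, of X] unfolding distrib_left by linarith
 thus ?thesis by (simp only: mod_mult_self2)
qed

text \<open>\<open>mu D 0\<close> is uniform on the residues modulo \<open>D\<close>, hence
  invariant under shifts. This will couple the points at the two ends of an arc of length
  \<open>X\<close>.\<close>

lemma wexp_shift:
 assumes D: "1 <= D"
 shows "distinct rs ==> set rs <= I ==>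
  wexp D (mu D 0) rs (%z. F (%r. if r : I then (z r + X) mod D else z r)) w
   = wexp D (mu D 0) rs F (%r. if r : I then (w r + X) mod D else w r)"
proof (induction rs arbitrary: w)
 case (Cons r rs)
 have bij: "bij_betw (%a. (a + X) mod D) {..<D} {..<D}"
 proof (rule bij_betwI[where g = "%a. (a + (D - X mod D)) mod D"])
  fix a assume a: "a : {..<D}"
  have e: "(a + (D - X mod D) + X) mod D = a mod D" by (rule mod_shift_back) (use D in simp)
  moreover have "a + X + (D - X mod D) = a + (D - X mod D) + X" by simp
  ultimately have "(a + X + (D - X mod D)) mod D = a mod D" by (simp only:)
  note e = this e
  show "((a + X) mod D + (D - X mod D)) mod D = a" "((a + (D - X mod D)) mod D + X) mod D = a"
   using a e unfolding mod_add_left_eq by simp_all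
 qed (use D in auto)
 define sh where "sh = (%w::point. %r. if r : I then (w r + X) mod D else w r)"
 have up: "sh (w(r := a)) = (sh w)(r := (a + X) mod D)" for a using Cons.prems by (auto simp: sh_def)
 have "wexp D (mu D 0) (r # rs) (%z. F (sh z)) w = (\<Sum>a<D. wexp D (mu D 0) rs F (sh (w(r := a)))) / real D"
  using Cons by (simp add: wexp_def wavg_def sum_mu sh_def)
 also have "(\<Sum>a<D. wexp D (mu D 0) rs F (sh (w(r := a)))) = (\<Sum>a<D. wexp D (mu D 0) rs F ((sh w)(r := a)))"
  unfolding up by (rule sum.reindex_bij_betw[OF bij, of "%a. wexp D (mu D 0) rs F ((sh w)(r := a))"])
 also have "... / real D = wexp D (mu D 0) (r # rs) F (sh w)" by (simp add: wexp_def wavg_def sum_mu)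
 finally show ?case by (simp add: sh_def)
qed (simp add: wexp_def)

text \<open>Wildcards are replaced by 0 one coordinate at a time; dependence on the first
  \<open>k\<close> coordinates makes finitely many replacements enough.\<close>

lemma downclosed_unstar:
 assumes "downclosed D G" "depends_on {..<k} G" "!!r. w r <= D"
 shows "G w <= G (%r. if w r < D then w r else 0)"
proof -
 have "G w <= G (%r. if r < n & ~ w r < D then 0 else w r)" for n
 proof (induction n)
  case (Suc n)
  let ?w = "%r. if r < n & ~ w r < D then 0 else w r"
  have "G ?w <= G (%r. if r < Suc n & ~ w r < D then 0 else w r)"
  proof (cases "w n < D")
   case True
   hence "?w = (%r. if r < Suc n & ~ w r < D then 0 else w r)" by (auto simp: less_Suc_eq)
   thus ?thesis by simp
  next
   case False
   hence "w n = D" using assms(3)[of n] by simp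
   hence "?w = ?w(n := D)" by auto
   hence "G ?w = G (?w(n := D))" by (rule arg_cong)
   also have "... <= G (?w(n := 0))" using assms(1) unfolding downclosed_def by blast
   also have "?w(n := 0) = (%r. if r < Suc n & ~ w r < D then 0 else w r)" using False by (auto simp: less_Suc_eq)
   finally show ?thesis .
  qed
  thus ?case using Suc by linarith
 qed simp
 moreover have "G (%r. if r < k & ~ w r < D then 0 else w r) = G (%r. if w r < D then w r else 0)"
  by (rule assms(2)[unfolded depends_on_def, rule_format]) auto
 ultimately show ?thesis by (metis (lifting))
qed

lemma depends_on_NC: "depends_on S f ==> depends_on S (NC D f r)"
proof -
 assume d: "depends_on S f"
 show ?thesis unfolding depends_on_def
 proof (intro allI impI)
  fix z z' :: point assume "\<forall>r\<in>S. z r = z' r"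
  hence "f (z(r := a)) = f (z'(r := a))" for a using d unfolding depends_on_def by auto
  thus "NC D f r z = NC D f r z'" by (simp add: NC_def)
 qed
qed

definition clamped :: "nat => pfun => bool" where
 "clamped D F \<longleftrightarrow> (\<forall>z r. F (z(r := min (z r) D)) = F z)"

lemma clamped_wexp: "clamped D F ==> clamped D (wexp D m rs F)"
proof (induction rs)
 case (Cons r rs)
 show ?case unfolding clamped_def
 proof (intro allI)
  fix z s
  show "wexp D m (r # rs) F (z(s := min (z s) D)) = wexp D m (r # rs) F z"
  proof (cases "r = s")
   case False
   have "wexp D m rs F (z(s := min (z s) D, r := a)) = wexp D m rs F (z(r := a))" for a
   proof -
    have "z(s := min (z s) D, r := a) = (z(r := a))(s := min ((z(r := a)) s) D)" using False by (auto simp: fun_upd_twist)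
    moreover have "wexp D m rs F ((z(r := a))(s := min ((z(r := a)) s) D)) = wexp D m rs F (z(r := a))"
     using Cons unfolding clamped_def by blast
    ultimately show ?thesis by (simp only:)
   qed
   thus ?thesis by (simp add: wexp_def wavg_def)
  qed (simp add: wexp_def wavg_def)
 qed
qed (simp add: wexp_def)

lemma clamped_many:
 assumes f: "clamped D f"
 shows "f (%s. if s < (n::nat) then min (z s) D else z s) = f z"
proof (induction n)
 case (Suc n)
 let ?z = "%s. if s < n then min (z s) D else z s"
 have "(%s. if s < Suc n then min (z s) D else z s) = ?z(n := min (?z n) D)" by (auto simp: less_Suc_eq)
 moreover have "f (?z(n := min (?z n) D)) = f ?z" using f unfolding clamped_def by blast
 ultimately show ?case using Suc by (simp only:)
qed simp

lemma depends_on_mono: "depends_on S F ==> S <= S' ==> depends_on S' F"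
 unfolding depends_on_def by blast

text \<open>Once \<open>J\<close> is restricted to \<open>w\<close>, the density stays large even if
  an opponent fixes up to \<open>t\<close> coordinates outside \<open>L\<close>. The same
  \<open>t\<close> bounds \<open>J\<close>, because in \<open>compat_if_disjointly_carried\<close>
  the opponent's set is the \<open>J\<close> of another function.\<close>

definition robust_core :: "nat => nat => nat => nat => pfun => nat set => nat set => point => bool" where
 "robust_core D k t T f L J w \<longleftrightarrow> J <= L & L <= {..<k} & card L <= T & card J <= t & (\<forall>r. w r < D) &
  (\<forall>K c. K <= {..<k} & K Int L = {} & card K <= t & (\<forall>r. c r < D) -->
   3/4 <= wexp D (mu D 0) (filter (%r. r ~: J Un K) [0..<k]) f (%r. if r : K then c r else w r))"

lemma robust_coreD:
 assumes "robust_core D k t T f L J w" "K <= {..<k}" "K Int L = {}" "card K <= t" "!!r. c r < D"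
 shows "3/4 <= wexp D (mu D 0) (filter (%r. r ~: J Un K) [0..<k]) f (%r. if r : K then c r else w r)"
proof (rule mp)
 show "K <= {..<k} & K Int L = {} & card K <= t & (\<forall>r. c r < D) -->
   3/4 <= wexp D (mu D 0) (filter (%r. r ~: J Un K) [0..<k]) f (%r. if r : K then c r else w r)"
  by (rule assms(1)[unfolded robust_core_def, THEN conjunct2, THEN conjunct2, THEN conjunct2, THEN conjunct2,
    THEN conjunct2, THEN spec, THEN spec])
qed (use assms(2-) in simp)

lemma card_large_le:
 fixes g :: "nat => real"
 assumes "!!r. 0 <= g r" "(\<Sum>r\<leftarrow>[0..<k]. g r) <= S" "0 < \<kappa>"
 shows "card {r. r < k & \<kappa> < g r} <= nat \<lceil>S / \<kappa>\<rceil>"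
proof -
 let ?A = "{r. r < k & \<kappa> < g r}"
 have "real (card ?A) * \<kappa> = (\<Sum>r\<in>?A. \<kappa>)" by simp
 also have "... <= (\<Sum>r\<in>?A. g r)" by (intro sum_mono) auto
 also have "... <= (\<Sum>r\<in>{0..<k}. g r)" using assms(1) by (intro sum_mono2) auto
 also have "... <= S" using assms(2) by (simp add: interv_sum_list_conv_sum_set_nat)
 finally have "real (card ?A) <= S / \<kappa>" using assms(3) by (simp add: field_simps)
 thus ?thesis by linarith
qed

text \<open>At a bias with small total influence, \<open>junta_boost\<close> restricts a small set
  \<open>J\<close> so that the density becomes 7/8, and the larger set \<open>L\<close> collects all
  coordinates that an opponent could exploit. \<open>t\<close> and \<open>T\<close> are chosen
  before \<open>k\<close>, which the order of parameters in the reduction demands.\<close>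

lemma robust_core_exists:
 assumes D: "1 <= D" and \<delta>: "0 < \<delta>"
 shows "\<exists>t T. \<forall>k f. boolean D f & downclosed D f & depends_on {..<k} f &
  \<delta> <= wexp D (mu D (1 / (real D + 1))) [0..<k] f (%_. 0) --> (\<exists>L J w. robust_core D k t T f L J w)"
proof -
 \<comment> \<open>\<open>q\<close> is the share of the wildcard in the uniform measure on
   \<open>{0..D}\<close>. The bias will lie between \<open>q / 2\<close> and \<open>q\<close>, so
   every symbol has mass at least \<open>lam\<close>.\<close>
 define q where "q = 1 / (real D + 1)"
 define lam where "lam = q / 2"
 define S where "S = 2 * real D / q"
 have q: "0 < q" "q <= 1/2" using D by (auto simp: q_def field_simps)
 have lam: "0 < lam" "lam <= 1/4" using q by (auto simp: lam_def)
 have S: "0 < S" using D q by (simp add: S_def)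
 \<comment> \<open>The noise loss \<open>(1 - \<rho>) * S\<close> and the smoothing error
   \<open>sqrt (\<eta> * S)\<close> get at most \<delta> / 32 each, within the slack
   \<open>(1 - 7/8) * \<delta>\<close> of \<open>junta_boost\<close>. The exponent
   \<open>2 ^ j\<close> brings the power of \<rho> below \<open>lam\<close>, where
   hypercontractivity applies.\<close>
 define \<rho> where "\<rho> = 1 - min (1/2) (\<delta> / (32 * S))"
 have \<rho>: "0 <= \<rho>" "\<rho> < 1" using \<delta> S by (auto simp: \<rho>_def)
 have \<rho>S: "(1 - \<rho>) * S <= \<delta> / 32"
 proof -
  have "(1 - \<rho>) * S <= \<delta> / (32 * S) * S" using S by (intro mult_right_mono) (auto simp: \<rho>_def)
  thus ?thesis using S by simp
 qed
 obtain j where j: "\<rho> ^ j < lam" using real_arch_pow_inv[OF lam(1) \<rho>(2)] by blast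
 have "\<rho> ^ (2 ^ j) <= \<rho> ^ j" using \<rho> by (intro power_decreasing) (auto intro: less_imp_le less_exp)
 hence \<rho>j: "\<rho> ^ (2 ^ j) <= lam" "0 <= \<rho> ^ (2 ^ j)" using j \<rho> by auto
 have \<rho>1: "4 * (\<rho> ^ (2 ^ j))\<^sup>2 <= 1"
 proof -
  have "(\<rho> ^ (2 ^ j))\<^sup>2 <= (1/4)\<^sup>2" using \<rho>j lam by (intro power_mono) auto
  thus ?thesis by (simp add: power2_eq_square)
 qed
 have \<rho>2: "3 * (\<rho> ^ (2 ^ j)) ^ 4 <= lam"
 proof -
  have "(\<rho> ^ (2 ^ j)) ^ 3 <= (1/4) ^ 3" using \<rho>j lam by (intro power_mono) auto
  hence "(\<rho> ^ (2 ^ j)) ^ 3 * \<rho> ^ (2 ^ j) <= (1/3) * lam" using \<rho>j lam by (intro mult_mono) (auto simp: power3_eq_cube)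
  thus ?thesis by (simp add: power4_eq_xxxx power3_eq_cube)
 qed
 define \<eta> where "\<eta> = (\<delta> / 32)\<^sup>2 / S"
 have \<eta>: "0 < \<eta>" using \<delta> S by (simp add: \<eta>_def)
 have \<eta>S: "sqrt (\<eta> * S) = \<delta> / 32" using \<delta> S by (simp add: \<eta>_def)
 define \<kappa> where "\<kappa> = \<eta> ^ (2 ^ Suc j)"
 have \<kappa>: "0 < \<kappa>" using \<eta> by (simp add: \<kappa>_def)
 define t where "t = nat \<lceil>S / \<kappa>\<rceil>"
 \<comment> \<open>Fixing \<open>J\<close> and part of \<open>K\<close> concerns at most
   \<open>2 * t + 1\<close> coordinates, each of which can raise an influence by a factor
   \<open>1 / lam\<close>. The threshold leaves a loss of \<open>1 / (8 * (t + 1))\<close> per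
   coordinate of \<open>K\<close>, so the density drops from 7/8 to no less than 3/4.\<close>
 define \<kappa>2 where "\<kappa>2 = min \<kappa> (lam ^ (2 * t + 1) / (8 * (real t + 1)))"
 have \<kappa>2: "0 < \<kappa>2" "\<kappa>2 <= \<kappa>" using \<kappa> lam by (auto simp: \<kappa>2_def)
 define T where "T = nat \<lceil>S / \<kappa>2\<rceil>"
 have "\<exists>L J w. robust_core D k t T f L J w"
  if f: "boolean D f" "downclosed D f" "depends_on {..<k} f" and \<delta>f: "\<delta> <= wexp D (mu D q) [0..<k] f (%_. 0)" for k f
 proof -
  obtain p where p: "q / 2 < p" "p < q" and S': "(\<Sum>r\<leftarrow>[0..<k]. wexp D (mu D p) [0..<k] (NC D f r) (%_. 0)) <= S"
   using small_total_influence[OF f(1,2) D q(1), of "[0..<k]" "%_. 0"] q unfolding S_def by auto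
  interpret finite_weights D "mu D p" using D q p by (intro finite_weights_mu) auto
  have mu_ge: "lam <= mu D p a" if "a <= D" for a
  proof (cases "a = D")
   case True thus ?thesis using p by (simp add: mu_def lam_def)
  next
   case False
   have "q * (real D + 1) = 1" by (simp add: q_def)
   hence "q = (1 - q) / real D" using D by (simp add: field_simps)
   also have "... <= (1 - p) / real D" using p D by (intro divide_right_mono) auto
   finally have "q <= mu D p a" using False by (simp add: mu_def)
   thus ?thesis using q by (simp add: lam_def)
  qed
  define P where "P r = EE [0..<k] (NC D f r) (%_. 0)" for r
  have P0: "0 <= P r" for r unfolding P_def by (rule EE_nonneg) (simp add: NC_bounds)
  have SP: "(\<Sum>r\<leftarrow>[0..<k]. P r) <= S" using S' by (simp add: P_def)
  \<comment> \<open>Lowering the wildcard probability from \<open>q\<close> to \<open>p\<close> can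
    only increase the density.\<close>
  have "\<delta> <= EE [0..<k] f (%_. 0)"
  proof -
   have 1: "((%p. wexp D (mu D p) [0..<k] f (%_. 0)) has_real_derivative
     - (\<Sum>r\<leftarrow>[0..<k]. wexp D (mu D x) [0..<k] (star_diff D r f) (%_. 0))) (at x)" if "p <= x" "x <= q" for x
    using that p q D by (intro russo) auto
   have 2: "- (\<Sum>r\<leftarrow>[0..<k]. wexp D (mu D x) [0..<k] (star_diff D r f) (%_. 0)) <= 0" if "p <= x" "x <= q" for x
   proof -
    interpret x: finite_weights D "mu D x" using D q p that by (intro finite_weights_mu) auto
    have "0 <= real D * star_diff D r f z" for r z using NC_le_star_diff[OF f(1,2) D, of r z] NC_bounds(1)[of f r z] by linarith
    hence "0 <= star_diff D r f z" for r z using D by (simp add: zero_le_mult_iff)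
    hence "0 <= wexp D (mu D x) [0..<k] (star_diff D r f) (%_. 0)" for r by (rule x.EE_nonneg)
    hence "0 <= (\<Sum>r\<leftarrow>[0..<k]. wexp D (mu D x) [0..<k] (star_diff D r f) (%_. 0))" by (intro sum_list_nonneg) auto
    thus ?thesis by simp
   qed
   have "wexp D (mu D q) [0..<k] f (%_. 0) <= wexp D (mu D p) [0..<k] f (%_. 0)"
   proof (rule DERIV_nonpos_imp_nonincreasing[where f = "%p. wexp D (mu D p) [0..<k] f (%_. 0)" and a = p and b = q])
    show "p <= q" using p by simp
   qed (use 1 2 in blast)
   thus ?thesis using \<delta>f by linarith
  qed
  hence "(1 - \<rho>) * S + sqrt (\<eta> * S) < (1 - 7/8) * EE [0..<k] f (%_. 0)"
   using \<rho>S \<eta>S \<delta> by simp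
  from junta_boost[OF f(1) lam(1) mu_ge \<rho>1 \<rho>2 \<rho>(1) less_imp_le[OF \<rho>(2)] less_imp_le[OF \<eta>] SP[unfolded P_def] this]
  obtain w0 where w0: "7/8 <= EE (filter (%r. P r <= \<kappa>) [0..<k]) f w0" by (auto simp: P_def \<kappa>_def)
  define J where "J = {r. r < k & \<kappa> < P r}"
  define L where "L = {r. r < k & \<kappa>2 < P r}"
  \<comment> \<open>\<open>junta_boost\<close> returns an arbitrary point. It is first clamped into
    \<open>{0..D}\<close>, and its wildcards are dropped in \<open>w\<close>.\<close>
  define w1 where "w1 = (%r. if r < k then min (w0 r) D else 0)"
  define w where "w = (%r. if w1 r < D then w1 r else 0)"
  have w1D: "w1 r <= D" for r by (simp add: w1_def)
  have fil: "filter (%r. P r <= \<kappa>) [0..<k] = filter (%r. r ~: J) [0..<k]"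
   by (rule filter_cong) (auto simp: J_def)
  have w1: "7/8 <= EE (filter (%r. r ~: J) [0..<k]) f w1"
  proof -
   define G where "G = EE (filter (%r. r ~: J) [0..<k]) f"
   have "clamped D f" using f(1) by (simp add: clamped_def boolean_def)
   hence "G (%s. if s < k then min (w0 s) D else w0 s) = G w0" unfolding G_def by (intro clamped_many clamped_wexp)
   moreover have "G (%s. if s < k then min (w0 s) D else w0 s) = G w1"
    using depends_on_wexp[OF f(3), of "filter (%r. r ~: J) [0..<k]"] unfolding depends_on_def G_def
    by (auto simp: w1_def)
   ultimately show ?thesis using w0 by (simp add: fil G_def)
  qed
  have J: "J <= L" "card J <= t" and L: "L <= {..<k}" "card L <= T"
   using card_large_le[OF P0 SP \<kappa>] card_large_le[OF P0 SP \<kappa>2(1)] \<kappa>2(2) by (auto simp: J_def L_def t_def T_def)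
  have wD: "w r < D" for r using D by (auto simp: w_def)
  have "3/4 <= wexp D (mu D 0) (filter (%r. r ~: J Un K) [0..<k]) f (%r. if r : K then c r else w r)"
   if K: "K <= {..<k}" "K Int L = {}" "card K <= t" and c: "\<forall>r. c r < D" for K c
  proof -
   define rest where "rest = filter (%r. r ~: J Un K) [0..<k]"
   define ks where "ks = filter (%r. r : K) [0..<k]"
   define js where "js = filter (%r. r : J) [0..<k]"
   define B where "B = 1 / (8 * (real t + 1))"
   have B0: "0 <= B" by (simp add: B_def)
   have dis: "distinct ks" "distinct rest" "distinct js" by (simp_all add: ks_def rest_def js_def)
   have sets: "set ks = K" "set js = J" "set rest = {..<k} - (J Un K)"
    using K L J by (auto simp: ks_def js_def rest_def)
   have JK: "J Int K = {}" using K J by auto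
   have len: "length ks <= t" "length js <= t" using dis sets K J by (metis distinct_card)+
   have "EE (filter (%r. r ~: J) [0..<k]) f = EE (ks @ rest) f"
   proof (rule EE_perm)
    have "set (filter (%r. r ~: J) [0..<k]) = set (ks @ rest)" using sets JK K by auto
    thus "mset (filter (%r. r ~: J) [0..<k]) = mset (ks @ rest)"
     using dis sets by (subst set_eq_iff_mset_eq_distinct[symmetric]) auto
   qed
   hence "7/8 <= EE (ks @ rest) f w1" using w1 by simp
   also have "... <= EE rest f (%s. if s : set ks then c s else w1 s) + real (length ks) * B"
   proof (rule wexp_fix_many[OF f(1)])
    fix as r bs assume ks: "ks = as @ r # bs"
    \<comment> \<open>The coordinates fixed so far, together with \<open>r\<close>. All others are
      averaged, so the global influence \<open>P r\<close> controls the conditional one.\<close>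
    define fs where "fs = js @ as @ [r]"
    define G where "G = EE (bs @ rest) (NC D f r)"
    define w2 where "w2 = (%s. if s : set fs then if s : set as then c s else w1 s else 0)"
    have r: "r : K" "r < k" using sets(1) ks K by auto
    have Kset: "K = set as Un {r} Un set bs" using sets(1) ks by auto
    have "depends_on ({..<k} - set (bs @ rest)) G" unfolding G_def
     by (intro depends_on_wexp depends_on_NC f)
    hence dG: "depends_on (set fs) G" by (rule depends_on_mono) (use sets Kset in "auto simp: fs_def")
    have "lam ^ length fs * G w2 <= EE fs G (%_. 0)"
    proof (rule wexp_fix_lower[OF lam(1) mu_ge])
     show "0 <= G z" for z unfolding G_def by (rule EE_nonneg) (simp add: NC_bounds)
     show "w2 s <= D" for s using c w1D by (auto simp: w2_def intro: less_imp_le)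
    qed (auto simp: w2_def)
    also have "EE fs G = EE (fs @ bs @ rest) (NC D f r)" by (simp add: G_def EE_append)
    also have "... = EE [0..<k] (NC D f r)"
    proof (rule EE_perm)
     have "distinct (fs @ bs @ rest)" using dis sets JK Kset K ks by (auto simp: fs_def)
     moreover have "set (fs @ bs @ rest) = set [0..<k]" using sets Kset K L J by (auto simp: fs_def)
     ultimately show "mset (fs @ bs @ rest) = mset [0..<k]"
      by (metis distinct_upt set_eq_iff_mset_eq_distinct)
    qed
    finally have "lam ^ length fs * G w2 <= P r" by (simp add: P_def)
    also have "P r <= \<kappa>2" using r K(2) by (auto simp: L_def)
    also have "\<kappa>2 <= lam ^ (2 * t + 1) * B" by (simp add: \<kappa>2_def B_def)
    also have "... <= lam ^ length fs * B"
     using len lam ks B0 by (intro mult_right_mono power_decreasing) (auto simp: fs_def)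
    finally have "G w2 <= B" using lam by simp
    moreover have "G (%s. if s : set as then c s else w1 s) = G w2"
     using dG unfolding depends_on_def by (auto simp: w2_def)
    ultimately show "EE (bs @ rest) (NC D f r) (%s. if s : set as then c s else w1 s) <= B" by (simp add: G_def)
   qed (use c dis sets in "auto intro: less_imp_le")
   also have "real (length ks) * B <= 1/8"
    using len(1) by (simp add: B_def field_simps)
   finally have 1: "3/4 <= EE rest f (%s. if s : K then c s else w1 s)" using sets by simp
   \<comment> \<open>Both the removal of wildcards from the assignment and the passage to
     \<open>mu D 0\<close> can only increase the density.\<close>
   have "EE rest f (%s. if s : K then c s else w1 s) <= EE rest f (%r. if (if r : K then c r else w1 r) < D then (if r : K then c r else w1 r) else 0)"
   proof (rule downclosed_unstar[where G = "EE rest f" and D = D and k = k and w = "%s. if s : K then c s else w1 s"])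
    show "downclosed D (EE rest f)" using p q by (intro downclosed_wexp f D) auto
    show "depends_on {..<k} (EE rest f)" using depends_on_wexp[OF f(3)] by (rule depends_on_mono) auto
    show "(if r : K then c r else w1 r) <= D" for r using c w1D by (auto intro: less_imp_le)
   qed
   also have "(%r. if (if r : K then c r else w1 r) < D then (if r : K then c r else w1 r) else 0) = (%r. if r : K then c r else w r)"
    using c by (auto simp: w_def)
   also have "EE rest f (%r. if r : K then c r else w r) <= wexp D (mu D 0) rest f (%r. if r : K then c r else w r)"
    using p q by (intro wexp_mu_mono f D) auto
   finally show ?thesis using 1 by (simp add: rest_def)
  qed
  hence "robust_core D k t T f L J w" unfolding robust_core_def using J L wD by blast
  thus ?thesis by blast
 qed
 thus ?thesis unfolding q_def by blast
qed

section \<open>Incompatible dense sets share a coordinate\<close>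

definition cube :: "nat => nat => nat list set" where
 "cube D k = {z. length z = k & set z <= {..D}}"

text \<open>A step along an arc of length \<open>X\<close> from the distances \<open>z\<close> to
  the distances \<open>y\<close>. A coordinate that would reach \<open>D\<close> is unconstrained,
  and so is one with a wildcard on either side, since \<open>D <= D + X\<close>.\<close>

definition compat :: "nat => nat => nat list => nat list => bool" where
 "compat D X z y \<longleftrightarrow> (\<forall>r < length z. D <= z ! r + X | y ! r = D | y ! r = z ! r + X)"

text \<open>The points that arise from members of \<open>A\<close> by filling in wildcards. This
  closure provides the monotonicity and does no harm, as wildcards only relax
  \<open>compat\<close>.\<close>

definition lift :: "nat => nat => nat list set => pfun" where
 "lift D k A z = of_bool (\<exists>x \<in> A. \<forall>r < k. x ! r = D | x ! r = min (z r) D)"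

lemma boolean_lift: "boolean D (lift D k A)"
proof -
 have "(min ((z(r := min (z r) D)) s) D) = min (z s) D" for z :: point and r s by auto
 hence "lift D k A (z(r := min (z r) D)) = lift D k A z" for z r unfolding lift_def by (simp only:)
 moreover have "lift D k A z : {0, 1}" for z by (simp add: lift_def of_bool_def)
 ultimately show ?thesis unfolding boolean_def by blast
qed

lemma downclosed_lift: "downclosed D (lift D k A)"
proof -
 have "\<exists>x\<in>A. \<forall>s<k. x ! s = D | x ! s = min ((z(r := a)) s) D"
  if h: "\<exists>x\<in>A. \<forall>s<k. x ! s = D | x ! s = min ((z(r := D)) s) D" for z :: point and r a
 proof -
  obtain x where x: "x : A" "\<forall>s<k. x ! s = D | x ! s = min ((z(r := D)) s) D" using h by blast
  have "x ! s = D | x ! s = min ((z(r := a)) s) D" if "s < k" for s using x(2) that by (cases "s = r") auto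
  thus ?thesis using x(1) by blast
 qed
 moreover have "of_bool P <= (of_bool Q :: real)" if "P ==> Q" for P Q using that by (cases P) auto
 ultimately show ?thesis unfolding downclosed_def lift_def by blast
qed

lemma depends_on_lift: "depends_on {..<k} (lift D k A)"
 unfolding depends_on_def lift_def by simp

lemma finite_cube: "finite (cube D k)" and card_cube: "card (cube D k) = (D + 1) ^ k"
proof -
 have e: "cube D k = {xs. set xs <= {..D} & length xs = k}" by (auto simp: cube_def)
 show "finite (cube D k)" unfolding e by (rule finite_lists_length_eq) simp
 show "card (cube D k) = (D + 1) ^ k" unfolding e by (subst card_lists_length_eq) auto
qed

text \<open>The uniform measure on the cube is the biased one with wildcard probability
  \<open>1 / (D + 1)\<close>, and \<open>lift\<close> dominates the indicator of
  \<open>A\<close>.\<close>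

lemma density_lift:
 assumes D: "1 <= D" and A: "A <= cube D k" and \<delta>: "\<delta> * (real D + 1) ^ k <= real (card A)"
 shows "\<delta> <= wexp D (mu D (1 / (real D + 1))) [0..<k] (lift D k A) (%_. 0)"
proof -
 define q where "q = 1 / (real D + 1)"
 have q: "0 < q" "q <= 1" using D by (auto simp: q_def)
 interpret finite_weights D "mu D q" using D q by (intro finite_weights_mu) auto
 have "q * (real D + 1) = 1" by (simp add: q_def)
 hence "q = (1 - q) / real D" using D by (simp add: field_simps)
 hence mq: "q <= mu D q a" for a by (simp add: mu_def)
 have fin: "finite A" using A finite_cube finite_subset by blast
 define G where "G x z = (of_bool (\<forall>r<k. z r = x ! r) :: real)" for x :: "nat list" and z :: point
 have G: "q ^ k <= EE [0..<k] (G x) (%_. 0)" if "x : A" for x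
 proof -
  have "length x = k" "set x <= {..D}" using A \<open>x : A\<close> by (auto simp: cube_def)
  hence xD: "x ! r <= D" if "r < k" for r using that by (metis atMost_iff nth_mem subsetD)
  have "q ^ length [0..<k] * G x (%r. if r < k then x ! r else 0) <= EE [0..<k] (G x) (%_. 0)"
   by (rule wexp_fix_lower[OF q(1) mq]) (auto simp: G_def xD)
  thus ?thesis by (simp add: G_def)
 qed
 have "\<delta> <= real (card A) * q ^ k" using \<delta> D by (simp add: q_def power_one_over field_simps)
 also have "... = (\<Sum>x\<in>A. q ^ k)" by simp
 also have "... <= (\<Sum>x\<in>A. EE [0..<k] (G x) (%_. 0))" by (intro sum_mono G)
 also have "... = EE [0..<k] (%z. \<Sum>x\<in>A. G x z) (%_. 0)" by (simp add: EE_sum[OF fin])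
 also have "... <= EE [0..<k] (lift D k A) (%_. 0)"
 proof (rule EE_mono)
  fix z :: point
  show "(\<Sum>x\<in>A. G x z) <= lift D k A z"
  proof (cases "\<exists>x\<in>A. \<forall>r<k. z r = x ! r")
   case True
   then obtain x where x: "x : A" "\<forall>r<k. z r = x ! r" by blast
   have "G y z = 0" if "y : A - {x}" for y
   proof -
    have "length x = k" "length y = k" using A x(1) that by (auto simp: cube_def)
    hence "\<exists>r<k. x ! r ~= y ! r" using that by (metis DiffD2 insertI1 nth_equalityI)
    thus ?thesis using x(2) by (auto simp: G_def)
   qed
   hence "(\<Sum>x\<in>A. G x z) = (\<Sum>x\<in>{x}. G x z)" using fin x(1) by (intro sum.mono_neutral_right) auto
   also have "... = G x z" by simp
   also have "... <= 1" unfolding G_def by simp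
   also have "1 = lift D k A z"
   proof -
    have "length x = k" "set x <= {..D}" using A x(1) by (auto simp: cube_def)
    hence "x ! r <= D" if "r < k" for r using that by (metis atMost_iff nth_mem subsetD)
    hence "x ! r = min (z r) D" if "r < k" for r using x(2) that by simp
    thus ?thesis using x(1) by (auto simp: lift_def)
   qed
   finally show ?thesis .
  next
   case False
   hence "G x z = 0" if "x : A" for x using that by (auto simp: G_def)
   hence "(\<Sum>x\<in>A. G x z) = 0" by simp
   thus ?thesis by (simp add: lift_def)
  qed
 qed
 finally show ?thesis by (simp add: q_def)
qed

text \<open>The interface to the reduction: of the core only the short label list \<open>L\<close>
  is kept.\<close>

definition carries :: "nat => nat => nat => nat => nat list set => nat set => bool" where
 "carries D k t T A L \<longleftrightarrow> (\<exists>J w. robust_core D k t T (lift D k A) L J w)"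

lemma carries_exists:
 assumes "1 <= D" "0 < \<delta>"
 shows "\<exists>t T. \<forall>k A. A <= cube D k & \<delta> * (real D + 1) ^ k <= real (card A) --> (\<exists>L. carries D k t T A L)"
proof -
 obtain t T where core: "!!k f. boolean D f ==> downclosed D f ==> depends_on {..<k} f ==>
  \<delta> <= wexp D (mu D (1 / (real D + 1))) [0..<k] f (%_. 0) ==> \<exists>L J w. robust_core D k t T f L J w"
  using robust_core_exists[OF assms] by blast
 show ?thesis unfolding carries_def
  by (intro exI[of _ t] exI[of _ T] allI impI, elim conjE)
   (intro core boolean_lift downclosed_lift depends_on_lift density_lift assms)
qed

lemma carriesD:
 assumes "carries D k t T A L"
 shows "L <= {..<k}" "card L <= T"
 using assms by (auto simp: carries_def robust_core_def)

text \<open>If the lists are disjoint, each core tolerates the values that the other one prescribes.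
  Both densities are then at least 3/4 over the remaining coordinates, and the shift by
  \<open>X\<close> couples the two uniform points, so by the union bound both sets are hit at
  once.\<close>

theorem compat_if_disjointly_carried:
 assumes D: "1 <= D" and A: "A <= cube D k" "carries D k t T A L" and B: "B <= cube D k" "carries D k t T B L'"
  and dis: "L Int L' = {}"
 shows "\<exists>z\<in>A. \<exists>y\<in>B. compat D X z y"
proof -
  interpret finite_weights D "mu D 0" using D by (intro finite_weights_mu) auto
  obtain J w where JA: "robust_core D k t T (lift D k A) L J w" using A(2) by (auto simp: carries_def)
  obtain J' w' where JB: "robust_core D k t T (lift D k B) L' J' w'" using B(2) by (auto simp: carries_def)
  have w: "w r < D" "w' r < D" for r using JA JB by (auto simp: robust_core_def)
  have sub: "J <= L" "J' <= L'" "L <= {..<k}" "L' <= {..<k}" "card J <= t" "card J' <= t"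
   using JA JB by (auto simp: robust_core_def)
  define rest where "rest = filter (%r. r ~: J Un J') [0..<k]"
  define sh where "sh = (%z::point. %r. if r : UNIV then (z r + X) mod D else z r)"
  \<comment> \<open>The value on \<open>J'\<close> is \<open>w'\<close> minus \<open>X\<close>
    modulo \<open>D\<close>, so that the shift of \<open>z0\<close> agrees with \<open>y0\<close> on
    all fixed coordinates.\<close>
  define z0 where "z0 = (%r. if r : J' then (w' r + (D - X mod D)) mod D else w r)"
  define y0 where "y0 = (%r. if r : J then (w r + X) mod D else w' r)"
  have D0: "0 < D" using D by simp
  have "3/4 <= EE rest (lift D k A) (%r. if r : J' then (%r. (w' r + (D - X mod D)) mod D) r else w r)"
   unfolding rest_def using sub dis D0 by (intro robust_coreD[OF JA]) auto
  hence zA: "3/4 <= EE rest (lift D k A) z0" by (simp add: z0_def)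
  have "3/4 <= EE (filter (%r. r ~: J' Un J) [0..<k]) (lift D k B) (%r. if r : J then (%r. (w r + X) mod D) r else w' r)"
   using sub dis D0 by (intro robust_coreD[OF JB]) auto
  hence yB: "3/4 <= EE rest (lift D k B) y0" by (simp add: y0_def rest_def Un_commute)
  have "EE rest (lift D k B) (sh z0) = EE rest (lift D k B) y0"
  proof -
   have "sh z0 r = y0 r" if "r : {..<k} - set rest" for r
   proof (cases "r : J'")
    case True
    hence "r ~: J" using sub dis by auto
    have "(w' r + (D - X mod D) + X) mod D = w' r" using mod_shift_back[OF D0, of "w' r" X] w by simp
    thus ?thesis using True \<open>r ~: J\<close> by (simp add: sh_def z0_def y0_def mod_add_left_eq)
   next
    case False
    hence "r : J" using that by (auto simp: rest_def)
    thus ?thesis using False by (simp add: sh_def z0_def y0_def)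
   qed
   thus ?thesis using depends_on_wexp[OF depends_on_lift[of k D B], of rest] unfolding depends_on_def by blast
  qed
  \<comment> \<open>Two 0-1 values whose sum averages at least 3/2 are both 1 somewhere.\<close>
  hence "3/2 <= EE rest (%z. lift D k A z + lift D k B (sh z)) z0"
   using zA yB wexp_shift[OF D, of rest UNIV "lift D k B" X z0] by (simp add: EE_add sh_def rest_def)
  from wexp_attained[OF D this] obtain z where z: "\<forall>r. r ~: set rest --> z r = z0 r" "\<forall>r \<in> set rest. z r < D"
   "3/2 <= lift D k A z + lift D k B (sh z)" by blast
  have zD: "z r < D" for r using z(1,2) w D0 by (cases "r : set rest") (auto simp: z0_def)
  have "lift D k A z = 1" "lift D k B (sh z) = 1"
   using z(3) boolean_cases[OF boolean_lift, of k A z] boolean_cases[OF boolean_lift, of k B "sh z"] by auto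
  then obtain x y where x: "x : A" "\<forall>r<k. x ! r = D | x ! r = min (z r) D"
   and y: "y : B" "\<forall>r<k. y ! r = D | y ! r = min (sh z r) D" by (auto simp: lift_def)
  have "compat D X x y" unfolding compat_def
  proof (intro allI impI)
   fix r assume "r < length x"
   hence r: "r < k" using x(1) A by (auto simp: cube_def)
   \<comment> \<open>The shift wraps around only where the distance reaches \<open>D\<close>, and
     there \<open>compat\<close> demands nothing.\<close>
   show "D <= x ! r + X | y ! r = D | y ! r = x ! r + X"
   proof (cases "z r + X < D")
    case True
    thus ?thesis using x(2)[rule_format, OF r] y(2)[rule_format, OF r] zD[of r] by (auto simp: sh_def)
   next
    case False
    thus ?thesis using x(2) r zD[of r] by auto
   qed
  qed
  thus ?thesis using x(1) y(1) by blast
qed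

text \<open>Carries a point from the labels of the second endpoint of a constraint to those of the
  first, where label \<open>r\<close> corresponds to \<open>\<pi> r\<close>.\<close>

definition permute :: "nat => (nat => nat) => nat list => nat list" where
 "permute k \<pi> z = map (%r. z ! \<pi> r) [0..<k]"

lemma length_permute [simp]: "length (permute k \<pi> z) = k"
 by (simp add: permute_def)

lemma nth_permute [simp]: "r < k ==> permute k \<pi> z ! r = z ! \<pi> r"
 by (simp add: permute_def)

lemma wexp_reindex:
 assumes "bij \<rho>"
 shows "wexp D m rs (%z. F (z \<circ> \<rho>)) z = wexp D m (map (inv \<rho>) rs) F (z \<circ> \<rho>)"
proof (induction rs arbitrary: z)
 case (Cons r rs)
 have upd: "z(r := a) \<circ> \<rho> = (z \<circ> \<rho>)(inv \<rho> r := a)" for z :: point and a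
  using assms by (auto simp: fun_eq_iff bij_is_surj surj_f_inv_f bij_inv_eq_iff)
 have C: "wexp D m (r # rs) G z = wavg D m r (wexp D m rs G) z" for r rs G z by (simp add: wexp_def)
 show ?case unfolding C list.map wavg_def Cons.IH upd ..
qed (simp add: wexp_def)

text \<open>Transport of the core. The permutation is extended by the identity to all naturals, so
  that \<open>wexp_reindex\<close> applies.\<close>

lemma carries_permute:
 assumes D: "1 <= D" and \<pi>: "bij_betw \<pi> {..<k} {..<k}" and L: "carries D k t T A L"
 shows "carries D k t T (permute k \<pi> ` A) {r. r < k & \<pi> r : L}"
proof -
 interpret finite_weights D "mu D 0" using D by (intro finite_weights_mu) auto
 obtain J w where J: "robust_core D k t T (lift D k A) L J w" using L by (auto simp: carries_def)
 define \<sigma> where "\<sigma> r = (if r < k then \<pi> r else r)" for r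
 have "bij_betw \<sigma> {..<k} {..<k}" using \<pi> by (subst bij_betw_cong[of _ \<sigma> \<pi>]) (auto simp: \<sigma>_def)
 hence "\<sigma> permutes {..<k}" by (rule bij_imp_permutes) (simp add: \<sigma>_def)
 hence bij: "bij \<sigma>" and \<sigma>k: "!!r. \<sigma> r < k \<longleftrightarrow> r < k" by (auto simp: permutes_bij dest: permutes_in_image)
 have inv: "inv \<sigma> (\<sigma> r) = r" "\<sigma> (inv \<sigma> r) = r" for r using bij by (auto simp: bij_is_inj bij_is_surj surj_f_inv_f)
 have invk: "inv \<sigma> r < k \<longleftrightarrow> r < k" for r using \<sigma>k[of "inv \<sigma> r"] inv by simp
 define L' J' where "L' = {r. r < k & \<pi> r : L}" and "J' = {r. r < k & \<pi> r : J}"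
 have sub: "J <= L" "L <= {..<k}" "card L <= T" "card J <= t" "!!r. w r < D" using J by (auto simp: robust_core_def)
 have im: "L' = inv \<sigma> ` L" "J' = inv \<sigma> ` J"
 proof -
  have *: "{r. r < k & \<pi> r : S} = inv \<sigma> ` S" if "S <= {..<k}" for S
  proof
   show "{r. r < k & \<pi> r : S} <= inv \<sigma> ` S"
   proof
    fix r assume "r : {r. r < k & \<pi> r : S}"
    hence "\<sigma> r : S" by (simp add: \<sigma>_def)
    thus "r : inv \<sigma> ` S" using inv(1)[of r] by (metis imageI)
   qed
   show "inv \<sigma> ` S <= {r. r < k & \<pi> r : S}"
   proof
    fix r assume "r : inv \<sigma> ` S"
    then obtain s where s: "s : S" "r = inv \<sigma> s" by blast
    hence "r < k" "\<sigma> r = s" using that invk inv by auto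
    thus "r : {r. r < k & \<pi> r : S}" using s by (simp add: \<sigma>_def)
   qed
  qed
  show "L' = inv \<sigma> ` L" unfolding L'_def by (rule *[OF sub(2)])
  show "J' = inv \<sigma> ` J" unfolding J'_def by (rule *[OF order_trans[OF sub(1,2)]])
 qed
 have fin: "finite L" "finite J" using sub finite_subset[of L "{..<k}"] finite_subset[of J L] by auto
 have lift: "lift D k (permute k \<pi> ` A) = (%z. lift D k A (z \<circ> inv \<sigma>))"
 proof
  fix z :: point
  have "(\<forall>r<k. permute k \<pi> x ! r = D | permute k \<pi> x ! r = min (z r) D) \<longleftrightarrow> (\<forall>r<k. x ! r = D | x ! r = min ((z \<circ> inv \<sigma>) r) D)" (is "?l \<longleftrightarrow> ?r") for x
  proof
   assume l: ?l
   show ?r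
   proof (intro allI impI)
    fix r assume "r < k"
    hence "inv \<sigma> r < k" "\<pi> (inv \<sigma> r) = r" using invk[of r] inv(2)[of r] by (auto simp: \<sigma>_def)
    thus "x ! r = D | x ! r = min ((z \<circ> inv \<sigma>) r) D" using l[rule_format, of "inv \<sigma> r"] by simp
   qed
  next
   assume r: ?r
   show ?l
   proof (intro allI impI)
    fix r assume "r < k"
    hence "\<sigma> r < k" "\<sigma> r = \<pi> r" using \<sigma>k[of r] by (auto simp: \<sigma>_def)
    thus "permute k \<pi> x ! r = D | permute k \<pi> x ! r = min (z r) D" using r[rule_format, of "\<sigma> r"] inv(1)[of r] \<open>r < k\<close> by simp
   qed
  qed
  thus "lift D k (permute k \<pi> ` A) z = lift D k A (z \<circ> inv \<sigma>)" unfolding lift_def by simp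
 qed
 have "robust_core D k t T (lift D k (permute k \<pi> ` A)) L' J' (w \<circ> \<sigma>)" unfolding robust_core_def
 proof (intro conjI allI impI; (elim conjE)?)
  show "J' <= L'" using sub(1) by (auto simp: J'_def L'_def)
  show "L' <= {..<k}" by (auto simp: L'_def)
  show "card L' <= T" unfolding im using card_image_le[OF fin(1), of "inv \<sigma>"] sub(3) by linarith
  show "card J' <= t" unfolding im using card_image_le[OF fin(2), of "inv \<sigma>"] sub(4) by linarith
  show "(w \<circ> \<sigma>) r < D" for r using sub(5) by simp
  fix K :: "nat set" and c :: point assume K: "K <= {..<k}" "K Int L' = {}" "card K <= t" "\<forall>r. c r < D"
  let ?K = "\<sigma> ` K"
  have "3/4 <= EE (filter (%r. r ~: J Un ?K) [0..<k]) (lift D k A) (%r. if r : ?K then (c \<circ> inv \<sigma>) r else w r)"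
  proof (rule robust_coreD[OF J])
   show "?K <= {..<k}" using K(1) \<sigma>k by auto
   show "?K Int L = {}" using K(1,2) by (auto simp: L'_def \<sigma>_def)
   show "card ?K <= t" using K(1,3) card_image_le[of K \<sigma>] finite_subset[of K "{..<k}"] by simp
  qed (use K(4) in simp)
  moreover have "(%r. if r : ?K then (c \<circ> inv \<sigma>) r else w r) = (%r. if r : K then c r else (w \<circ> \<sigma>) r) \<circ> inv \<sigma>"
  proof
   fix r
   have "r : ?K \<longleftrightarrow> inv \<sigma> r : K" using inv by (metis image_iff)
   thus "(if r : ?K then (c \<circ> inv \<sigma>) r else w r) = ((%r. if r : K then c r else (w \<circ> \<sigma>) r) \<circ> inv \<sigma>) r" using inv by simp
  qed
  moreover have "EE (filter (%r. r ~: J Un ?K) [0..<k]) (lift D k A) = EE (map (inv (inv \<sigma>)) (filter (%r. r ~: J' Un K) [0..<k])) (lift D k A)"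
  proof (rule EE_perm)
   have ii: "inv (inv \<sigma>) = \<sigma>" using bij by (rule inv_inv_eq)
   have "set (filter (%r. r ~: J Un ?K) [0..<k]) = \<sigma> ` set (filter (%r. r ~: J' Un K) [0..<k])"
   proof -
    have "r : J' \<longleftrightarrow> \<sigma> r : J" if "r < k" for r using that by (simp add: J'_def \<sigma>_def)
    moreover have "r : K \<longleftrightarrow> \<sigma> r : ?K" for r using inv(1) by (metis image_iff)
    ultimately have *: "r < k & r ~: J' Un K \<longleftrightarrow> \<sigma> r < k & \<sigma> r ~: J Un ?K" for r using \<sigma>k[of r] by blast
    show ?thesis
    proof (intro set_eqI iffI)
     fix r assume "r : set (filter (%r. r ~: J Un ?K) [0..<k])"
     hence "inv \<sigma> r < k & inv \<sigma> r ~: J' Un K" using *[of "inv \<sigma> r"] inv(2)[of r] by simp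
     thus "r : \<sigma> ` set (filter (%r. r ~: J' Un K) [0..<k])" by (intro image_eqI[of _ _ "inv \<sigma> r"]) (simp_all add: inv)
    next
     fix r assume "r : \<sigma> ` set (filter (%r. r ~: J' Un K) [0..<k])"
     then obtain s where "r = \<sigma> s" "s < k & s ~: J' Un K" by auto
     thus "r : set (filter (%r. r ~: J Un ?K) [0..<k])" using *[of s] by simp
    qed
   qed
   moreover have "distinct (map \<sigma> (filter (%r. r ~: J' Un K) [0..<k]))"
    using bij by (simp add: distinct_map bij_is_inj inj_on_subset[OF _ subset_UNIV])
   ultimately show "mset (filter (%r. r ~: J Un ?K) [0..<k]) = mset (map (inv (inv \<sigma>)) (filter (%r. r ~: J' Un K) [0..<k]))"
    unfolding ii by (subst set_eq_iff_mset_eq_distinct[symmetric]) auto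
  qed
  ultimately show "3/4 <= EE (filter (%r. r ~: J' Un K) [0..<k]) (lift D k (permute k \<pi> ` A)) (%r. if r : K then c r else (w \<circ> \<sigma>) r)"
   unfolding lift wexp_reindex[OF bij_imp_bij_inv[OF bij]] by simp
 qed
 thus ?thesis unfolding carries_def L'_def by blast
qed

section \<open>Counting\<close>

lemma card_lists_nth:
 assumes "!!i. i < n ==> finite (F i)"
 shows "finite {c. length c = n & (\<forall>i<n. c ! i : F i)} & card {c. length c = n & (\<forall>i<n. c ! i : F i)} = (\<Prod>i<n. card (F i))"
 using assms
proof (induction n arbitrary: F)
 case 0
 have "{c::'a list. length c = 0 & (\<forall>i<0. c ! i : F i)} = {[]}" by auto
 thus ?case by simp
next
 case (Suc n)
 let ?B = "{c. length c = n & (\<forall>i<n. c ! i : F (Suc i))}"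
 have eq: "{c. length c = Suc n & (\<forall>i<Suc n. c ! i : F i)} = (%(x, c). x # c) ` (F 0 \<times> ?B)"
 proof (intro set_eqI iffI)
  fix c assume c: "c : {c. length c = Suc n & (\<forall>i<Suc n. c ! i : F i)}"
  then obtain x d where d: "c = x # d" by (cases c) auto
  have "x : F 0" using c d by force
  moreover have "d ! i : F (Suc i)" if "i < n" for i using c d that by force
  ultimately show "c : (%(x, c). x # c) ` (F 0 \<times> ?B)" using c d by (intro image_eqI[of _ _ "(x, d)"]) auto
 next
  fix c assume "c : (%(x, c). x # c) ` (F 0 \<times> ?B)"
  then obtain x d where "c = x # d" "x : F 0" "length d = n" "\<forall>i<n. d ! i : F (Suc i)" by auto
  thus "c : {c. length c = Suc n & (\<forall>i<Suc n. c ! i : F i)}" by (auto simp: nth_Cons split: nat.split)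
 qed
 have inj: "inj_on (%(x, c). x # c) (F 0 \<times> ?B)" by (auto simp: inj_on_def)
 have fin: "finite (F 0)" by (rule Suc.prems) simp
 have IH: "finite ?B" "card ?B = (\<Prod>i<n. card (F (Suc i)))" using Suc.IH[of "%i. F (Suc i)"] Suc.prems by auto
 show ?case unfolding eq card_image[OF inj] card_cartesian_product IH(2) prod.lessThan_Suc_shift
  using fin IH(1) by auto
qed

lemma card_lists_fixed:
 assumes "finite E" "I <= {..<n}" "!!i. i : I ==> g i : E"
 shows "card {c. length c = n & set c <= E & (\<forall>i\<in>I. c ! i = g i)} = card E ^ (n - card I)"
proof -
 let ?F = "%i. if i : I then {g i} else E"
 have "{c. length c = n & set c <= E & (\<forall>i\<in>I. c ! i = g i)} = {c. length c = n & (\<forall>i<n. c ! i : ?F i)}"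
 proof (intro set_eqI iffI)
  fix c assume "c : {c. length c = n & set c <= E & (\<forall>i\<in>I. c ! i = g i)}"
  thus "c : {c. length c = n & (\<forall>i<n. c ! i : ?F i)}" by auto
 next
  fix c assume c: "c : {c. length c = n & (\<forall>i<n. c ! i : ?F i)}"
  have "c ! i : E" if "i < n" for i using c assms(3) that by (cases "i : I") force+
  hence "set c <= E" using c by (auto simp: in_set_conv_nth)
  thus "c : {c. length c = n & set c <= E & (\<forall>i\<in>I. c ! i = g i)}" using c assms(2) by force
 qed
 hence "card {c. length c = n & set c <= E & (\<forall>i\<in>I. c ! i = g i)} = (\<Prod>i<n. card (?F i))"
  using card_lists_nth[of n ?F] assms(1) by auto
 also have "... = (\<Prod>i\<in>{..<n} - I. card (?F i)) * (\<Prod>i\<in>I. card (?F i))"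
  by (rule prod.subset_diff[OF assms(2)]) simp
 also have "(\<Prod>i\<in>I. card (?F i)) = 1" by simp
 also have "(\<Prod>i\<in>{..<n} - I. card (?F i)) = (\<Prod>i\<in>{..<n} - I. card E)" by (rule prod.cong) auto
 also have "... = card E ^ (n - card I)" using assms(2) by (simp add: card_Diff_subset finite_subset)
 finally show ?thesis by simp
qed

text \<open>Averaging over all labelings that choose from short lists.\<close>

lemma labeling_from_lists:
 fixes N :: "nat => nat set" and \<pi> :: "nat * nat => nat => nat"
 assumes V: "finite V" and N: "!!v. v : V ==> N v <= {..<k} & card (N v) <= Q" and k: "1 <= k" and Q: "1 <= Q"
  and E: "finite E" "E <= V \<times> V" "!!e. e : E ==> fst e ~= snd e"
  and P: "P <= E" "!!e. e : P ==> \<exists>a\<in>N (fst e). \<pi> e a : N (snd e)"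
 shows "\<exists>l\<in>V \<rightarrow>\<^sub>E {..<k}. card P <= Q * Q * card {e : E. \<pi> e (l (fst e)) = l (snd e)}"
proof (rule ccontr)
 assume "~ ?thesis"
 hence small: "Q * Q * card {e : E. \<pi> e (l (fst e)) = l (snd e)} < card P" if "l : V \<rightarrow>\<^sub>E {..<k}" for l
  using that by (auto simp: not_le)
 \<comment> \<open>Empty lists get the dummy label 0, so that a list labeling exists at all.\<close>
 define N' where "N' v = (if N v = {} then {0} else N v)" for v
 have N': "N' v <= {..<k}" "N' v ~= {}" "finite (N' v)" "card (N' v) <= Q" if "v : V" for v
  using N[OF that] k Q finite_subset[of "N v" "{..<k}"] by (auto simp: N'_def)
 define L where "L = PiE V N'"
 have sub: "L <= V \<rightarrow>\<^sub>E {..<k}" unfolding L_def using N' by (intro PiE_mono) auto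
 have finL: "finite L" unfolding L_def using V N' by (intro finite_PiE) auto
 have L0: "L ~= {}" unfolding L_def PiE_eq_empty_iff using N'(2) by blast
 have finP: "finite P" using P E finite_subset by blast
 have each: "card L <= Q * Q * card {l : L. \<pi> e (l (fst e)) = l (snd e)}" if eP: "e : P" for e
 proof -
  obtain a where a: "a : N (fst e)" "\<pi> e a : N (snd e)" using P(2)[OF eP] by blast
  define u v b where "u = fst e" and "v = snd e" and "b = \<pi> e a"
  have uv: "u : V" "v : V" "u ~= v" using eP P(1) E(2,3) by (auto simp: u_def v_def)
  let ?S = "{l : L. \<pi> e (l (fst e)) = l (snd e)}"
  \<comment> \<open>Overwriting the labels of \<open>u\<close> and \<open>v\<close> by a matching
    pair is at most \<open>Q * Q\<close> to one, so each constraint in \<open>P\<close> is satisfied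
    by at least that fraction of the list labelings.\<close>
  have "card L <= card (N' u \<times> (N' v \<times> ?S))"
  proof (rule card_inj_on_le)
   let ?h = "%l. (l u, (l v, l(u := a, v := b)))"
   show "inj_on ?h L"
   proof (rule inj_onI)
    fix l l' assume "?h l = ?h l'"
    hence h: "l u = l' u" "l v = l' v" "l(u := a, v := b) = l'(u := a, v := b)" by auto
    show "l = l'"
    proof
     fix x show "l x = l' x" using h(1,2) fun_cong[OF h(3), of x] by (cases "x = u"; cases "x = v") auto
    qed
   qed
   show "?h ` L <= N' u \<times> (N' v \<times> ?S)"
   proof (rule image_subsetI)
    fix l assume l: "l : L"
    have "a : N' u" "b : N' v" using a by (auto simp: N'_def u_def v_def b_def)
    hence "l(u := a, v := b) : L" using l uv unfolding L_def by (auto simp: PiE_iff extensional_def)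
    thus "?h l : N' u \<times> (N' v \<times> ?S)" using l uv by (auto simp: L_def PiE_iff u_def v_def b_def)
   qed
   show "finite (N' u \<times> (N' v \<times> ?S))" using N' uv finL by auto
  qed
  also have "... = card (N' u) * (card (N' v) * card ?S)" by (simp add: card_cartesian_product)
  also have "... <= Q * (Q * card ?S)" using N'(4) uv by (intro mult_le_mono) auto
  finally show ?thesis by (simp add: mult.assoc)
 qed
 have "card P * card L = (\<Sum>e\<in>P. card L)" by simp
 also have "... <= (\<Sum>e\<in>P. Q * Q * card {l : L. \<pi> e (l (fst e)) = l (snd e)})" by (intro sum_mono each)
 also have "... = Q * Q * (\<Sum>e\<in>P. \<Sum>l\<in>L. of_bool (\<pi> e (l (fst e)) = l (snd e)))"
  using finL by (simp add: sum_distrib_left Int_def)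
 also have "... = Q * Q * (\<Sum>l\<in>L. \<Sum>e\<in>P. of_bool (\<pi> e (l (fst e)) = l (snd e)))" by (subst sum.swap) simp
 also have "... = (\<Sum>l\<in>L. Q * Q * card {e : P. \<pi> e (l (fst e)) = l (snd e)})"
  using finP by (simp add: sum_distrib_left Int_def)
 also have "... <= (\<Sum>l\<in>L. Q * Q * card {e : E. \<pi> e (l (fst e)) = l (snd e)})"
  using P(1) E(1) by (intro sum_mono mult_le_mono2 card_mono) auto
 also have "... < (\<Sum>l\<in>L. card P)" using small sub by (intro sum_strict_mono finL L0) auto
 also have "... = card P * card L" by simp
 finally show False by simp
qed

lemma permute_preimage:
 assumes "bij_betw \<pi> {..<k} {..<k}" "y : cube D k"
 shows "\<exists>z\<in>cube D k. permute k \<pi> z = y"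
proof -
 define \<rho> where "\<rho> = the_inv_into {..<k} \<pi>"
 have \<rho>: "\<rho> r < k" "\<pi> (\<rho> r) = r" if "r < k" for r
  using that assms(1) the_inv_into_into[of \<pi> "{..<k}" r "{..<k}"] f_the_inv_into_f[of \<pi> "{..<k}" r]
  by (auto simp: bij_betw_def \<rho>_def)
 have \<rho>2: "\<rho> (\<pi> r) = r" if "r < k" for r
  using that assms(1) by (auto simp: bij_betw_def \<rho>_def intro: the_inv_into_f_f)
 have \<pi>: "\<pi> r < k" if "r < k" for r using that assms(1) by (auto simp: bij_betw_def)
 have "permute k \<pi> (permute k \<rho> y) = y"
  using assms(2) by (intro nth_equalityI) (auto simp: cube_def \<pi> \<rho>2)
 moreover have "permute k \<rho> y : cube D k" using assms(2) \<rho>(1)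
  by (auto simp: cube_def permute_def subset_iff)
 ultimately show ?thesis by blast
qed

lemma permute_cube:
 assumes "bij_betw \<pi> {..<k} {..<k}" "z : cube D k"
 shows "permute k \<pi> z : cube D k"
proof -
 have \<pi>: "\<pi> r < k" if "r < k" for r using that assms(1) by (auto simp: bij_betw_def)
 thus ?thesis using assms(2) by (auto simp: cube_def permute_def subset_iff)
qed

section \<open>The reduction\<close>

text \<open>\<open>Hub c e y\<close> stands for the tail of the arc \<open>e\<close> of the gap
  instance at center \<open>c\<close>, \<open>Slot\<close> is its copy for one sampled constraint,
  and \<open>Leaf\<close> belongs to the second endpoint of that constraint. Leaves do not mention
  the center: sharing them ties the label lists of different centers to a vertex of the
  game.\<close>

datatype node = Term nat | Hub "(nat * nat) list" "nat * nat" "nat list"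
 | Slot "(nat * nat) list" nat "nat * nat" "nat list" | Leaf nat "nat * nat" "nat list"

inductive dist_reach :: "(nat * nat) set => (nat * nat => nat) => nat => nat => nat => bool" for E0 X s where
 start: "dist_reach E0 X s s 0"
| step: "dist_reach E0 X s (fst e) d ==> e : E0 ==> dist_reach E0 X s (snd e) (d + X e)"

text \<open>\<open>sl u b\<close> turns an arbitrary constraint \<open>b\<close> into one that
  leaves \<open>u\<close>. If \<open>u\<close> is the first endpoint of a uniform constraint and
  \<open>b\<close> is uniform, \<open>balanced\<close> says that no constraint is hit with
  probability above \<open>2 / card E\<close>. Sampling through \<open>E\<close> gives the same
  number of choices at every vertex, whatever its degree.\<close>

locale reduction =
 fixes Fd E0 :: "(nat * nat) set" and X W :: "nat * nat => nat" and D k t :: nat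
  and E :: "(nat * nat) set" and \<pi> :: "nat * nat => nat => nat" and sl :: "nat => nat * nat => nat * nat"
 assumes fin_Fd: "finite Fd" and bip: "fst ` Fd Int snd ` Fd = {}"
  and fin_E0: "finite E0" and D: "1 <= D" and X: "e : E0 ==> X e <= D"
  and k: "1 <= k" and t: "1 <= t" and fin_E: "finite E" and E_ne: "E ~= {}" and loopfree: "e : E ==> fst e ~= snd e"
  and bij: "e : E ==> bij_betw (\<pi> e) {..<k} {..<k}"
  and sl: "a : E ==> b : E ==> sl (fst a) b : E & fst (sl (fst a) b) = fst a"
  and balanced: "e : E ==> card {a : E. fst a = fst e} * card {b : E. sl (fst e) b = e} <= 2 * card E"
begin

text \<open>The first entry only selects the vertex; the others are turned into constraints at it by
  \<open>slot\<close>.\<close>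

definition centers :: "(nat * nat) list set" where
 "centers = {c. length c = Suc t & set c <= E}"

definition slot :: "(nat * nat) list => nat => nat * nat" where
 "slot c j = sl (fst (c ! 0)) (c ! Suc j)"

definition light :: "(node * node) set" where
 "light = {(Hub c e y, Slot c j e y) | c e y j. c : centers & e : E0 & y : cube D k & j < t}"

text \<open>Arcs that must not be cut; their weight \<open>big\<close> will outweigh every
  acceptable solution. A leaf leads back to the hubs of each center that samples its vertex. Only
  sources have arcs out of them and only sinks have arcs into them.\<close>

inductive_set heavy :: "(node * node) set" where
 Term_Hub: "c : centers ==> e : E0 ==> y : cube D k ==> fst e : fst ` Fd ==> (Term (fst e), Hub c e y) : heavy"
| Slot_Leaf: "c : centers ==> j < t ==> e : E0 ==> z : cube D k ==>
  (Slot c j e (permute k (\<pi> (slot c j)) z), Leaf (snd (slot c j)) e z) : heavy"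
| Leaf_Hub: "c : centers ==> j < t ==> e : E0 ==> e' : E0 ==> snd e = fst e' ==> z : cube D k ==> y : cube D k ==>
  compat D (X e) (permute k (\<pi> (slot c j)) z) y ==> (Leaf (snd (slot c j)) e z, Hub c e' y) : heavy"
| Leaf_Term: "c : centers ==> j < t ==> e : E0 ==> z : cube D k ==> snd e : snd ` Fd ==>
  (Leaf (snd (slot c j)) e z, Term (snd e)) : heavy"

definition separates :: "(node * node) set => bool" where
 "separates K \<longleftrightarrow> (\<forall>(s, d)\<in>Fd. (Term s, Term d) ~: (light Un heavy - K)\<^sup>*)"

definition ncut :: "(node * node) set => (nat * nat) list => nat * nat => nat" where
 "ncut K c e = card {(j, y). j < t & y : cube D k & (Hub c e y, Slot c j e y) : K}"

definition cost :: "(node * node) set => nat" where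
 "cost K = (\<Sum>c\<in>centers. \<Sum>e\<in>E0. W e * ncut K c e)"

lemma fin_centers: "finite centers" and card_centers: "card centers = card E ^ Suc t"
proof -
 have eq: "centers = {c. set c <= E & length c = Suc t}" by (auto simp: centers_def)
 show "finite centers" unfolding eq by (rule finite_lists_length_eq[OF fin_E])
 show "card centers = card E ^ Suc t" unfolding eq by (rule card_lists_length_eq[OF fin_E])
qed

lemma card_E_pos: "0 < card E" using fin_E E_ne by (simp add: card_gt_0_iff)

lemma center_nth: "c : centers ==> i <= t ==> c ! i : E"
 by (auto simp: centers_def)

lemma slot_E: "c : centers ==> j < t ==> slot c j : E & fst (slot c j) = fst (c ! 0)"
 unfolding slot_def by (intro sl center_nth) auto

lemma fin_cut: "finite {(j, y). j < t & y : cube D k & R j y}"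
 by (rule finite_subset[of _ "{..<t} \<times> cube D k"]) (auto simp: finite_cube)

lemma card_slot_pairs: "P <= E ==> card {(a, b). a : E & b : E & sl (fst a) b : P} <= 2 * card E * card P"
proof -
 assume P: "P <= E"
 have finP: "finite P" using P fin_E finite_subset by blast
 have "{(a, b). a : E & b : E & sl (fst a) b : P} <= (\<Union>e\<in>P. {a : E. fst a = fst e} \<times> {b : E. sl (fst e) b = e})"
 proof
  fix p assume "p : {(a, b). a : E & b : E & sl (fst a) b : P}"
  then obtain a b where p: "p = (a, b)" "a : E" "b : E" "sl (fst a) b : P" by blast
  from sl[OF p(2,3)] have "fst (sl (fst a) b) = fst a" by blast
  with p show "p : (\<Union>e\<in>P. {a : E. fst a = fst e} \<times> {b : E. sl (fst e) b = e})"
   by (intro UN_I[of "sl (fst a) b"]) simp_all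
 qed
 hence "card {(a, b). a : E & b : E & sl (fst a) b : P} <= card (\<Union>e\<in>P. {a : E. fst a = fst e} \<times> {b : E. sl (fst e) b = e})"
  by (rule card_mono[rotated]) (use finP fin_E in auto)
 also have "... <= (\<Sum>e\<in>P. card ({a : E. fst a = fst e} \<times> {b : E. sl (fst e) b = e}))" by (rule card_UN_le[OF finP])
 also have "... <= (\<Sum>e\<in>P. 2 * card E)" using balanced P by (intro sum_mono) (auto simp: card_cartesian_product)
 finally show ?thesis by (simp add: mult.commute)
qed

subsection \<open>Completeness\<close>

text \<open>Union bound over the slots, each of which is a nearly uniform constraint by
  \<open>card_slot_pairs\<close>.\<close>

lemma card_bad_centers:
 assumes "B <= E"
 shows "card {c : centers. \<exists>j<t. slot c j : B} <= 2 * t * card B * card E ^ t"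
proof -
 have one: "card {c : centers. slot c j : B} <= card E ^ (t - 1) * (2 * card E * card B)" if j: "j < t" for j
 proof -
  let ?P = "{(a, b). a : E & b : E & sl (fst a) b : B}"
  let ?G = "%p. {c. length c = Suc t & set c <= E & (\<forall>i\<in>{0, Suc j}. c ! i = (if i = 0 then fst p else snd p))}"
  have finP: "finite ?P" by (rule finite_subset[of _ "E \<times> E"]) (use fin_E in auto)
  have "{c : centers. slot c j : B} <= (\<Union>p\<in>?P. ?G p)"
  proof
   fix c assume c: "c : {c : centers. slot c j : B}"
   hence "(c ! 0, c ! Suc j) : ?P" using j by (auto simp: slot_def intro: center_nth)
   moreover have "c : ?G (c ! 0, c ! Suc j)" using c by (auto simp: centers_def)
   ultimately show "c : (\<Union>p\<in>?P. ?G p)" by blast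
  qed
  moreover have "finite (?G p)" for p by (rule finite_subset[OF _ fin_centers]) (auto simp: centers_def)
  ultimately have "card {c : centers. slot c j : B} <= card (\<Union>p\<in>?P. ?G p)" using finP by (intro card_mono finite_UN_I) auto
  also have "... <= (\<Sum>p\<in>?P. card (?G p))" by (rule card_UN_le[OF finP])
  also have "... = (\<Sum>p\<in>?P. card E ^ (t - 1))"
  proof (rule sum.cong[OF refl])
   fix p assume "p : ?P"
   hence "card (?G p) = card E ^ (Suc t - card {0, Suc j})" using j by (intro card_lists_fixed fin_E) auto
   thus "card (?G p) = card E ^ (t - 1)" by simp
  qed
  also have "... = card ?P * card E ^ (t - 1)" by simp
  also have "... <= (2 * card E * card B) * card E ^ (t - 1)" by (intro mult_le_mono1 card_slot_pairs assms)
  finally show ?thesis by (simp add: mult.commute)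
 qed
 have "{c : centers. \<exists>j<t. slot c j : B} = (\<Union>j\<in>{..<t}. {c : centers. slot c j : B})" by auto
 hence "card {c : centers. \<exists>j<t. slot c j : B} <= (\<Sum>j<t. card {c : centers. slot c j : B})" by (simp add: card_UN_le)
 also have "... <= (\<Sum>j<t. card E ^ (t - 1) * (2 * card E * card B))" by (intro sum_mono one) auto
 also have "... = 2 * t * card B * (card E * card E ^ (t - 1))" by (simp add: algebra_simps)
 also have "card E * card E ^ (t - 1) = card E ^ t" using t by (cases t) auto
 finally show ?thesis .
qed

text \<open>This is the fraction \<open>(x + 1) / (D + 1)\<close> of the cube, the origin of
  \<open>X e + 1\<close> in the gap instance.\<close>

lemma card_dictator:
 assumes "r < k" "x <= D"
 shows "card {y : cube D k. D <= y ! r + x} = (x + 1) * (D + 1) ^ (k - 1)"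
proof -
 let ?F = "%i. if i = r then {D - x..D} else {..D}"
 have "{y : cube D k. D <= y ! r + x} = {y. length y = k & (\<forall>i<k. y ! i : ?F i)}"
 proof (intro set_eqI iffI)
  fix y assume "y : {y : cube D k. D <= y ! r + x}"
  hence y: "length y = k" "set y <= {..D}" "D <= y ! r + x" by (auto simp: cube_def)
  hence "y ! i <= D" if "i < k" for i using that by (metis atMost_iff nth_mem subsetD)
  thus "y : {y. length y = k & (\<forall>i<k. y ! i : ?F i)}" using y by auto
 next
  fix y assume y: "y : {y. length y = k & (\<forall>i<k. y ! i : ?F i)}"
  hence "y ! i <= D" if "i < k" for i using that by (auto split: if_splits)
  hence "set y <= {..D}" using y by (auto simp: in_set_conv_nth)
  moreover have "D - x <= y ! r" using y assms(1) by auto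
  ultimately show "y : {y : cube D k. D <= y ! r + x}" using y by (auto simp: cube_def)
 qed
 hence "card {y : cube D k. D <= y ! r + x} = (\<Prod>i<k. card (?F i))" using card_lists_nth[of k ?F] by auto
 also have "... = card (?F r) * (\<Prod>i\<in>{..<k} - {r}. card (?F i))" using assms by (intro prod.remove) auto
 also have "(\<Prod>i\<in>{..<k} - {r}. card (?F i)) = (\<Prod>i\<in>{..<k} - {r}. D + 1)" by (rule prod.cong) auto
 also have "card (?F r) = x + 1" using assms by simp
 also have "(\<Prod>i\<in>{..<k} - {r}. D + 1) = (D + 1) ^ (k - 1)" using assms by simp
 finally show ?thesis .
qed

text \<open>At a center without violated slots the cut takes the arcs on which the coordinate of its
  own label would reach \<open>D\<close>; at the other centers it takes all light arcs. The two
  summands are the costs of these two kinds.\<close>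

lemma completeness:
 assumes far: "!!s d n. (s, d) : Fd ==> dist_reach E0 X s d n ==> D <= n"
  and l: "!!e. e : E ==> l (fst e) < k" and viol: "card {e : E. \<pi> e (l (fst e)) ~= l (snd e)} <= v"
 shows "\<exists>K \<subseteq> light. separates K &
  cost K <= card centers * (t * (\<Sum>e\<in>E0. W e * (X e + 1)) * (D + 1) ^ (k - 1)) + 2 * t * v * card E ^ t * (t * (\<Sum>e\<in>E0. W e) * (D + 1) ^ k)"
proof -
 define B where "B = {e : E. \<pi> e (l (fst e)) ~= l (snd e)}"
 define bad where "bad c \<longleftrightarrow> (\<exists>j<t. slot c j : B)" for c
 define lc where "lc c = l (fst (c ! 0))" for c :: "(nat * nat) list"
 have lc: "lc c < k" if "c : centers" for c using l center_nth[OF that, of 0] by (simp add: lc_def)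
 define K where "K = {(Hub c e y, Slot c j e y) | c e y j. c : centers & e : E0 & y : cube D k & j < t & (bad c | D <= y ! lc c + X e)}"
 have sub: "K <= light" by (auto simp: K_def light_def)
 have good: "\<pi> (slot c j) (lc c) = l (snd (slot c j))" if "c : centers" "j < t" "~ bad c" for c j
  using that slot_E[of c j] by (auto simp: bad_def B_def lc_def)
 \<comment> \<open>In the coordinate of its label a reached node records at least the length of some
   walk from \<open>s\<close> in the gap instance. A walk that enters a bad center ends there, so
   nothing is claimed about its hubs.\<close>
 define Inv where "Inv s n = (case n of Term h => h = s | h : snd ` Fd & (\<exists>d<D. dist_reach E0 X s h d)
  | Hub c e y => bad c | (\<exists>d \<le> y ! lc c. dist_reach E0 X s (fst e) d)
  | Slot c j e y => ~ bad c & (\<exists>d \<le> y ! lc c. dist_reach E0 X s (fst e) d) & y ! lc c + X e < D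
  | Leaf v e z => (\<exists>d \<le> z ! l v. dist_reach E0 X s (fst e) d) & z ! l v + X e < D)" for s n
 have inv_step: "Inv s n'" if iv: "Inv s n" and ar: "(n, n') : light Un heavy - K" for s n n'
 proof (cases "(n, n') : light")
  case True
  then obtain c e y j where n: "n = Hub c e y" "n' = Slot c j e y" "c : centers" "e : E0" "y : cube D k" "j < t" by (auto simp: light_def)
  hence "~ (bad c | D <= y ! lc c + X e)" using ar unfolding K_def by blast
  thus ?thesis using iv n by (simp add: Inv_def)
 next
  case False
  hence "(n, n') : heavy" using ar by blast
  thus ?thesis
  proof cases
   case (Term_Hub c e y)
   \<comment> \<open>Bipartiteness: a terminal that is left is a source, hence no sink reached on
     the way, so it is \<open>s\<close> itself.\<close>
   hence "fst e ~: snd ` Fd" using bip by blast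
   hence "fst e = s" using iv Term_Hub by (simp add: Inv_def)
   thus ?thesis using Term_Hub dist_reach.start[of E0 X s] by (auto simp: Inv_def)
  next
   case (Slot_Leaf c j e z)
   have inv: "~ bad c" "\<exists>d \<le> permute k (\<pi> (slot c j)) z ! lc c. dist_reach E0 X s (fst e) d" "permute k (\<pi> (slot c j)) z ! lc c + X e < D"
    using iv Slot_Leaf by (auto simp: Inv_def)
   have "permute k (\<pi> (slot c j)) z ! lc c = z ! l (snd (slot c j))"
    using good[OF Slot_Leaf(3,4) inv(1)] lc[OF Slot_Leaf(3)] by simp
   thus ?thesis using inv Slot_Leaf by (simp add: Inv_def)
  next
   case (Leaf_Hub c j e e' z y)
   obtain d where inv: "d <= z ! l (snd (slot c j))" "dist_reach E0 X s (fst e) d" "z ! l (snd (slot c j)) + X e < D"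
    using iv Leaf_Hub by (auto simp: Inv_def)
   show ?thesis
   proof (cases "bad c")
    case True thus ?thesis using Leaf_Hub by (simp add: Inv_def)
   next
    case False
    have p: "permute k (\<pi> (slot c j)) z ! lc c = z ! l (snd (slot c j))"
     using good[OF Leaf_Hub(3,4) False] lc[OF Leaf_Hub(3)] by simp
    have "lc c < length (permute k (\<pi> (slot c j)) z)" using lc[OF Leaf_Hub(3)] by simp
    hence "y ! lc c = D | y ! lc c = z ! l (snd (slot c j)) + X e"
     using Leaf_Hub(10) inv(3) p unfolding compat_def by fastforce
    hence "d + X e <= y ! lc c" using inv by auto
    moreover have "dist_reach E0 X s (fst e') (d + X e)" using dist_reach.step[OF inv(2) Leaf_Hub(5)] Leaf_Hub(7) by simp
    ultimately show ?thesis using Leaf_Hub by (auto simp: Inv_def)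
   qed
  next
   case (Leaf_Term c j e z)
   obtain d where inv: "d <= z ! l (snd (slot c j))" "dist_reach E0 X s (fst e) d" "z ! l (snd (slot c j)) + X e < D"
    using iv Leaf_Term by (auto simp: Inv_def)
   hence "dist_reach E0 X s (snd e) (d + X e)" "d + X e < D" using dist_reach.step[OF inv(2) Leaf_Term(5)] by auto
   thus ?thesis using Leaf_Term by (auto simp: Inv_def)
  qed
 qed
 have "separates K" unfolding separates_def
 proof (intro ballI, clarify)
  fix s d assume sd: "(s, d) : Fd" and r: "(Term s, Term d) : (light Un heavy - K)\<^sup>*"
  from r have "Inv s (Term d)"
  proof (induction rule: rtrancl_induct)
   case base show ?case by (simp add: Inv_def)
  next
   case (step n n') thus ?case using inv_step by blast
  qed
  moreover have "d ~= s" using sd bip by force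
  ultimately obtain n where "n < D" "dist_reach E0 X s d n" by (auto simp: Inv_def)
  thus False using far[OF sd] by fastforce
 qed
 moreover have "cost K <= card centers * (t * (\<Sum>e\<in>E0. W e * (X e + 1)) * (D + 1) ^ (k - 1)) + 2 * t * v * card E ^ t * (t * (\<Sum>e\<in>E0. W e) * (D + 1) ^ k)"
 proof -
  let ?good = "t * (\<Sum>e\<in>E0. W e * (X e + 1)) * (D + 1) ^ (k - 1)" and ?bad = "t * (\<Sum>e\<in>E0. W e) * (D + 1) ^ k"
  have c1: "(\<Sum>e\<in>E0. W e * ncut K c e) <= ?good + of_bool (bad c) * ?bad" if c: "c : centers" for c
  proof (cases "bad c")
   case True
   have "ncut K c e <= card ({..<t} \<times> cube D k)" for e unfolding ncut_def by (intro card_mono) (auto simp: finite_cube)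
   hence "ncut K c e <= t * (D + 1) ^ k" for e by (simp add: card_cartesian_product card_cube)
   hence "(\<Sum>e\<in>E0. W e * ncut K c e) <= (\<Sum>e\<in>E0. W e * (t * (D + 1) ^ k))" by (intro sum_mono mult_le_mono2)
   also have "... = (\<Sum>e\<in>E0. W e) * (t * (D + 1) ^ k)" by (rule sum_distrib_right[symmetric])
   also have "... = ?bad" by (simp only: mult.assoc mult.left_commute)
   finally show ?thesis using True by simp
  next
   case False
   have "ncut K c e = t * ((X e + 1) * (D + 1) ^ (k - 1))" if e: "e : E0" for e
   proof -
    have "{(j, y). j < t & y : cube D k & (Hub c e y, Slot c j e y) : K} = {..<t} \<times> {y : cube D k. D <= y ! lc c + X e}"
     using False c e by (cases e) (auto simp: K_def)
    thus ?thesis unfolding ncut_def by (simp add: card_cartesian_product card_dictator[OF lc[OF c] X[OF e]])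
   qed
   hence "(\<Sum>e\<in>E0. W e * ncut K c e) = (\<Sum>e\<in>E0. (W e * (X e + 1)) * (t * (D + 1) ^ (k - 1)))"
    by (intro sum.cong) (simp_all only: mult.assoc mult.left_commute mult.commute)
   also have "... = (\<Sum>e\<in>E0. W e * (X e + 1)) * (t * (D + 1) ^ (k - 1))" by (rule sum_distrib_right[symmetric])
   also have "... = ?good" by (simp only: mult.assoc mult.left_commute)
   finally show ?thesis by simp
  qed
  have "cost K <= (\<Sum>c\<in>centers. ?good + of_bool (bad c) * ?bad)" unfolding cost_def by (intro sum_mono c1)
  also have "... = card centers * ?good + card {c : centers. bad c} * ?bad"
   using fin_centers by (simp add: sum.distrib sum_distrib_right[symmetric] Int_def)
  also have "card {c : centers. bad c} <= 2 * t * card B * card E ^ t" unfolding bad_def by (rule card_bad_centers) (auto simp: B_def)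
  also have "... <= 2 * t * v * card E ^ t" using viol by (simp add: B_def)
  finally show ?thesis by simp
 qed
 ultimately show ?thesis using sub by blast
qed

subsection \<open>Soundness\<close>

text \<open>The partner of \<open>u\<close> is the constraint at \<open>u\<close> that collides with
  the most samples. Colliding pairs of slots are thus dominated by collisions with one fixed
  constraint per vertex, and this constraint will define a label list for \<open>u\<close>.\<close>

lemma card_pairs_with_partner:
 "\<exists>partner. (\<forall>u \<in> fst ` E. partner u : E & fst (partner u) = u) &
  card {c : centers. \<exists>i<t. \<exists>j<t. i ~= j & R (slot c i) (slot c j)} <= 2 * (t * t) * card E ^ t * card {e : E. R e (partner (fst e))}"
proof -
 define m where "m = card E"
 define n where "n u b = card {a : E. R (sl u a) (sl u b)}" for u b
 define best where "best u = (SOME b. b : E & (\<forall>b'\<in>E. n u b' <= n u b))" for u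
 have best: "best u : E" "!!b. b : E ==> n u b <= n u (best u)" for u
 proof -
  have "\<exists>b. b : E & (\<forall>b'\<in>E. n u b' <= n u b)"
  proof -
   have "Max (n u ` E) : n u ` E" using fin_E E_ne by (intro Max_in) auto
   then obtain b where "b : E" "n u b = Max (n u ` E)" by auto
   moreover have "n u b' <= Max (n u ` E)" if "b' : E" for b' using fin_E that by simp
   ultimately show ?thesis by (intro exI[of _ b] conjI ballI) simp_all
  qed
  from someI_ex[OF this] show "best u : E" "!!b. b : E ==> n u b <= n u (best u)" unfolding best_def[of u] by blast+
 qed
 define partner where "partner u = sl u (best u)" for u
 define P where "P = {e : E. R e (partner (fst e))}"
 have partner: "\<forall>u \<in> fst ` E. partner u : E & fst (partner u) = u" 
 proof
  fix u assume "u : fst ` E"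
  then obtain a where "a : E" "u = fst a" by blast
  with sl[OF this(1) best(1)[of u]] show "partner u : E & fst (partner u) = u" by (simp add: partner_def)
 qed
 let ?X = "{(a, b, b'). a : E & b : E & b' : E & R (sl (fst a) b) (sl (fst a) b')}"
 have finX: "finite ?X" by (rule finite_subset[of _ "E \<times> E \<times> E"]) (use fin_E in auto)
 have cardX: "card ?X <= m * (2 * m * card P)"
 proof -
  have "?X = (\<Union>a\<in>E. \<Union>b'\<in>E. (%b. (a, b, b')) ` {b : E. R (sl (fst a) b) (sl (fst a) b')})" by auto
  hence "card ?X <= (\<Sum>a\<in>E. card (\<Union>b'\<in>E. (%b. (a, b, b')) ` {b : E. R (sl (fst a) b) (sl (fst a) b')}))"
   using card_UN_le[OF fin_E] by simp
  also have "... <= (\<Sum>a\<in>E. \<Sum>b'\<in>E. n (fst a) b')"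
   unfolding n_def by (intro sum_mono order_trans[OF card_UN_le[OF fin_E]] card_image_le) (use fin_E in auto)
  also have "... <= (\<Sum>a\<in>E. \<Sum>b'\<in>E. n (fst a) (best (fst a)))" by (intro sum_mono best(2))
  also have "... = m * (\<Sum>a\<in>E. n (fst a) (best (fst a)))" by (simp add: m_def sum_distrib_left)
  also have "(\<Sum>a\<in>E. n (fst a) (best (fst a))) = card (SIGMA a:E. {b : E. R (sl (fst a) b) (partner (fst a))})"
   using fin_E by (simp add: n_def partner_def)
  also have "(SIGMA a:E. {b : E. R (sl (fst a) b) (partner (fst a))}) = {(a, b). a : E & b : E & sl (fst a) b : P}"
   using sl by (auto simp: P_def)
  also have "card ... <= 2 * m * card P" unfolding m_def by (rule card_slot_pairs) (auto simp: P_def)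
  finally show ?thesis by simp
 qed
 have one: "card {c : centers. R (slot c i) (slot c j)} <= 2 * m ^ t * card P" if ij: "i < t" "j < t" "i ~= j" for i j
 proof -
  let ?G = "%p. {c. length c = Suc t & set c <= E & (\<forall>q\<in>{0, Suc i, Suc j}. c ! q = (if q = 0 then fst p else if q = Suc i then fst (snd p) else snd (snd p)))}"
  have "{c : centers. R (slot c i) (slot c j)} <= (\<Union>p\<in>?X. ?G p)"
  proof
   fix c assume c: "c : {c : centers. R (slot c i) (slot c j)}"
   hence "(c ! 0, c ! Suc i, c ! Suc j) : ?X" using ij by (auto simp: slot_def intro: center_nth)
   moreover have "c : ?G (c ! 0, c ! Suc i, c ! Suc j)" using c by (auto simp: centers_def)
   ultimately show "c : (\<Union>p\<in>?X. ?G p)" by blast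
  qed
  moreover have "finite (?G p)" for p by (rule finite_subset[OF _ fin_centers]) (auto simp: centers_def)
  ultimately have "card {c : centers. R (slot c i) (slot c j)} <= card (\<Union>p\<in>?X. ?G p)" using finX by (intro card_mono finite_UN_I) auto
  also have "... <= (\<Sum>p\<in>?X. card (?G p))" by (rule card_UN_le[OF finX])
  also have "... = (\<Sum>p\<in>?X. m ^ (t - 2))"
  proof (rule sum.cong[OF refl])
   fix p assume "p : ?X"
   \<comment> \<open>Three entries are prescribed: the one that selects the vertex and the two
     slots.\<close>
   hence "card (?G p) = card E ^ (Suc t - card {0, Suc i, Suc j})" using ij by (intro card_lists_fixed fin_E) auto
   thus "card (?G p) = m ^ (t - 2)" using ij by (simp add: m_def numeral_2_eq_2)
  qed
  also have "... = card ?X * m ^ (t - 2)" by simp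
  also have "... <= m * (2 * m * card P) * m ^ (t - 2)" by (intro mult_le_mono1 cardX)
  also have "... = 2 * (m * m * m ^ (t - 2)) * card P" by (simp only: mult.assoc mult.left_commute mult.commute)
  also have "m * m * m ^ (t - 2) = m ^ t"
  proof -
   have "t = Suc (Suc (t - 2))" using ij by linarith
   hence "m ^ t = m * (m * m ^ (t - 2))" using power_Suc[of m] by metis
   thus ?thesis by (simp add: mult.assoc)
  qed
  finally show ?thesis .
 qed
 let ?I = "{p : {..<t} \<times> {..<t}. fst p ~= snd p}"
 have "{c : centers. \<exists>i<t. \<exists>j<t. i ~= j & R (slot c i) (slot c j)} = (\<Union>p\<in>?I. {c : centers. R (slot c (fst p)) (slot c (snd p))})" by auto blast
 hence "card {c : centers. \<exists>i<t. \<exists>j<t. i ~= j & R (slot c i) (slot c j)} <= (\<Sum>p\<in>?I. card {c : centers. R (slot c (fst p)) (slot c (snd p))})"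
  using card_UN_le[of ?I "%p. {c : centers. R (slot c (fst p)) (slot c (snd p))}"] by simp
 also have "... <= (\<Sum>p\<in>?I. 2 * m ^ t * card P)" by (intro sum_mono one) auto
 also have "... = card ?I * (2 * m ^ t * card P)" by simp
 also have "... <= t * t * (2 * m ^ t * card P)"
  using card_mono[of "{..<t} \<times> {..<t}" ?I] by (intro mult_le_mono1) (auto simp: card_cartesian_product)
 finally have "card {c : centers. \<exists>i<t. \<exists>j<t. i ~= j & R (slot c i) (slot c j)} <= 2 * (t * t) * card E ^ t * card P"
  by (simp add: m_def mult.assoc mult.left_commute)
 thus ?thesis using partner unfolding P_def by blast
qed

text \<open>Double counting: at least a \<open>2 * \<delta>\<close> fraction of the pairs of a slot
  and a point survives the cut, and slots with few surviving points account for at most half of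
  this.\<close>

lemma many_alive_slots:
 assumes M: "M <= cube D k" "(1 - \<delta>) * (real D + 1) ^ k <= real (card M)"
  and cut: "real (ncut K c e) < (1 - 3 * \<delta>) * real t * (real D + 1) ^ k" and \<delta>: "0 < \<delta>"
 shows "\<delta> * real t <= real (card {j. j < t & \<delta> * (real D + 1) ^ k <= real (card {y : M. (Hub c e y, Slot c j e y) ~: K})})"
proof -
 define N where "N = (real D + 1) ^ k"
 have N: "0 < N" by (simp add: N_def)
 define U where "U j = {y : M. (Hub c e y, Slot c j e y) ~: K}" for j
 define al where "al = {j. j < t & \<delta> * N <= real (card (U j))}"
 have finM: "finite M" using M(1) finite_cube finite_subset by blast
 have cM: "real (card M) <= N"
  using card_mono[OF finite_cube M(1)] unfolding card_cube N_def by (metis of_nat_1 of_nat_add of_nat_le_iff of_nat_power)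
 have "{..<t} \<times> M <= {(j, y). j < t & y : cube D k & (Hub c e y, Slot c j e y) : K} Un (SIGMA j:{..<t}. U j)"
  using M(1) by (auto simp: U_def)
 hence "card ({..<t} \<times> M) <= card ({(j, y). j < t & y : cube D k & (Hub c e y, Slot c j e y) : K} Un (SIGMA j:{..<t}. U j))"
  by (rule card_mono[rotated]) (use fin_cut finM in "auto simp: U_def")
 also have "... <= ncut K c e + card (SIGMA j:{..<t}. U j)" unfolding ncut_def by (rule card_Un_le)
 also have "card (SIGMA j:{..<t}. U j) = (\<Sum>j<t. card (U j))" using finM by (simp add: U_def)
 finally have "t * card M <= ncut K c e + (\<Sum>j<t. card (U j))" by (simp add: card_cartesian_product)
 hence 1: "real t * real (card M) <= real (ncut K c e) + (\<Sum>j<t. real (card (U j)))"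
  by (metis of_nat_add of_nat_le_iff of_nat_mult of_nat_sum)
 have "(\<Sum>j<t. real (card (U j))) <= (\<Sum>j<t. of_bool (j : al) * N + \<delta> * N)"
 proof (rule sum_mono)
  fix j assume "j : {..<t}"
  have "card (U j) <= card M" by (rule card_mono[OF finM]) (auto simp: U_def)
  hence "real (card (U j)) <= N" using cM by linarith
  moreover have "0 <= \<delta> * N" using \<delta> N by simp
  ultimately show "real (card (U j)) <= of_bool (j : al) * N + \<delta> * N" using \<open>j : {..<t}\<close> by (auto simp: al_def)
 qed
 also have "... = (\<Sum>j<t. of_bool (j : al)) * N + real t * (\<delta> * N)" by (simp add: sum.distrib sum_distrib_right)
 also have "(\<Sum>j<t. of_bool (j : al)) = real (card al)"
 proof -
  have "{..<t} Int {j. j : al} = al" by (auto simp: al_def)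
  thus ?thesis by simp
 qed
 finally have 2: "(\<Sum>j<t. real (card (U j))) <= real (card al) * N + real t * (\<delta> * N)" .
 have "real t * ((1 - \<delta>) * N) <= real t * real (card M)" using M(2) by (intro mult_left_mono) (auto simp: N_def)
 with 1 2 cut have "real t * ((1 - \<delta>) * N) <= (1 - 3 * \<delta>) * real t * N + (real (card al) * N + real t * (\<delta> * N))"
  unfolding N_def by linarith
 hence "(\<delta> * real t) * N <= real (card al) * N" by (simp add: algebra_simps)
 hence "\<delta> * real t <= real (card al)" using N by simp
 thus ?thesis by (simp add: al_def U_def N_def)
qed

text \<open>A center pays about \<open>opt\<close> unless the arcs it does not cut almost completely
  connect some demand of the gap instance. In that case two of its slots share a label, and
  \<open>card_pairs_with_partner\<close> with \<open>labeling_from_lists\<close> shows that this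
  happens at few centers if no labeling is good.\<close>

lemma soundness:
 fixes opt :: nat
 assumes \<delta>: "0 < \<delta>" and car: "!!A. A <= cube D k ==> \<delta> * (real D + 1) ^ k <= real (card A) ==> \<exists>L. carries D k tc T A L"
  and big: "real T < \<delta> * real t" and gap: "!!F. F <= E0 ==> (\<forall>(s, d)\<in>Fd. (s, d) ~: (E0 - F)\<^sup>*) ==> opt <= sum W F"
  and K: "K Int heavy = {}" "separates K" and V: "finite V" "E <= V \<times> V" and \<delta>3: "3 * \<delta> <= 1"
  and Q: "Q = 2 * (card Fd * card E0 * T) + 1"
 shows "\<exists>l\<in>V \<rightarrow>\<^sub>E {..<k}. (real (card centers) - real (2 * (t * t) * card E ^ t * (Q * Q * card {e : E. \<pi> e (l (fst e)) = l (snd e)}))) *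
  ((1 - 3 * \<delta>) * real t * (real D + 1) ^ k * real opt) <= real (cost K)"
proof -
 define N where "N = (real D + 1) ^ k"
 have N: "0 < N" by (simp add: N_def)
 have cN: "real (card (cube D k)) = N" by (simp add: card_cube N_def add.commute)
 define G where "G = light Un heavy - K"
 have heavyG: "x : G" if "x : heavy" for x using that K(1) by (auto simp: G_def)
 define R where "R s = {n. (Term s, n) : G\<^sup>*}" for s
 have R_step: "n' : R s" if "n : R s" "(n, n') : G" for s n n' using that by (auto simp: R_def intro: rtrancl_into_rtrancl)
 define A where "A s e v = {z : cube D k. Leaf v e z : R s}" for s e v
 define M where "M s c e = {y : cube D k. Hub c e y : R s}" for s c e
 \<comment> \<open>The list depends on the source, the arc and the vertex, but not on the center.
   Choosing it once makes the lists seen by different centers consistent.\<close>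
 define \<Lambda> where "\<Lambda> s e v = (if \<delta> * N <= real (card (A s e v)) then SOME L. carries D k tc T (A s e v) L else {})" for s e v
 have \<Lambda>: "carries D k tc T (A s e v) (\<Lambda> s e v)" if "\<delta> * N <= real (card (A s e v))" for s e v
  using someI_ex[OF car[of "A s e v"]] that by (auto simp: \<Lambda>_def A_def N_def)
 have \<Lambda>b: "\<Lambda> s e v <= {..<k}" "card (\<Lambda> s e v) <= T" for s e v
  using carriesD[OF \<Lambda>[of s e v]] by (cases "\<delta> * N <= real (card (A s e v))"; simp add: \<Lambda>_def)+
 define Lst where "Lst v = (\<Union>p\<in>Fd \<times> E0. \<Lambda> (fst (fst p)) (snd p) v)" for v
 have Lst: "Lst v <= {..<k}" "card (Lst v) <= card Fd * card E0 * T" for v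
 proof -
  show "Lst v <= {..<k}" unfolding Lst_def using \<Lambda>b(1) by (intro UN_least)
  have "card (Lst v) <= (\<Sum>p\<in>Fd \<times> E0. card (\<Lambda> (fst (fst p)) (snd p) v))"
   unfolding Lst_def using fin_Fd fin_E0 by (intro card_UN_le) auto
  also have "... <= (\<Sum>p\<in>Fd \<times> E0. T)" by (intro sum_mono \<Lambda>b(2))
  finally show "card (Lst v) <= card Fd * card E0 * T" by (simp add: card_cartesian_product)
 qed
 define coll where "coll e e' \<longleftrightarrow> (\<exists>r<k. \<pi> e r : Lst (snd e) & \<pi> e' r : Lst (snd e'))" for e e'
 \<comment> \<open>The arcs of the gap instance that are cut almost completely at \<open>c\<close>;
   the slack \<open>3 * \<delta>\<close> is the one in \<open>many_alive_slots\<close>.\<close>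
 define F where "F c = {e : E0. (1 - 3 * \<delta>) * real t * N <= real (ncut K c e)}" for c
 define opn where "opn c \<longleftrightarrow> (\<exists>(s, d)\<in>Fd. (s, d) : (E0 - F c)\<^sup>*)" for c
 have collide: "\<exists>i<t. \<exists>j<t. i ~= j & coll (slot c i) (slot c j)" if c: "c : centers" and op: "opn c" for c
 proof (rule ccontr)
  assume nc: "~ ?thesis"
  obtain s d where sd: "(s, d) : Fd" "(s, d) : (E0 - F c)\<^sup>*" using op by (auto simp: opn_def)
  have sS: "s : fst ` Fd" using sd by force
  define U where "U e j = {y : M s c e. (Hub c e y, Slot c j e y) ~: K}" for e j
  define al where "al e = {j. j < t & \<delta> * N <= real (card (U e j))}" for e
  have alive: "\<delta> * real t <= real (card (al e))" if "e : E0 - F c" "(1 - \<delta>) * N <= real (card (M s c e))" for e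
   unfolding al_def U_def N_def
   by (rule many_alive_slots) (use that \<delta> in "auto simp: F_def M_def N_def not_le")
  have bj: "bij_betw (\<pi> (slot c j)) {..<k} {..<k}" if "j < t" for j using slot_E[OF c that] bij by blast
  have UA: "U e j <= permute k (\<pi> (slot c j)) ` A s e (snd (slot c j))" if eE: "e : E0" and jt: "j < t" for e j
  proof
   fix y assume y: "y : U e j"
   hence yc: "y : cube D k" "Hub c e y : R s" "(Hub c e y, Slot c j e y) ~: K" by (auto simp: U_def M_def)
   obtain z where z: "z : cube D k" "permute k (\<pi> (slot c j)) z = y" using permute_preimage[OF bj[OF jt] yc(1)] by blast
   have "(Hub c e y, Slot c j e y) : light" using c eE jt yc(1) unfolding light_def by blast
   hence "(Hub c e y, Slot c j e y) : G" using yc(3) by (simp add: G_def)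
   hence "Slot c j e y : R s" by (rule R_step[OF yc(2)])
   moreover have "(Slot c j e y, Leaf (snd (slot c j)) e z) : G"
    using heavy.Slot_Leaf[OF c jt eE z(1)] z(2) by (intro heavyG) simp
   ultimately have "Leaf (snd (slot c j)) e z : R s" by (rule R_step)
   thus "y : permute k (\<pi> (slot c j)) ` A s e (snd (slot c j))" using z by (auto simp: A_def)
  qed
  have finA: "finite (A s e v)" for e v by (rule finite_subset[OF _ finite_cube[of D k]]) (auto simp: A_def)
  have dense: "\<delta> * N <= real (card (A s e (snd (slot c j))))" if "e : E0" "j : al e" for e j
  proof -
   have "card (U e j) <= card (A s e (snd (slot c j)))"
    using card_mono[OF finite_imageI[OF finA] UA[OF that(1), of j]] card_image_le[OF finA, of "permute k (\<pi> (slot c j))" e "snd (slot c j)"] that(2)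
    by (auto simp: al_def)
   thus ?thesis using that(2) by (auto simp: al_def)
  qed
  \<comment> \<open>The walk: wherever the gap instance leads without \<open>F c\<close>, almost all
    points of the hubs at that vertex are reached. A loss of this density produces a
    collision.\<close>
  have M_dense: "(s, h) : (E0 - F c)\<^sup>* ==> \<forall>e\<in>E0. fst e = h --> (1 - \<delta>) * N <= real (card (M s c e))" for h
  proof (induction rule: rtrancl_induct)
   case base
   show ?case
   proof (intro ballI impI)
    fix e assume e: "e : E0" "fst e = s"
    have Ts: "Term s : R s" by (simp add: R_def)
    have "Hub c e y : R s" if "y : cube D k" for y
    proof (rule R_step[OF Ts heavyG])
     show "(Term s, Hub c e y) : heavy" using heavy.Term_Hub[OF c e(1) that] sS e(2) by simp
    qed
    hence "M s c e = cube D k" by (auto simp: M_def)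
    thus "(1 - \<delta>) * N <= real (card (M s c e))" using \<delta> N cN by (simp add: field_simps)
   qed
  next
   case (step h h')
   define e where "e = (h, h')"
   have e: "e : E0 - F c" "fst e = h" "snd e = h'" using step by (auto simp: e_def)
   have al: "\<delta> * real t <= real (card (al e))" using step.IH e by (intro alive) auto
   show ?case
   proof (intro ballI impI, rule ccontr)
    fix e' assume e': "e' : E0" "fst e' = h'" and less: "~ (1 - \<delta>) * N <= real (card (M s c e'))"
    \<comment> \<open>The points not reached form a dense set and therefore carry a short list
      \<open>L\<close>.\<close>
    define B where "B = cube D k - M s c e'"
    have "real (card B) = N - real (card (M s c e'))" unfolding B_def
     by (subst card_Diff_subset) (auto simp: M_def cN[symmetric] finite_subset[OF _ finite_cube[of D k]] intro!: of_nat_diff card_mono finite_cube)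
    hence "\<delta> * N <= real (card B)" using less by (simp add: algebra_simps)
    then obtain L where L: "carries D k tc T B L" using car[of B] by (auto simp: B_def N_def)
    \<comment> \<open>If the lists were disjoint, a heavy arc would lead from a reached leaf into
      \<open>B\<close>.\<close>
    have meet: "L Int {r. r < k & \<pi> (slot c j) r : \<Lambda> s e (snd (slot c j))} ~= {}" if j: "j : al e" for j
    proof
     assume dis: "L Int {r. r < k & \<pi> (slot c j) r : \<Lambda> s e (snd (slot c j))} = {}"
     have jt: "j < t" using j by (simp add: al_def)
     have eE: "e : E0" using e by simp
     let ?A = "permute k (\<pi> (slot c j)) ` A s e (snd (slot c j))"
     have cA: "carries D k tc T ?A {r. r < k & \<pi> (slot c j) r : \<Lambda> s e (snd (slot c j))}"
      by (rule carries_permute[OF D bj[OF jt] \<Lambda>[OF dense[OF eE j]]])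
     have "?A <= cube D k" using permute_cube[OF bj[OF jt]] by (auto simp: A_def)
     moreover have "B <= cube D k" by (auto simp: B_def)
     moreover have "{r. r < k & \<pi> (slot c j) r : \<Lambda> s e (snd (slot c j))} Int L = {}" using dis by blast
     ultimately have "\<exists>z\<in>?A. \<exists>y\<in>B. compat D (X e) z y" using cA L by (intro compat_if_disjointly_carried[OF D])
     then obtain z y where zy: "z : A s e (snd (slot c j))" "y : B" "compat D (X e) (permute k (\<pi> (slot c j)) z) y" by blast
     hence z: "z : cube D k" "Leaf (snd (slot c j)) e z : R s" and y: "y : cube D k" "Hub c e' y ~: R s"
      by (auto simp: A_def B_def M_def)
     have "(Leaf (snd (slot c j)) e z, Hub c e' y) : G"
      by (rule heavyG, rule heavy.Leaf_Hub) (use c jt eE e' e z y zy in auto)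
     thus False using R_step[OF z(2)] y(2) by blast
    qed
    define pick where "pick j = (SOME r. r : L Int {r. r < k & \<pi> (slot c j) r : \<Lambda> s e (snd (slot c j))})" for j
    have pick: "pick j : L Int {r. r < k & \<pi> (slot c j) r : \<Lambda> s e (snd (slot c j))}" if "j : al e" for j
     unfolding pick_def by (rule someI_ex) (use meet[OF that] in blast)
    \<comment> \<open>There are more alive slots than labels in \<open>L\<close>, so two of them
      pick the same label.\<close>
    have lt: "card L < card (al e)" using carriesD(2)[OF L] big al by linarith
    have fL: "finite L" using carriesD(1)[OF L] finite_subset by blast
    have "pick ` al e <= L" using pick by blast
    hence "~ inj_on pick (al e)" using card_inj_on_le[of pick "al e" L] lt fL by linarith
    then obtain i j where ij: "i : al e" "j : al e" "i ~= j" "pick i = pick j" unfolding inj_on_def by blast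
    have "((s, d), e) : Fd \<times> E0" using sd(1) e(1) by blast
    from UN_upper[OF this, of "%p. \<Lambda> (fst (fst p)) (snd p) v" for v] have sub: "\<Lambda> s e v <= Lst v" for v
     by (simp only: Lst_def fst_conv snd_conv)
    have "pick i < k" "\<pi> (slot c i) (pick i) : Lst (snd (slot c i))" "\<pi> (slot c j) (pick i) : Lst (snd (slot c j))"
     using pick[OF ij(1)] pick[OF ij(2)] ij(4) sub by auto
    hence "coll (slot c i) (slot c j)" unfolding coll_def by blast
    thus False using nc ij by (auto simp: al_def)
   qed
  qed
  have "s ~= d" using sd(1) bip by force
  then obtain h where h: "(s, h) : (E0 - F c)\<^sup>*" "(h, d) : E0 - F c" using sd(2) by (metis rtranclE)
  define e where "e = (h, d)"
  have e: "e : E0" "e : E0 - F c" using h by (auto simp: e_def)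
  have "(1 - \<delta>) * N <= real (card (M s c e))" using M_dense[OF h(1)] e by (auto simp: e_def)
  hence "\<delta> * real t <= real (card (al e))" using alive e by blast
  moreover have "0 < \<delta> * real t" using \<delta> t by simp
  ultimately have "card (al e) ~= 0" by linarith
  then obtain j where j: "j : al e" by (metis card.empty ex_in_conv)
  have "0 < \<delta> * N" using \<delta> N by simp
  hence "card (A s e (snd (slot c j))) ~= 0" using dense[OF e(1) j] by linarith
  hence "A s e (snd (slot c j)) ~= {}" by (metis card.empty)
  then obtain z where z: "z : cube D k" "Leaf (snd (slot c j)) e z : R s" unfolding A_def by blast
  have "d : snd ` Fd" using sd(1) by force
  hence "(Leaf (snd (slot c j)) e z, Term (snd e)) : G"
   using j by (intro heavyG heavy.Leaf_Term c e z) (auto simp: al_def e_def)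
  hence "Term d : R s" using R_step[OF z(2)] by (simp add: e_def)
  thus False using K(2) sd(1) by (auto simp: separates_def R_def G_def)
 qed
 obtain partner where partner: "\<forall>u \<in> fst ` E. partner u : E & fst (partner u) = u"
  and cp: "card {c : centers. \<exists>i<t. \<exists>j<t. i ~= j & coll (slot c i) (slot c j)} <= 2 * (t * t) * card E ^ t * card {e : E. coll e (partner (fst e))}"
  using card_pairs_with_partner[of coll] by blast
 \<comment> \<open>The list of a first endpoint is the preimage of its partner's list, hence no
   longer than that one.\<close>
 define Rl where "Rl u = (if u : fst ` E then {r. r < k & \<pi> (partner u) r : Lst (snd (partner u))} else {})" for u
 have Rl: "Rl u <= {..<k}" "card (Rl u) <= card Fd * card E0 * T" for u
 proof -
  show "Rl u <= {..<k}" by (auto simp: Rl_def)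
  show "card (Rl u) <= card Fd * card E0 * T"
  proof (cases "u : fst ` E")
   case True
   hence "inj_on (\<pi> (partner u)) {..<k}" using bij[of "partner u"] partner by (simp add: bij_betw_def)
   hence "inj_on (\<pi> (partner u)) (Rl u)" by (rule inj_on_subset) (auto simp: Rl_def)
   moreover have "\<pi> (partner u) ` Rl u <= Lst (snd (partner u))" by (auto simp: Rl_def)
   moreover have "finite (Lst (snd (partner u)))" using Lst(1) finite_subset by blast
   ultimately have "card (Rl u) <= card (Lst (snd (partner u)))" by (rule card_inj_on_le)
   thus ?thesis using Lst(2) order_trans by blast
  qed (simp add: Rl_def)
 qed
 \<comment> \<open>A vertex can occur as first and as second endpoint, so it gets both lists; hence
   the factor 2 in \<open>Q\<close>. The added 1 makes \<open>Q\<close> positive.\<close>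
 define Nl where "Nl v = Lst v Un Rl v" for v
 have Nl: "Nl v <= {..<k} & card (Nl v) <= Q" for v
  using Lst[of v] Rl[of v] card_Un_le[of "Lst v" "Rl v"] unfolding Nl_def Q by auto
 have ex: "\<exists>a\<in>Nl (fst e). \<pi> e a : Nl (snd e)" if e: "e : {e : E. coll e (partner (fst e))}" for e
 proof -
  obtain r where "r < k" "\<pi> e r : Lst (snd e)" "\<pi> (partner (fst e)) r : Lst (snd (partner (fst e)))" using e unfolding coll_def by blast
  moreover have "fst e : fst ` E" using e by blast
  ultimately have "r : Nl (fst e)" "\<pi> e r : Nl (snd e)" by (simp_all add: Nl_def Rl_def)
  thus ?thesis by blast
 qed
 have "1 <= Q" by (simp add: Q)
 hence "\<exists>l\<in>V \<rightarrow>\<^sub>E {..<k}. card {e : E. coll e (partner (fst e))} <= Q * Q * card {e : E. \<pi> e (l (fst e)) = l (snd e)}"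
  using ex by (intro labeling_from_lists[OF V(1) Nl k _ fin_E V(2) loopfree]) blast+
 then obtain l where l: "l : V \<rightarrow>\<^sub>E {..<k}" "card {e : E. coll e (partner (fst e))} <= Q * Q * card {e : E. \<pi> e (l (fst e)) = l (snd e)}"
  by blast
 \<comment> \<open>If no demand survives outside \<open>F c\<close>, then \<open>F c\<close> is
   itself a multicut of the gap instance.\<close>
 have cost_c: "(1 - 3 * \<delta>) * real t * N * real opt <= real (\<Sum>e\<in>E0. W e * ncut K c e)" if "~ opn c" for c
 proof -
  have nn: "0 <= (1 - 3 * \<delta>) * real t * N" using \<delta>3 N by (intro mult_nonneg_nonneg) auto
  have "opt <= sum W (F c)" using that by (intro gap) (auto simp: F_def opn_def)
  hence "real opt <= real (sum W (F c))" by (rule of_nat_mono)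
  hence "(1 - 3 * \<delta>) * real t * N * real opt <= (1 - 3 * \<delta>) * real t * N * real (sum W (F c))" by (rule mult_left_mono[OF _ nn])
  also have "... = (\<Sum>e\<in>F c. real (W e) * ((1 - 3 * \<delta>) * real t * N))" by (simp only: of_nat_sum sum_distrib_left mult_ac)
  also have "... <= (\<Sum>e\<in>F c. real (W e) * real (ncut K c e))" by (intro sum_mono mult_left_mono) (auto simp: F_def)
  also have "... <= (\<Sum>e\<in>E0. real (W e) * real (ncut K c e))" using fin_E0 by (intro sum_mono2) (auto simp: F_def)
  finally show ?thesis by simp
 qed
 let ?O = "{c : centers. opn c}"
 have "card ?O <= card {c : centers. \<exists>i<t. \<exists>j<t. i ~= j & coll (slot c i) (slot c j)}"
  using collide fin_centers by (intro card_mono) auto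
 also have "... <= 2 * (t * t) * card E ^ t * card {e : E. coll e (partner (fst e))}" by (rule cp)
 also have "... <= 2 * (t * t) * card E ^ t * (Q * Q * card {e : E. \<pi> e (l (fst e)) = l (snd e)})" by (rule mult_le_mono2[OF l(2)])
 finally have O: "card ?O <= 2 * (t * t) * card E ^ t * (Q * Q * card {e : E. \<pi> e (l (fst e)) = l (snd e)})" .
 have "(real (card centers) - real (2 * (t * t) * card E ^ t * (Q * Q * card {e : E. \<pi> e (l (fst e)) = l (snd e)}))) * ((1 - 3 * \<delta>) * real t * N * real opt)
   <= real (card (centers - ?O)) * ((1 - 3 * \<delta>) * real t * N * real opt)"
 proof (rule mult_right_mono)
  have "card (centers - ?O) + card ?O = card centers"
   using fin_centers card_mono[OF fin_centers, of ?O] by (subst card_Diff_subset) auto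
  hence "real (card centers) - real (card ?O) = real (card (centers - ?O))" by linarith
  thus "real (card centers) - real (2 * (t * t) * card E ^ t * (Q * Q * card {e : E. \<pi> e (l (fst e)) = l (snd e)})) <= real (card (centers - ?O))"
   using of_nat_mono[OF O, where 'a = real] by linarith
  show "0 <= (1 - 3 * \<delta>) * real t * N * real opt" using \<delta>3 N by (intro mult_nonneg_nonneg) auto
 qed
 also have "... = (\<Sum>c\<in>centers - ?O. (1 - 3 * \<delta>) * real t * N * real opt)" by simp
 also have "... <= (\<Sum>c\<in>centers - ?O. real (\<Sum>e\<in>E0. W e * ncut K c e))" by (intro sum_mono cost_c) auto
 also have "... <= (\<Sum>c\<in>centers. real (\<Sum>e\<in>E0. W e * ncut K c e))" by (rule sum_mono2[OF fin_centers Diff_subset]) (rule of_nat_0_le_iff)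
 also have "... = real (cost K)" by (simp add: cost_def)
 finally show ?thesis using l(1) unfolding N_def by blast
qed

end

section \<open>Gap instances\<close>

lemma apath_iff_rtrancl:
 assumes "pair_wf_digraph G" "s : pverts G"
 shows "(\<exists>p. pre_digraph.apath (with_proj G) s p d) \<longleftrightarrow> (s, d) : (parcs G)\<^sup>*"
proof -
 interpret wf_digraph "with_proj G" using assms(1) by (simp add: wf_digraph_wp_iff)
 have "(\<exists>p. apath s p d) \<longleftrightarrow> (s, d) : rtrancl_on (pverts G) (parcs G)"
  unfolding reachable_apath[symmetric] reachable_def by simp
 also have "... \<longleftrightarrow> (s, d) : (parcs G)\<^sup>*"
 proof
  assume r: "(s, d) : (parcs G)\<^sup>*"
  hence "d : pverts G"
   using assms by (induction rule: rtrancl_induct) (auto dest: pair_wf_digraph.in_arcsD2)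
  thus "(s, d) : rtrancl_on (pverts G) (parcs G)"
   using r assms by (intro rtrancl_consistent_rtrancl_on) (auto dest: pair_wf_digraph.in_arcsD2)
 qed (rule rtrancl_on_rtranclI)
 finally show ?thesis .
qed

lemma multicut_iff_rtrancl:
 assumes "pair_wf_digraph G" "pverts H <= pverts G" "pair_wf_digraph H"
 shows "multicut H G K \<longleftrightarrow> K <= parcs G & (\<forall>(s, d)\<in>parcs H. (s, d) ~: (parcs G - K)\<^sup>*)"
proof -
 have wf: "pair_wf_digraph (G\<lparr>parcs := parcs G - K\<rparr>)"
  using assms(1) by (auto simp: pair_wf_digraph_def)
 have eq: "(\<exists>p. pre_digraph.apath (with_proj (G\<lparr>parcs := parcs G - K\<rparr>)) s p d) \<longleftrightarrow> (s, d) : (parcs G - K)\<^sup>*" if "(s, d) : parcs H" for s d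
  using apath_iff_rtrancl[OF wf, of s d] that assms(2) pair_wf_digraph.in_arcsD1[OF assms(3) that] by auto
 show ?thesis unfolding multicut_def
 proof (intro conj_cong refl ball_cong)
  fix x assume x: "x : parcs H"
  obtain s d where sd: "x = (s, d)" by (cases x)
  show "(case x of (s, d) => ~ (\<exists>p. pre_digraph.apath (with_proj (G\<lparr>parcs := parcs G - K\<rparr>)) s p d)) = (case x of (s, d) => (s, d) ~: (parcs G - K)\<^sup>*)"
   unfolding sd prod.case using eq[of s d] x sd by blast
 qed
qed

context wf_digraph
begin

text \<open>The LP speaks about paths only. Deleting cycles does not lengthen a walk, so walks obey
  the same lower bound.\<close>

lemma awalk_shortcut:
 fixes x :: "'b => real"
 assumes "awalk u p v" "!!e. e : arcs G ==> 0 <= x e"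
 shows "\<exists>q. apath u q v & (\<Sum>e\<leftarrow>q. x e) <= (\<Sum>e\<leftarrow>p. x e)"
 using assms(1)
proof (induction p rule: length_induct)
 case (1 p)
 show ?case
 proof (cases "distinct (awalk_verts u p)")
  case True
  thus ?thesis using 1 by (auto simp: apath_def)
 next
  case False
  obtain q r s where d: "p = q @ r @ s" "\<exists>w. awalk u q w & awalk w r w & awalk w s v" "closed_w r"
   using awalk_cyc_decompE'[OF 1(2) False] by metis
  then obtain w where w: "awalk u q w" "awalk w r w" "awalk w s v" by blast
  have "awalk u (q @ s) v" using w by auto
  moreover have "length (q @ s) < length p" using d by (auto simp: closed_w_def)
  ultimately obtain q' where "apath u q' v" "(\<Sum>e\<leftarrow>q'. x e) <= (\<Sum>e\<leftarrow>q @ s. x e)" using 1(1) by blast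
  moreover have "0 <= (\<Sum>e\<leftarrow>r. x e)" using w(2) assms(2) by (intro sum_list_nonneg) (auto simp: awalk_def)
  ultimately show ?thesis using d by (intro exI[of _ q']) auto
 qed
qed

end

text \<open>A walk of rounded length below \<open>D\<close> uses no arc truncated at
  \<open>D\<close>, and all other lengths are rounded up, so its LP length would be below 1.\<close>

lemma far_if_lp_feasible:
 assumes G: "pair_wf_digraph G" and H: "(s, d) : parcs H" "s : pverts G" and x: "lp_feasible H G x"
  and X: "!!e. e : parcs G ==> X e = min D (nat \<lceil>real D * x e\<rceil>)" and r: "dist_reach (parcs G) X s d n"
 shows "D <= n"
proof (rule ccontr)
 assume n: "~ D <= n"
 interpret wf_digraph "with_proj G" using G by (simp add: wf_digraph_wp_iff)
 have x0: "0 <= x e" if "e : parcs G" for e using x that by (auto simp: lp_feasible_def)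
 have "n < D --> (\<exists>p. awalk s p d & real D * (\<Sum>e\<leftarrow>p. x e) <= real n)" using r
 proof (induction rule: dist_reach.induct)
  case start
  show ?case using H(2) by (auto intro!: exI[of _ "[]"] simp: awalk_Nil_iff)
 next
  case (step e n)
  show ?case
  proof
   assume less: "n + X e < D"
   then obtain p where p: "awalk s p (fst e)" "real D * (\<Sum>e\<leftarrow>p. x e) <= real n" using step.IH by auto
   have "awalk (fst e) [e] (snd e)" using step.hyps G by (auto simp: awalk_simps pair_wf_digraph.arc_snd_in_verts)
   hence "awalk s (p @ [e]) (snd e)" using p(1) by auto
   moreover have "real D * x e <= real (X e)"
    using X[OF step.hyps(2)] less x0[OF step.hyps(2)] by (auto simp: min_def split: if_splits)
   ultimately show "\<exists>p. awalk s p (snd e) & real D * (\<Sum>e\<leftarrow>p. x e) <= real (n + X e)"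
    using p(2) by (intro exI[of _ "p @ [e]"]) (simp add: algebra_simps)
  qed
 qed
 then obtain p where p: "awalk s p d" "real D * (\<Sum>e\<leftarrow>p. x e) <= real n" using n by auto
 obtain q where q: "apath s q d" "(\<Sum>e\<leftarrow>q. x e) <= (\<Sum>e\<leftarrow>p. x e)" using awalk_shortcut[OF p(1), of x] x0 by auto
 have "1 <= (\<Sum>e\<leftarrow>q. x e)" using x q(1) H(1) by (auto simp: lp_feasible_def)
 hence "real D * 1 <= real D * (\<Sum>e\<leftarrow>p. x e)" using q(2) by (intro mult_left_mono) auto
 thus False using p(2) n by linarith
qed

lemma lp_feasible_one:
 assumes "pair_digraph H"
 shows "lp_feasible H G (%_. 1)"
 unfolding lp_feasible_def
proof (intro conjI ballI, simp, clarify)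
 fix s d p assume H: "(s, d) : parcs H" and p: "pre_digraph.apath (with_proj G) s p d"
 interpret H: pair_digraph H by (rule assms)
 have "p ~= []" using p H.pair_no_loops[OF H] by (auto simp: pre_digraph.apath_def pre_digraph.awalk_def pre_digraph.cas.simps)
 thus "1 <= (\<Sum>e\<leftarrow>p. 1 :: real)" by (cases p) (auto simp: sum_list_triv)
qed

text \<open>The gap is a supremum of reals, so a value below it yields an instance only if the set
  of ratios is not empty. The witness is a single demand arc of weight 1.\<close>

lemma flow_cut_gap_nonempty:
 assumes H: "pair_digraph H" and ne: "parcs H ~= {}"
 shows "\<exists>G w. multicut_instance H G w & lp_opt H G w > 0"
proof -
 interpret H: pair_digraph H by (rule H)
 obtain s d where sd: "(s, d) : parcs H" using ne by auto
 define G where "G = \<lparr>pverts = pverts H, parcs = {(s, d)}\<rparr>"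
 have G: "pair_fin_digraph G" using H.in_arcsD1[OF sd] H.in_arcsD2[OF sd] H.pair_finite_verts
  by unfold_locales (auto simp: G_def)
 then interpret G: pair_fin_digraph G .
 have inst: "multicut_instance H G (%_. 1)" using G by (simp add: multicut_instance_def G_def)
 have "1 <= lp_opt H G (%_. 1)" unfolding lp_opt_def
 proof (rule cInf_greatest)
  show "(%x. \<Sum>e\<in>parcs G. 1 * x e) ` {x. lp_feasible H G x} ~= {}" using lp_feasible_one[OF H] by blast
  fix v assume "v : (%x. \<Sum>e\<in>parcs G. 1 * x e) ` {x. lp_feasible H G x}"
  then obtain x where x: "lp_feasible H G x" "v = x (s, d)" by (auto simp: G_def)
  have "s ~= d" using H.pair_no_loops[OF sd] by simp
  hence "pre_digraph.apath (with_proj G) s [(s, d)] d"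
   using H.in_arcsD1[OF sd] H.in_arcsD2[OF sd]
   by (auto simp: pre_digraph.apath_def pre_digraph.awalk_def pre_digraph.cas.simps pre_digraph.awalk_verts.simps G_def)
  thus "1 <= v" using x sd by (force simp: lp_feasible_def)
 qed
 thus ?thesis using inst by (intro exI[of _ G] exI[of _ "%_. 1"]) auto
qed

text \<open>The indicator of a multicut is feasible.\<close>

lemma lp_opt_le_multicut:
 assumes H: "pair_digraph H" and G: "multicut_instance H G w" and K: "multicut H G K"
 shows "lp_opt H G w <= sum w K"
proof -
 interpret G: pair_fin_digraph G using G by (simp add: multicut_instance_def)
 have w0: "0 <= w e" if "e : parcs G" for e using G that by (simp add: multicut_instance_def)
 have KG: "K <= parcs G" using K by (simp add: multicut_def)
 define x where "x e = (of_bool (e : K) :: real)" for e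
 have "lp_feasible H G x" unfolding lp_feasible_def
 proof (intro conjI ballI, simp add: x_def, clarify)
  fix s d p assume sd: "(s, d) : parcs H" and p: "pre_digraph.apath (with_proj G) s p d"
  have "~ pre_digraph.apath (with_proj (G\<lparr>parcs := parcs G - K\<rparr>)) s p d" using K sd by (auto simp: multicut_def)
  then obtain e where e: "e : set p" "e : K" using p
   by (auto simp: pre_digraph.apath_def pre_digraph.awalk_def cas_with_proj_eq awalk_verts_with_proj_eq)
  have "x e <= (\<Sum>e\<leftarrow>p. x e)" by (rule member_le_sum_list) (use e in "auto simp: x_def")
  thus "1 <= (\<Sum>e\<leftarrow>p. x e)" using e by (simp add: x_def)
 qed
 moreover have "(\<Sum>e\<in>parcs G. w e * x e) = sum w K"
  using KG G.pair_finite_arcs by (simp add: x_def sum.inter_restrict[symmetric] Int_absorb1 of_bool_def if_distrib cong: if_cong)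
 moreover have "bdd_below ((%x. \<Sum>e\<in>parcs G. w e * x e) ` {x. lp_feasible H G x})"
  by (rule bdd_belowI[of _ 0]) (auto simp: lp_feasible_def intro!: sum_nonneg mult_nonneg_nonneg w0)
 ultimately show ?thesis unfolding lp_opt_def by (metis (mono_tags, lifting) cInf_lower imageI mem_Collect_eq)
qed

lemma multicut_all:
 assumes H: "pair_digraph H"
 shows "multicut H G (parcs G)"
 unfolding multicut_def
proof (intro conjI ballI, simp, clarify)
 fix s d p assume sd: "(s, d) : parcs H" and p: "pre_digraph.apath (with_proj (G\<lparr>parcs := parcs G - parcs G\<rparr>)) s p d"
 interpret H: pair_digraph H by (rule H)
 have "p ~= []" using p H.pair_no_loops[OF sd] by (auto simp: pre_digraph.apath_def pre_digraph.awalk_def pre_digraph.cas.simps)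
 thus False using p by (cases p) (auto simp: pre_digraph.apath_def pre_digraph.awalk_def)
qed

text \<open>Lengths and weights are multiplied by a common integer \<open>m\<close> and rounded up.
  The main terms grow like \<open>m * m\<close> and the rounding errors only like \<open>m\<close>,
  so the strict gap survives for large \<open>m\<close>. The factor is \<open>max \<beta> 0\<close>
  because \<beta> may be negative.\<close>

theorem gap_instance_exists:
 fixes \<beta> :: real
 assumes H: "pair_digraph H" and ne: "parcs H ~= {}" and \<beta>: "\<beta> < flow_cut_gap H"
 shows "\<exists>E0 X W D opt. finite E0 & 1 <= D & (\<forall>e\<in>E0. X e <= D) &
  (\<forall>s d n. (s, d) : parcs H --> dist_reach E0 X s d n --> D <= n) &
  (\<forall>F. F <= E0 --> (\<forall>(s, d)\<in>parcs H. (s, d) ~: (E0 - F)\<^sup>*) --> opt <= sum W F) & 0 < opt &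
  max \<beta> 0 * real (\<Sum>e\<in>E0. W e * (X e + 1)) < (real D + 1) * real (opt :: nat)"
proof -
 interpret H: pair_digraph H by (rule H)
 have "\<exists>r\<in>{multicut_opt H G w / lp_opt H G w |G w. multicut_instance H G w & lp_opt H G w > 0}. \<beta> < r"
  using flow_cut_gap_nonempty[OF H ne] \<beta> unfolding flow_cut_gap_def by (intro less_cSupD) auto
 then obtain G w where inst: "multicut_instance H G w" and lp: "lp_opt H G w > 0" and ratio: "\<beta> < multicut_opt H G w / lp_opt H G w" by blast
 interpret G: pair_fin_digraph G using inst by (simp add: multicut_instance_def)
 have sub: "pverts H <= pverts G" using inst by (simp add: multicut_instance_def)
 have w0: "0 <= w e" if "e : parcs G" for e using inst that by (simp add: multicut_instance_def)
 have finM: "finite {K. multicut H G K}" by (rule finite_subset[of _ "Pow (parcs G)"]) (auto simp: multicut_def G.pair_finite_arcs)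
 define opt0 where "opt0 = multicut_opt H G w"
 have opt0: "opt0 <= sum w K" if "multicut H G K" for K
  unfolding opt0_def multicut_opt_def using finM that by (intro Min_le) auto
 have "opt0 : sum w ` {K. multicut H G K}" unfolding opt0_def multicut_opt_def
  using finM multicut_all[OF H, of G] by (intro Min_in) auto
 hence opt_lp: "lp_opt H G w <= opt0" using lp_opt_le_multicut[OF H inst] by auto
 define b where "b = max \<beta> 0"
 have b0: "0 <= b" by (simp add: b_def)
 have "b * lp_opt H G w < opt0" using ratio lp opt_lp by (auto simp: b_def opt0_def max_def field_simps)
 have "\<exists>x. lp_feasible H G x & b * (\<Sum>e\<in>parcs G. w e * x e) < opt0"
 proof (cases "b = 0")
  case True
  thus ?thesis using lp_feasible_one[OF H, of G] lp opt_lp by auto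
 next
  case False
  hence bp: "0 < b" using b0 by simp
  hence "lp_opt H G w < opt0 / b" using \<open>b * lp_opt H G w < opt0\<close> by (simp add: field_simps)
  then obtain v where "v : (%x. \<Sum>e\<in>parcs G. w e * x e) ` {x. lp_feasible H G x}" "v < opt0 / b"
   unfolding lp_opt_def using lp_feasible_one[OF H, of G] by (metis (no_types, lifting) cInf_lessD empty_iff imageI mem_Collect_eq)
  thus ?thesis using bp by (auto simp: field_simps)
 qed
 then obtain x where x: "lp_feasible H G x" "b * (\<Sum>e\<in>parcs G. w e * x e) < opt0" by blast
 have x0: "0 <= x e" if "e : parcs G" for e using x that by (auto simp: lp_feasible_def)
 \<comment> \<open>The coefficients of the terms of order \<open>m\<close> in
   \<open>(m * w e + 1) * (m * x e + 2)\<close>, with the constant 2 bounded by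
   \<open>2 * m\<close>.\<close>
 define S where "S = (\<Sum>e\<in>parcs G. 2 * w e + x e + 2)"
 have S0: "0 <= S" unfolding S_def using w0 x0 by (intro sum_nonneg) (auto intro: add_nonneg_nonneg)
 define gp where "gp = opt0 - b * (\<Sum>e\<in>parcs G. w e * x e)"
 have gp: "0 < gp" using x by (simp add: gp_def)
 obtain n :: nat where n: "b * S / gp < real n" using reals_Archimedean2 by blast
 define m where "m = Suc n"
 have m: "b * S < gp * real m" "1 <= m" using n gp by (auto simp: m_def field_simps)
 define X where "X e = min m (nat \<lceil>real m * x e\<rceil>)" for e
 define W where "W e = nat \<lceil>real m * w e\<rceil>" for e
 define opt where "opt = nat \<lceil>real m * opt0\<rceil>"
 have "0 < opt0" using lp opt_lp by linarith
 hence optp: "0 < opt" using m(2) by (simp add: opt_def)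
 have gap: "opt <= sum W F" if F: "F <= parcs G" "\<forall>(s, d)\<in>parcs H. (s, d) ~: (parcs G - F)\<^sup>*" for F
 proof -
  have "multicut H G F" using multicut_iff_rtrancl[OF G.pair_wf_digraph_axioms sub H.pair_wf_digraph_axioms] F by simp
  hence "real m * opt0 <= real m * sum w F" using opt0 by (intro mult_left_mono) auto
  also have "... = (\<Sum>e\<in>F. real m * w e)" by (rule sum_distrib_left)
  also have "... <= (\<Sum>e\<in>F. real (W e))" unfolding W_def by (intro sum_mono) linarith
  finally have "real m * opt0 <= real (sum W F)" by simp
  thus ?thesis unfolding opt_def by linarith
 qed
 have "real (W e * (X e + 1)) <= real m * real m * (w e * x e) + real m * (2 * w e + x e + 2)" if e: "e : parcs G" for e
 proof -
  have 1: "real (W e) <= real m * w e + 1" unfolding W_def using w0[OF e] by (simp add: of_nat_nat; linarith?)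
  have "real (X e) <= real (nat \<lceil>real m * x e\<rceil>)" by (simp add: X_def)
  also have "... <= real m * x e + 1" using x0[OF e] by (simp add: of_nat_nat; linarith?)
  finally have 2: "real (X e) + 1 <= real m * x e + 2" by simp
  have "real (W e * (X e + 1)) = real (W e) * (real (X e) + 1)" by (simp add: algebra_simps)
  also have "... <= (real m * w e + 1) * (real m * x e + 2)" using 1 2 w0[OF e] by (intro mult_mono) auto
  also have "... = real m * real m * (w e * x e) + (real m * (2 * w e + x e) + 2 * 1)" by (simp add: algebra_simps)
  also have "... <= real m * real m * (w e * x e) + (real m * (2 * w e + x e) + 2 * real m)" using m(2) by simp
  finally show ?thesis by (simp add: algebra_simps)
 qed
 hence "(\<Sum>e\<in>parcs G. real (W e * (X e + 1))) <= (\<Sum>e\<in>parcs G. real m * real m * (w e * x e) + real m * (2 * w e + x e + 2))" by (rule sum_mono)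
 hence "real (\<Sum>e\<in>parcs G. W e * (X e + 1)) <= real m * real m * (\<Sum>e\<in>parcs G. w e * x e) + real m * S"
  unfolding of_nat_sum S_def sum_distrib_left sum.distrib[symmetric] .
 hence "b * real (\<Sum>e\<in>parcs G. W e * (X e + 1)) <= b * (real m * real m * (\<Sum>e\<in>parcs G. w e * x e) + real m * S)" by (rule mult_left_mono[OF _ b0])
 also have "... = real m * real m * (opt0 - gp) + real m * (b * S)" by (simp add: gp_def algebra_simps)
 also have "... < real m * real m * (opt0 - gp) + real m * (gp * real m)" using m by (intro add_strict_left_mono mult_strict_left_mono) auto
 also have "... = real m * (real m * opt0)" by (simp add: algebra_simps)
 also have "... <= real m * real opt" unfolding opt_def using m(2) by (intro mult_left_mono) linarith+
 also have "... <= (real m + 1) * real opt" by (simp add: mult_right_mono)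
 finally have final: "max \<beta> 0 * real (\<Sum>e\<in>parcs G. W e * (X e + 1)) < (real m + 1) * real opt" by (simp only: b_def)
 have far: "m <= n" if "(s, d) : parcs H" "dist_reach (parcs G) X s d n" for s d n
  by (rule far_if_lp_feasible[OF G.pair_wf_digraph_axioms that(1) _ x(1) _ that(2)])
   (use H.in_arcsD1[OF that(1)] sub in "auto simp: X_def")
 show ?thesis
  by (rule exI[of _ "parcs G"], rule exI[of _ X], rule exI[of _ W], rule exI[of _ m], rule exI[of _ opt])
   (intro conjI allI impI ballI; (rule G.pair_finite_arcs m(2) optp final gap far | simp add: X_def); assumption?)
qed

section \<open>A language of stack programs with running times\<close>

type_synonym store = "nat => bool list"
type_synonym io = "(int => nat) \<times> int"

text \<open>Registers are stacks of bits and the only tests are for emptiness and the top bit, so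
  each basic step is a bounded number of moves of a multitape machine. The \<open>IO\<close>
  commands act on the tape that holds the input and the output.\<close>

datatype com =
  Skip
 | Push nat bool
 | Pop nat com com com
 | Seq com com (infixr ";;" 60)
 | While nat com
 | IO_Move int
 | IO_Write nat
 | IO_Case com com com

text \<open>The number is an upper bound of the running time, as \<open>runs_weaken\<close> makes
  explicit; times can be rounded up freely.\<close>

inductive runs :: "com => store \<times> io => nat => store \<times> io => bool" where
 runs_Skip: "runs Skip \<sigma> 1 \<sigma>"
| runs_Push: "runs (Push r b) (s, i) 1 (s(r := b # s r), i)"
| runs_PopE: "s r = [] ==> runs c (s, i) n \<tau> ==> runs (Pop r c c' c'') (s, i) (Suc n) \<tau>"
| runs_PopF: "s r = False # xs ==> runs c' (s(r := xs), i) n \<tau> ==> runs (Pop r c c' c'') (s, i) (Suc n) \<tau>"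
| runs_PopT: "s r = True # xs ==> runs c'' (s(r := xs), i) n \<tau> ==> runs (Pop r c c' c'') (s, i) (Suc n) \<tau>"
| runs_Seq: "runs c \<sigma> n \<rho> ==> runs d \<rho> m \<tau> ==> runs (c ;; d) \<sigma> (n + m) \<tau>"
| runs_WhileE: "s r = [] ==> runs (While r c) (s, i) 1 (s, i)"
| runs_WhileC: "s r ~= [] ==> runs c (s, i) n \<rho> ==> runs (While r c) \<rho> m \<tau> ==>
  runs (While r c) (s, i) (Suc (n + m)) \<tau>"
| runs_IO_Move: "d : {-1, 0, 1} ==> runs (IO_Move d) (s, (t, h)) 1 (s, (t, h + d))"
| runs_IO_Write: "a < 3 ==> runs (IO_Write a) (s, (t, h)) 1 (s, (t(h := a), h))"
| runs_IO_CaseE: "t h = 0 ==> runs c (s, (t, h)) n \<tau> ==> runs (IO_Case c c' c'') (s, (t, h)) (Suc n) \<tau>"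
| runs_IO_CaseF: "t h = 1 ==> runs c' (s, (t, h)) n \<tau> ==> runs (IO_Case c c' c'') (s, (t, h)) (Suc n) \<tau>"
| runs_IO_CaseT: "t h = 2 ==> runs c'' (s, (t, h)) n \<tau> ==> runs (IO_Case c c' c'') (s, (t, h)) (Suc n) \<tau>"
| runs_weaken: "runs c \<sigma> n \<tau> ==> n <= m ==> runs c \<sigma> m \<tau>"

text \<open>A step pushes at most one bit, so time bounds serve as space bounds too.\<close>

lemma runs_length: "runs c \<sigma> n \<tau> ==> length (fst \<tau> r) <= length (fst \<sigma> r) + n"
proof (induction arbitrary: r rule: runs.induct)
 case (runs_Seq c \<sigma> n \<rho> d m \<tau>)
 show ?case using runs_Seq.IH(1)[of r] runs_Seq.IH(2)[of r] by linarith
next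
 case (runs_WhileC s r' c i n \<rho> m \<tau>)
 show ?case using runs_WhileC.IH(1)[of r] runs_WhileC.IH(2)[of r] by simp
next
 case (runs_PopE s r' c i n \<tau> c' c'')
 show ?case using runs_PopE.IH[of r] by simp
next
 case (runs_PopF s r' xs c' i n \<tau> c c'')
 show ?case using runs_PopF.IH[of r] runs_PopF(1) by (auto split: if_splits)
next
 case (runs_PopT s r' xs c'' i n \<tau> c c')
 show ?case using runs_PopT.IH[of r] runs_PopT(1) by (auto split: if_splits)
next
 case (runs_weaken c \<sigma> n \<tau> m)
 show ?case using runs_weaken.IH[of r] runs_weaken(2) by linarith
next
 case (runs_IO_CaseE t h c s n \<tau> c' c'')
 show ?case using runs_IO_CaseE.IH[of r] by simp
next
 case (runs_IO_CaseF t h c' s n \<tau> c c'')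
 show ?case using runs_IO_CaseF.IH[of r] by simp
next
 case (runs_IO_CaseT t h c'' s n \<tau> c c')
 show ?case using runs_IO_CaseT.IH[of r] by simp
qed auto

section \<open>Compilation to Turing machines\<close>

text \<open>A state scans and changes one tape only; the others stay as they are.\<close>

type_synonym instr = "nat * (nat => nat * int \<times> nat)"

text \<open>\<open>Push\<close> takes two states because the head has to move before it
  writes.\<close>

primrec com_size :: "com => nat" where
 "com_size Skip = 1"
| "com_size (Push r b) = 2"
| "com_size (Pop r c c' c'') = 1 + com_size c + com_size c' + com_size c''"
| "com_size (c ;; d) = com_size c + com_size d"
| "com_size (While r c) = 1 + com_size c"
| "com_size (IO_Move d) = 1"
| "com_size (IO_Write a) = 1"
| "com_size (IO_Case c c' c'') = 1 + com_size c + com_size c' + com_size c''"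

text \<open>The code of a command occupies the states from \<open>a\<close> on and continues at state \<open>e\<close>.  Register
 \<open>r\<close> is kept on tape \<open>Suc r\<close>, with its top at the head and a blank below its bottom.\<close>

primrec compile :: "com => nat => nat => instr list" where
 "compile Skip a e = [(0, %x. (x, 0, e))]"
| "compile (Push r b) a e = [(Suc r, %x. (x, -1, a + 1)), (Suc r, %x. (letter b, 0, e))]"
| "compile (Pop r c c' c'') a e =
  (Suc r, %x. if x = 0 then (x, 0, a + 1) else if x = 1 then (x, 1, a + 1 + com_size c)
      else (x, 1, a + 1 + com_size c + com_size c')) #
  compile c (a + 1) e @ compile c' (a + 1 + com_size c) e @
  compile c'' (a + 1 + com_size c + com_size c') e"
| "compile (c ;; d) a e = compile c a (a + com_size c) @ compile d (a + com_size c) e"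
| "compile (While r c) a e =
  (Suc r, %x. if x = 0 then (x, 0, e) else (x, 0, a + 1)) # compile c (a + 1) a"
| "compile (IO_Move d) a e = [(0, %x. (x, if d : {-1, 0, 1} then d else 0, e))]"
| "compile (IO_Write y) a e = [(0, %x. (if y < 3 then y else 0, 0, e))]"
| "compile (IO_Case c c' c'') a e =
  (0, %x. if x = 0 then (x, 0, a + 1) else if x = 1 then (x, 0, a + 1 + com_size c)
      else (x, 0, a + 1 + com_size c + com_size c')) #
  compile c (a + 1) e @ compile c' (a + 1 + com_size c) e @
  compile c'' (a + 1 + com_size c + com_size c') e"

lemma length_compile [simp]: "length (compile c a e) = com_size c"
 by (induction c arbitrary: a e) auto

lemma com_size_pos: "0 < com_size c"
 by (induction c) auto

primrec com_regs :: "com => nat" where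
 "com_regs Skip = 0"
| "com_regs (Push r b) = Suc r"
| "com_regs (Pop r c c' c'') = max (Suc r) (max (com_regs c) (max (com_regs c') (com_regs c'')))"
| "com_regs (c ;; d) = max (com_regs c) (com_regs d)"
| "com_regs (While r c) = max (Suc r) (com_regs c)"
| "com_regs (IO_Move d) = 0"
| "com_regs (IO_Write a) = 0"
| "com_regs (IO_Case c c' c'') = max (com_regs c) (max (com_regs c') (com_regs c''))"

definition instr_delta :: "instr list => nat => nat list => nat * (nat * int) list" where
 "instr_delta P q rs = (case P ! q of (r, g) => case g (rs ! r) of (w, d, q') =>
  (q', (map (%x. (x, 0)) rs)[r := (w, d)]))"

definition instr_tm :: "nat => instr list => tm" where
 "instr_tm R P = \<lparr>tm_tapes = Suc R, tm_states = length P, tm_symbols = 3, tm_delta = instr_delta P\<rparr>"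

definition instr_wf :: "nat => nat => instr => bool" where
 "instr_wf R N I \<longleftrightarrow> fst I <= R & (\<forall>x < 3. case snd I x of (w, d, q') => w < 3 & d : {-1, 0, 1} & q' < N)"

lemma compile_wf:
 "com_regs c <= R ==> a + com_size c <= N ==> e < N ==> \<forall>I \<in> set (compile c a e). instr_wf R N I"
proof (induction c arbitrary: a e)
 case (Seq c d)
 hence "a + com_size c < N" using com_size_pos[of d] by simp
 with Seq.IH(1)[of a "a + com_size c"] Seq.IH(2)[of "a + com_size c" e] Seq.prems
 show ?case unfolding compile.simps set_append ball_Un by simp
next
 case (Pop r c c' c'')
 note pos = com_size_pos[of c] com_size_pos[of c'] com_size_pos[of c'']
 have 1: "\<forall>I \<in> set (compile c (a + 1) e). instr_wf R N I" "\<forall>I \<in> set (compile c' (a + 1 + com_size c) e). instr_wf R N I"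
  "\<forall>I \<in> set (compile c'' (a + 1 + com_size c + com_size c') e). instr_wf R N I"
  using Pop.IH(1)[of "a + 1" e] Pop.IH(2)[of "a + 1 + com_size c" e]
   Pop.IH(3)[of "a + 1 + com_size c + com_size c'" e] Pop.prems by simp_all
 show ?case unfolding compile.simps set_append ball_Un list.set ball_simps
  using Pop.prems pos by (intro conjI 1) (auto simp: instr_wf_def)
next
 case (IO_Case c c' c'')
 note pos = com_size_pos[of c] com_size_pos[of c'] com_size_pos[of c'']
 have 1: "\<forall>I \<in> set (compile c (a + 1) e). instr_wf R N I" "\<forall>I \<in> set (compile c' (a + 1 + com_size c) e). instr_wf R N I"
  "\<forall>I \<in> set (compile c'' (a + 1 + com_size c + com_size c') e). instr_wf R N I"
  using IO_Case.IH(1)[of "a + 1" e] IO_Case.IH(2)[of "a + 1 + com_size c" e]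
   IO_Case.IH(3)[of "a + 1 + com_size c + com_size c'" e] IO_Case.prems by simp_all
 show ?case unfolding compile.simps set_append ball_Un list.set ball_simps
  using IO_Case.prems pos by (intro conjI 1) (auto simp: instr_wf_def)
next
 case (While r c)
 have "\<forall>I \<in> set (compile c (a + 1) a). instr_wf R N I" using While.IH[of "a + 1" a] While.prems by simp
 thus ?case unfolding compile.simps list.set ball_simps
  using While.prems com_size_pos[of c] by (intro conjI) (auto simp: instr_wf_def)
qed (auto simp: instr_wf_def letter_def)

lemma instr_tm_wf:
 assumes "2 <= length P" "\<forall>I \<in> set P. instr_wf R (length P) I"
 shows "tm_wf (instr_tm R P)"
proof -
 have "fst (instr_delta P q rs) < length P & length (snd (instr_delta P q rs)) = Suc R &
   set (snd (instr_delta P q rs)) <= {..<3} \<times> {-1, 0, 1}"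
  if "q < length P" "length rs = Suc R" "set rs <= {..<3}" for q rs
 proof -
  obtain r g where I: "P ! q = (r, g)" by force
  obtain w d q' where g: "g (rs ! r) = (w, d, q')" by (metis prod_cases3)
  have wf: "instr_wf R (length P) (r, g)" using assms(2) that(1) I by (metis nth_mem)
  hence r: "r <= R" by (simp add: instr_wf_def)
  hence "rs ! r < 3" using that by (metis lessThan_iff le_imp_less_Suc nth_mem subsetD)
  with wf g have *: "w < 3" "d : {-1, 0, 1}" "q' < length P" by (force simp: instr_wf_def)+
  have "set ((map (%x. (x, 0::int)) rs)[r := (w, d)]) <= insert (w, d) ((%x. (x, 0)) ` set rs)"
   using set_update_subset_insert by fastforce
  with * that show ?thesis unfolding instr_delta_def I g prod.case by auto
 qed
 thus ?thesis using assms(1) by (simp add: tm_wf_def instr_tm_def)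
qed

lemma tm_step_instr:
 assumes "q ~= 1" "fst (P ! q) = r" "r < length ts" "ts ! r = (t, h)" "snd (P ! q) (t h) = (w, d, q')"
 shows "tm_step (instr_tm R P) (q, ts) = (q', ts[r := (t(h := w), h + d)])"
proof -
 have "map2 (%(t, h) (s, d). (t(h := s), h + d)) ts
   ((map (%x. (x, 0)) (map (%(t, h). t h) ts))[r := (w, d)]) = ts[r := (t(h := w), h + d)]"
  using assms(3,4) by (intro nth_equalityI) (auto simp: nth_list_update split: prod.splits)
 moreover have "map (%(t, h). t h) ts ! r = t h" using assms by simp
 moreover obtain g where "P ! q = (r, g)" using assms(2) by (metis prod.collapse)
 ultimately show ?thesis using assms
  by (simp add: tm_step_def instr_tm_def instr_delta_def)
qed

text \<open>Cells to the left of the head are unconstrained, so popping need not erase and pushing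
  overwrites.\<close>

definition is_stack :: "(int => nat) \<times> int => bool list => bool" where
 "is_stack th xs \<longleftrightarrow> (\<forall>i < length xs. fst th (snd th + int i) = letter (xs ! i)) & fst th (snd th + int (length xs)) = 0"

lemma is_stack_top: "is_stack (t, h) [] ==> t h = 0" "is_stack (t, h) (b # xs) ==> t h = letter b"
 by (auto simp: is_stack_def)

lemma is_stack_pop: "is_stack (t, h) (b # xs) ==> is_stack (t, h + 1) xs"
 unfolding is_stack_def
 by (auto simp: algebra_simps dest!: spec[of _ "Suc _"])

lemma is_stack_push: "is_stack (t, h) xs ==> is_stack (t(h - 1 := letter b), h - 1) (b # xs)"
 unfolding is_stack_def
 by (auto simp: nth_Cons split: nat.splits)

definition tapes_rel :: "nat => store \<times> io => io list => bool" where
 "tapes_rel R \<sigma> ts \<longleftrightarrow> length ts = Suc R & ts ! 0 = snd \<sigma> & (\<forall>r < R. is_stack (ts ! Suc r) (fst \<sigma> r))"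

text \<open>The factor 2 is the cost of \<open>Push\<close>. The bound \<open>2 <= a\<close> keeps
  the code away from the halting state 1, where the machine stands still.\<close>

lemma runs_compile:
 assumes "runs c \<sigma> n \<tau>" "com_regs c <= R" "2 <= a"
  "!!i. i < com_size c ==> P ! (a + i) = compile c a e ! i" "tapes_rel R \<sigma> ts"
 shows "\<exists>ts' m. m <= 2 * n & (tm_step (instr_tm R P) ^^ m) (a, ts) = (e, ts') & tapes_rel R \<tau> ts'"
 using assms
proof (induction arbitrary: a e ts rule: runs.induct)
 case (runs_Skip \<sigma>)
 have "P ! a = (0, %x. (x, 0, e))" using runs_Skip(3)[of 0] by simp
 hence "tm_step (instr_tm R P) (a, ts) = (e, ts[0 := ((fst (ts!0))(snd (ts!0) := fst (ts!0) (snd (ts!0))), snd (ts!0) + 0)])"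
  by (intro tm_step_instr) (use runs_Skip in "auto simp: tapes_rel_def")
 thus ?case using runs_Skip by (intro exI[of _ ts] exI[of _ 1]) simp
next
 case (runs_Push r b s i)
 obtain t h where th: "ts ! Suc r = (t, h)" by force
 have P1: "P ! a = (Suc r, %x. (x, -1, a + 1))" using runs_Push(3)[of 0] by simp
 have P2: "P ! (a + 1) = (Suc r, %x. (letter b, 0, e))" using runs_Push(3)[of 1] by simp
 have len: "Suc r < length ts" using runs_Push by (auto simp: tapes_rel_def)
 have 1: "tm_step (instr_tm R P) (a, ts) = (a + 1, ts[Suc r := (t(h := t h), h + -1)])"
  using runs_Push th P1 len by (intro tm_step_instr) auto
 have 2: "tm_step (instr_tm R P) (a + 1, ts[Suc r := (t, h - 1)])
  = (e, (ts[Suc r := (t, h - 1)])[Suc r := (t(h - 1 := letter b), h - 1 + 0)])"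
  using runs_Push th P2 len by (intro tm_step_instr) auto
 have "tapes_rel R (s(r := b # s r), i) (ts[Suc r := (t(h - 1 := letter b), h - 1)])"
  using runs_Push(4) th is_stack_push[of t h "s r" b] len
  by (auto simp: tapes_rel_def nth_list_update)
 thus ?case using 1 2 by (intro exI[of _ "ts[Suc r := (t(h - 1 := letter b), h - 1)]"] exI[of _ 2]) (simp add: numeral_2_eq_2)
next
 case (runs_PopE s r c i n \<tau> c' c'')
 obtain t h where th: "ts ! Suc r = (t, h)" by force
 have len: "Suc r < length ts" using runs_PopE by (auto simp: tapes_rel_def)
 have P1: "P ! a = compile (Pop r c c' c'') a e ! 0" using runs_PopE.prems(3)[of 0] by simp
 have "is_stack (ts ! Suc r) (s r)" using runs_PopE.prems by (auto simp: tapes_rel_def)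
 hence t0: "t h = 0" using runs_PopE(1) th is_stack_top(1) by simp
 have 1: "tm_step (instr_tm R P) (a, ts) = (a + 1, ts[Suc r := (t(h := t h), h + 0)])"
  using runs_PopE th P1 len t0 by (intro tm_step_instr) auto
 have "P ! (a + 1 + j) = compile c (a + 1) e ! j" if "j < com_size c" for j
  using runs_PopE.prems(3)[of "Suc j"] that by (simp add: nth_append)
 from runs_PopE.IH[OF _ _ this runs_PopE.prems(4)] runs_PopE.prems obtain ts' m where
  "m <= 2 * n" "(tm_step (instr_tm R P) ^^ m) (a + 1, ts) = (e, ts')" "tapes_rel R \<tau> ts'" by auto
 thus ?case using 1 th by (intro exI[of _ ts'] exI[of _ "Suc m"]) (simp add: funpow_swap1 del: funpow.simps add: funpow_Suc_right list_update_id[of ts "Suc r", unfolded th])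
next
 case (runs_PopF s r xs c' i n \<tau> c c'')
 obtain t h where th: "ts ! Suc r = (t, h)" by force
 have len: "Suc r < length ts" using runs_PopF by (auto simp: tapes_rel_def)
 have P1: "P ! a = compile (Pop r c c' c'') a e ! 0" using runs_PopF.prems(3)[of 0] by simp
 have "is_stack (ts ! Suc r) (s r)" using runs_PopF.prems by (auto simp: tapes_rel_def)
 hence st: "is_stack (t, h) (False # xs)" using runs_PopF(1) th by simp
 hence t0: "t h = 1" using is_stack_top(2)[of t h False] by (simp add: letter_def)
 have 1: "tm_step (instr_tm R P) (a, ts) = (a + 1 + com_size c, ts[Suc r := (t(h := t h), h + 1)])"
  using runs_PopF th P1 len t0 by (intro tm_step_instr) auto
 have co: "P ! (a + 1 + com_size c + j) = compile c' (a + 1 + com_size c) e ! j" if "j < com_size c'" for j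
  using runs_PopF.prems(3)[of "Suc (com_size c + j)"] that by (simp add: nth_append add.assoc)
 have "tapes_rel R (s(r := xs), i) (ts[Suc r := (t, h + 1)])"
  using runs_PopF.prems(4) is_stack_pop[OF st] len by (auto simp: tapes_rel_def nth_list_update)
 from runs_PopF.IH[OF _ _ co this] runs_PopF.prems obtain ts' m where
  "m <= 2 * n" "(tm_step (instr_tm R P) ^^ m) (a + 1 + com_size c, ts[Suc r := (t, h + 1)]) = (e, ts')" "tapes_rel R \<tau> ts'" by auto
 thus ?case using 1 th by (intro exI[of _ ts'] exI[of _ "Suc m"]) (simp del: funpow.simps add: funpow_Suc_right)
next
 case (runs_PopT s r xs c'' i n \<tau> c c')
 obtain t h where th: "ts ! Suc r = (t, h)" by force
 have len: "Suc r < length ts" using runs_PopT by (auto simp: tapes_rel_def)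
 have P1: "P ! a = compile (Pop r c c' c'') a e ! 0" using runs_PopT.prems(3)[of 0] by simp
 have "is_stack (ts ! Suc r) (s r)" using runs_PopT.prems by (auto simp: tapes_rel_def)
 hence st: "is_stack (t, h) (True # xs)" using runs_PopT(1) th by simp
 hence t0: "t h = 2" using is_stack_top(2)[of t h True] by (simp add: letter_def)
 have 1: "tm_step (instr_tm R P) (a, ts) = (a + 1 + com_size c + com_size c', ts[Suc r := (t(h := t h), h + 1)])"
  using runs_PopT th P1 len t0 by (intro tm_step_instr) auto
 have co: "P ! (a + 1 + com_size c + com_size c' + j) = compile c'' (a + 1 + com_size c + com_size c') e ! j" if "j < com_size c''" for j
  using runs_PopT.prems(3)[of "Suc (com_size c + com_size c' + j)"] that by (simp add: nth_append add.assoc)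
 have "tapes_rel R (s(r := xs), i) (ts[Suc r := (t, h + 1)])"
  using runs_PopT.prems(4) is_stack_pop[OF st] len by (auto simp: tapes_rel_def nth_list_update)
 from runs_PopT.IH[OF _ _ co this] runs_PopT.prems obtain ts' m where
  "m <= 2 * n" "(tm_step (instr_tm R P) ^^ m) (a + 1 + com_size c + com_size c', ts[Suc r := (t, h + 1)]) = (e, ts')" "tapes_rel R \<tau> ts'" by auto
 thus ?case using 1 th by (intro exI[of _ ts'] exI[of _ "Suc m"]) (simp del: funpow.simps add: funpow_Suc_right)
next
 case (runs_Seq c \<sigma> n \<rho> d m \<tau>)
 have co1: "P ! (a + j) = compile c a (a + com_size c) ! j" if "j < com_size c" for j
  using runs_Seq.prems(3)[of j] that by (simp add: nth_append)
 have co2: "P ! (a + com_size c + j) = compile d (a + com_size c) e ! j" if "j < com_size d" for j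
  using runs_Seq.prems(3)[of "com_size c + j"] that by (simp add: nth_append add.assoc)
 from runs_Seq.IH(1)[OF _ _ co1 runs_Seq.prems(4)] runs_Seq.prems obtain ts1 m1 where
  1: "m1 <= 2 * n" "(tm_step (instr_tm R P) ^^ m1) (a, ts) = (a + com_size c, ts1)" "tapes_rel R \<rho> ts1" by auto
 from runs_Seq.IH(2)[OF _ _ co2 1(3)] runs_Seq.prems obtain ts2 m2 where
  2: "m2 <= 2 * m" "(tm_step (instr_tm R P) ^^ m2) (a + com_size c, ts1) = (e, ts2)" "tapes_rel R \<tau> ts2" by auto
 show ?case using 1 2 by (intro exI[of _ ts2] exI[of _ "m2 + m1"]) (simp add: funpow_add)
next
 case (runs_WhileE s r c i)
 obtain t h where th: "ts ! Suc r = (t, h)" by force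
 have len: "Suc r < length ts" using runs_WhileE by (auto simp: tapes_rel_def)
 have P1: "P ! a = compile (While r c) a e ! 0" using runs_WhileE.prems(3)[of 0] by simp
 have "is_stack (ts ! Suc r) (s r)" using runs_WhileE.prems by (auto simp: tapes_rel_def)
 hence t0: "t h = 0" using runs_WhileE(1) th is_stack_top(1) by simp
 have "tm_step (instr_tm R P) (a, ts) = (e, ts[Suc r := (t(h := t h), h + 0)])"
  using runs_WhileE th P1 len t0 by (intro tm_step_instr) auto
 thus ?case using runs_WhileE th
  by (intro exI[of _ ts] exI[of _ 1]) (simp add: list_update_id[of ts "Suc r", unfolded th])
next
 case (runs_WhileC s r c i n \<rho> m \<tau>)
 obtain t h where th: "ts ! Suc r = (t, h)" by force
 have len: "Suc r < length ts" using runs_WhileC by (auto simp: tapes_rel_def)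
 have P1: "P ! a = compile (While r c) a e ! 0" using runs_WhileC.prems(3)[of 0] by simp
 obtain b xs where bx: "s r = b # xs" using runs_WhileC(1) by (cases "s r") auto
 have "is_stack (ts ! Suc r) (s r)" using runs_WhileC.prems by (auto simp: tapes_rel_def)
 hence "is_stack (t, h) (s r)" using th by simp
 hence t0: "t h ~= 0" unfolding bx using is_stack_top(2)[of t h b xs] by (auto simp: letter_def)
 have 0: "tm_step (instr_tm R P) (a, ts) = (a + 1, ts[Suc r := (t(h := t h), h + 0)])"
  using runs_WhileC th P1 len t0 by (intro tm_step_instr) auto
 have co1: "P ! (a + 1 + j) = compile c (a + 1) a ! j" if "j < com_size c" for j
  using runs_WhileC.prems(3)[of "Suc j"] that by (simp add: nth_append)
 from runs_WhileC.IH(1)[OF _ _ co1 runs_WhileC.prems(4)] runs_WhileC.prems obtain ts1 m1 where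
  1: "m1 <= 2 * n" "(tm_step (instr_tm R P) ^^ m1) (a + 1, ts) = (a, ts1)" "tapes_rel R \<rho> ts1" by auto
 from runs_WhileC.IH(2)[OF _ _ runs_WhileC.prems(3) 1(3)] runs_WhileC.prems obtain ts2 m2 where
  2: "m2 <= 2 * m" "(tm_step (instr_tm R P) ^^ m2) (a, ts1) = (e, ts2)" "tapes_rel R \<tau> ts2" by auto
 show ?case using 0 1 2 th by (intro exI[of _ ts2] exI[of _ "m2 + Suc m1"])
  (simp del: funpow.simps add: funpow_add funpow_Suc_right list_update_id[of ts "Suc r", unfolded th])
next
 case (runs_IO_Move d s t h)
 have "P ! a = (0, %x. (x, d, e))" using runs_IO_Move.prems(3)[of 0] runs_IO_Move(1) by auto
 hence "tm_step (instr_tm R P) (a, ts) = (e, ts[0 := (t(h := t h), h + d)])"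
  by (intro tm_step_instr) (use runs_IO_Move in "auto simp: tapes_rel_def")
 thus ?case using runs_IO_Move
  by (intro exI[of _ "ts[0 := (t, h + d)]"] exI[of _ 1]) (auto simp: tapes_rel_def)
next
 case (runs_IO_Write y s t h)
 have "P ! a = (0, %x. (y, 0, e))" using runs_IO_Write.prems(3)[of 0] runs_IO_Write(1) by auto
 hence "tm_step (instr_tm R P) (a, ts) = (e, ts[0 := (t(h := y), h + 0)])"
  by (intro tm_step_instr) (use runs_IO_Write in "auto simp: tapes_rel_def")
 thus ?case using runs_IO_Write
  by (intro exI[of _ "ts[0 := (t(h := y), h)]"] exI[of _ 1]) (auto simp: tapes_rel_def)
next
 case (runs_IO_CaseE t h c s n \<tau> c' c'')
 have th: "ts ! 0 = (t, h)" and len: "0 < length ts" using runs_IO_CaseE by (auto simp: tapes_rel_def)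
 have P1: "P ! a = compile (IO_Case c c' c'') a e ! 0" using runs_IO_CaseE.prems(3)[of 0] by simp
 have 1: "tm_step (instr_tm R P) (a, ts) = (a + 1, ts[0 := (t(h := t h), h + 0)])"
  using runs_IO_CaseE P1 len th by (intro tm_step_instr) auto
 have co: "P ! (a + 1 + j) = compile c (a + 1) e ! j" if "j < com_size c" for j
  using runs_IO_CaseE.prems(3)[of "Suc j"] that by (simp add: nth_append)
 from runs_IO_CaseE.IH[OF _ _ co runs_IO_CaseE.prems(4)] runs_IO_CaseE.prems obtain ts' m where
  "m <= 2 * n" "(tm_step (instr_tm R P) ^^ m) (a + 1, ts) = (e, ts')" "tapes_rel R \<tau> ts'" by auto
 thus ?case using 1 th by (intro exI[of _ ts'] exI[of _ "Suc m"])
  (simp del: funpow.simps add: funpow_Suc_right list_update_id[of ts 0, unfolded th])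
next
 case (runs_IO_CaseF t h c' s n \<tau> c c'')
 have th: "ts ! 0 = (t, h)" and len: "0 < length ts" using runs_IO_CaseF by (auto simp: tapes_rel_def)
 have P1: "P ! a = compile (IO_Case c c' c'') a e ! 0" using runs_IO_CaseF.prems(3)[of 0] by simp
 have 1: "tm_step (instr_tm R P) (a, ts) = (a + 1 + com_size c, ts[0 := (t(h := t h), h + 0)])"
  using runs_IO_CaseF P1 len th by (intro tm_step_instr) auto
 have co: "P ! (a + 1 + com_size c + j) = compile c' (a + 1 + com_size c) e ! j" if "j < com_size c'" for j
  using runs_IO_CaseF.prems(3)[of "Suc (com_size c + j)"] that by (simp add: nth_append add.assoc)
 from runs_IO_CaseF.IH[OF _ _ co runs_IO_CaseF.prems(4)] runs_IO_CaseF.prems obtain ts' m where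
  "m <= 2 * n" "(tm_step (instr_tm R P) ^^ m) (a + 1 + com_size c, ts) = (e, ts')" "tapes_rel R \<tau> ts'" by auto
 thus ?case using 1 th by (intro exI[of _ ts'] exI[of _ "Suc m"])
  (simp del: funpow.simps add: funpow_Suc_right list_update_id[of ts 0, unfolded th])
next
 case (runs_IO_CaseT t h c'' s n \<tau> c c')
 have th: "ts ! 0 = (t, h)" and len: "0 < length ts" using runs_IO_CaseT by (auto simp: tapes_rel_def)
 have P1: "P ! a = compile (IO_Case c c' c'') a e ! 0" using runs_IO_CaseT.prems(3)[of 0] by simp
 have 1: "tm_step (instr_tm R P) (a, ts) = (a + 1 + com_size c + com_size c', ts[0 := (t(h := t h), h + 0)])"
  using runs_IO_CaseT P1 len th by (intro tm_step_instr) auto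
 have co: "P ! (a + 1 + com_size c + com_size c' + j) = compile c'' (a + 1 + com_size c + com_size c') e ! j" if "j < com_size c''" for j
  using runs_IO_CaseT.prems(3)[of "Suc (com_size c + com_size c' + j)"] that by (simp add: nth_append add.assoc)
 from runs_IO_CaseT.IH[OF _ _ co runs_IO_CaseT.prems(4)] runs_IO_CaseT.prems obtain ts' m where
  "m <= 2 * n" "(tm_step (instr_tm R P) ^^ m) (a + 1 + com_size c + com_size c', ts) = (e, ts')" "tapes_rel R \<tau> ts'" by auto
 thus ?case using 1 th by (intro exI[of _ ts'] exI[of _ "Suc m"])
  (simp del: funpow.simps add: funpow_Suc_right list_update_id[of ts 0, unfolded th])
next
 case (runs_weaken c \<sigma> n \<tau> m)
 from runs_weaken.IH[OF runs_weaken.prems(1,2) runs_weaken.prems(3,4)] obtain ts' m' where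
  "m' <= 2 * n" "(tm_step (instr_tm R P) ^^ m') (a, ts) = (e, ts')" "tapes_rel R \<tau> ts'" by blast
 thus ?case using runs_weaken(2) by (intro exI[of _ ts'] exI[of _ m']) auto
qed

section \<open>Polynomial bounds\<close>

text \<open>The base is at least 2, so sums and constants are absorbed by a larger exponent.\<close>

definition pbound :: "(nat => nat) => bool" where
 "pbound T \<longleftrightarrow> (\<exists>k. \<forall>n. T n <= (n + 2) ^ k)"

lemma pboundI: "(!!n. T n <= (n + 2) ^ k) ==> pbound T"
 by (auto simp: pbound_def)

lemma pbound_const: "pbound (%n. c)"
proof (rule pboundI)
 fix n :: nat
 have "c <= 2 ^ c" by (rule less_imp_le) (rule less_exp)
 also have "... <= (n + 2) ^ c" by (rule power_mono) auto
 finally show "c <= (n + 2) ^ c" .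
qed

lemma pbound_id: "pbound (%n. n)"
 by (rule pboundI[of _ 1]) simp

lemma pbound_mult:
 assumes "pbound T" "pbound T'"
 shows "pbound (%n. T n * T' n)"
proof -
 obtain k k' where "!!n. T n <= (n + 2) ^ k" "!!n. T' n <= (n + 2) ^ k'" using assms by (auto simp: pbound_def)
 thus ?thesis by (intro pboundI[of _ "k + k'"]) (simp add: power_add mult_mono del: add_2_eq_Suc')
qed

lemma pbound_add:
 assumes "pbound T" "pbound T'"
 shows "pbound (%n. T n + T' n)"
proof -
 obtain k k' where k: "!!n. T n <= (n + 2) ^ k" "!!n. T' n <= (n + 2) ^ k'" using assms by (auto simp: pbound_def)
 show ?thesis
 proof (rule pboundI[of _ "Suc (max k k')"])
  fix n :: nat
  have "T n <= (n + 2) ^ max k k'" "T' n <= (n + 2) ^ max k k'"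
   by (rule order_trans[OF k(1)] order_trans[OF k(2)], rule power_increasing, simp, simp)+
  hence "T n + T' n <= 2 * (n + 2) ^ max k k'" by linarith
  also have "... <= (n + 2) * (n + 2) ^ max k k'" by (rule mult_right_mono) auto
  finally show "T n + T' n <= (n + 2) ^ Suc (max k k')" by simp
 qed
qed

lemma pbound_power: "pbound T ==> pbound (%n. T n ^ k)"
 by (induction k) (auto intro: pbound_mult pbound_const)

lemma pbound_Suc: "pbound T ==> pbound (%n. Suc (T n))"
 using pbound_add[of T "%_. 1"] pbound_const by simp

lemmas pbound_intros = pbound_const pbound_id pbound_mult pbound_add pbound_power pbound_Suc

lemma pbound_poly: "pbound (%n. poly p n)"
 by (induction p) (auto intro!: pbound_intros)

section \<open>Functions computed by commands\<close>

text \<open>A command for base register \<open>b\<close> transforms register \<open>b\<close>, using the higher registers as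
 scratch space that is empty before and after the run.\<close>

definition computes :: "nat => com => (nat => nat) => (bool list => bool list) => bool" where
 "computes b c T f \<longleftrightarrow> (\<forall>s i. (\<forall>r>b. s r = []) --> runs c (s, i) (T (length (s b))) (s(b := f (s b)), i))"

text \<open>One time bound serves all base registers, so that a command can be placed above
  registers that are in use.\<close>

definition pt :: "(bool list => bool list) => bool" where
 "pt f \<longleftrightarrow> (\<exists>T. pbound T & (\<forall>b. \<exists>c. computes b c T f))"

lemma computes_mono: "computes b c T f ==> (!!n. T n <= T' n) ==> computes b c T' f"
 unfolding computes_def by (meson runs_weaken)

lemma ptE:
 assumes "pt f"
 obtains k c where "!!b. computes b (c b) (%n. (n + 2) ^ k) f"
proof -
 obtain T k where "\<forall>n. T n <= (n + 2) ^ k" "\<forall>b. \<exists>c. computes b c T f" using assms by (auto simp: pt_def pbound_def)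
 hence "\<forall>b. \<exists>c. computes b c (%n. (n + 2) ^ k) f" using computes_mono by metis
 thus ?thesis using that by metis
qed

lemma computes_runs:
 assumes "computes b c T f" "!!r. r > b ==> s r = []" "s b = x"
 shows "runs c (s, i) (T (length x)) (s(b := f x), i)"
 using assms(1)[unfolded computes_def, rule_format, of s i] assms(2,3) by simp

lemma computes_length: "computes b c T f ==> length (f x) <= length x + T (length x)"
 using runs_length[of c "((%_. [])(b := x), undefined)" "T (length x)" "((%_. [])(b := x, b := f x), undefined)" b]
  computes_runs[of b c T f "(%_. [])(b := x)" x undefined] by auto

subsection \<open>Basic macros\<close>

lemma runs_convert: "runs c (s', i') n (t', j') ==> s' = s ==> i' = i ==> t' = t ==> j' = j ==> n <= m ==> runs c (s, i) m (t, j)"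
 by (auto intro: runs_weaken)

lemma run_Skip: "t = s ==> 1 <= n ==> runs Skip (s, i) n (t, i)"
 using runs_Skip runs_weaken by blast

lemma run_Push: "t = s(r := b # s r) ==> 1 <= n ==> runs (Push r b) (s, i) n (t, i)"
 using runs_Push runs_weaken by blast

lemma run_Seq: "runs c \<sigma> n \<rho> ==> runs d \<rho> m \<tau> ==> n + m <= k ==> runs (c ;; d) \<sigma> k \<tau>"
 using runs_Seq runs_weaken by blast

lemma run_PopE: "s r = [] ==> runs c (s, i) n \<tau> ==> Suc n <= m ==> runs (Pop r c c0 c1) (s, i) m \<tau>"
 using runs_PopE runs_weaken by blast

lemma run_Pop: "s r = x # xs ==> runs (if x then c1 else c0) (s(r := xs), i) n \<tau> ==> Suc n <= m ==> runs (Pop r c c0 c1) (s, i) m \<tau>"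
 by (cases x) (auto intro: runs_PopT runs_PopF runs_weaken)

lemma run_WhileE: "s r = [] ==> t = s ==> 1 <= n ==> runs (While r c) (s, i) n (t, i)"
 using runs_WhileE runs_weaken by blast

lemma run_WhileC: "s r ~= [] ==> runs c (s, i) n \<rho> ==> runs (While r c) \<rho> m \<tau> ==> Suc (n + m) <= k ==> runs (While r c) (s, i) k \<tau>"
 using runs_WhileC runs_weaken by blast

lemma run_IO_Move: "d : {-1, 0, 1} ==> j = (fst i, snd i + d) ==> 1 <= n ==> runs (IO_Move d) (s, i) n (s, j)"
 using runs_IO_Move[of d s "fst i" "snd i"] runs_weaken by auto

lemma run_IO_Write: "y < 3 ==> j = ((fst i)(snd i := y), snd i) ==> 1 <= n ==> runs (IO_Write y) (s, i) n (s, j)"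
 using runs_IO_Write[of y s "fst i" "snd i"] runs_weaken by auto

text \<open>A loop that consumes register \<open>a\<close>; \<open>S ys zs\<close> is the state when \<open>ys\<close> has been consumed and
 \<open>zs\<close> remains.\<close>

lemma runs_For:
 assumes a: "!!ys zs. ys @ zs = w ==> fst (S ys zs) a = zs"
  and step: "!!ys z zs. ys @ z # zs = w ==>
   runs (if z then c1 else c0) ((fst (S ys (z # zs)))(a := zs), snd (S ys (z # zs))) n (S (ys @ [z]) zs)"
 shows "runs (While a (Pop a Skip c0 c1)) (S [] w) (length w * (n + 2) + 1) (S w [])"
proof -
 have "runs (While a (Pop a Skip c0 c1)) (S ys zs) (length zs * (n + 2) + 1) (S w [])" if "ys @ zs = w" for ys zs
  using that
 proof (induction zs arbitrary: ys)
  case Nil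
  thus ?case using a[of ys "[]"] by (cases "S ys []") (auto intro!: run_WhileE)
 next
  case (Cons z zs)
  obtain s i where S: "S ys (z # zs) = (s, i)" using prod.exhaust by blast
  have sa: "s a = z # zs" using a[OF Cons.prems] S by simp
  have "runs (Pop a Skip c0 c1) (s, i) (Suc n) (S (ys @ [z]) zs)"
   by (rule run_Pop[of s a, OF sa]) (use step[OF Cons.prems] S in auto)
  from runs_WhileC[of s a, OF _ this Cons.IH[of "ys @ [z]"]] Cons.prems sa show ?case
   unfolding S by (auto intro: runs_weaken)
 qed
 from this[of "[]" w] show ?thesis by simp
qed

definition rev_move :: "nat => nat => com" where
 "rev_move a b = While a (Pop a Skip (Push b False) (Push b True))"

lemma runs_rev_move:
 assumes "a ~= b" "t = s(a := [], b := rev (s a) @ s b)" "3 * length (s a) + 1 <= n"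
 shows "runs (rev_move a b) (s, i) n (t, i)"
proof -
 have "runs (rev_move a b) ((%ys zs. (s(a := zs, b := rev ys @ s b), i)) [] (s a)) (length (s a) * (1 + 2) + 1)
   ((%ys zs. (s(a := zs, b := rev ys @ s b), i)) (s a) [])"
  unfolding rev_move_def by (rule runs_For) (use assms(1) in "auto intro!: run_Push simp: fun_eq_iff")
 thus ?thesis by (elim runs_convert) (use assms in "auto simp: fun_eq_iff")
qed

definition clear :: "nat => com" where
 "clear a = While a (Pop a Skip Skip Skip)"

lemma runs_clear:
 assumes "t = s(a := [])" "3 * length (s a) + 1 <= n"
 shows "runs (clear a) (s, i) n (t, i)"
proof -
 have "runs (clear a) ((%ys zs. (s(a := zs), i)) [] (s a)) (length (s a) * (1 + 2) + 1) ((%ys zs. (s(a := zs), i)) (s a) [])"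
  unfolding clear_def by (rule runs_For) (auto intro!: run_Skip simp: fun_eq_iff)
 thus ?thesis by (elim runs_convert) (use assms in "auto simp: fun_eq_iff")
qed

definition move :: "nat => nat => nat => com" where
 "move a b c = rev_move a c ;; rev_move c b"

lemma runs_move:
 assumes "distinct [a, b, c]" "s c = []" "t = s(a := [], b := s a @ s b)" "6 * length (s a) + 2 <= n"
 shows "runs (move a b c) (s, i) n (t, i)"
 unfolding move_def
 by (rule run_Seq[where \<rho> = "(s(a := [], c := rev (s a)), i)" and n = "3 * length (s a) + 1" and m = "3 * length (s a) + 1"];
   (intro runs_rev_move)?) (use assms in "auto simp: fun_eq_iff")

definition rev_dup :: "nat => nat => nat => com" where
 "rev_dup a b c = While a (Pop a Skip (Push b False ;; Push c False) (Push b True ;; Push c True))"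

lemma runs_rev_dup:
 assumes "distinct [a, b, c]" "t = s(a := [], b := rev (s a) @ s b, c := rev (s a) @ s c)" "4 * length (s a) + 1 <= n"
 shows "runs (rev_dup a b c) (s, i) n (t, i)"
proof -
 have step: "runs (Push b z ;; Push c z) (s', i) 2 (t', i)" if "t' = s'(b := z # s' b, c := z # s' c)" for s' t' z
  by (rule run_Seq[where \<rho> = "(s'(b := z # s' b), i)" and n = 1 and m = 1]; (intro run_Push)?) (use that assms(1) in auto)
 have "runs (rev_dup a b c) ((%ys zs. (s(a := zs, b := rev ys @ s b, c := rev ys @ s c), i)) [] (s a)) (length (s a) * (2 + 2) + 1)
   ((%ys zs. (s(a := zs, b := rev ys @ s b, c := rev ys @ s c), i)) (s a) [])"
  unfolding rev_dup_def by (rule runs_For) (use assms(1) in "auto intro!: step simp: fun_eq_iff")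
 thus ?thesis by (elim runs_convert) (use assms in "auto simp: fun_eq_iff")
qed

definition copy :: "nat => nat => nat => com" where
 "copy a b c = rev_move a c ;; rev_dup c a b"

lemma runs_copy:
 assumes "distinct [a, b, c]" "s c = []" "t = s(b := s a @ s b)" "7 * length (s a) + 2 <= n"
 shows "runs (copy a b c) (s, i) n (t, i)"
 unfolding copy_def
 by (rule run_Seq[where \<rho> = "(s(a := [], c := rev (s a)), i)" and n = "3 * length (s a) + 1" and m = "4 * length (s a) + 1"];
   (intro runs_rev_move runs_rev_dup)?) (use assms in "auto simp: fun_eq_iff")

section \<open>Commands give polynomial-time functions\<close>

text \<open>Loops can test registers only, so a flag in register 2 keeps the reading loop alive
  until a blank is met. The second loop undoes the reversal and brings the head back to cell
  0.\<close>

definition io_read :: com where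
 "io_read = Push 2 True ;; While 2 (IO_Case (Pop 2 Skip Skip Skip) (Push 1 False ;; IO_Move 1) (Push 1 True ;; IO_Move 1)) ;;
  While 1 (Pop 1 Skip (Push 0 False ;; IO_Move (-1)) (Push 0 True ;; IO_Move (-1)))"

definition io_write :: com where
 "io_write = While 0 (Pop 0 Skip (IO_Write 1 ;; IO_Move 1) (IO_Write 2 ;; IO_Move 1)) ;; IO_Write 0"

lemma word_tape_nth: "word_tape (ys @ z # zs) (int (length ys)) = letter z"
 by (simp add: word_tape_def)

lemma run_IO_Case: "fst i (snd i) = letter z ==> runs (if z then c1 else c0) (s, i) n \<tau> ==> Suc n <= m ==> runs (IO_Case c c0 c1) (s, i) m \<tau>"
 by (cases i; cases z) (simp_all add: letter_def runs_weaken[OF runs_IO_CaseT] runs_weaken[OF runs_IO_CaseF])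

lemma run_IO_CaseE: "fst i (snd i) = 0 ==> runs c (s, i) n \<tau> ==> Suc n <= m ==> runs (IO_Case c c0 c1) (s, i) m \<tau>"
 by (cases i) (simp add: runs_weaken[OF runs_IO_CaseE])

lemma io_read_loop1:
 assumes "s 2 = [True]" "x = ys @ zs" "t = s(1 := rev zs @ s 1, 2 := [])"
 shows "runs (While 2 (IO_Case (Pop 2 Skip Skip Skip) (Push 1 False ;; IO_Move 1) (Push 1 True ;; IO_Move 1)))
  (s, (word_tape x, int (length ys))) (4 * length zs + 5) (t, (word_tape x, int (length x)))" (is "runs (While 2 ?B) _ _ _")
 using assms
proof (induction zs arbitrary: s ys)
 case Nil
 let ?i = "(word_tape x, int (length ys))"
 have 0: "fst ?i (snd ?i) = 0" using Nil by (simp add: word_tape_def)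
 have "runs (Pop 2 Skip Skip Skip) (s, ?i) 2 (s(2 := []), ?i)"
  by (rule run_Pop[of _ _ True "[]"]) (use Nil in "auto intro!: run_Skip")
 hence B: "runs ?B (s, ?i) 3 (s(2 := []), ?i)" by (rule run_IO_CaseE[OF 0]) simp
 have "runs (While 2 ?B) (s(2 := []), ?i) 1 (s(2 := []), ?i)" by (rule run_WhileE) auto
 hence "runs (While 2 ?B) (s, ?i) 5 (s(2 := []), ?i)" by (intro run_WhileC[OF _ B]) (use Nil in auto)
 thus ?case by (elim runs_convert) (use Nil in "auto simp: fun_eq_iff")
next
 case (Cons z zs)
 let ?i = "(word_tape x, int (length ys))"
 let ?i' = "(word_tape x, int (length (ys @ [z])))"
 let ?s' = "s(1 := z # s 1)"
 have *: "runs (Push 1 z ;; IO_Move 1) (s, ?i) 2 (?s', ?i')"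
  by (rule run_Seq[where \<rho> = "(?s', ?i)" and n = 1 and m = 1]; (intro run_Push run_IO_Move)?) auto
 have B: "runs ?B (s, ?i) 3 (?s', ?i')"
  by (rule run_IO_Case[of _ z]) (use * Cons.prems word_tape_nth[of ys z zs] in auto)
 have "runs (While 2 ?B) (?s', ?i') (4 * length zs + 5) (t, (word_tape x, int (length x)))"
  by (rule Cons.IH) (use Cons.prems in "auto simp: fun_eq_iff")
 thus ?case by (intro run_WhileC[OF _ B]) (use Cons.prems in auto)
qed

lemma runs_io_read:
 "runs io_read (%_. [], (word_tape x, 0)) (8 * length x + 7) ((%_. [])(0 := x), (word_tape x, 0))"
proof -
 let ?S = "%ys zs. ((%_. [])(0 := rev ys, 1 := zs), (word_tape x, int (length zs)))"
 have step: "runs (Push 0 z ;; IO_Move (-1)) (s, (t, h)) 2 (s', (t, h'))" if "s' = s(0 := z # s 0)" "h' = h - 1" for s s' z and t :: "int => nat" and h h'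
  by (rule run_Seq[where \<rho> = "(s', (t, h))" and n = 1 and m = 1]; (intro run_Push run_IO_Move)?) (use that in auto)
 have "runs (While 1 (Pop 1 Skip (Push 0 False ;; IO_Move (-1)) (Push 0 True ;; IO_Move (-1))))
   (?S [] (rev x)) (length (rev x) * (2 + 2) + 1) (?S (rev x) [])"
  by (rule runs_For) (auto intro!: step simp: fun_eq_iff)
 hence 3: "runs (While 1 (Pop 1 Skip (Push 0 False ;; IO_Move (-1)) (Push 0 True ;; IO_Move (-1))))
   ((%_. [])(1 := rev x), (word_tape x, int (length x))) (4 * length x + 1) ((%_. [])(0 := x), (word_tape x, 0))"
  by (elim runs_convert) (auto simp: fun_eq_iff)
 have 2: "runs (While 2 (IO_Case (Pop 2 Skip Skip Skip) (Push 1 False ;; IO_Move 1) (Push 1 True ;; IO_Move 1)))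
   ((%_. [])(2 := [True]), (word_tape x, int (length ([]::bool list)))) (4 * length x + 5) ((%_. [])(1 := rev x), (word_tape x, int (length x)))"
  by (rule io_read_loop1) (auto simp: fun_eq_iff)
 have 1: "runs (Push 2 True) (%_. [], (word_tape x, 0)) 1 ((%_. [])(2 := [True]), (word_tape x, int (length ([]::bool list))))"
  by (rule runs_convert[OF runs_Push]) auto
 from runs_Seq[OF 1 runs_Seq[OF 2 3]] show ?thesis unfolding io_read_def by (rule runs_weaken) simp
qed

definition write_tape :: "(int => nat) => bool list => int => nat" where
 "write_tape t ys j = (if 0 <= j & j < int (length ys) then letter (ys ! nat j) else t j)"

lemma runs_io_write:
 "runs io_write ((%_. [])(0 := y), (t, 0)) (4 * length y + 2) ((%_. []), ((write_tape t y)(int (length y) := 0), int (length y)))"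
proof -
 let ?S = "%ys zs. ((%_. [])(0 := zs), (write_tape t ys, int (length ys)))"
 have wt: "write_tape t (ys @ [z]) = (write_tape t ys)(int (length ys) := letter z)" for ys z
  by (auto simp: write_tape_def fun_eq_iff nth_append)
 have step: "runs (IO_Write (letter z) ;; IO_Move 1) (s, (write_tape t ys, int (length ys))) 2 (s', (write_tape t (ys @ [z]), int (length (ys @ [z]))))"
  if "s' = s" for s s' z ys
  by (rule run_Seq[where \<rho> = "(s, (write_tape t (ys @ [z]), int (length ys)))" and n = 1 and m = 1]; (intro run_IO_Write)?; (unfold \<open>s' = s\<close>, intro run_IO_Move)?)
   (auto simp: wt letter_def)
 have "runs (While 0 (Pop 0 Skip (IO_Write (letter False) ;; IO_Move 1) (IO_Write (letter True) ;; IO_Move 1)))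
   (?S [] y) (length y * (2 + 2) + 1) (?S y [])"
 proof (rule runs_For)
  fix ys z zs
  have "runs (IO_Write (letter z) ;; IO_Move 1) ((fst (?S ys (z # zs)))(0 := zs), snd (?S ys (z # zs))) 2 (?S (ys @ [z]) zs)"
   unfolding fst_conv snd_conv by (rule step) (auto simp: fun_eq_iff)
  thus "runs (if z then IO_Write (letter True) ;; IO_Move 1 else IO_Write (letter False) ;; IO_Move 1)
    ((fst (?S ys (z # zs)))(0 := zs), snd (?S ys (z # zs))) 2 (?S (ys @ [z]) zs)" by (cases z) auto
 qed simp
 hence 1: "runs (While 0 (Pop 0 Skip (IO_Write 1 ;; IO_Move 1) (IO_Write 2 ;; IO_Move 1))) ((%_. [])(0 := y), (t, 0)) (4 * length y + 1)
   ((%_. []), (write_tape t y, int (length y)))"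
  unfolding letter_def by (simp, elim runs_convert) (auto simp: fun_eq_iff write_tape_def)
 show ?thesis unfolding io_write_def
  by (rule run_Seq[OF 1, where m = 1]; (rule run_IO_Write)?) auto
qed

theorem polytime_if_pt:
 assumes "pt f"
 shows "polytime f"
proof -
 obtain k C where C: "!!b. computes b (C b) (%n. (n + 2) ^ k) f" using ptE[OF assms] by metis
 define main where "main = io_read ;; C 0 ;; io_write"
 define R where "R = com_regs main"
 \<comment> \<open>States 0 and 1 are fixed as initial and halting. State 0 jumps to the code at
   state 2, and the code exits to state 1.\<close>
 define P where "P = [(0, %x. (x, 0, 2)), (0, %x. (x, 0, 1))] @ compile main 2 1"
 define T where "T n = (8 * n + 7) + ((n + 2) ^ k + (4 * (n + (n + 2) ^ k) + 2))" for n :: nat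
 have run: "\<exists>t'. runs main (%_. [], (word_tape x, 0)) (T (length x)) ((%_. []), ((write_tape t' (f x))(int (length (f x)) := 0), int (length (f x))))" for x
 proof -
  have "runs (C 0) ((%_. [])(0 := x), (word_tape x, 0)) ((length x + 2) ^ k) (((%_. [])(0 := x))(0 := f x), (word_tape x, 0))"
   by (rule computes_runs[OF C]) auto
  hence "runs (C 0) ((%_. [])(0 := x), (word_tape x, 0)) ((length x + 2) ^ k) ((%_. [])(0 := f x), (word_tape x, 0))"
   by (elim runs_convert) (auto simp: fun_eq_iff)
  note 2 = this runs_io_write[of "f x" "word_tape x"]
  have "length (f x) <= length x + (length x + 2) ^ k" by (rule computes_length[OF C])
  with runs_Seq[OF runs_io_read runs_Seq[OF 2]]
  have "runs main (%_. [], (word_tape x, 0)) (T (length x)) ((%_. []), ((write_tape (word_tape x) (f x))(int (length (f x)) := 0), int (length (f x))))"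
   unfolding main_def T_def by (elim runs_weaken) simp
  thus ?thesis by blast
 qed
 have lenP: "length P = 2 + com_size main" by (simp add: P_def)
 have wf: "tm_wf (instr_tm R P)"
 proof (rule instr_tm_wf)
  have "\<forall>I\<in>set (compile main 2 1). instr_wf R (length P) I"
   by (rule compile_wf) (auto simp: R_def lenP)
  moreover have "0 < com_size main" by (rule com_size_pos)
  ultimately show "\<forall>I\<in>set P. instr_wf R (length P) I" unfolding P_def set_append ball_Un
   by (auto simp: instr_wf_def)
 qed (simp add: lenP)
 have out: "\<exists>n \<le> 2 * T (length x) + 1. tm_outputs ((tm_step (instr_tm R P) ^^ n) (tm_init (instr_tm R P) x)) (f x)" for x
 proof -
  obtain t' where t': "runs main (%_. [], (word_tape x, 0)) (T (length x)) ((%_. []), ((write_tape t' (f x))(int (length (f x)) := 0), int (length (f x))))"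
   using run by blast
  define ts :: "io list" where "ts = (word_tape x, 0) # replicate R (%_. 0, 0)"
  have init: "tm_init (instr_tm R P) x = (0, ts)" by (simp add: tm_init_def instr_tm_def ts_def)
  have rel: "tapes_rel R (%_. [], (word_tape x, 0)) ts" by (simp add: tapes_rel_def ts_def is_stack_def)
  have "tm_step (instr_tm R P) (0, ts) = (2, ts[0 := ((word_tape x)(0 := word_tape x 0), 0 + 0)])"
   by (rule tm_step_instr) (auto simp: P_def ts_def)
  hence 0: "tm_step (instr_tm R P) (0, ts) = (2, ts)" by (simp add: ts_def)
  have "P ! (2 + j) = compile main 2 1 ! j" for j by (simp add: P_def nth_append)
  from runs_compile[OF t' _ _ this rel] obtain ts' m where m: "m <= 2 * T (length x)"
   "(tm_step (instr_tm R P) ^^ m) (2, ts) = (1, ts')"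
   "tapes_rel R ((%_. []), ((write_tape t' (f x))(int (length (f x)) := 0), int (length (f x)))) ts'"
   by (auto simp: R_def)
  have "hd ts' = ts' ! 0" using m(3) by (intro hd_conv_nth) (auto simp: tapes_rel_def)
  hence "tm_outputs (1, ts') (f x)" using m(3) by (auto simp: tm_outputs_def tapes_rel_def Let_def write_tape_def)
  thus ?thesis using m 0 init
   by (intro exI[of _ "Suc m"]) (simp del: funpow.simps add: funpow_Suc_right)
 qed
 have "pbound (%n. 2 * T n + 1)" unfolding T_def by (intro pbound_intros)
 then obtain l where l: "2 * T n + 1 <= (n + 2) ^ l" for n unfolding pbound_def by blast
 \<comment> \<open>\<open>polytime\<close> asks for a polynomial with natural coefficients; this one
   evaluates to \<open>(n + 2) ^ l\<close>.\<close>
 have "poly ([:2, 1:] ^ l) n = (n + 2) ^ l" for n :: nat by (simp add: add.commute)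
 hence "\<exists>n \<le> poly ([:2, 1:] ^ l) (length x). tm_outputs ((tm_step (instr_tm R P) ^^ n) (tm_init (instr_tm R P) x)) (f x)" for x
  using out[of x] l[of "length x"] by (metis le_trans)
 thus ?thesis unfolding polytime_def using wf by blast
qed

section \<open>Simulating Turing machines by commands\<close>

text \<open>A tape symbol is written in unary; a tape is a pair of stacks of symbols, the cells to the left
 of the head and those from the head on, both continued by blanks.\<close>

definition usym :: "nat => bool list" where
 "usym a = replicate a True @ [False]"

definition usyms :: "nat list => bool list" where
 "usyms xs = concat (map usym xs)"

lemma usyms_Nil [simp]: "usyms [] = []" and usyms_Cons [simp]: "usyms (x # xs) = usym x @ usyms xs"
 by (simp_all add: usyms_def)

definition hd0 :: "nat list => nat" where
 "hd0 xs = (case xs of [] => 0 | x # _ => x)"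

definition nth0 :: "nat list => nat => nat" where
 "nth0 xs n = (if n < length xs then xs ! n else 0)"

lemma nth0_0 [simp]: "nth0 xs 0 = hd0 xs" and nth0_Suc: "nth0 xs (Suc n) = nth0 (tl xs) n"
 and nth0_Cons_0: "nth0 (x # xs) 0 = x" and nth0_Cons_Suc: "nth0 (x # xs) (Suc n) = nth0 xs n"
 by (cases xs; simp add: nth0_def hd0_def)+

text \<open>Branches on a unary symbol by nested pops with one continuation per symbol, so the
  finite transition table is unfolded into the program. An empty stack counts as a blank.\<close>

primrec read_sym :: "nat => (nat => com) => nat => nat => com" where
 "read_sym r K 0 j = Skip"
| "read_sym r K (Suc N) j = Pop r (K 0) (K j) (read_sym r K N (Suc j))"

lemma runs_read_sym_aux:
 "s r = usym a @ xs ==> a < N ==> runs (K (j + a)) (s(r := xs), i) n \<tau> ==> runs (read_sym r K N j) (s, i) (n + a + 1) \<tau>"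
proof (induction N arbitrary: s a j)
 case (Suc N)
 show ?case
 proof (cases a)
  case 0
  have "s r = False # xs" using Suc.prems 0 by (simp add: usym_def)
  moreover have "runs (K j) (s(r := xs), i) n \<tau>" using Suc.prems(3) 0 by (simp only: add_0_right)
  ultimately show ?thesis unfolding read_sym.simps
   by (intro run_Pop[of s r False xs, where n = n]) auto
 next
  case (Suc a')
  have s: "s r = True # (usym a' @ xs)" using Suc.prems \<open>a = Suc a'\<close> by (simp add: usym_def)
  have "runs (read_sym r K N (Suc j)) (s(r := usym a' @ xs), i) (n + a' + 1) \<tau>"
  proof (rule Suc.IH)
   show "runs (K (Suc j + a')) ((s(r := usym a' @ xs))(r := xs), i) n \<tau>"
    using Suc.prems(3) \<open>a = Suc a'\<close> by (simp only: fun_upd_upd add_Suc_shift)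
  qed (use Suc.prems \<open>a = Suc a'\<close> in auto)
  thus ?thesis unfolding read_sym.simps
   by (intro run_Pop[of s r, OF s]) (use Suc.prems \<open>a = Suc a'\<close> in auto)
 qed
qed simp

lemma runs_read_sym:
 assumes "s r = usyms xs" "set xs <= {..<N}" "0 < N" "runs (K (hd0 xs)) (s(r := usyms (tl xs)), i) n \<tau>" "n + N + 1 <= m"
 shows "runs (read_sym r K N 0) (s, i) m \<tau>"
proof (cases xs)
 case Nil
 hence "s(r := []) = s" using assms by (auto simp: fun_eq_iff)
 obtain N' where "N = Suc N'" using assms(3) by (cases N) auto
 thus ?thesis using Nil assms \<open>s(r := []) = s\<close> by (auto simp: hd0_def intro!: run_PopE[of s r])
next
 case (Cons a ys)
 have "runs (read_sym r K N 0) (s, i) (n + a + 1) \<tau>"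
  by (rule runs_read_sym_aux) (use assms Cons in "auto simp: hd0_def")
 thus ?thesis by (rule runs_weaken) (use assms Cons in auto)
qed

primrec push_true :: "nat => nat => com" where
 "push_true r 0 = Skip"
| "push_true r (Suc n) = Push r True ;; push_true r n"

lemma runs_push_true: "t = s(r := replicate n True @ s r) ==> n + 1 <= m ==> runs (push_true r n) (s, i) m (t, i)"
proof (induction n arbitrary: s m)
 case (Suc n)
 have "runs (push_true r n) (s(r := True # s r), i) (n + 1) (t, i)"
  by (rule Suc.IH) (use Suc.prems in "auto simp: fun_eq_iff replicate_app_Cons_same")
 thus ?case unfolding push_true.simps
  by (intro run_Seq[where \<rho> = "(s(r := True # s r), i)" and n = 1] run_Push) (use Suc.prems in auto)
qed (auto intro!: run_Skip simp: fun_eq_iff)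

definition write_sym :: "nat => nat => com" where
 "write_sym r a = Push r False ;; push_true r a"

lemma runs_write_sym: "t = s(r := usym a @ s r) ==> a + 2 <= m ==> runs (write_sym r a) (s, i) m (t, i)"
 unfolding write_sym_def
 by (intro run_Seq[where \<rho> = "(s(r := False # s r), i)" and n = 1 and m = "a + 1"] run_Push runs_push_true)
  (auto simp: usym_def fun_eq_iff)

definition tape_rep :: "(int => nat) \<times> int => nat list => nat list => bool" where
 "tape_rep th L R \<longleftrightarrow> (\<forall>n. fst th (snd th + int n) = nth0 R n & fst th (snd th - 1 - int n) = nth0 L n)"

lemma tape_rep_head: "tape_rep th L R ==> hd0 R = fst th (snd th)"
proof -
 assume "tape_rep th L R"
 hence "fst th (snd th + int 0) = nth0 R 0" unfolding tape_rep_def by blast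
 thus ?thesis by simp
qed

lemma tape_rep_stay:
 assumes "tape_rep (t, h) L R"
 shows "tape_rep (t(h := w), h) L (w # tl R)"
 unfolding tape_rep_def
proof
 fix n
 have 1: "t (h + int n) = nth0 R n" and 2: "t (h - 1 - int n) = nth0 L n" using assms by (auto simp: tape_rep_def)
 show "fst (t(h := w), h) (snd (t(h := w), h) + int n) = nth0 (w # tl R) n & fst (t(h := w), h) (snd (t(h := w), h) - 1 - int n) = nth0 L n"
  using 1 2 by (cases n) (auto simp: nth0_Suc nth0_Cons_Suc nth0_Cons_0 hd0_def)
qed

lemma tape_rep_right:
 assumes "tape_rep (t, h) L (w # R)"
 shows "tape_rep (t, h + 1) (w # L) R"
 unfolding tape_rep_def
proof
 fix n
 have 1: "t (h + int (Suc n)) = nth0 (w # R) (Suc n)" using assms by (simp only: tape_rep_def fst_conv snd_conv)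
 have 2: "t (h - 1 - int m) = nth0 L m" for m using assms by (simp only: tape_rep_def fst_conv snd_conv)
 have 3: "t h = w" using tape_rep_head[OF assms] by (simp add: hd0_def)
 have "t (h - int n) = nth0 (w # L) n" using 2[of "n - 1"] 3 by (cases n) (auto simp: nth0_Cons_Suc nth0_Cons_0 hd0_def algebra_simps)
 thus "fst (t, h + 1) (snd (t, h + 1) + int n) = nth0 R n & fst (t, h + 1) (snd (t, h + 1) - 1 - int n) = nth0 (w # L) n"
  using 1 by (simp add: nth0_Cons_Suc algebra_simps)
qed

lemma tape_rep_left:
 assumes "tape_rep (t, h) L R"
 shows "tape_rep (t, h - 1) (tl L) (hd0 L # R)"
 unfolding tape_rep_def
proof
 fix n
 have 1: "t (h + int m) = nth0 R m" for m using assms by (simp only: tape_rep_def fst_conv snd_conv)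
 have 2: "t (h - 1 - int m) = nth0 L m" for m using assms by (simp only: tape_rep_def fst_conv snd_conv)
 have "t (h - 1 + int n) = nth0 (hd0 L # R) n"
  using 1[of "n - 1"] 2[of 0] by (cases n) (auto simp: nth0_Cons_Suc nth0_Cons_0 hd0_def algebra_simps)
 moreover have "t (h - 1 - 1 - int n) = nth0 (tl L) n" using 2[of "Suc n"] by (simp add: nth0_Suc algebra_simps)
 ultimately show "fst (t, h - 1) (snd (t, h - 1) + int n) = nth0 (hd0 L # R) n & fst (t, h - 1) (snd (t, h - 1) - 1 - int n) = nth0 (tl L) n"
  by simp
qed

locale tm_simulation =
 fixes M :: tm and b :: nat
 assumes wf: "tm_wf M"
begin

abbreviation "K \<equiv> tm_tapes M"
abbreviation "N \<equiv> tm_symbols M"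
definition "pos = b + 1"
definition "neg = b + 2"
definition "fl = b + 3"
definition "st = b + 4"
definition "lr j = b + 5 + 2 * j"
definition "rr j = b + 6 + 2 * j"

lemmas reg_defs = pos_def neg_def fl_def st_def lr_def rr_def

lemma reg_simps [simp]:
 "lr j = lr j' \<longleftrightarrow> j = j'" "rr j = rr j' \<longleftrightarrow> j = j'" "lr j ~= rr j'" "rr j' ~= lr j"
 "lr j ~= b" "rr j ~= b" "b ~= lr j" "b ~= rr j" "lr j ~= pos" "rr j ~= pos" "pos ~= lr j" "pos ~= rr j"
 "lr j ~= neg" "rr j ~= neg" "neg ~= lr j" "neg ~= rr j" "lr j ~= fl" "rr j ~= fl" "fl ~= lr j" "fl ~= rr j"
 "lr j ~= st" "rr j ~= st" "st ~= lr j" "st ~= rr j"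
 "pos ~= neg" "neg ~= pos" "pos ~= fl" "fl ~= pos" "pos ~= st" "st ~= pos" "neg ~= fl" "fl ~= neg" "neg ~= st" "st ~= neg"
 "fl ~= st" "st ~= fl" "b ~= pos" "pos ~= b" "b ~= neg" "neg ~= b" "b ~= fl" "fl ~= b" "b ~= st" "st ~= b"
 unfolding reg_defs by presburger+

lemma N3: "3 <= N" and K1: "1 <= K"
 using wf by (auto simp: tm_wf_def)

definition cell :: "store => nat => (int => nat) \<times> int => bool" where
 "cell s j th \<longleftrightarrow> (\<exists>L R. s (lr j) = usyms L & s (rr j) = usyms R & tape_rep th L R & set L <= {..<N} & set R <= {..<N})"

text \<open>The situation between reading and acting: the scanned symbol has been popped from the
  right stack.\<close>

definition pcell :: "store => nat => (int => nat) \<times> int => bool" where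
 "pcell s j th \<longleftrightarrow> (\<exists>L R. s (lr j) = usyms L & s (rr j) = usyms (tl R) & tape_rep th L R & set L <= {..<N} & set R <= {..<N})"

text \<open>The head position of the first tape, in two unary counters. It is needed to find cell 0
  again when the output is read.\<close>

definition posneg :: "store => int => bool" where
 "posneg s h \<longleftrightarrow> (\<exists>p n. s pos = replicate p True & s neg = replicate n True & h = int p - int n)"

lemma cell_cong: "s (lr j) = s' (lr j) ==> s (rr j) = s' (rr j) ==> cell s j th = cell s' j th"
 by (simp add: cell_def)
lemma pcell_cong: "s (lr j) = s' (lr j) ==> s (rr j) = s' (rr j) ==> pcell s j th = pcell s' j th"
 by (simp add: pcell_def)
lemma posneg_cong: "s pos = s' pos ==> s neg = s' neg ==> posneg s h = posneg s' h"
 by (simp add: posneg_def)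

lemma hd0_less: "set R <= {..<N} ==> hd0 R < N"
 using N3 by (cases R) (auto simp: hd0_def)

lemma set_tl_sub: "set R <= A ==> set (tl R) <= A"
 by (cases R) auto

primrec read_all :: "nat list => (nat list => com) => nat list => com" where
 "read_all [] C rs = C rs"
| "read_all (j # js) C rs = read_sym (rr j) (%a. read_all js C (rs @ [a])) N 0"

text \<open>The store after reading is fixed before the time and the result of the continuation are
  known, so that the continuation may be chosen by the scanned symbols.\<close>

lemma runs_read_all:
 "distinct js ==> (!!j. j : set js ==> cell s j (th j)) ==>
 \<exists>s'. (\<forall>j \<in> set js. pcell s' j (th j)) & (\<forall>x. x ~: rr ` set js --> s' x = s x) &
  (\<forall>n \<tau>. runs (C (rs @ map (%j. fst (th j) (snd (th j))) js)) (s', i) n \<tau> -->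
    runs (read_all js C rs) (s, i) (n + length js * (N + 1)) \<tau>)"
proof (induction js arbitrary: s rs)
 case Nil
 thus ?case by (intro exI[of _ s]) (auto simp del: split_paired_All)
next
 case (Cons j js)
 obtain L R where LR: "s (lr j) = usyms L" "s (rr j) = usyms R" "tape_rep (th j) L R" "set L <= {..<N}" "set R <= {..<N}"
  using Cons.prems(2)[of j] by (auto simp: cell_def)
 let ?s1 = "s(rr j := usyms (tl R))"
 have "\<exists>s'. (\<forall>j \<in> set js. pcell s' j (th j)) & (\<forall>x. x ~: rr ` set js --> s' x = ?s1 x) &
  (\<forall>n \<tau>. runs (C ((rs @ [hd0 R]) @ map (%j. fst (th j) (snd (th j))) js)) (s', i) n \<tau> -->
    runs (read_all js C (rs @ [hd0 R])) (?s1, i) (n + length js * (N + 1)) \<tau>)"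
 proof (rule Cons.IH)
  fix k assume k: "k : set js"
  hence "k ~= j" using Cons.prems(1) by auto
  thus "cell ?s1 k (th k)" using Cons.prems(2)[of k] k cell_cong[of ?s1 k s] by auto
 qed (use Cons.prems in auto)
 then obtain s' where s': "\<forall>j \<in> set js. pcell s' j (th j)" "\<forall>x. x ~: rr ` set js --> s' x = ?s1 x"
  "!!n \<tau>. runs (C ((rs @ [hd0 R]) @ map (%j. fst (th j) (snd (th j))) js)) (s', i) n \<tau> ==>
    runs (read_all js C (rs @ [hd0 R])) (?s1, i) (n + length js * (N + 1)) \<tau>" by blast
 have jn: "lr j ~: rr ` set js" "rr j ~: rr ` set js" using Cons.prems(1) by auto
 have "pcell s' j (th j)" unfolding pcell_def using LR s'(2) jn by (intro exI[of _ L] exI[of _ R]) auto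
 moreover have "runs (read_all (j # js) C rs) (s, i) (n + length (j # js) * (N + 1)) \<tau>"
  if "runs (C (rs @ map (%j. fst (th j) (snd (th j))) (j # js))) (s', i) n \<tau>" for n \<tau>
 proof -
  have k: "runs (read_all js C (rs @ [hd0 R])) (?s1, i) (n + length js * (N + 1)) \<tau>"
   by (rule s'(3)) (use that tape_rep_head[OF LR(3)] in simp)
  show ?thesis unfolding read_all.simps
   by (rule runs_read_sym[where s = s and r = "rr j" and xs = R and n = "n + length js * (N + 1)"])
    (use LR N3 k in auto)
 qed
 ultimately show ?case using s'(1,2) by (intro exI[of _ s']) auto
qed

definition move_left :: com where
 "move_left = read_sym (lr 0) (%a. write_sym (rr 0) a) N 0"

definition act :: "nat => nat * int => com" where
 "act j wd = (if snd wd = 0 then write_sym (rr j) (fst wd)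
  else if snd wd = 1 then write_sym (lr j) (fst wd) ;; (if j = 0 then Pop neg (Push pos True) Skip Skip else Skip)
  else write_sym (rr j) (fst wd) ;; read_sym (lr j) (%a. write_sym (rr j) a) N 0 ;;
   (if j = 0 then Pop pos (Push neg True) Skip Skip else Skip))"

lemma posneg_right:
 assumes "posneg s h"
 shows "\<exists>s'. runs (Pop neg (Push pos True) Skip Skip) (s, i) 2 (s', i) & posneg s' (h + 1) & (\<forall>x. x ~: {pos, neg} --> s' x = s x)"
proof -
 obtain p n where pn: "s pos = replicate p True" "s neg = replicate n True" "h = int p - int n" using assms by (auto simp: posneg_def)
 show ?thesis
 proof (cases n)
  case 0
  have "runs (Pop neg (Push pos True) Skip Skip) (s, i) 2 (s(pos := True # s pos), i)"
   by (rule run_PopE[of s neg, where n = 1]) (use pn 0 in "auto intro!: run_Push")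
  moreover have "posneg (s(pos := True # s pos)) (h + 1)" unfolding posneg_def
   using pn 0 by (intro exI[of _ "Suc p"] exI[of _ 0]) auto
  ultimately show ?thesis by (intro exI[of _ "s(pos := True # s pos)"]) auto
 next
  case (Suc m)
  have "runs (Pop neg (Push pos True) Skip Skip) (s, i) 2 (s(neg := replicate m True), i)"
   by (rule run_Pop[of s neg True "replicate m True", where n = 1]) (use pn Suc in "auto intro!: run_Skip")
  moreover have "posneg (s(neg := replicate m True)) (h + 1)" unfolding posneg_def
   using pn Suc by (intro exI[of _ p] exI[of _ m]) auto
  ultimately show ?thesis by (intro exI[of _ "s(neg := replicate m True)"]) auto
 qed
qed

lemma posneg_left:
 assumes "posneg s h"
 shows "\<exists>s'. runs (Pop pos (Push neg True) Skip Skip) (s, i) 2 (s', i) & posneg s' (h - 1) & (\<forall>x. x ~: {pos, neg} --> s' x = s x)"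
proof -
 obtain p n where pn: "s pos = replicate p True" "s neg = replicate n True" "h = int p - int n" using assms by (auto simp: posneg_def)
 show ?thesis
 proof (cases p)
  case 0
  have "runs (Pop pos (Push neg True) Skip Skip) (s, i) 2 (s(neg := True # s neg), i)"
   by (rule run_PopE[of s pos, where n = 1]) (use pn 0 in "auto intro!: run_Push")
  moreover have "posneg (s(neg := True # s neg)) (h - 1)" unfolding posneg_def
   using pn 0 by (intro exI[of _ 0] exI[of _ "Suc n"]) auto
  ultimately show ?thesis by (intro exI[of _ "s(neg := True # s neg)"]) auto
 next
  case (Suc m)
  have "runs (Pop pos (Push neg True) Skip Skip) (s, i) 2 (s(pos := replicate m True), i)"
   by (rule run_Pop[of s pos True "replicate m True", where n = 1]) (use pn Suc in "auto intro!: run_Skip")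
  moreover have "posneg (s(pos := replicate m True)) (h - 1)" unfolding posneg_def
   using pn Suc by (intro exI[of _ m] exI[of _ n]) auto
  ultimately show ?thesis by (intro exI[of _ "s(pos := replicate m True)"]) auto
 qed
qed

lemma runs_act:
 assumes pc: "pcell s j (t, h)" and w: "w < N" and d: "d : {-1, 0, 1}" and pn: "j = 0 ==> posneg s h"
 shows "\<exists>s'. runs (act j (w, d)) (s, i) (4 * N + 10) (s', i) & cell s' j (t(h := w), h + d) &
  (j = 0 --> posneg s' (h + d)) & (\<forall>x. x ~: {lr j, rr j} --> (j = 0 --> x ~: {pos, neg}) --> s' x = s x)"
proof -
 obtain L R where LR: "s (lr j) = usyms L" "s (rr j) = usyms (tl R)" "tape_rep (t, h) L R" "set L <= {..<N}" "set R <= {..<N}"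
  using pc by (auto simp: pcell_def)
 have stay: "tape_rep (t(h := w), h) L (w # tl R)" by (rule tape_rep_stay[OF LR(3)])
 have setR: "set (w # tl R) <= {..<N}" using set_tl_sub[OF LR(5)] w by auto
 consider "d = 0" | "d = 1" | "d = -1" using d by auto
 thus ?thesis
 proof cases
  case 1
  let ?s = "s(rr j := usym w @ s (rr j))"
  have "runs (act j (w, d)) (s, i) (4 * N + 10) (?s, i)" unfolding act_def using 1 w
   by (auto intro!: runs_write_sym)
  moreover have "cell ?s j (t(h := w), h + d)" unfolding cell_def
   using 1 stay LR setR by (intro exI[of _ L] exI[of _ "w # tl R"]) auto
  moreover have "j = 0 --> posneg ?s (h + d)" using pn 1 posneg_cong[of ?s s] by auto
  ultimately show ?thesis by (intro exI[of _ ?s]) auto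
 next
  case 2
  let ?s = "s(lr j := usym w @ s (lr j))"
  have 1: "runs (write_sym (lr j) w) (s, i) (N + 2) (?s, i)" using w by (auto intro!: runs_write_sym)
  have c: "cell ?s j (t(h := w), h + d)" unfolding cell_def
   using 2 tape_rep_right[OF stay] LR setR w by (intro exI[of _ "w # L"] exI[of _ "tl R"]) auto
  show ?thesis
  proof (cases "j = 0")
   case True
   have "posneg ?s h" using pn True posneg_cong[of ?s s] by auto
   from posneg_right[OF this] obtain s' where s': "runs (Pop neg (Push pos True) Skip Skip) (?s, i) 2 (s', i)"
    "posneg s' (h + 1)" "\<forall>x. x ~: {pos, neg} --> s' x = ?s x" by blast
   have "runs (act j (w, d)) (s, i) (4 * N + 10) (s', i)"
    unfolding act_def using 2 True run_Seq[OF 1 s'(1)] by auto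
   moreover have "cell s' j (t(h := w), h + d)" using c s'(3) cell_cong[of s' j ?s] by auto
   ultimately show ?thesis using s' 2 True by (intro exI[of _ s']) auto
  next
   case False
   have "runs (act j (w, d)) (s, i) (4 * N + 10) (?s, i)"
    unfolding act_def using 2 False run_Seq[OF 1 run_Skip[of ?s ?s 1]] by auto
   thus ?thesis using c False by (intro exI[of _ ?s]) auto
  qed
 next
  case 3
  let ?s = "s(rr j := usym w @ s (rr j))"
  let ?s2 = "s(rr j := usym (hd0 L) @ usym w @ s (rr j), lr j := usyms (tl L))"
  have 1: "runs (write_sym (rr j) w) (s, i) (N + 2) (?s, i)" using w by (auto intro!: runs_write_sym)
  have "runs (write_sym (rr j) (hd0 L)) (?s(lr j := usyms (tl L)), i) (N + 2) (?s2, i)"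
   using hd0_less[OF LR(4)] by (intro runs_write_sym) (auto simp: fun_eq_iff)
  hence 2: "runs (read_sym (lr j) (%a. write_sym (rr j) a) N 0) (?s, i) (2 * N + 3) (?s2, i)"
   by (intro runs_read_sym[of _ _ L]) (use LR N3 in auto)
  have c: "cell ?s2 j (t(h := w), h + d)" unfolding cell_def
   using 3 tape_rep_left[OF stay] LR setR w hd0_less[OF LR(4)] set_tl_sub[OF LR(4)]
   by (intro exI[of _ "tl L"] exI[of _ "hd0 L # w # tl R"]) auto
  show ?thesis
  proof (cases "j = 0")
   case True
   have "posneg ?s2 h" using pn True posneg_cong[of ?s2 s] by auto
   from posneg_left[OF this] obtain s' where s': "runs (Pop pos (Push neg True) Skip Skip) (?s2, i) 2 (s', i)"
    "posneg s' (h - 1)" "\<forall>x. x ~: {pos, neg} --> s' x = ?s2 x" by blast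
   have "runs (act j (w, d)) (s, i) (4 * N + 10) (s', i)"
    unfolding act_def using 3 True run_Seq[OF 1 run_Seq[OF 2 s'(1) order_refl]] by auto
   moreover have "cell s' j (t(h := w), h + d)" using c s'(3) cell_cong[of s' j ?s2] by auto
   ultimately show ?thesis using s' 3 True by (intro exI[of _ s']) auto
  next
   case False
   have "runs (act j (w, d)) (s, i) (4 * N + 10) (?s2, i)"
    unfolding act_def using 3 False run_Seq[OF 1 run_Seq[OF 2 run_Skip[of ?s2 ?s2 1] order_refl]] by auto
   thus ?thesis using c False by (intro exI[of _ ?s2]) auto
  qed
 qed
qed

primrec acts :: "(nat * int) list => nat => com" where
 "acts [] j = Skip"
| "acts (wd # wds) j = act j wd ;; acts wds (Suc j)"

lemma runs_acts:
 "set wds <= {..<N} \<times> {-1, 0, 1} ==> (!!l. l < length wds ==> pcell s (j + l) (th (j + l))) ==>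
 (j = 0 ==> wds ~= [] ==> posneg s (snd (th 0))) ==>
 \<exists>s'. runs (acts wds j) (s, i) (length wds * (4 * N + 10) + 1) (s', i) &
  (\<forall>l < length wds. cell s' (j + l) ((fst (th (j + l)))(snd (th (j + l)) := fst (wds ! l)), snd (th (j + l)) + snd (wds ! l))) &
  (j = 0 --> wds ~= [] --> posneg s' (snd (th 0) + snd (wds ! 0))) &
  (\<forall>x. (\<forall>l < length wds. x ~: {lr (j + l), rr (j + l)}) --> (j = 0 --> x ~: {pos, neg}) --> s' x = s x)"
proof (induction wds arbitrary: s j)
 case Nil
 show ?case by (intro exI[of _ s]) (auto intro: run_Skip)
next
 case (Cons wd wds)
 obtain w d where wd: "wd = (w, d)" by force
 have "pcell s j (fst (th j), snd (th j))" using Cons.prems(2)[of 0] by simp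
 from runs_act[OF this, of w d i] obtain s1 where s1: "runs (act j wd) (s, i) (4 * N + 10) (s1, i)"
  "cell s1 j ((fst (th j))(snd (th j) := w), snd (th j) + d)" "j = 0 --> posneg s1 (snd (th j) + d)"
  "\<forall>x. x ~: {lr j, rr j} --> (j = 0 --> x ~: {pos, neg}) --> s1 x = s x"
  using Cons.prems(1,3) wd by auto
 have "pcell s1 (Suc j + l) (th (Suc j + l))" if "l < length wds" for l
  using Cons.prems(2)[of "Suc l"] that pcell_cong[of s1 "Suc j + l" s] s1(4) by auto
 hence "\<exists>s'. runs (acts wds (Suc j)) (s1, i) (length wds * (4 * N + 10) + 1) (s', i) &
  (\<forall>l < length wds. cell s' (Suc j + l) ((fst (th (Suc j + l)))(snd (th (Suc j + l)) := fst (wds ! l)), snd (th (Suc j + l)) + snd (wds ! l))) &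
  (Suc j = 0 --> wds ~= [] --> posneg s' (snd (th 0) + snd (wds ! 0))) &
  (\<forall>x. (\<forall>l < length wds. x ~: {lr (Suc j + l), rr (Suc j + l)}) --> (Suc j = 0 --> x ~: {pos, neg}) --> s' x = s1 x)"
  by (intro Cons.IH) (use Cons.prems(1) in auto)
 then obtain s' where s':
  "runs (acts wds (Suc j)) (s1, i) (length wds * (4 * N + 10) + 1) (s', i)"
  "\<forall>l < length wds. cell s' (Suc j + l) ((fst (th (Suc j + l)))(snd (th (Suc j + l)) := fst (wds ! l)), snd (th (Suc j + l)) + snd (wds ! l))"
  "\<forall>x. (\<forall>l < length wds. x ~: {lr (Suc j + l), rr (Suc j + l)}) --> (Suc j = 0 --> x ~: {pos, neg}) --> s' x = s1 x" by blast
 have eq: "s' (lr j) = s1 (lr j)" "s' (rr j) = s1 (rr j)" "s' pos = s1 pos" "s' neg = s1 neg" using s'(3) by auto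
 show ?case
 proof (intro exI[of _ s'] conjI allI impI)
  show "runs (acts (wd # wds) j) (s, i) (length (wd # wds) * (4 * N + 10) + 1) (s', i)"
   unfolding acts.simps by (rule run_Seq[OF s1(1) s'(1)]) simp
  fix l assume l: "l < length (wd # wds)"
  show "cell s' (j + l) ((fst (th (j + l)))(snd (th (j + l)) := fst ((wd # wds) ! l)), snd (th (j + l)) + snd ((wd # wds) ! l))"
   using l s'(2) s1(2) cell_cong[OF eq(1,2)] wd by (cases l) auto
 next
  assume "j = 0"
  thus "posneg s' (snd (th 0) + snd ((wd # wds) ! 0))" using s1(3) posneg_cong[OF eq(3,4)] wd by auto
 next
  fix x assume x: "\<forall>l < length (wd # wds). x ~: {lr (j + l), rr (j + l)}" "j = 0 --> x ~: {pos, neg}"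
  have "x ~: {lr (Suc j + l), rr (Suc j + l)}" if "l < length wds" for l using x(1)[rule_format, of "Suc l"] that by simp
  hence "s' x = s1 x" using s'(3) by blast
  also have "... = s x" using s1(4) x(1)[rule_format, of 0] x(2) by simp
  finally show "s' x = s x" .
 qed
qed


text \<open>The flag \<open>fl\<close> mirrors the halting state, since a loop can only test a
  register for emptiness. \<open>s0\<close> records the registers outside the simulation, which must
  be preserved.\<close>

definition rep :: "store => store => tm_config => bool" where
 "rep s0 s c \<longleftrightarrow> s st = usym (fst c) & s fl = (if fst c = 1 then [] else [True]) & fst c < tm_states M &
  length (snd c) = K & (\<forall>j < K. cell s j (snd c ! j)) & posneg s (snd (snd c ! 0)) &
  s b = [] & (\<forall>x. x < b | lr K <= x --> s x = s0 x)"

definition step_com :: com where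
 "step_com = read_sym st (%q. read_all [0..<K] (%rs. acts (snd (tm_delta M q rs)) 0 ;;
  write_sym st (fst (tm_delta M q rs)) ;; (if fst (tm_delta M q rs) = 1 then Pop fl Skip Skip Skip else Skip)) []) (tm_states M) 0"

definition step_time :: nat where
 "step_time = K * (4 * N + 10) + K * (N + 1) + 2 * tm_states M + 10"

lemma runs_step:
 assumes r: "rep s0 s (q, ts)" and q: "q ~= 1"
 shows "\<exists>s'. runs step_com (s, i) step_time (s', i) & rep s0 s' (tm_step M (q, ts))"
proof -
 have len: "length ts = K" and qM: "q < tm_states M" and cells: "!!j. j < K ==> cell s j (ts ! j)"
  using r by (auto simp: rep_def)
 define rs where "rs = map (%(t, h). t h) ts"
 obtain q' wds where \<delta>: "tm_delta M q rs = (q', wds)" by force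
 have rs: "rs = map (%j. fst (ts ! j) (snd (ts ! j))) [0..<K]"
  using len by (intro nth_equalityI) (auto simp: rs_def split_beta)
 have "set rs <= {..<N}"
 proof -
  have "fst (ts ! j) (snd (ts ! j)) < N" if j: "j < K" for j
  proof -
   obtain L R where "tape_rep (ts ! j) L R" "set R <= {..<N}" using cells[OF j] by (auto simp: cell_def)
   thus ?thesis using tape_rep_head hd0_less by metis
  qed
  thus ?thesis by (auto simp: rs)
 qed
 moreover have "length rs = K" using len by (simp add: rs_def)
 ultimately have "fst (tm_delta M q rs) < tm_states M & length (snd (tm_delta M q rs)) = K &
   set (snd (tm_delta M q rs)) <= {..<N} \<times> {-1, 0, 1}"
  using wf[unfolded tm_wf_def] qM by blast
 hence d: "q' < tm_states M" "length wds = K" "set wds <= {..<N} \<times> {-1, 0, 1}" by (simp_all only: \<delta> fst_conv snd_conv)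
 define C where "C = (%q rs. acts (snd (tm_delta M q rs)) 0 ;;
  write_sym st (fst (tm_delta M q rs)) ;; (if fst (tm_delta M q rs) = 1 then Pop fl Skip Skip Skip else Skip))"
 define s1 where "s1 = s(st := [])"
 have c1: "cell s1 j (ts ! j)" if "j : set [0..<K]" for j
  using that cells cell_cong[of s1 j s] by (auto simp: s1_def)
 obtain s2 where s2: "\<forall>j \<in> set [0..<K]. pcell s2 j (ts ! j)" "\<forall>x. x ~: rr ` set [0..<K] --> s2 x = s1 x"
  "\<forall>n \<tau>. runs (C q ([] @ map (%j. fst (ts ! j) (snd (ts ! j))) [0..<K])) (s2, i) n \<tau> -->
    runs (read_all [0..<K] (C q) []) (s1, i) (n + length [0..<K] * (N + 1)) \<tau>"
  using runs_read_all[where th = "%j. ts ! j" and C = "C q" and rs = "[]" and i = i, OF distinct_upt c1] by blast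
 have "s2 pos = s pos" "s2 neg = s neg" using s2(2) by (auto simp: s1_def image_iff)
 hence "posneg s2 (snd (ts ! 0))" using r posneg_cong[of s2 s] by (simp add: rep_def)
 hence "\<exists>s'. runs (acts wds 0) (s2, i) (length wds * (4 * N + 10) + 1) (s', i) &
  (\<forall>l < length wds. cell s' (0 + l) ((fst (ts ! (0 + l)))(snd (ts ! (0 + l)) := fst (wds ! l)), snd (ts ! (0 + l)) + snd (wds ! l))) &
  (0 = (0::nat) --> wds ~= [] --> posneg s' (snd (ts ! 0) + snd (wds ! 0))) &
  (\<forall>x. (\<forall>l < length wds. x ~: {lr (0 + l), rr (0 + l)}) --> (0 = (0::nat) --> x ~: {pos, neg}) --> s' x = s2 x)"
  by (intro runs_acts) (use s2(1) d in auto)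
 then obtain s3 where s3: "runs (acts wds 0) (s2, i) (length wds * (4 * N + 10) + 1) (s3, i)"
  "\<forall>l < length wds. cell s3 (0 + l) ((fst (ts ! (0 + l)))(snd (ts ! (0 + l)) := fst (wds ! l)), snd (ts ! (0 + l)) + snd (wds ! l))"
  "wds ~= [] --> posneg s3 (snd (ts ! 0) + snd (wds ! 0))"
  "\<forall>x. (\<forall>l < length wds. x ~: {lr (0 + l), rr (0 + l)}) --> (0 = (0::nat) --> x ~: {pos, neg}) --> s3 x = s2 x" by blast
 define s4 where "s4 = s3(st := usym q')"
 define s5 where "s5 = (if q' = 1 then s4(fl := []) else s4)"
 have far: "s3 x = s x" if "x < b | lr K <= x" "x ~= st" for x
 proof -
  have "x ~: {lr (0 + l), rr (0 + l)}" if "l < length wds" for l using \<open>x < b | lr K <= x\<close> that d(2) by (auto simp: reg_defs)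
  moreover have "x ~: {pos, neg}" using \<open>x < b | lr K <= x\<close> by (auto simp: reg_defs)
  ultimately have "s3 x = s2 x" using s3(4) by blast
  also have "... = s1 x"
  proof -
   have "x ~: rr ` set [0..<K]" using \<open>x < b | lr K <= x\<close> by (auto simp: reg_defs)
   thus ?thesis using s2(2) by blast
  qed
  finally show ?thesis using that(2) by (simp add: s1_def)
 qed
 have near: "s3 x = s x" if "x : {b, fl}" for x
 proof -
  have "s3 x = s2 x" using s3(4) that by auto
  also have "... = s1 x" using s2(2) that by (auto simp: image_iff)
  finally show ?thesis using that by (auto simp: s1_def)
 qed
 have st3: "s3 st = []"
 proof -
  have "s3 st = s2 st" using s3(4) by auto
  also have "... = s1 st" using s2(2) by (auto simp: image_iff)
  finally show ?thesis by (simp add: s1_def)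
 qed
 have w4: "runs (write_sym st q') (s3, i) (tm_states M + 2) (s4, i)"
  by (rule runs_write_sym) (use st3 d in "auto simp: s4_def")
 have w5: "runs (if q' = 1 then Pop fl Skip Skip Skip else Skip) (s4, i) 2 (s5, i)"
 proof (cases "q' = 1")
  case True
  have "s4 fl = [True]" using near[of fl] r q by (auto simp: s4_def rep_def)
  hence "runs (Pop fl Skip Skip Skip) (s4, i) 2 (s4(fl := []), i)"
   by (intro run_Pop[of s4 fl True "[]", where n = 1]) (auto intro!: run_Skip)
  thus ?thesis using True by (simp add: s5_def)
 qed (auto intro!: run_Skip simp: s5_def)
 have "runs (C q rs) (s2, i) ((length wds * (4 * N + 10) + 1) + ((tm_states M + 2) + 2)) (s5, i)"
  unfolding C_def \<delta> fst_conv snd_conv by (intro runs_Seq[OF s3(1)] runs_Seq[OF w4 w5])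
 hence "runs (C q ([] @ map (%j. fst (ts ! j) (snd (ts ! j))) [0..<K])) (s2, i) ((length wds * (4 * N + 10) + 1) + ((tm_states M + 2) + 2)) (s5, i)"
  by (simp only: rs append_Nil)
 from s2(3)[rule_format, OF this] have ra: "runs (read_all [0..<K] (C q) []) (s1, i) (((length wds * (4 * N + 10) + 1) + ((tm_states M + 2) + 2)) + K * (N + 1)) (s5, i)"
  by (simp only: length_upt diff_zero)
 have step_eq: "step_com = read_sym st (%q. read_all [0..<K] (C q) []) (tm_states M) 0"
  by (simp only: step_com_def C_def)
 have "runs step_com (s, i) step_time (s5, i)" unfolding step_eq
 proof (rule runs_read_sym[where xs = "[q]"])
  show "s st = usyms [q]" using r by (simp add: rep_def)
  show "runs (read_all [0..<K] (C (hd0 [q])) []) (s(st := usyms (tl [q])), i) (((length wds * (4 * N + 10) + 1) + ((tm_states M + 2) + 2)) + K * (N + 1)) (s5, i)"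
   using ra by (simp add: hd0_def s1_def)
 qed (use qM d in "auto simp: step_time_def")
 moreover have "rep s0 s5 (tm_step M (q, ts))"
 proof -
  define ts' where "ts' = map2 (%(t, h) (s, d). (t(h := s), h + d)) ts wds"
  have step: "tm_step M (q, ts) = (q', ts')" using q \<delta> by (simp add: tm_step_def ts'_def rs_def)
  have ts': "ts' ! j = ((fst (ts ! j))(snd (ts ! j) := fst (wds ! j)), snd (ts ! j) + snd (wds ! j))" if "j < K" for j
   using that len d(2) by (simp add: ts'_def split_beta)
  have "cell s5 j (ts' ! j)" if j: "j < K" for j
  proof -
   have "cell s3 j (ts' ! j)" using s3(2) j d(2) ts' by simp
   thus ?thesis using cell_cong[of s5 j s3] by (auto simp: s5_def s4_def)
  qed
  moreover have "posneg s5 (snd (ts' ! 0))"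
  proof -
   have "posneg s3 (snd (ts' ! 0))" using s3(3) ts'[of 0] K1 d(2) by auto
   thus ?thesis using posneg_cong[of s5 s3] by (auto simp: s5_def s4_def)
  qed
  moreover have "s5 fl = (if q' = 1 then [] else [True])" using near[of fl] r q by (auto simp: s5_def s4_def rep_def)
  moreover have "s5 x = s0 x" if "x < b | lr K <= x" for x
  proof -
   have "x ~= st" "x ~= fl" using that by (auto simp: reg_defs)
   thus ?thesis using far[OF that] that r by (auto simp: s5_def s4_def rep_def)
  qed
  moreover have "s5 st = usym q'" "s5 b = []" using near[of b] r by (auto simp: s5_def s4_def rep_def)
  moreover have "length ts' = K" using len d(2) by (simp add: ts'_def)
  ultimately show ?thesis unfolding rep_def step using d(1) by simp
 qed
 ultimately show ?thesis by blast
qed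

text \<open>A halted configuration is a fixed point of \<open>tm_step\<close>, so the loop may stop
  before \<open>n\<close> rounds.\<close>

lemma runs_loop:
 "rep s0 s c ==> fst ((tm_step M ^^ n) c) = 1 ==>
 \<exists>s'. runs (While fl step_com) (s, i) (n * (step_time + 1) + 1) (s', i) & rep s0 s' ((tm_step M ^^ n) c)"
proof (induction n arbitrary: s c)
 case 0
 hence "s fl = []" by (simp add: rep_def)
 hence "runs (While fl step_com) (s, i) 1 (s, i)" by (intro run_WhileE) auto
 thus ?case using 0 by (intro exI[of _ s]) simp
next
 case (Suc n)
 show ?case
 proof (cases "fst c = 1")
  case True
  have id: "tm_step M c = c" using True by (cases c) (simp add: tm_step_def)
  hence "(tm_step M ^^ m) c = c" for m by (induction m) auto
  hence it: "(tm_step M ^^ Suc n) c = c" by blast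
  have "s fl = []" using Suc.prems True by (simp add: rep_def)
  hence "runs (While fl step_com) (s, i) (Suc n * (step_time + 1) + 1) (s, i)" by (intro run_WhileE) auto
  thus ?thesis unfolding it using Suc.prems(1) by blast
 next
  case False
  obtain q ts where c: "c = (q, ts)" by force
  obtain s1 where s1: "runs step_com (s, i) step_time (s1, i)" "rep s0 s1 (tm_step M c)"
   using runs_step[of s0 s q ts i] Suc.prems False c by auto
  have it: "(tm_step M ^^ Suc n) c = (tm_step M ^^ n) (tm_step M c)" by (simp add: funpow_swap1)
  obtain s2 where s2: "runs (While fl step_com) (s1, i) (n * (step_time + 1) + 1) (s2, i)" "rep s0 s2 ((tm_step M ^^ n) (tm_step M c))"
   using Suc.IH[OF s1(2)] Suc.prems(2) unfolding it by blast
  have "s fl ~= []" using Suc.prems False by (simp add: rep_def)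
  from run_WhileC[of s fl, OF this s1(1) s2(1)] have "runs (While fl step_com) (s, i) (Suc n * (step_time + 1) + 1) (s2, i)" by simp
  thus ?thesis unfolding it using s2(2) by blast
 qed
qed


definition load_com :: com where
 "load_com = rev_move b pos ;; While pos (Pop pos Skip (write_sym (rr 0) 1) (write_sym (rr 0) 2)) ;; write_sym st 0 ;; Push fl True"

lemma runs_load:
 assumes "!!r. b < r ==> s r = []" "s b = x"
 shows "runs load_com (s, i) (10 * length x + 6) (s(b := [], rr 0 := usyms (map letter x), st := usym 0, fl := [True]), i)"
proof -
 have far: "s pos = []" "s st = []" "s fl = []" "s (rr 0) = []" using assms(1) by (auto simp: reg_defs)
 let ?S = "%ys zs. (s(b := [], pos := zs, rr 0 := usyms (map letter (rev ys))), i)"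
 have 1: "runs (rev_move b pos) (s, i) (3 * length x + 1) (?S [] (rev x))"
  by (rule runs_rev_move) (use far assms in "auto simp: fun_eq_iff")
 have step: "runs (if z then write_sym (rr 0) 2 else write_sym (rr 0) 1) ((fst (?S ys (z # zs)))(pos := zs), snd (?S ys (z # zs))) 4 (?S (ys @ [z]) zs)"
  if "ys @ z # zs = rev x" for ys z zs
 proof -
  have "runs (write_sym (rr 0) (letter z)) ((fst (?S ys (z # zs)))(pos := zs), snd (?S ys (z # zs))) 4 (?S (ys @ [z]) zs)"
   unfolding fst_conv snd_conv by (rule runs_write_sym) (auto simp: letter_def fun_eq_iff)
  thus ?thesis by (cases z) (simp_all only: letter_def if_True if_False)
 qed
 have at: "fst (?S ys zs) pos = zs" if "ys @ zs = rev x" for ys zs by simp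
 have "runs (While pos (Pop pos Skip (write_sym (rr 0) 1) (write_sym (rr 0) 2))) (?S [] (rev x)) (length (rev x) * (4 + 2) + 1) (?S (rev x) [])"
  by (rule runs_For[of "rev x" ?S pos "write_sym (rr 0) 2" "write_sym (rr 0) 1" 4, OF at step])
 hence 2: "runs (While pos (Pop pos Skip (write_sym (rr 0) 1) (write_sym (rr 0) 2))) (?S [] (rev x)) (6 * length x + 1) (?S (rev x) [])"
  by (rule runs_weaken) simp
 have 3: "runs (write_sym st 0) (?S (rev x) []) 2 (s(b := [], rr 0 := usyms (map letter x), st := usym 0), i)"
  by (rule runs_write_sym) (use far in "auto simp: fun_eq_iff")
 have 4: "runs (Push fl True) (s(b := [], rr 0 := usyms (map letter x), st := usym 0), i) 1
   (s(b := [], rr 0 := usyms (map letter x), st := usym 0, fl := [True]), i)"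
  by (rule run_Push) (use far in "auto simp: fun_eq_iff")
 show ?thesis unfolding load_com_def
  by (rule run_Seq[OF 1 run_Seq[OF 2 run_Seq[OF 3 4 order_refl] order_refl]]) simp
qed

lemma rep_init:
 assumes "!!r. b < r ==> s r = []"
 shows "rep s (s(b := [], rr 0 := usyms (map letter x), st := usym 0, fl := [True])) (tm_init M x)"
proof -
 let ?s = "s(b := [], rr 0 := usyms (map letter x), st := usym 0, fl := [True])"
 have far: "s pos = []" "s neg = []" "s (lr j) = []" "s (rr j) = []" for j using assms by (auto simp: reg_defs)
 have c0: "cell ?s 0 (word_tape x, 0)" unfolding cell_def
 proof (rule exI[of _ "[]"], rule exI[of _ "map letter x"], intro conjI)
  show "tape_rep (word_tape x, 0) [] (map letter x)" by (auto simp: tape_rep_def word_tape_def nth0_def)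
  show "set (map letter x) <= {..<N}" using N3 by (auto simp: letter_def)
 qed (use far in auto)
 have cj: "cell ?s (Suc j) (%_. 0, 0)" for j unfolding cell_def
  by (intro exI[of _ "[]"] conjI) (use far in "auto simp: tape_rep_def nth0_def")
 have "cell ?s j (snd (tm_init M x) ! j)" if "j < K" for j
  using c0 cj that by (cases j) (auto simp: tm_init_def)
 moreover have "posneg ?s (snd (snd (tm_init M x) ! 0))"
  unfolding posneg_def using far by (intro exI[of _ 0]) (auto simp: tm_init_def)
 moreover have "?s y = s y" if "y < b | lr K <= y" for y using that K1 by (auto simp: reg_defs)
 moreover have "0 < tm_states M" using wf by (auto simp: tm_wf_def)
 ultimately show ?thesis unfolding rep_def using K1 by (simp add: tm_init_def)
qed

definition move_right :: com where
 "move_right = read_sym (rr 0) (%a. write_sym (lr 0) a) N 0"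

lemma runs_move_left:
 assumes "cell s 0 (t, h)"
 shows "\<exists>s'. runs move_left (s, i) (2 * N + 3) (s', i) & cell s' 0 (t, h - 1) & (\<forall>x. x ~: {lr 0, rr 0} --> s' x = s x)"
proof -
 obtain L R where LR: "s (lr 0) = usyms L" "s (rr 0) = usyms R" "tape_rep (t, h) L R" "set L <= {..<N}" "set R <= {..<N}"
  using assms by (auto simp: cell_def)
 let ?s = "s(lr 0 := usyms (tl L), rr 0 := usym (hd0 L) @ s (rr 0))"
 have "runs (write_sym (rr 0) (hd0 L)) (s(lr 0 := usyms (tl L)), i) (N + 2) (?s, i)"
  using hd0_less[OF LR(4)] by (intro runs_write_sym) (auto simp: fun_eq_iff)
 hence "runs move_left (s, i) (2 * N + 3) (?s, i)" unfolding move_left_def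
  by (intro runs_read_sym[of _ _ L]) (use LR N3 in auto)
 moreover have "cell ?s 0 (t, h - 1)" unfolding cell_def
  using tape_rep_left[OF LR(3)] LR hd0_less[OF LR(4)] set_tl_sub[OF LR(4)]
  by (intro exI[of _ "tl L"] exI[of _ "hd0 L # R"]) auto
 ultimately show ?thesis by (intro exI[of _ ?s]) auto
qed

lemma runs_move_right:
 assumes "cell s 0 (t, h)"
 shows "\<exists>s'. runs move_right (s, i) (2 * N + 3) (s', i) & cell s' 0 (t, h + 1) & (\<forall>x. x ~: {lr 0, rr 0} --> s' x = s x)"
proof -
 obtain L R where LR: "s (lr 0) = usyms L" "s (rr 0) = usyms R" "tape_rep (t, h) L R" "set L <= {..<N}" "set R <= {..<N}"
  using assms by (auto simp: cell_def)
 let ?s = "s(rr 0 := usyms (tl R), lr 0 := usym (hd0 R) @ s (lr 0))"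
 have "runs (write_sym (lr 0) (hd0 R)) (s(rr 0 := usyms (tl R)), i) (N + 2) (?s, i)"
  using hd0_less[OF LR(5)] by (intro runs_write_sym) (auto simp: fun_eq_iff)
 hence "runs move_right (s, i) (2 * N + 3) (?s, i)" unfolding move_right_def
  by (intro runs_read_sym[of _ _ R]) (use LR N3 in auto)
 moreover have "t(h := hd0 R) = t" using tape_rep_head[OF LR(3)] by auto
 hence "tape_rep (t, h + 1) (hd0 R # L) (tl R)"
  using tape_rep_right[OF tape_rep_stay[OF LR(3), of "hd0 R"]] by simp
 hence "cell ?s 0 (t, h + 1)" unfolding cell_def
  using LR hd0_less[OF LR(5)] set_tl_sub[OF LR(5)]
  by (intro exI[of _ "hd0 R # L"] exI[of _ "tl R"]) auto
 ultimately show ?thesis by (intro exI[of _ ?s]) auto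
qed

lemma runs_norm_pos:
 "cell s 0 (t, h) ==> s pos = replicate p True ==>
 \<exists>s'. runs (While pos (Pop pos Skip Skip move_left)) (s, i) (p * (2 * N + 5) + 1) (s', i) & cell s' 0 (t, h - int p) &
  s' pos = [] & (\<forall>x. x ~: {lr 0, rr 0, pos} --> s' x = s x)"
proof (induction p arbitrary: s h)
 case 0
 hence "runs (While pos (Pop pos Skip Skip move_left)) (s, i) 1 (s, i)" by (intro run_WhileE) auto
 thus ?case using 0 by (intro exI[of _ s]) auto
next
 case (Suc p)
 let ?s = "s(pos := replicate p True)"
 have "cell ?s 0 (t, h)" using Suc.prems(1) cell_cong[of ?s 0 s] by auto
 from runs_move_left[OF this] obtain s1 where s1: "runs move_left (?s, i) (2 * N + 3) (s1, i)" "cell s1 0 (t, h - 1)"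
  "\<forall>x. x ~: {lr 0, rr 0} --> s1 x = ?s x" by blast
 have B: "runs (Pop pos Skip Skip move_left) (s, i) (2 * N + 4) (s1, i)"
  by (rule run_Pop[of s pos True "replicate p True"]) (use Suc.prems s1(1) in auto)
 have "s1 pos = replicate p True" using s1(3) by auto
 from Suc.IH[OF s1(2) this] obtain s2 where s2: "runs (While pos (Pop pos Skip Skip move_left)) (s1, i) (p * (2 * N + 5) + 1) (s2, i)"
  "cell s2 0 (t, h - 1 - int p)" "s2 pos = []" "\<forall>x. x ~: {lr 0, rr 0, pos} --> s2 x = s1 x" by blast
 have "runs (While pos (Pop pos Skip Skip move_left)) (s, i) (Suc p * (2 * N + 5) + 1) (s2, i)"
  by (rule run_WhileC[of s pos, OF _ B s2(1)]) (use Suc.prems in auto)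
 thus ?case using s2 s1(3) by (intro exI[of _ s2]) (auto simp: algebra_simps)
qed

lemma runs_norm_neg:
 "cell s 0 (t, h) ==> s neg = replicate p True ==>
 \<exists>s'. runs (While neg (Pop neg Skip Skip move_right)) (s, i) (p * (2 * N + 5) + 1) (s', i) & cell s' 0 (t, h + int p) &
  s' neg = [] & (\<forall>x. x ~: {lr 0, rr 0, neg} --> s' x = s x)"
proof (induction p arbitrary: s h)
 case 0
 hence "runs (While neg (Pop neg Skip Skip move_right)) (s, i) 1 (s, i)" by (intro run_WhileE) auto
 thus ?case using 0 by (intro exI[of _ s]) auto
next
 case (Suc p)
 let ?s = "s(neg := replicate p True)"
 have "cell ?s 0 (t, h)" using Suc.prems(1) cell_cong[of ?s 0 s] by auto
 from runs_move_right[OF this] obtain s1 where s1: "runs move_right (?s, i) (2 * N + 3) (s1, i)" "cell s1 0 (t, h + 1)"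
  "\<forall>x. x ~: {lr 0, rr 0} --> s1 x = ?s x" by blast
 have B: "runs (Pop neg Skip Skip move_right) (s, i) (2 * N + 4) (s1, i)"
  by (rule run_Pop[of s neg True "replicate p True"]) (use Suc.prems s1(1) in auto)
 have "s1 neg = replicate p True" using s1(3) by auto
 from Suc.IH[OF s1(2) this] obtain s2 where s2: "runs (While neg (Pop neg Skip Skip move_right)) (s1, i) (p * (2 * N + 5) + 1) (s2, i)"
  "cell s2 0 (t, h + 1 + int p)" "s2 neg = []" "\<forall>x. x ~: {lr 0, rr 0, neg} --> s2 x = s1 x" by blast
 have "runs (While neg (Pop neg Skip Skip move_right)) (s, i) (Suc p * (2 * N + 5) + 1) (s2, i)"
  by (rule run_WhileC[of s neg, OF _ B s2(1)]) (use Suc.prems in auto)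
 thus ?case using s2 s1(3) by (intro exI[of _ s2]) (auto simp: algebra_simps)
qed

text \<open>Stops at the first non-letter, which is the blank that \<open>tm_outputs\<close>
  requires behind the output. The output comes out reversed.\<close>

definition out_body :: com where
 "out_body = read_sym (rr 0) (%a. if a = 1 then Push b False else if a = 2 then Push b True else Pop fl Skip Skip Skip) N 0"

lemma runs_out:
 "s (rr 0) = usyms R ==> set R <= {..<N} ==> (!!j. j < length y ==> nth0 R j = letter (y ! j)) ==> nth0 R (length y) = 0 ==>
 s fl = [True] ==>
 \<exists>s'. runs (While fl out_body) (s, i) (Suc (length y) * (N + 4) + 1) (s', i) & s' b = rev y @ s b & s' fl = [] &
  (\<forall>x. x ~: {b, fl, rr 0} --> s' x = s x)"
proof (induction y arbitrary: s R)
 case Nil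
 let ?s = "s(rr 0 := usyms (tl R))"
 have "runs (Pop fl Skip Skip Skip) (?s, i) 2 (?s(fl := []), i)"
  by (rule run_Pop[of ?s fl True "[]", where n = 1]) (use Nil in "auto intro!: run_Skip")
 hence B: "runs out_body (s, i) (N + 3) (?s(fl := []), i)" unfolding out_body_def
  by (intro runs_read_sym[of s "rr 0" R N _ i 2]) (use Nil N3 in auto)
 have "runs (While fl out_body) (?s(fl := []), i) 1 (?s(fl := []), i)" by (rule run_WhileE) auto
 hence run: "runs (While fl out_body) (s, i) (Suc (length []) * (N + 4) + 1) (?s(fl := []), i)"
  by (intro run_WhileC[of s fl, OF _ B]) (use Nil in auto)
 show ?case by (rule exI[of _ "?s(fl := [])"], rule conjI, rule run) auto
next
 case (Cons c y)
 let ?s = "s(rr 0 := usyms (tl R), b := c # s b)"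
 have hd: "hd0 R = letter c" using Cons.prems(3)[of 0] by simp
 have "runs (Push b c) (s(rr 0 := usyms (tl R)), i) 2 (?s, i)" by (rule run_Push) (auto simp: fun_eq_iff)
 hence B: "runs out_body (s, i) (N + 3) (?s, i)" unfolding out_body_def
  by (intro runs_read_sym[of s "rr 0" R N _ i 2]) (use Cons.prems N3 hd in "auto simp: letter_def")
 have "\<exists>s'. runs (While fl out_body) (?s, i) (Suc (length y) * (N + 4) + 1) (s', i) & s' b = rev y @ ?s b & s' fl = [] &
  (\<forall>x. x ~: {b, fl, rr 0} --> s' x = ?s x)"
 proof (rule Cons.IH)
  show "nth0 (tl R) j = letter (y ! j)" if "j < length y" for j using Cons.prems(3)[of "Suc j"] that by (simp add: nth0_Suc)
  show "nth0 (tl R) (length y) = 0" using Cons.prems(4) by (simp add: nth0_Suc)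
  show "set (tl R) <= {..<N}" by (rule set_tl_sub[OF Cons.prems(2)])
 qed (use Cons.prems in auto)
 then obtain s' where s': "runs (While fl out_body) (?s, i) (Suc (length y) * (N + 4) + 1) (s', i)" "s' b = rev y @ ?s b" "s' fl = []"
  "\<forall>x. x ~: {b, fl, rr 0} --> s' x = ?s x" by blast
 have "runs (While fl out_body) (s, i) (Suc (length (c # y)) * (N + 4) + 1) (s', i)"
  by (rule run_WhileC[of s fl, OF _ B s'(1)]) (use Cons.prems in auto)
 thus ?case using s' by (intro exI[of _ s']) auto
qed

primrec clear_all :: "nat list => com" where
 "clear_all [] = Skip"
| "clear_all (r # rs) = clear r ;; clear_all rs"

lemma runs_clear_all:
 "(!!r. r : set rs ==> length (s r) <= l) ==> t = (%r. if r : set rs then [] else s r) ==> runs (clear_all rs) (s, i) (length rs * (3 * l + 1) + 1) (t, i)"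
proof (induction rs arbitrary: s)
 case Nil
 thus ?case by (auto intro!: run_Skip)
next
 case (Cons r rs)
 have 1: "runs (clear r) (s, i) (3 * l + 1) (s(r := []), i)" by (rule runs_clear) (use Cons.prems(1)[of r] in auto)
 have 2: "runs (clear_all rs) (s(r := []), i) (length rs * (3 * l + 1) + 1) (t, i)"
  by (rule Cons.IH) (use Cons.prems in "auto simp: fun_eq_iff")
 show ?case unfolding clear_all.simps by (rule run_Seq[OF 1 2]) simp
qed

definition sim_com :: com where
 "sim_com = (load_com ;; While fl step_com ;; While pos (Pop pos Skip Skip move_left) ;; While neg (Pop neg Skip Skip move_right) ;;
  Push fl True ;; While fl out_body) ;; clear_all (st # map lr [0..<K] @ map rr [0..<K]) ;; rev_move b pos ;; rev_move pos neg ;; rev_move neg b"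

text \<open>\<open>A\<close>, \<open>B\<close> and \<open>C\<close> are the times after simulation,
  head return and output. Added to the input length they also bound the registers, by
  \<open>runs_length\<close>. The last summands pay for clearing and for three reversals.\<close>

definition sim_time :: "nat => nat => nat" where
 "sim_time l n = (let A = 10 * l + 6 + (n * (step_time + 1) + 1);
  B = A + 2 * ((l + A) * (2 * N + 5) + 1) + 1;
  C = B + (Suc (l + B) * (N + 4) + 1)
 in C + ((2 * K + 1) * (3 * (l + C) + 1) + 1) + 9 * (l + C) + 3)"


lemma computes_sim:
 assumes f: "!!x. \<exists>n \<le> T (length x). tm_outputs ((tm_step M ^^ n) (tm_init M x)) (f x)"
 shows "computes b sim_com (%l. sim_time l (T l)) f"
 unfolding computes_def
proof (intro allI impI)
 fix s :: store and i :: io assume e: "\<forall>r>b. s r = []"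
 define x where "x = s b"
 obtain n where n: "n <= T (length x)" "tm_outputs ((tm_step M ^^ n) (tm_init M x)) (f x)" using f by blast
 define A where "A = 10 * length x + 6 + (T (length x) * (step_time + 1) + 1)"
 define B where "B = A + 2 * ((length x + A) * (2 * N + 5) + 1) + 1"
 define C where "C = B + (Suc (length x + B) * (N + 4) + 1)"
 have lenx: "length (s r) <= length x" if "b <= r" for r using e that x_def by (cases "r = b") auto
 define s1 where "s1 = s(b := [], rr 0 := usyms (map letter x), st := usym 0, fl := [True])"
 have 1: "runs load_com (s, i) (10 * length x + 6) (s1, i)" unfolding s1_def by (rule runs_load) (use e x_def in auto)
 have "rep s s1 (tm_init M x)" unfolding s1_def by (rule rep_init) (use e in auto)
 moreover have fin: "fst ((tm_step M ^^ n) (tm_init M x)) = 1" using n(2) by (simp add: tm_outputs_def)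
 ultimately obtain s2 where s2: "runs (While fl step_com) (s1, i) (n * (step_time + 1) + 1) (s2, i)" "rep s s2 ((tm_step M ^^ n) (tm_init M x))"
  using runs_loop by blast
 have 2: "runs (While fl step_com) (s1, i) (T (length x) * (step_time + 1) + 1) (s2, i)"
  by (rule runs_weaken[OF s2(1)]) (use mult_le_mono1[OF n(1), of "step_time + 1"] in simp)
 have A2: "runs (load_com ;; While fl step_com) (s, i) A (s2, i)" unfolding A_def by (rule run_Seq[OF 1 2]) simp
 define c where "c = (tm_step M ^^ n) (tm_init M x)"
 obtain t h where th: "snd c ! 0 = (t, h)" by force
 have "\<forall>j<K. cell s2 j (snd c ! j)" using s2(2) unfolding rep_def c_def[symmetric] by blast
 hence cell2: "cell s2 0 (t, h)" using K1 th by (auto dest: spec[of _ 0])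
 have pn: "posneg s2 h" and sb: "s2 b = []" and fl2: "s2 fl = []" and far2: "!!y. y < b | lr K <= y ==> s2 y = s y"
  using s2(2) K1 th fin unfolding rep_def c_def[symmetric] by auto
 have "snd c ~= []" using s2(2) K1 unfolding rep_def c_def[symmetric] by auto
 hence out: "\<forall>j < length (f x). t (int j) = letter (f x ! j)" "t (int (length (f x))) = 0"
  using n(2) th unfolding c_def[symmetric] by (auto simp: tm_outputs_def Let_def hd_conv_nth)
 obtain p q where pq: "s2 pos = replicate p True" "s2 neg = replicate q True" "h = int p - int q" using pn by (auto simp: posneg_def)
 have pqA: "p <= length x + A" "q <= length x + A"
  using runs_length[OF A2, of pos] runs_length[OF A2, of neg] lenx[of pos] lenx[of neg] pq by (auto simp: reg_defs)
 obtain s3 where s3: "runs (While pos (Pop pos Skip Skip move_left)) (s2, i) (p * (2 * N + 5) + 1) (s3, i)" "cell s3 0 (t, h - int p)"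
  "s3 pos = []" "\<forall>x. x ~: {lr 0, rr 0, pos} --> s3 x = s2 x" using runs_norm_pos[OF cell2 pq(1)] by blast
 have "s3 neg = replicate q True" using s3(4) pq(2) by auto
 from runs_norm_neg[OF s3(2) this] obtain s4 where s4: "runs (While neg (Pop neg Skip Skip move_right)) (s3, i) (q * (2 * N + 5) + 1) (s4, i)"
  "cell s4 0 (t, h - int p + int q)" "s4 neg = []" "\<forall>x. x ~: {lr 0, rr 0, neg} --> s4 x = s3 x" by blast
 have fl4: "s4 fl = []" using s4(4) s3(4) fl2 by auto
 define s5 where "s5 = s4(fl := [True])"
 have 5: "runs (Push fl True) (s4, i) 1 (s5, i)" by (rule run_Push) (use fl4 in "auto simp: s5_def")
 have "cell s5 0 (t, 0)" using s4(2) pq(3) cell_cong[of s5 0 s4] by (auto simp: s5_def)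
 then obtain L R where LR: "s5 (rr 0) = usyms R" "tape_rep (t, 0) L R" "set R <= {..<N}" by (auto simp: cell_def)
 have nR: "nth0 R j = t (int j)" for j using LR(2) by (simp add: tape_rep_def)
 have fl5: "s5 fl = [True]" by (simp add: s5_def)
 obtain s6 where s6: "runs (While fl out_body) (s5, i) (Suc (length (f x)) * (N + 4) + 1) (s6, i)" "s6 b = rev (f x) @ s5 b" "s6 fl = []"
  "\<forall>y. y ~: {b, fl, rr 0} --> s6 y = s5 y"
  using runs_out[OF LR(1,3) _ _ fl5, of "f x" i] out nR by auto
 have pre5: "runs (load_com ;; While fl step_com ;; While pos (Pop pos Skip Skip move_left) ;; While neg (Pop neg Skip Skip move_right) ;;
  Push fl True) (s, i) B (s5, i)"
 proof -
  have w3: "runs (While pos (Pop pos Skip Skip move_left)) (s2, i) ((length x + A) * (2 * N + 5) + 1) (s3, i)"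
   by (rule runs_weaken[OF s3(1)]) (use pqA in "auto intro: mult_right_mono")
  have w4: "runs (While neg (Pop neg Skip Skip move_right)) (s3, i) ((length x + A) * (2 * N + 5) + 1) (s4, i)"
   by (rule runs_weaken[OF s4(1)]) (use pqA in "auto intro: mult_right_mono")
  show ?thesis by (rule run_Seq[OF 1 run_Seq[OF 2 run_Seq[OF w3 run_Seq[OF w4 5 order_refl] order_refl] order_refl]])
   (simp add: B_def A_def)
 qed
 have sb5: "s5 b = []" using sb s3(4) s4(4) by (auto simp: s5_def)
 \<comment> \<open>Letters are not blank, so the output lies within the recorded part of the tape,
   whose size is bounded by the running time so far.\<close>
 have "length (f x) <= length R"
 proof (rule ccontr)
  assume "~ ?thesis"
  hence "letter (f x ! length R) = 0" using out(1) nR[of "length R"] by (auto simp: nth0_def)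
  thus False by (simp add: letter_def split: if_splits)
 qed
 also have "length R <= length (usyms R)" by (induction R) (auto simp: usym_def)
 also have "... <= length x + B" using runs_length[OF pre5, of "rr 0"] lenx[of "rr 0"] LR(1) by (simp add: reg_defs)
 finally have fx: "length (f x) <= length x + B" .
 have 6: "runs (While fl out_body) (s5, i) (Suc (length x + B) * (N + 4) + 1) (s6, i)"
  by (rule runs_weaken[OF s6(1)]) (use fx in "auto intro!: mult_right_mono")
 have pre6: "runs (load_com ;; While fl step_com ;; While pos (Pop pos Skip Skip move_left) ;; While neg (Pop neg Skip Skip move_right) ;;
  Push fl True ;; While fl out_body) (s, i) C (s6, i)"
 proof -
  have w3: "runs (While pos (Pop pos Skip Skip move_left)) (s2, i) ((length x + A) * (2 * N + 5) + 1) (s3, i)"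
   by (rule runs_weaken[OF s3(1)]) (use pqA in "auto intro: mult_right_mono")
  have w4: "runs (While neg (Pop neg Skip Skip move_right)) (s3, i) ((length x + A) * (2 * N + 5) + 1) (s4, i)"
   by (rule runs_weaken[OF s4(1)]) (use pqA in "auto intro: mult_right_mono")
  show ?thesis by (rule run_Seq[OF 1 run_Seq[OF 2 run_Seq[OF w3 run_Seq[OF w4 run_Seq[OF 5 6 order_refl] order_refl] order_refl] order_refl]])
   (simp add: C_def B_def A_def)
 qed
 define regs where "regs = st # map lr [0..<K] @ map rr [0..<K]"
 define s7 where "s7 = (%r. if r : set regs then [] else s6 r)"
 have 7: "runs (clear_all regs) (s6, i) (length regs * (3 * (length x + C) + 1) + 1) (s7, i)"
 proof (rule runs_clear_all)
  fix r assume "r : set regs"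
  hence "b <= r" by (auto simp: regs_def reg_defs)
  thus "length (s6 r) <= length x + C" using runs_length[OF pre6, of r] lenx[of r] by simp
 qed (simp add: s7_def)
 have s7: "s7 = s(b := rev (f x))"
 proof
  fix r
  consider "r < b" | "r = b" | "r = pos" | "r = neg" | "r = fl" | "r : set regs" | "lr K <= r"
  proof -
   have "r : set regs" if "b + 4 <= r" "r < lr K"
   proof (cases "r = b + 4")
    case False
    define m where "m = r - (b + 5)"
    have m: "r = b + 5 + m" using that False by (simp add: m_def)
    have "m div 2 < K" using that(2) m by (simp add: lr_def)
    moreover have "r = lr (m div 2) | r = rr (m div 2)" unfolding m reg_defs by presburger
    ultimately show ?thesis by (auto simp: regs_def)
   qed (simp add: regs_def st_def)
   thus ?thesis using that by (fastforce simp: reg_defs)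
  qed
  thus "s7 r = (s(b := rev (f x))) r"
  proof cases
   case 1
   hence "r ~: set regs" "r ~: {b, fl, rr 0}" "r ~: {lr 0, rr 0, neg}" "r ~: {lr 0, rr 0, pos}" by (auto simp: regs_def reg_defs)
   thus ?thesis using 1 s6(4) s4(4) s3(4) far2[of r] by (auto simp: s7_def s5_def)
  next
   case 2
   thus ?thesis using s6(2) sb5 by (auto simp: s7_def regs_def)
  next
   case 3
   hence "s6 r = s4 r" using s6(4) by (auto simp: s5_def)
   also have "... = []" using s4(4) s3(3) 3 by auto
   finally show ?thesis using e 3 by (auto simp: s7_def reg_defs)
  next
   case 4
   hence "s6 r = s4 r" using s6(4) by (auto simp: s5_def)
   also have "... = []" using s4(3) 4 by auto
   finally show ?thesis using e 4 by (auto simp: s7_def reg_defs)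
  next
   case 5
   thus ?thesis using s6(3) e by (auto simp: s7_def reg_defs)
  next
   case 6
   hence "b < r" by (auto simp: regs_def reg_defs)
   thus ?thesis using 6 e by (auto simp: s7_def)
  next
   case 7
   hence "r ~: set regs" "r ~: {b, fl, rr 0}" "r ~: {lr 0, rr 0, neg}" "r ~: {lr 0, rr 0, pos}" "r > b"
    using K1 by (auto simp: regs_def reg_defs)
   thus ?thesis using 7 s6(4) s4(4) s3(4) far2[of r] by (auto simp: s7_def s5_def)
  qed
 qed
 have e': "s pos = []" "s neg = []" using e by (auto simp: reg_defs)
 \<comment> \<open>The output loop has reversed the word, so an odd number of reversals is called
   for; three of them lead back to register \<open>b\<close>.\<close>
 have 8: "runs (rev_move b pos) (s7, i) (3 * length (f x) + 1) (s(b := [], pos := f x), i)"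
  by (rule runs_rev_move) (use e' in "auto simp: s7 fun_eq_iff")
 have 9: "runs (rev_move pos neg) (s(b := [], pos := f x), i) (3 * length (f x) + 1) (s(b := [], neg := rev (f x)), i)"
  by (rule runs_rev_move) (use e' in "auto simp: fun_eq_iff")
 have 10: "runs (rev_move neg b) (s(b := [], neg := rev (f x)), i) (3 * length (f x) + 1) (s(b := f x), i)"
  by (rule runs_rev_move) (use e' in "auto simp: fun_eq_iff")
 have BC: "B <= C" by (simp add: C_def)
 have lr: "length regs = 2 * K + 1" by (simp add: regs_def)
 have time: "sim_time (length x) (T (length x)) = C + ((2 * K + 1) * (3 * (length x + C) + 1) + 1) + 9 * (length x + C) + 3"
  by (simp only: sim_time_def Let_def A_def B_def C_def)
 have le: "C + (length regs * (3 * (length x + C) + 1) + 1 + (3 * length (f x) + 1 + (3 * length (f x) + 1 + (3 * length (f x) + 1))))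
   <= sim_time (length x) (T (length x))"
 proof -
  have "C + (Z + 1 + (3 * length (f x) + 1 + (3 * length (f x) + 1 + (3 * length (f x) + 1)))) <= C + (Z + 1) + 9 * (length x + C) + 3" for Z
   using fx BC by simp
  thus ?thesis unfolding time lr .
 qed
 have "runs sim_com (s, i) (sim_time (length x) (T (length x))) (s(b := f x), i)"
  unfolding sim_com_def regs_def[symmetric]
  by (rule run_Seq[OF pre6 run_Seq[OF 7 run_Seq[OF 8 run_Seq[OF 9 10 order_refl] order_refl] order_refl]]) (rule le)
 thus "runs sim_com (s, i) (sim_time (length (s b)) (T (length (s b)))) (s(b := f (s b)), i)" by (simp only: x_def)
qed

end

text \<open>With \<open>polytime_if_pt\<close> this reduces all questions about polynomial time to
  programs and their combinators.\<close>

theorem pt_if_polytime: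
 assumes "polytime f"
 shows "pt f"
proof -
 obtain M p where M: "tm_wf M" "!!x. \<exists>n \<le> poly p (length x). tm_outputs ((tm_step M ^^ n) (tm_init M x)) (f x)"
  using assms by (auto simp: polytime_def)
 have "\<exists>c. computes b c (%l. tm_simulation.sim_time M l (poly p l)) f" for b
  using tm_simulation.computes_sim[where M = M and b = b and T = "poly p" and f = f] M by (auto simp: tm_simulation_def)
 moreover have "pbound (%l. tm_simulation.sim_time M l (poly p l))"
  unfolding tm_simulation.sim_time_def[OF tm_simulation.intro[OF M(1)]] Let_def by (intro pbound_intros pbound_poly)
 ultimately show ?thesis unfolding pt_def by blast
qed

section \<open>Closure properties of polynomial-time functions\<close>

lemma ptI: "pbound T ==> (!!b. \<exists>c. computes b c T f) ==> pt f"
 by (auto simp: pt_def)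

text \<open>Functions on data are computed on their codes. The bound on the size of the result is
  part of the notion, as it makes compositions polynomial.\<close>

definition pruns :: "('a => bool list) => ('b => bool list) => ('a => 'b) => nat => (nat => com) => bool" where
 "pruns ea eb f k c \<longleftrightarrow> (\<forall>b s i x. (\<forall>r>b. s r = []) --> s b = ea x -->
  runs (c b) (s, i) ((length (ea x) + 2) ^ k) (s(b := eb (f x)), i)) & (\<forall>x. length (eb (f x)) <= (length (ea x) + 2) ^ k)"

text \<open>The behaviour on words that are not code words is left open.\<close>

definition pcr :: "('a => bool list) => ('b => bool list) => ('a => 'b) => bool" where
 "pcr ea eb f \<longleftrightarrow> (\<exists>k c. pruns ea eb f k c)"

lemma pruns_run:
 assumes "pruns ea eb f k c" "!!r. r > b ==> s r = []" "s b = ea x" "t = s(b := eb (f x))" "(length (ea x) + 2) ^ k <= n"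
 shows "runs (c b) (s, i) n (t, i)"
proof -
 have "runs (c b) (s, i) ((length (ea x) + 2) ^ k) (s(b := eb (f x)), i)" using assms(1-3) unfolding pruns_def by blast
 thus ?thesis unfolding assms(4) using assms(5) by (rule runs_weaken)
qed

lemma pruns_length: "pruns ea eb f k c ==> length (eb (f x)) <= (length (ea x) + 2) ^ k"
 unfolding pruns_def by blast

lemma pcrE:
 assumes "pcr ea eb f"
 obtains k c where "pruns ea eb f k c"
 using assms unfolding pcr_def by blast

lemma pcrI:
 assumes T: "pbound T" and c: "!!b. \<exists>c. \<forall>s i x. (\<forall>r>b. s r = []) --> s b = ea x --> runs c (s, i) (T (length (ea x))) (s(b := eb (f x)), i)"
 shows "pcr ea eb f"
proof -
 have "pbound (%n. n + T n)" by (intro pbound_intros T)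
 then obtain k where k: "!!n. n + T n <= (n + 2) ^ k" by (auto simp: pbound_def)
 obtain d where d: "!!b s i x. (\<forall>r>b. s r = []) ==> s b = ea x ==> runs (d b) (s, i) (T (length (ea x))) (s(b := eb (f x)), i)"
  using c by metis
 have "pruns ea eb f k d" unfolding pruns_def
 proof (intro conjI allI impI)
  fix b and s :: store and i :: io and x assume "\<forall>r>b. s r = []" "s b = ea x"
  from d[OF this, of i] show "runs (d b) (s, i) ((length (ea x) + 2) ^ k) (s(b := eb (f x)), i)"
   by (rule runs_weaken) (use k[of "length (ea x)"] in linarith)
 next
  fix x
  have "runs (d 0) ((%_. [])(0 := ea x), undefined) (T (length (ea x))) (((%_. [])(0 := ea x))(0 := eb (f x)), undefined)"
   by (rule d) auto
  from runs_length[OF this, of 0] k[of "length (ea x)"] show "length (eb (f x)) <= (length (ea x) + 2) ^ k" by simp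
 qed
 thus ?thesis by (auto simp: pcr_def)
qed

lemma pcr_if_pt:
 assumes "pt h" "!!x. h (ea x) = eb (f x)"
 shows "pcr ea eb f"
proof -
 obtain k c where c: "!!b. computes b (c b) (%n. (n + 2) ^ k) h" using ptE[OF assms(1)] by metis
 show ?thesis
 proof (rule pcrI)
  show "pbound (%n. (n + 2) ^ k)" by (intro pbound_intros)
  fix b show "\<exists>c. \<forall>s i x. (\<forall>r>b. s r = []) --> s b = ea x --> runs c (s, i) ((length (ea x) + 2) ^ k) (s(b := eb (f x)), i)"
  proof (intro exI[of _ "c b"] allI impI)
   fix s :: store and i :: io and x assume a: "\<forall>r>b. s r = []" "s b = ea x"
   show "runs (c b) (s, i) ((length (ea x) + 2) ^ k) (s(b := eb (f x)), i)"
    using computes_runs[OF c[of b], of s "ea x" i] a assms(2)[of x] by simp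
  qed
 qed
qed

lemma pt_if_pcr:
 assumes "pcr (%x. x) (%x. x) f"
 shows "pt f"
proof -
 obtain k c where "pruns (%x. x) (%x. x) f k c" using pcrE[OF assms] .
 hence "\<forall>b. computes b (c b) (%n. (n + 2) ^ k) f" unfolding pruns_def computes_def by blast
 moreover have "pbound (%n::nat. (n + 2) ^ k)" by (intro pbound_intros)
 ultimately show ?thesis unfolding pt_def by blast
qed

lemma power_pad_mono: "(n::nat) <= m ==> (n + 2) ^ k <= (m + 2) ^ k"
 by (rule power_mono) auto

lemma pt_id: "pt (%x. x)"
 by (rule ptI[OF pbound_const[of 1]]) (auto simp: computes_def intro!: exI[of _ Skip] run_Skip)

lemma pt_Cons: "pt (%x. a # x)"
proof (rule ptI[OF pbound_const[of 1]])
 fix b show "\<exists>c. computes b c (%_. 1) ((#) a)"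
  by (rule exI[of _ "Push b a"]) (auto simp: computes_def intro!: run_Push)
qed

lemma pcr_comp:
 assumes "pcr ea eb f" "pcr eb ec g"
 shows "pcr ea ec (%x. g (f x))"
proof -
 obtain k c where c: "pruns ea eb f k c" using pcrE[OF assms(1)] .
 obtain l d where d: "pruns eb ec g l d" using pcrE[OF assms(2)] .
 show ?thesis
 proof (rule pcrI)
  show "pbound (%n. (n + 2) ^ k + ((n + 2) ^ k + 2) ^ l)" by (intro pbound_intros)
  fix b show "\<exists>e. \<forall>s i x. (\<forall>r>b. s r = []) --> s b = ea x --> runs e (s, i) ((length (ea x) + 2) ^ k + ((length (ea x) + 2) ^ k + 2) ^ l) (s(b := ec (g (f x))), i)"
  proof (intro exI[of _ "c b ;; d b"] allI impI)
   fix s :: store and i :: io and x assume e: "\<forall>r>b. s r = []" "s b = ea x"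
   show "runs (c b ;; d b) (s, i) ((length (ea x) + 2) ^ k + ((length (ea x) + 2) ^ k + 2) ^ l) (s(b := ec (g (f x))), i)"
    by (rule run_Seq[OF pruns_run[OF c, of b s x] pruns_run[OF d, of b "s(b := eb (f x))" "f x"] order_refl])
     (use e power_pad_mono[OF pruns_length[OF c, of x]] in auto)
  qed
 qed
qed

primrec push_word :: "nat => bool list => com" where
 "push_word r [] = Skip"
| "push_word r (a # w) = push_word r w ;; Push r a"

lemma runs_push_word: "t = s(r := w @ s r) ==> length w + 1 <= n ==> runs (push_word r w) (s, i) n (t, i)"
proof (induction w arbitrary: t n)
 case (Cons a w)
 show ?case unfolding push_word.simps
  by (rule run_Seq[OF Cons.IH[OF refl order_refl] run_Push[of _ _ _ _ 1]]) (use Cons.prems in auto)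
qed (auto intro!: run_Skip)

lemma pt_const: "pt (%x. w)"
proof (rule ptI)
 show "pbound (%n. (3 * n + 1) + (length w + 1))" by (intro pbound_intros)
 fix b show "\<exists>c. computes b c (%n. (3 * n + 1) + (length w + 1)) (%x. w)"
 proof (intro exI[of _ "clear b ;; push_word b w"], unfold computes_def, intro allI impI)
  fix s :: store and i :: io
  show "runs (clear b ;; push_word b w) (s, i) ((3 * length (s b) + 1) + (length w + 1)) (s(b := w), i)"
   by (rule run_Seq[OF runs_clear[of "s(b := [])"] runs_push_word order_refl]) auto
 qed
qed

definition enc_prod :: "('a => bool list) => ('b => bool list) => 'a \<times> 'b => bool list" where
 "enc_prod ea eb p = ea (fst p) @ eb (snd p)"

lemma enc_prod_Pair [simp]: "enc_prod ea eb (x, y) = ea x @ eb y"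
 by (simp add: enc_prod_def)

text \<open>The second component is computed first, since stacking the first one on top of it then
  gives the concatenation. The input is always placed above live data, because a command needs the
  higher registers empty.\<close>

lemma pcr_Pair:
 assumes "pcr ea eb f" "pcr ea ec g"
 shows "pcr ea (enc_prod eb ec) (%x. (f x, g x))"
proof -
 obtain k c where c: "pruns ea eb f k c" using pcrE[OF assms(1)] .
 obtain l d where d: "pruns ea ec g l d" using pcrE[OF assms(2)] .
 define T where "T n = (7 * n + 2) + ((n + 2) ^ l + ((6 * n + 2) + ((n + 2) ^ k + ((6 * (n + 2) ^ l + 2) + (6 * (n + 2) ^ k + 2)))))" for n :: nat
 show ?thesis
 proof (rule pcrI)
  show "pbound T" unfolding T_def by (intro pbound_intros)
  fix b
  let ?e = "copy b (b + 1) (b + 2) ;; d (b + 1) ;; move b (b + 2) (b + 3) ;; c (b + 2) ;; move (b + 1) b (b + 3) ;; move (b + 2) b (b + 3)"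
  show "\<exists>e. \<forall>s i x. (\<forall>r>b. s r = []) --> s b = ea x --> runs e (s, i) (T (length (ea x))) (s(b := enc_prod eb ec (f x, g x)), i)"
  proof (intro exI[of _ ?e] allI impI)
   fix s :: store and i :: io and x0 assume e: "\<forall>r>b. s r = []" and sb: "s b = ea x0"
   define x where "x = ea x0"
   have 1: "runs (copy b (b + 1) (b + 2)) (s, i) (7 * length x + 2) (s(b + 1 := x), i)"
    by (rule runs_copy) (use e sb in "auto simp: x_def")
   have 2: "runs (d (b + 1)) (s(b + 1 := x), i) ((length x + 2) ^ l) (s(b + 1 := ec (g x0)), i)"
    by (rule pruns_run[OF d, of _ _ x0]) (use e in "auto simp: x_def")
   have 3: "runs (move b (b + 2) (b + 3)) (s(b + 1 := ec (g x0)), i) (6 * length x + 2) (s(b := [], b + 1 := ec (g x0), b + 2 := x), i)"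
    by (rule runs_move) (use e sb in "auto simp: x_def fun_eq_iff")
   have 4: "runs (c (b + 2)) (s(b := [], b + 1 := ec (g x0), b + 2 := x), i) ((length x + 2) ^ k) (s(b := [], b + 1 := ec (g x0), b + 2 := eb (f x0)), i)"
    by (rule pruns_run[OF c, of _ _ x0]) (use e in "auto simp: x_def")
   have 5: "runs (move (b + 1) b (b + 3)) (s(b := [], b + 1 := ec (g x0), b + 2 := eb (f x0)), i) (6 * (length x + 2) ^ l + 2) (s(b := ec (g x0), b + 2 := eb (f x0)), i)"
    by (rule runs_move) (use e pruns_length[OF d, of x0] in "auto simp: fun_eq_iff x_def")
   have 6: "runs (move (b + 2) b (b + 3)) (s(b := ec (g x0), b + 2 := eb (f x0)), i) (6 * (length x + 2) ^ k + 2) (s(b := enc_prod eb ec (f x0, g x0)), i)"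
    by (rule runs_move) (use e pruns_length[OF c, of x0] in "auto simp: fun_eq_iff x_def")
   from runs_Seq[OF 1 runs_Seq[OF 2 runs_Seq[OF 3 runs_Seq[OF 4 runs_Seq[OF 5 6]]]]]
   show "runs ?e (s, i) (T (length (ea x0))) (s(b := enc_prod eb ec (f x0, g x0)), i)" unfolding T_def x_def .
  qed
 qed
qed

lemma pcr_if:
 assumes "pcr ea (%b. [b]) p" "pcr ea eb f" "pcr ea eb g"
 shows "pcr ea eb (%x. if p x then f x else g x)"
proof -
 obtain j a where a: "pruns ea (%b. [b]) p j a" using pcrE[OF assms(1)] .
 obtain k c where c: "pruns ea eb f k c" using pcrE[OF assms(2)] .
 obtain l d where d: "pruns ea eb g l d" using pcrE[OF assms(3)] .
 define R where "R n = (n + 2) ^ k + (n + 2) ^ l" for n :: nat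
 define T where "T n = (7 * n + 2) + ((n + 2) ^ j + (R n + 2))" for n :: nat
 show ?thesis
 proof (rule pcrI)
  show "pbound T" unfolding T_def R_def numeral_2_eq_2 add_Suc_right add_0_right by (intro pbound_intros)
  fix b
  let ?e = "copy b (b + 1) (b + 2) ;; a (b + 1) ;; Pop (b + 1) Skip (d b) (c b)"
  show "\<exists>e. \<forall>s i x. (\<forall>r>b. s r = []) --> s b = ea x --> runs e (s, i) (T (length (ea x))) (s(b := eb (if p x then f x else g x)), i)"
  proof (intro exI[of _ ?e] allI impI)
   fix s :: store and i :: io and x0 assume e: "\<forall>r>b. s r = []" and sb: "s b = ea x0"
   define x where "x = ea x0"
   have 1: "runs (copy b (b + 1) (b + 2)) (s, i) (7 * length x + 2) (s(b + 1 := x), i)"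
    by (rule runs_copy) (use e sb in "auto simp: x_def")
   have 2: "runs (a (b + 1)) (s(b + 1 := x), i) ((length x + 2) ^ j) (s(b + 1 := [p x0]), i)"
    by (rule pruns_run[OF a, of _ _ x0]) (use e in "auto simp: x_def")
   have F: "runs (d b) (s, i) (R (length x)) (s(b := eb (g x0)), i)"
    by (rule pruns_run[OF d, of _ _ x0]) (use e sb in "auto simp: x_def R_def")
   have C: "runs (c b) (s, i) (R (length x)) (s(b := eb (f x0)), i)"
    by (rule pruns_run[OF c, of _ _ x0]) (use e sb in "auto simp: x_def R_def")
   have s1: "(s(b + 1 := [p x0]))(b + 1 := []) = s" using e by (auto simp: fun_eq_iff)
   have "runs (if p x0 then c b else d b) (s, i) (R (length x)) (s(b := eb (if p x0 then f x0 else g x0)), i)"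
    using F C by (cases "p x0") (simp_all only: if_True if_False)
   hence "runs (if p x0 then c b else d b) ((s(b + 1 := [p x0]))(b + 1 := []), i) (R (length x)) (s(b := eb (if p x0 then f x0 else g x0)), i)"
    unfolding s1 .
   hence 3: "runs (Pop (b + 1) Skip (d b) (c b)) (s(b + 1 := [p x0]), i) (R (length x) + 2) (s(b := eb (if p x0 then f x0 else g x0)), i)"
    by (rule run_Pop[of "s(b + 1 := [p x0])" "b + 1" "p x0" "[]", rotated]) auto
   from runs_Seq[OF 1 runs_Seq[OF 2 3]]
   show "runs ?e (s, i) (T (length (ea x0))) (s(b := eb (if p x0 then f x0 else g x0)), i)" unfolding T_def x_def .
  qed
 qed
qed

lemma pt_tl: "pt tl"
proof (rule ptI[OF pbound_const[of 2]])
 fix b show "\<exists>c. computes b c (%_. 2) tl"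
 proof (intro exI[of _ "Pop b Skip Skip Skip"], unfold computes_def, intro allI impI)
  fix s :: store and i :: io
  show "runs (Pop b Skip Skip Skip) (s, i) 2 (s(b := tl (s b)), i)"
  proof (cases "s b")
   case Nil
   thus ?thesis by (intro run_PopE[where n = 1] run_Skip) (auto simp: fun_eq_iff)
  next
   case (Cons a w)
   thus ?thesis by (intro run_Pop[of s b a w, where n = 1]) (auto intro!: run_Skip)
  qed
 qed
qed

lemma pt_head: "pt (%w. [w ~= [] & hd w])"
proof (rule ptI)
 show "pbound (%n. (3 * n + 1) + 4)" by (intro pbound_intros)
 fix b show "\<exists>c. computes b c (%n. (3 * n + 1) + 4) (%w. [w ~= [] & hd w])"
 proof (intro exI[of _ "Pop b (Push b False) (clear b ;; Push b False) (clear b ;; Push b True)"], unfold computes_def, intro allI impI)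
  fix s :: store and i :: io
  have cp: "runs (clear b ;; Push b v) (s(b := w), i) (3 * length w + 2) (s(b := [v]), i)" for v w
   by (rule run_Seq[OF runs_clear[of "s(b := [])" _ _ "3 * length w + 1"] run_Push[of _ _ _ _ 1]]) auto
  show "runs (Pop b (Push b False) (clear b ;; Push b False) (clear b ;; Push b True)) (s, i) ((3 * length (s b) + 1) + 4) (s(b := [s b ~= [] & hd (s b)]), i)"
  proof (cases "s b")
   case Nil
   thus ?thesis by (intro run_PopE[where n = 1] run_Push) (auto simp: fun_eq_iff)
  next
   case (Cons a w)
   thus ?thesis using cp[of a w] by (intro run_Pop[of s b a w, where n = "3 * length w + 2"]) (cases a; auto)+
  qed
 qed
qed


text \<open>\<open>ea\<close> is self-delimiting: the command splits off the first code word of a stream.\<close>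

definition sd_com :: "('a => bool list) => nat => (nat => com) => bool" where
 "sd_com ea k c \<longleftrightarrow> (\<forall>b s i x y. (\<forall>r>b. s r = []) --> s b = ea x @ y -->
  runs (c b) (s, i) ((length (s b) + 2) ^ k) (s(b := y, Suc b := ea x), i))"

definition sd :: "('a => bool list) => bool" where
 "sd ea \<longleftrightarrow> (\<exists>k c. sd_com ea k c)"

lemma sd_run:
 assumes "sd_com ea k c" "!!r. r > b ==> s r = []" "s b = ea x @ y" "t = s(b := y, Suc b := ea x)" "(length (ea x @ y) + 2) ^ k <= n"
 shows "runs (c b) (s, i) n (t, i)"
proof -
 have "runs (c b) (s, i) ((length (s b) + 2) ^ k) (s(b := y, Suc b := ea x), i)"
  using assms(1)[unfolded sd_com_def, rule_format, of b s x y i] assms(2,3) by blast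
 thus ?thesis unfolding assms(3,4) using assms(5) by (rule runs_weaken)
qed

lemma sdI:
 assumes "pbound T" "!!b. \<exists>c. \<forall>s i x y. (\<forall>r>b. s r = []) --> s b = ea x @ y -->
  runs c (s, i) (T (length (s b))) (s(b := y, Suc b := ea x), i)"
 shows "sd ea"
proof -
 obtain k where k: "!!n. T n <= (n + 2) ^ k" using assms(1) by (auto simp: pbound_def)
 obtain c where c: "!!b s i x y. (\<forall>r>b. s r = []) ==> s b = ea x @ y ==>
  runs (c b) (s, i) (T (length (s b))) (s(b := y, Suc b := ea x), i)" using assms(2) by metis
 have "sd_com ea k c" unfolding sd_com_def
 proof (intro allI impI)
  fix b and s :: store and i :: io and x y assume "\<forall>r>b. s r = []" "s b = ea x @ y"
  from c[OF this, of i] k show "runs (c b) (s, i) ((length (s b) + 2) ^ k) (s(b := y, Suc b := ea x), i)"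
   by (rule runs_weaken)
 qed
 thus ?thesis by (auto simp: sd_def)
qed

lemma enc_list_Nil [simp]: "enc_list f [] = [False]" and enc_list_Cons [simp]: "enc_list f (x # xs) = True # f x @ enc_list f xs"
 by (simp_all add: enc_list_def)

lemma sd_bool: "sd (%b::bool. [b])"
proof (rule sdI[OF pbound_const[of 2]])
 fix b show "\<exists>c. \<forall>s i x y. (\<forall>r>b. s r = []) --> s b = [x] @ y --> runs c (s, i) 2 (s(b := y, Suc b := [x]), i)"
 proof (intro exI[of _ "Pop b Skip (Push (Suc b) False) (Push (Suc b) True)"] allI impI)
  fix s :: store and i :: io and x y assume e: "\<forall>r>b. s r = []" and sb: "s b = [x] @ y"
  have "runs (Push (Suc b) x) (s(b := y), i) 1 (s(b := y, Suc b := [x]), i)" by (rule run_Push) (use e in auto)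
  thus "runs (Pop b Skip (Push (Suc b) False) (Push (Suc b) True)) (s, i) 2 (s(b := y, Suc b := [x]), i)"
   using sb by (intro run_Pop[of s b x y, where n = 1]) (cases x; auto)+
 qed
qed

lemma sd_prod:
 assumes "sd ea" "sd eb"
 shows "sd (enc_prod ea eb)"
proof -
 obtain k c where c: "sd_com ea k c" using assms by (auto simp: sd_def)
 obtain l d where d: "sd_com eb l d" using assms by (auto simp: sd_def)
 define T where "T n = (n + 2) ^ k + ((6 * n + 2) + ((n + 2) ^ l + ((3 * n + 1) + ((6 * n + 2) + ((3 * n + 1) + (6 * n + 2))))))" for n :: nat
 show ?thesis
 proof (rule sdI)
  show "pbound T" unfolding T_def by (intro pbound_intros)
  fix b
  let ?e = "c b ;; move b (b + 2) (b + 3) ;; d (b + 2) ;; rev_move (b + 1) (b + 4) ;; move (b + 3) (b + 1) (b + 5) ;; rev_move (b + 4) (b + 1) ;; move (b + 2) b (b + 3)"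
  show "\<exists>e. \<forall>s i p y. (\<forall>r>b. s r = []) --> s b = enc_prod ea eb p @ y --> runs e (s, i) (T (length (s b))) (s(b := y, Suc b := enc_prod ea eb p), i)"
  proof (intro exI[of _ ?e] allI impI)
   fix s :: store and i :: io and p y assume e: "\<forall>r>b. s r = []" and sb: "s b = enc_prod ea eb p @ y"
   obtain u v where p: "p = (u, v)" by force
   define n where "n = length (s b)"
   have n: "n = length (ea u) + length (eb v) + length y" by (simp add: n_def sb p)
   have 1: "runs (c b) (s, i) ((n + 2) ^ k) (s(b := eb v @ y, Suc b := ea u), i)"
    by (rule sd_run[OF c]) (use e in "auto simp: sb p n add.assoc")
   have 2: "runs (move b (b + 2) (b + 3)) (s(b := eb v @ y, Suc b := ea u), i) (6 * n + 2) (s(b := [], Suc b := ea u, b + 2 := eb v @ y), i)"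
    by (rule runs_move) (use e in "auto simp: n fun_eq_iff")
   have 3: "runs (d (b + 2)) (s(b := [], Suc b := ea u, b + 2 := eb v @ y), i) ((n + 2) ^ l) (s(b := [], Suc b := ea u, b + 2 := y, b + 3 := eb v), i)"
    by (rule sd_run[OF d]) (use e in "auto simp: n fun_eq_iff intro!: power_mono")
   have 4: "runs (rev_move (b + 1) (b + 4)) (s(b := [], Suc b := ea u, b + 2 := y, b + 3 := eb v), i) (3 * n + 1)
     (s(b := [], b + 2 := y, b + 3 := eb v, b + 4 := rev (ea u)), i)"
    by (rule runs_rev_move) (use e in "auto simp: n fun_eq_iff")
   have 5: "runs (move (b + 3) (b + 1) (b + 5)) (s(b := [], b + 2 := y, b + 3 := eb v, b + 4 := rev (ea u)), i) (6 * n + 2)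
     (s(b := [], b + 1 := eb v, b + 2 := y, b + 4 := rev (ea u)), i)"
    by (rule runs_move) (use e in "auto simp: n fun_eq_iff")
   have 6: "runs (rev_move (b + 4) (b + 1)) (s(b := [], b + 1 := eb v, b + 2 := y, b + 4 := rev (ea u)), i) (3 * n + 1)
     (s(b := [], b + 1 := ea u @ eb v, b + 2 := y), i)"
    by (rule runs_rev_move) (use e in "auto simp: n fun_eq_iff")
   have 7: "runs (move (b + 2) b (b + 3)) (s(b := [], b + 1 := ea u @ eb v, b + 2 := y), i) (6 * n + 2) (s(b := y, Suc b := enc_prod ea eb p), i)"
    by (rule runs_move) (use e in "auto simp: n p fun_eq_iff")
   from runs_Seq[OF 1 runs_Seq[OF 2 runs_Seq[OF 3 runs_Seq[OF 4 runs_Seq[OF 5 runs_Seq[OF 6 7]]]]]]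
   show "runs ?e (s, i) (T (length (s b))) (s(b := y, Suc b := enc_prod ea eb p), i)" unfolding T_def n_def .
  qed
 qed
qed

text \<open>Register \<open>b + 1\<close> is the loop flag, cleared when the end marker has been
  copied; register \<open>b\<close> collects the consumed code in reverse.\<close>

lemma sd_list_loop:
 fixes ea :: "'a => bool list"
 assumes c: "sd_com ea k c"
  and e: "!!r. r > b + 2 ==> s r = []" "s (b + 1) = [True]" "s (b + 2) = enc_list ea xs @ y"
  and m: "length (enc_list ea xs @ y) <= m"
  and t: "t = s(b := rev (enc_list ea xs) @ s b, b + 1 := [], b + 2 := y)"
 shows "runs (While (b + 1) (Pop (b + 2) Skip (Push b False ;; Pop (b + 1) Skip Skip Skip) (Push b True ;; c (b + 2) ;; rev_move (b + 3) b)))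
  (s, i) (length (enc_list ea xs) * ((m + 2) ^ k + 3 * m + 9) + 1) (t, i)" (is "runs (While _ ?B) _ _ _")
 using e m t
proof (induction xs arbitrary: s)
 case Nil
 let ?s = "s(b + 2 := y)"
 have 1: "runs (Push b False) (?s, i) 1 (s(b := False # s b, b + 2 := y), i)" by (rule run_Push) (auto simp: fun_eq_iff)
 have "runs (Pop (b + 1) Skip Skip Skip) (s(b := False # s b, b + 2 := y), i) 2 (t, i)"
  by (rule run_Pop[of _ _ True "[]", where n = 1]) (use Nil in "auto intro!: run_Skip simp: fun_eq_iff")
 from runs_Seq[OF 1 this] have "runs (if False then (Push b True ;; c (b + 2) ;; rev_move (b + 3) b) else (Push b False ;; Pop (b + 1) Skip Skip Skip)) (s(b + 2 := y), i) 3 (t, i)" by (simp only: if_False) (erule runs_weaken, simp)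
 hence B: "runs ?B (s, i) 4 (t, i)" by (rule run_Pop[of s "b + 2" False y, rotated]) (use Nil in auto)
 have "runs (While (b + 1) ?B) (t, i) 1 (t, i)" by (rule run_WhileE) (use Nil in auto)
 thus ?case by (rule run_WhileC[of s "b + 1", OF _ B, rotated]) (use Nil(2) in simp_all)
next
 case (Cons x xs)
 define rest where "rest = enc_list ea xs @ y"
 have lens: "length (ea x @ rest) <= m" using Cons.prems(4) by (simp add: rest_def)
 have sb2: "s (b + 2) = True # (ea x @ rest)" using Cons.prems(3) by (simp add: rest_def)
 let ?s0 = "s(b + 2 := ea x @ rest)"
 define s1 where "s1 = s(b := True # s b, b + 2 := ea x @ rest)"
 define s2 where "s2 = s(b := True # s b, b + 2 := rest, b + 3 := ea x)"
 define s3 where "s3 = s(b := rev (ea x) @ True # s b, b + 2 := rest)"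
 have 1: "runs (Push b True) (?s0, i) 1 (s1, i)" by (rule run_Push) (auto simp: s1_def fun_eq_iff)
 have 2: "runs (c (b + 2)) (s1, i) ((m + 2) ^ k) (s2, i)"
 proof (rule sd_run[OF c, where x = x and y = rest])
  show "s1 r = []" if "r > b + 2" for r using Cons.prems(1)[OF that] that by (simp add: s1_def)
  show "(length (ea x @ rest) + 2) ^ k <= (m + 2) ^ k" by (rule power_pad_mono[OF lens])
 qed (auto simp: s1_def s2_def fun_eq_iff)
 have e3: "s (b + 3) = []" by (rule Cons.prems(1)) simp
 have 3: "runs (rev_move (b + 3) b) (s2, i) (3 * m + 1) (s3, i)"
  by (rule runs_rev_move) (use e3 lens in "auto simp: s2_def s3_def fun_eq_iff")
 have "runs (if True then (Push b True ;; c (b + 2) ;; rev_move (b + 3) b) else (Push b False ;; Pop (b + 1) Skip Skip Skip)) (?s0, i) (1 + ((m + 2) ^ k + (3 * m + 1))) (s3, i)"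
  using runs_Seq[OF 1 runs_Seq[OF 2 3]] by simp
 hence B: "runs ?B (s, i) ((m + 2) ^ k + 3 * m + 3) (s3, i)"
  by (rule run_Pop[of s "b + 2" True "ea x @ rest", OF sb2]) simp
 have IH: "runs (While (b + 1) ?B) (s3, i) (length (enc_list ea xs) * ((m + 2) ^ k + 3 * m + 9) + 1) (t, i)"
 proof (rule Cons.IH)
  show "s3 r = []" if "r > b + 2" for r using Cons.prems(1)[OF that] that by (simp add: s3_def)
  show "s3 (b + 1) = [True]" using Cons.prems(2) by (simp add: s3_def)
  show "s3 (b + 2) = enc_list ea xs @ y" by (simp add: s3_def rest_def)
  show "length (enc_list ea xs @ y) <= m" using lens by (simp add: rest_def)
  show "t = s3(b := rev (enc_list ea xs) @ s3 b, b + 1 := [], b + 2 := y)"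
   using Cons.prems(5) by (auto simp: s3_def fun_eq_iff)
 qed
 have len: "Suc (length (enc_list ea xs)) <= length (enc_list ea (x # xs))" by simp
 have aux: "Suc ((q + 3 * m + 3) + (l * (q + 3 * m + 9) + 1)) <= Suc l * (q + 3 * m + 9) + 1" for q l :: nat by simp
 have "Suc (((m + 2) ^ k + 3 * m + 3) + (length (enc_list ea xs) * ((m + 2) ^ k + 3 * m + 9) + 1))
  <= Suc (length (enc_list ea xs)) * ((m + 2) ^ k + 3 * m + 9) + 1" by (rule aux)
 also have "... <= length (enc_list ea (x # xs)) * ((m + 2) ^ k + 3 * m + 9) + 1"
  using mult_le_mono1[OF len] by (intro add_right_mono)
 finally show ?case by (rule run_WhileC[of s "b + 1", OF _ B IH, rotated]) (use Cons.prems(2) in simp)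
qed

lemma sd_list:
 assumes "sd ea"
 shows "sd (enc_list ea)"
proof -
 obtain k c where c: "sd_com ea k c" using assms by (auto simp: sd_def)
 define T where "T n = (6 * n + 2) + (1 + ((n * ((n + 2) ^ k + 3 * n + 9) + 1) + ((3 * n + 1) + (6 * n + 2))))" for n :: nat
 show ?thesis
 proof (rule sdI)
  show "pbound T" unfolding T_def by (intro pbound_intros)
  fix b
  let ?W = "While (b + 1) (Pop (b + 2) Skip (Push b False ;; Pop (b + 1) Skip Skip Skip) (Push b True ;; c (b + 2) ;; rev_move (b + 3) b))"
  let ?e = "move b (b + 2) (b + 3) ;; Push (b + 1) True ;; ?W ;; rev_move b (b + 1) ;; move (b + 2) b (b + 3)"
  show "\<exists>e. \<forall>s i xs y. (\<forall>r>b. s r = []) --> s b = enc_list ea xs @ y --> runs e (s, i) (T (length (s b))) (s(b := y, Suc b := enc_list ea xs), i)"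
  proof (intro exI[of _ ?e] allI impI)
   fix s :: store and i :: io and xs y assume e: "\<forall>r>b. s r = []" and sb: "s b = enc_list ea xs @ y"
   define n where "n = length (s b)"
   define w where "w = enc_list ea xs"
   have n: "n = length w + length y" by (simp add: n_def sb w_def)
   have 1: "runs (move b (b + 2) (b + 3)) (s, i) (6 * n + 2) (s(b := [], b + 2 := w @ y), i)"
    by (rule runs_move) (use e in "auto simp: n_def sb w_def fun_eq_iff")
   have 2: "runs (Push (b + 1) True) (s(b := [], b + 2 := w @ y), i) 1 (s(b := [], b + 1 := [True], b + 2 := w @ y), i)"
    by (rule run_Push) (use e in "auto simp: fun_eq_iff")
   have "runs ?W (s(b := [], b + 1 := [True], b + 2 := w @ y), i) (length (enc_list ea xs) * ((n + 2) ^ k + 3 * n + 9) + 1) (s(b := rev w, b + 2 := y), i)"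
    by (rule sd_list_loop[OF c]) (use e in "auto simp: w_def n fun_eq_iff")
   hence 3: "runs ?W (s(b := [], b + 1 := [True], b + 2 := w @ y), i) (n * ((n + 2) ^ k + 3 * n + 9) + 1) (s(b := rev w, b + 2 := y), i)"
    by (rule runs_weaken) (unfold w_def[symmetric], intro add_right_mono mult_le_mono1, unfold n, rule le_add1)
   have 4: "runs (rev_move b (b + 1)) (s(b := rev w, b + 2 := y), i) (3 * n + 1) (s(b := [], b + 1 := w, b + 2 := y), i)"
    by (rule runs_rev_move) (use e in "auto simp: n fun_eq_iff")
   have 5: "runs (move (b + 2) b (b + 3)) (s(b := [], b + 1 := w, b + 2 := y), i) (6 * n + 2) (s(b := y, Suc b := w), i)"
    by (rule runs_move) (use e in "auto simp: n fun_eq_iff")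
   from runs_Seq[OF 1 runs_Seq[OF 2 runs_Seq[OF 3 runs_Seq[OF 4 5]]]]
   show "runs ?e (s, i) (T (length (s b))) (s(b := y, Suc b := enc_list ea xs), i)" unfolding T_def n_def w_def .
  qed
 qed
qed

lemma pcr_fst:
 assumes "sd ea"
 shows "pcr (enc_prod ea eb) ea fst"
proof -
 obtain k c where c: "sd_com ea k c" using assms by (auto simp: sd_def)
 define T where "T n = (n + 2) ^ k + ((3 * n + 1) + (6 * n + 2))" for n :: nat
 show ?thesis
 proof (rule pcrI)
  show "pbound T" unfolding T_def by (intro pbound_intros)
  fix b
  let ?e = "c b ;; clear b ;; move (b + 1) b (b + 2)"
  show "\<exists>e. \<forall>s i p. (\<forall>r>b. s r = []) --> s b = enc_prod ea eb p --> runs e (s, i) (T (length (enc_prod ea eb p))) (s(b := ea (fst p)), i)"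
  proof (intro exI[of _ ?e] allI impI)
   fix s :: store and i :: io and p assume e: "\<forall>r>b. s r = []" and sb: "s b = enc_prod ea eb p"
   obtain u v where p: "p = (u, v)" by force
   define n where "n = length (enc_prod ea eb p)"
   have n: "n = length (ea u @ eb v)" by (simp add: n_def p)
   have 1: "runs (c b) (s, i) ((n + 2) ^ k) (s(b := eb v, Suc b := ea u), i)"
    by (rule sd_run[OF c]) (use e in "auto simp: sb p n")
   have 2: "runs (clear b) (s(b := eb v, Suc b := ea u), i) (3 * n + 1) (s(b := [], Suc b := ea u), i)"
    by (rule runs_clear) (use e in "auto simp: n fun_eq_iff")
   have 3: "runs (move (b + 1) b (b + 2)) (s(b := [], Suc b := ea u), i) (6 * n + 2) (s(b := ea (fst p)), i)"
    by (rule runs_move) (use e in "auto simp: n p fun_eq_iff")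
   from runs_Seq[OF 1 runs_Seq[OF 2 3]]
   show "runs ?e (s, i) (T (length (enc_prod ea eb p))) (s(b := ea (fst p)), i)" unfolding T_def n_def .
  qed
 qed
qed

lemma pcr_snd:
 assumes "sd ea"
 shows "pcr (enc_prod ea eb) eb snd"
proof -
 obtain k c where c: "sd_com ea k c" using assms by (auto simp: sd_def)
 define T where "T n = (n + 2) ^ k + (3 * n + 1)" for n :: nat
 show ?thesis
 proof (rule pcrI)
  show "pbound T" unfolding T_def by (intro pbound_intros)
  fix b
  let ?e = "c b ;; clear (b + 1)"
  show "\<exists>e. \<forall>s i p. (\<forall>r>b. s r = []) --> s b = enc_prod ea eb p --> runs e (s, i) (T (length (enc_prod ea eb p))) (s(b := eb (snd p)), i)"
  proof (intro exI[of _ ?e] allI impI)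
   fix s :: store and i :: io and p assume e: "\<forall>r>b. s r = []" and sb: "s b = enc_prod ea eb p"
   obtain u v where p: "p = (u, v)" by force
   define n where "n = length (enc_prod ea eb p)"
   have n: "n = length (ea u @ eb v)" by (simp add: n_def p)
   have 1: "runs (c b) (s, i) ((n + 2) ^ k) (s(b := eb v, Suc b := ea u), i)"
    by (rule sd_run[OF c]) (use e in "auto simp: sb p n")
   have 2: "runs (clear (b + 1)) (s(b := eb v, Suc b := ea u), i) (3 * n + 1) (s(b := eb (snd p)), i)"
    by (rule runs_clear) (use e in "auto simp: n p fun_eq_iff")
   from runs_Seq[OF 1 2]
   show "runs ?e (s, i) (T (length (enc_prod ea eb p))) (s(b := eb (snd p)), i)" unfolding T_def n_def .
  qed
 qed
qed

lemma pt_enc_word: "pt enc_word"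
proof (rule ptI)
 show "pbound (%n. (3 * n + 1) + (1 + (4 * n + 1)))" by (intro pbound_intros)
 fix b
 let ?W = "While (b + 1) (Pop (b + 1) Skip (Push b False ;; Push b True) (Push b True ;; Push b True))"
 show "\<exists>c. computes b c (%n. (3 * n + 1) + (1 + (4 * n + 1))) enc_word"
 proof (intro exI[of _ "rev_move b (b + 1) ;; Push b False ;; ?W"], unfold computes_def, intro allI impI)
  fix s :: store and i :: io assume e: "\<forall>r>b. s r = []"
  define x where "x = s b"
  have 1: "runs (rev_move b (b + 1)) (s, i) (3 * length x + 1) (s(b := [], b + 1 := rev x), i)"
   by (rule runs_rev_move) (use e in "auto simp: x_def")
  have 2: "runs (Push b False) (s(b := [], b + 1 := rev x), i) 1 (s(b := [False], b + 1 := rev x), i)"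
   by (rule run_Push) (auto simp: fun_eq_iff)
  have step: "runs (Push b z ;; Push b True) (s', i) 2 (t', i)" if "t' = s'(b := True # z # s' b)" for s' t' z
   by (rule run_Seq[where \<rho> = "(s'(b := z # s' b), i)" and n = 1 and m = 1]; (intro run_Push)?) (use that in auto)
  let ?S = "%ys zs. (s(b := enc_word (rev ys), b + 1 := zs), i)"
  have "runs ?W (?S [] (rev x)) (length (rev x) * (2 + 2) + 1) (?S (rev x) [])"
  proof (rule runs_For)
   fix ys z zs
   have "runs (Push b z ;; Push b True) ((fst (?S ys (z # zs)))(b + 1 := zs), snd (?S ys (z # zs))) 2 (?S (ys @ [z]) zs)"
    unfolding snd_conv by (rule step) (auto simp: fun_eq_iff enc_word_def)
   thus "runs (if z then Push b True ;; Push b True else Push b False ;; Push b True) ((fst (?S ys (z # zs)))(b + 1 := zs), snd (?S ys (z # zs))) 2 (?S (ys @ [z]) zs)"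
    by (cases z) (simp_all only: if_True if_False)
  qed simp
  hence 3: "runs ?W (s(b := [False], b + 1 := rev x), i) (4 * length x + 1) (s(b := enc_word x), i)"
   by (elim runs_convert) (use e in "auto simp: fun_eq_iff enc_word_def")
  from runs_Seq[OF 1 runs_Seq[OF 2 3]]
  show "runs (rev_move b (b + 1) ;; Push b False ;; ?W) (s, i) ((3 * length (s b) + 1) + (1 + (4 * length (s b) + 1))) (s(b := enc_word (s b)), i)"
   unfolding x_def .
 qed
qed

lemma length_le_enc_list: "length xs <= length (enc_list ea xs)"
 by (induction xs) auto

lemma fold_loop:
 fixes ea :: "'a => bool list"
 assumes c: "sd_com ea k c" and d: "pruns (enc_prod ea es) es (%(x, st). f x st) l d"
  and e: "!!r. r > b + 2 ==> s r = []" "s b = es st" "s (b + 1) = [True]" "s (b + 2) = enc_list ea xs"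
  and m: "length (enc_list ea xs) <= m" and M: "!!ys zs. xs = ys @ zs ==> length (es (fold f ys st)) <= M"
  and t: "t = s(b := es (fold f xs st), b + 1 := [], b + 2 := [])"
  and Q: "Q = (m + 2) ^ k + ((6 * M + 2) + ((6 * m + 2) + ((m + M + 2) ^ l + (6 * M + 2))))"
 shows "runs (While (b + 1) (Pop (b + 2) Skip (Pop (b + 1) Skip Skip Skip)
   (c (b + 2) ;; move b (b + 4) (b + 5) ;; move (b + 3) (b + 4) (b + 5) ;; d (b + 4) ;; move (b + 4) b (b + 5))))
  (s, i) (length xs * (Q + 3) + 5) (t, i)" (is "runs (While _ ?B) _ _ _")
 using e m M t
proof (induction xs arbitrary: s st)
 case Nil
 have "runs (Pop (b + 1) Skip Skip Skip) (s(b + 2 := []), i) 2 (t, i)"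
  by (rule run_Pop[of _ _ True "[]", where n = 1]) (use Nil in "auto intro!: run_Skip simp: fun_eq_iff")
 hence B: "runs ?B (s, i) 3 (t, i)"
  by (intro run_Pop[of s "b + 2" False "[]", where n = 2]) (use Nil(4) in "simp_all only: if_False enc_list_Nil")
 have "runs (While (b + 1) ?B) (t, i) 1 (t, i)" by (rule run_WhileE) (use Nil in auto)
 thus ?case by (rule run_WhileC[of s "b + 1", OF _ B, rotated]) (use Nil(3) in simp_all)
next
 case (Cons x xs)
 define rest where "rest = enc_list ea xs"
 have lens: "length (ea x @ rest) <= m" using Cons.prems(5) by (simp add: rest_def)
 have M0: "length (es st) <= M" using Cons.prems(6)[of "[]"] by simp
 have M1: "length (es (f x st)) <= M" using Cons.prems(6)[of "[x]" xs] by simp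
 have sb2: "s (b + 2) = True # (ea x @ rest)" using Cons.prems(4) by (simp add: rest_def)
 have emp: "s (b + 3) = []" "s (b + 4) = []" "s (b + 5) = []" by (rule Cons.prems(1), simp)+
 define s1 where "s1 = s(b + 2 := ea x @ rest)"
 define s2 where "s2 = s(b + 2 := rest, b + 3 := ea x)"
 define s3 where "s3 = s(b := [], b + 2 := rest, b + 3 := ea x, b + 4 := es st)"
 define s4 where "s4 = s(b := [], b + 2 := rest, b + 4 := ea x @ es st)"
 define s5 where "s5 = s(b := [], b + 2 := rest, b + 4 := es (f x st))"
 define s6 where "s6 = s(b := es (f x st), b + 2 := rest)"
 have 1: "runs (c (b + 2)) (s1, i) ((m + 2) ^ k) (s2, i)"
 proof (rule sd_run[OF c, where x = x and y = rest])
  show "s1 r = []" if "r > b + 2" for r using Cons.prems(1)[OF that] that by (simp add: s1_def)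
  show "(length (ea x @ rest) + 2) ^ k <= (m + 2) ^ k" by (rule power_pad_mono[OF lens])
 qed (auto simp: s1_def s2_def fun_eq_iff)
 have 2: "runs (move b (b + 4) (b + 5)) (s2, i) (6 * M + 2) (s3, i)"
  by (rule runs_move) (use emp M0 Cons.prems(2) in "auto simp: s2_def s3_def fun_eq_iff")
 have 3: "runs (move (b + 3) (b + 4) (b + 5)) (s3, i) (6 * m + 2) (s4, i)"
  by (rule runs_move) (use emp lens in "auto simp: s3_def s4_def fun_eq_iff")
 have 4: "runs (d (b + 4)) (s4, i) ((m + M + 2) ^ l) (s5, i)"
 proof (rule pruns_run[OF d, where x = "(x, st)"])
  show "s4 r = []" if "r > b + 4" for r using Cons.prems(1)[of r] that by (simp add: s4_def)
  have "length (enc_prod ea es (x, st)) <= m + M" using lens M0 by simp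
  from power_pad_mono[OF this] show "(length (enc_prod ea es (x, st)) + 2) ^ l <= (m + M + 2) ^ l" .
 qed (auto simp: s4_def s5_def fun_eq_iff)
 have 5: "runs (move (b + 4) b (b + 5)) (s5, i) (6 * M + 2) (s6, i)"
  by (rule runs_move) (use emp M1 in "auto simp: s5_def s6_def fun_eq_iff")
 have "runs (if True then (c (b + 2) ;; move b (b + 4) (b + 5) ;; move (b + 3) (b + 4) (b + 5) ;; d (b + 4) ;; move (b + 4) b (b + 5)) else Pop (b + 1) Skip Skip Skip) (s(b + 2 := ea x @ rest), i) Q (s6, i)"
  using runs_Seq[OF 1 runs_Seq[OF 2 runs_Seq[OF 3 runs_Seq[OF 4 5]]]] unfolding Q s1_def if_True .
 hence B: "runs ?B (s, i) (Suc Q) (s6, i)"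
  by (rule run_Pop[of s "b + 2" True "ea x @ rest", OF sb2]) simp
 have IH: "runs (While (b + 1) ?B) (s6, i) (length xs * (Q + 3) + 5) (t, i)"
 proof (rule Cons.IH)
  show "s6 r = []" if "r > b + 2" for r using Cons.prems(1)[OF that] that by (simp add: s6_def)
  show "s6 b = es (f x st)" by (simp add: s6_def)
  show "s6 (b + 1) = [True]" using Cons.prems(3) by (simp add: s6_def)
  show "s6 (b + 2) = enc_list ea xs" by (simp add: s6_def rest_def)
  show "length (enc_list ea xs) <= m" using lens by (simp add: rest_def)
  show "length (es (fold f ys (f x st))) <= M" if "xs = ys @ zs" for ys zs using Cons.prems(6)[of "x # ys" zs] that by simp
  show "t = s6(b := es (fold f xs (f x st)), b + 1 := [], b + 2 := [])" using Cons.prems(7) by (auto simp: s6_def fun_eq_iff)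
 qed
 have "Suc (Suc Q + (length xs * (Q + 3) + 5)) <= length (x # xs) * (Q + 3) + 5" by simp
 thus ?case by (rule run_WhileC[of s "b + 1", OF _ B IH, rotated]) (use Cons.prems(3) in simp)
qed

text \<open>The size bound is assumed for all lists and thus covers all prefixes. A polynomial step
  alone could double the state in every round.\<close>

lemma pcr_fold:
 fixes ea :: "'a => bool list"
 assumes "sd ea" "pcr (enc_prod ea es) es (%(x, st). f x st)"
  and bound: "!!xs st. length (es (fold f xs st)) <= (length (enc_list ea xs) + length (es st) + 2) ^ K"
 shows "pcr (enc_prod (enc_list ea) es) es (%(xs, st). fold f xs st)"
proof -
 obtain k c where c: "sd_com ea k c" using assms by (auto simp: sd_def)
 obtain q a where a: "sd_com (enc_list ea) q a" using sd_list[OF assms(1)] by (auto simp: sd_def)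
 obtain l d where d: "pruns (enc_prod ea es) es (%(x, st). f x st) l d" using pcrE[OF assms(2)] .
 define Q where "Q n = (n + 2) ^ k + ((6 * (n + 2) ^ K + 2) + ((6 * n + 2) + ((n + (n + 2) ^ K + 2) ^ l + (6 * (n + 2) ^ K + 2))))" for n :: nat
 define T where "T n = (n + 2) ^ q + ((6 * n + 2) + (1 + (n * (Q n + 3) + 5)))" for n :: nat
 show ?thesis
 proof (rule pcrI)
  show "pbound T" unfolding T_def Q_def by (intro pbound_intros)
  fix b
  let ?W = "While (b + 1) (Pop (b + 2) Skip (Pop (b + 1) Skip Skip Skip)
   (c (b + 2) ;; move b (b + 4) (b + 5) ;; move (b + 3) (b + 4) (b + 5) ;; d (b + 4) ;; move (b + 4) b (b + 5)))"
  let ?e = "a b ;; move (b + 1) (b + 2) (b + 3) ;; Push (b + 1) True ;; ?W"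
  show "\<exists>e. \<forall>s i p. (\<forall>r>b. s r = []) --> s b = enc_prod (enc_list ea) es p -->
   runs e (s, i) (T (length (enc_prod (enc_list ea) es p))) (s(b := es (case p of (xs, st) => fold f xs st)), i)"
  proof (intro exI[of _ ?e] allI impI)
   fix s :: store and i :: io and p assume e: "\<forall>r>b. s r = []" and sb: "s b = enc_prod (enc_list ea) es p"
   obtain xs st where p: "p = (xs, st)" by force
   define n where "n = length (enc_prod (enc_list ea) es p)"
   have n: "n = length (enc_list ea xs @ es st)" by (simp add: n_def p)
   have 1: "runs (a b) (s, i) ((n + 2) ^ q) (s(b := es st, Suc b := enc_list ea xs), i)"
    by (rule sd_run[OF a]) (use e in "auto simp: sb p n")
   have 2: "runs (move (b + 1) (b + 2) (b + 3)) (s(b := es st, Suc b := enc_list ea xs), i) (6 * n + 2) (s(b := es st, b + 2 := enc_list ea xs), i)"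
    by (rule runs_move) (use e in "auto simp: n fun_eq_iff")
   have 3: "runs (Push (b + 1) True) (s(b := es st, b + 2 := enc_list ea xs), i) 1 (s(b := es st, b + 1 := [True], b + 2 := enc_list ea xs), i)"
    by (rule run_Push) (use e in "auto simp: fun_eq_iff")
   have "runs ?W (s(b := es st, b + 1 := [True], b + 2 := enc_list ea xs), i) (length xs * (Q n + 3) + 5) (s(b := es (fold f xs st)), i)"
   proof (rule fold_loop[OF c d, where xs = xs and st = st and m = n and M = "(n + 2) ^ K"])
    show "length (es (fold f ys st)) <= (n + 2) ^ K" if "xs = ys @ zs" for ys zs
    proof -
     have "length (enc_list ea ys) + length (es st) <= n" using that by (simp add: n enc_list_def)
     from power_pad_mono[OF this] show ?thesis using bound[of ys st] by (rule order_trans[rotated])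
    qed
   qed (use e in "auto simp: n Q_def fun_eq_iff")
   hence 4: "runs ?W (s(b := es st, b + 1 := [True], b + 2 := enc_list ea xs), i) (n * (Q n + 3) + 5) (s(b := es (fold f xs st)), i)"
    by (rule runs_weaken) (intro add_right_mono mult_le_mono1, use length_le_enc_list[of xs ea] in "simp add: n")
   from runs_Seq[OF 1 runs_Seq[OF 2 runs_Seq[OF 3 4]]]
   show "runs ?e (s, i) (T (length (enc_prod (enc_list ea) es p))) (s(b := es (case p of (xs, st) => fold f xs st)), i)"
    unfolding T_def n_def p by simp
  qed
 qed
qed

text \<open>The first condition lets a program split a stream of codes. The second makes codes
  faithful, so that data can be compared by comparing codes.\<close>

class enc =
 fixes enc :: "'a => bool list"
 assumes sd_enc: "sd enc" and enc_prefix_free: "enc x @ v = enc y @ w ==> x = y"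

instantiation bool :: enc
begin
definition enc_bool_def: "enc b = [b :: bool]"
instance by standard (use sd_bool in "simp_all add: enc_bool_def[abs_def]")
end

instantiation prod :: (enc, enc) enc
begin
definition enc_prod_def': "enc = enc_prod enc enc"
instance
proof
 fix p q :: "'a \<times> 'b" and v w assume "enc p @ v = enc q @ w"
 hence *: "enc (fst p) @ enc (snd p) @ v = enc (fst q) @ enc (snd q) @ w" by (simp add: enc_prod_def' enc_prod_def)
 from enc_prefix_free[OF this] have "fst p = fst q" .
 moreover from this * enc_prefix_free have "snd p = snd q" by (metis same_append_eq)
 ultimately show "p = q" by (rule prod_eqI)
qed (simp add: enc_prod_def' sd_prod sd_enc)
end

instantiation list :: (enc) enc
begin
definition enc_list_def': "enc = enc_list enc"
instance
proof
 fix xs ys :: "'a list" and v w assume "enc xs @ v = enc ys @ w"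
 thus "xs = ys" unfolding enc_list_def'
 proof (induction xs arbitrary: ys)
  case Nil
  thus ?case by (cases ys) auto
 next
  case (Cons x xs)
  then obtain y zs where ys: "ys = y # zs" by (cases ys) auto
  have *: "enc x @ enc_list enc xs @ v = enc y @ enc_list enc zs @ w" using Cons.prems ys by simp
  from enc_prefix_free[OF this] have "x = y" .
  with * Cons.IH[of zs] ys show ?case by simp
 qed
qed (simp add: enc_list_def' sd_list sd_enc)
end

lemma inj_nat_bits: "nat_bits m = nat_bits n ==> m = n"
proof (induction m arbitrary: n rule: less_induct)
 case (less m)
 show ?case
 proof (cases "m = 0 | n = 0")
  case True
  thus ?thesis using less.prems by (auto simp: nat_bits.simps[of m] nat_bits.simps[of n] nat_bits.simps[of 0] split: if_splits)
 next
  case False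
  hence "odd m = odd n" "nat_bits (m div 2) = nat_bits (n div 2)"
   using less.prems nat_bits.simps[of m] nat_bits.simps[of n] by auto
  moreover from this less.IH[of "m div 2"] False have "m div 2 = n div 2" by simp
  ultimately show ?thesis by (metis odd_iff_mod_2_eq_one even_iff_mod_2_eq_zero mult_div_mod_eq)
 qed
qed

instantiation nat :: enc
begin
definition enc_nat_def': "enc = enc_nat"
instance
proof
 have eq: "(enc :: nat => _) = (%n. enc (nat_bits n))"
  by (simp add: enc_nat_def' enc_nat_def[abs_def] enc_word_def enc_list_def' enc_bool_def[abs_def])
 obtain k c where c: "sd_com (enc :: bool list => _) k c" using sd_enc[where 'a = "bool list"] by (auto simp: sd_def)
 have "sd_com (%n. enc (nat_bits n)) k c" unfolding sd_com_def using c[unfolded sd_com_def] by simp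
 thus "sd (enc :: nat => _)" unfolding eq by (auto simp: sd_def)
 show "m = n" if "enc m @ v = enc n @ w" for m n :: nat and v w
  using enc_prefix_free[of "nat_bits m" v "nat_bits n" w] that inj_nat_bits unfolding eq by blast
qed
end

lemma enc_word_enc: "enc_word = enc"
 by (simp add: enc_word_def enc_list_def' enc_bool_def[abs_def])

lemma enc_Pair [simp]: "enc (x, y) = enc x @ enc y"
 by (simp add: enc_prod_def')

lemma enc_Nil [simp]: "enc [] = [False]" and enc_Cons [simp]: "enc (x # xs) = True # enc x @ enc xs"
 by (simp_all add: enc_list_def')

lemma enc_nat_bits: "enc n = enc (nat_bits n)"
 by (simp add: enc_nat_def' enc_nat_def enc_word_enc)

lemma length_enc_append: "Suc (length (enc (xs @ ys))) = length (enc xs) + length (enc ys)"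
 by (induction xs) auto

lemma inj_enc: "inj enc"
proof (rule injI)
 fix x y :: 'a assume "enc x = enc y"
 thus "x = y" using enc_prefix_free[of x "[]" y "[]"] by simp
qed

section \<open>Polynomial-time combinators for encodable types\<close>

abbreviation pc :: "('a::enc => 'b::enc) => bool" where
 "pc \<equiv> pcr enc enc"

lemma pcr_const: "pcr ea eb (%x. c)"
 by (rule pcr_if_pt[OF pt_const]) (rule refl)

lemma pcr_id: "pcr ea ea (%x. x)"
 by (rule pcr_if_pt[OF pt_id]) (rule refl)

lemma pcr_pair: "pcr ea enc f ==> pcr ea enc g ==> pcr ea enc (%x. (f x, g x))"
 unfolding enc_prod_def' by (rule pcr_Pair)

lemma pc_fst: "pcr ea enc f ==> pcr ea enc (%x. fst (f x))"
 by (erule pcr_comp) (unfold enc_prod_def', rule pcr_fst[OF sd_enc])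

lemma pc_snd: "pcr ea enc f ==> pcr ea enc (%x. snd (f x))"
 by (erule pcr_comp) (unfold enc_prod_def', rule pcr_snd[OF sd_enc])

lemma pc_comp2: "pc (%p. F (fst p) (snd p)) ==> pcr ea enc f ==> pcr ea enc g ==> pcr ea enc (%x. F (f x) (g x))"
 using pcr_comp[OF pcr_pair, of ea f g enc "%p. F (fst p) (snd p)"] by simp

lemma pc_comp3: "pc (%p. F (fst p) (fst (snd p)) (snd (snd p))) ==> pcr ea enc f ==> pcr ea enc g ==> pcr ea enc h ==> pcr ea enc (%x. F (f x) (g x) (h x))"
 using pcr_comp[OF pcr_pair[OF _ pcr_pair], of ea f g h enc "%p. F (fst p) (fst (snd p)) (snd (snd p))"] by simp

lemma pc_if: "pcr ea enc p ==> pcr ea enc f ==> pcr ea enc g ==> pcr ea enc (%x. if p x then f x else g x)"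
 by (rule pcr_if) (simp_all add: enc_bool_def[abs_def])

lemma pc_not: "pcr ea enc p ==> pcr ea enc (%x. ~ p x)"
 using pc_if[of ea p "%_. False" "%_. True", OF _ pcr_const pcr_const] by (simp add: if_bool_eq_conj)

lemma pc_conj: "pcr ea enc p ==> pcr ea enc q ==> pcr ea enc (%x. p x & q x)"
 using pc_if[of ea p q "%_. False", OF _ _ pcr_const] by (simp add: if_bool_eq_conj conj_commute cong: conj_cong)

lemma pc_disj: "pcr ea enc p ==> pcr ea enc q ==> pcr ea enc (%x. p x | q x)"
 using pc_not[OF pc_conj[OF pc_not[of ea p] pc_not[of ea q]]] by simp

lemma pc_Cons: "pcr ea enc f ==> pcr ea enc g ==> pcr ea enc (%x. f x # g x)"
 by (rule pc_comp2) (rule pcr_if_pt[OF pt_Cons[of True]], auto simp: enc_prod_def' enc_prod_def)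

lemma pc_Nil_iff: "pcr ea enc f ==> pcr ea enc (%x. f x = [])"
proof -
 assume "pcr ea enc f"
 moreover have "pc (%xs :: 'b list. xs ~= [])"
 proof (rule pcr_if_pt[OF pt_head])
  fix xs :: "'b list" show "[enc xs ~= [] & hd (enc xs)] = enc (xs ~= [])" by (cases xs) (auto simp: enc_bool_def)
 qed
 ultimately have "pcr ea enc (%x. f x ~= [])" by (rule pcr_comp)
 from pc_not[OF this] show ?thesis by simp
qed

lemma pt_if_tl: "pt (%w. if w ~= [] & hd w then tl w else z)"
proof -
 have "pcr (%x. x) (%x. x) (%w :: bool list. if w ~= [] & hd w then tl w else z)"
  by (intro pcr_if pcr_const) (rule pcr_if_pt[OF pt_head] pcr_if_pt[OF pt_tl], simp)+
 thus ?thesis by (rule pt_if_pcr)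
qed

text \<open>\<open>hd []\<close> is some fixed value, so its code can be wired into the program, and
  \<open>hd\<close> and \<open>tl\<close> are covered without side conditions.\<close>

lemma pc_uncons: "pc (%xs :: 'a::enc list. (hd xs, tl xs))"
proof (rule pcr_if_pt[OF pt_if_tl])
 fix xs :: "'a list"
 show "(if enc xs ~= [] & hd (enc xs) then tl (enc xs) else enc (hd ([] :: 'a list), [] :: 'a list)) = enc (hd xs, tl xs)"
  by (cases xs) auto
qed

lemma pc_hd: "pcr ea enc f ==> pcr ea enc (%x. hd (f x))"
 using pc_fst[OF pcr_comp[OF _ pc_uncons]] by simp

lemma pc_tl: "pcr ea enc f ==> pcr ea enc (%x. tl (f x))"
 using pc_snd[OF pcr_comp[OF _ pc_uncons]] by simp

lemma pcr_length:
 assumes "pcr ea eb f"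
 shows "\<exists>k. \<forall>x. length (eb (f x)) <= (length (ea x) + 2) ^ k"
 using assms unfolding pcr_def pruns_def by blast

text \<open>The context travels in the state. A step may add a polynomial in the context and the
  element, but not in the state; hence the growth is at most linear in the list for each fixed size
  of the data.\<close>

lemma pc_fold_ctx:
 fixes f :: "'c::enc => 'a::enc => 's::enc => 's"
 assumes step: "pc (%p. f (fst p) (fst (snd p)) (snd (snd p)))"
  and growth: "!!c x s. length (enc (f c x s)) <= length (enc s) + (length (enc c) + length (enc x) + 2) ^ K"
  and args: "pcr ea enc c" "pcr ea enc xs" "pcr ea enc s"
 shows "pcr ea enc (%x. fold (f (c x)) (xs x) (s x))"
proof -
 define h where "h x p = (fst p, f (fst p) x (snd p))" for x and p :: "'c \<times> 's"
 have h: "fold (h) xs (c, s) = (c, fold (f c) xs s)" for xs c s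
  by (induction xs arbitrary: s) (auto simp: h_def)
 have b1: "length (enc (fold (f c) xs s)) <= length (enc s) + length (enc xs) * (length (enc c) + length (enc xs) + 2) ^ K" for c xs s
 proof (induction xs arbitrary: s)
  case (Cons x xs)
  let ?N = "(length (enc c) + length (enc (x # xs)) + 2) ^ K"
  have 1: "(length (enc c) + length (enc x) + 2) ^ K <= ?N" by (rule power_mono) auto
  have 2: "(length (enc c) + length (enc xs) + 2) ^ K <= ?N" by (rule power_mono) auto
  have "length (enc (fold (f c) xs (f c x s))) <= length (enc (f c x s)) + length (enc xs) * (length (enc c) + length (enc xs) + 2) ^ K"
   by (rule Cons.IH)
  also have "... <= (length (enc s) + ?N) + length (enc xs) * ?N"
   using growth[of c x s] 1 by (intro add_mono mult_le_mono2 2) linarith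
  also have "... = length (enc s) + Suc (length (enc xs)) * ?N" by simp
  also have "... <= length (enc s) + length (enc (x # xs)) * ?N" by (intro add_left_mono mult_le_mono1) simp
  finally show ?case by simp
 qed simp
 have "pbound (%n. n + (n + n * (n + 2) ^ K))" by (intro pbound_intros)
 then obtain L where L: "n + (n + n * (n + 2) ^ K) <= (n + 2) ^ L" for n :: nat unfolding pbound_def by blast
 have b2: "length (enc_prod enc enc (fold h xs p)) <= (length (enc_list enc xs) + length (enc_prod enc enc p) + 2) ^ L" for xs p
 proof -
  obtain c s where p: "p = (c, s)" by force
  let ?n = "length (enc xs) + length (enc p)"
  have "length (enc (fold h xs p)) = length (enc c) + length (enc (fold (f c) xs s))" by (simp add: p h)
  also have "... <= ?n + (?n + ?n * (?n + 2) ^ K)"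
   by (rule add_mono[OF _ order_trans[OF b1 add_mono[OF _ mult_mono[OF _ power_mono]]]]) (auto simp: p)
  also have "... <= (?n + 2) ^ L" by (rule L)
  finally show ?thesis unfolding enc_list_def'[symmetric] enc_prod_def'[symmetric] .
 qed
 have "pc (%q. h (fst q) (snd q))" unfolding h_def
  by (intro pcr_pair pc_fst pc_snd pcr_id pc_comp3[where F = f, OF step])
 hence "pcr (enc_prod enc (enc_prod enc enc)) (enc_prod enc enc) (%(x, st). h x st)"
  by (simp add: enc_prod_def' split_def)
 from pcr_fold[OF sd_enc this b2] have *: "pc (%(xs, st). fold h xs st)"
  by (simp add: enc_prod_def' enc_list_def')
 have "pcr ea enc (%x. (xs x, (c x, s x)))" by (intro pcr_pair args)
 from pc_snd[OF pcr_comp[OF this *]] show ?thesis by (simp add: h)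
qed

lemma pc_rev:
 fixes xs :: "_ => 'a::enc list"
 assumes "pcr ea enc xs"
 shows "pcr ea enc (%x. rev (xs x))"
proof -
 have "pcr ea enc (%x. fold ((%_::bool. (#)) True) (xs x) [])"
  by (rule pc_fold_ctx[where K = 1, OF _ _ pcr_const assms pcr_const])
   (intro pc_Cons pc_fst pc_snd pcr_id, simp)
 thus ?thesis by (simp add: fold_Cons_rev)
qed

lemma pc_append:
 fixes xs :: "_ => 'a::enc list"
 assumes "pcr ea enc xs" "pcr ea enc ys"
 shows "pcr ea enc (%x. xs x @ ys x)"
proof -
 have "pcr ea enc (%x. fold ((%_::bool. (#)) True) (rev (xs x)) (ys x))"
  by (rule pc_fold_ctx[where K = 1, OF _ _ pcr_const pc_rev[OF assms(1)] assms(2)])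
   (intro pc_Cons pc_fst pc_snd pcr_id, simp)
 thus ?thesis by (simp add: fold_Cons_rev)
qed

lemma pc_concat_map:
 fixes g :: "'c::enc => 'a::enc => 'b::enc list"
 assumes g: "pc (%p. g (fst p) (snd p))" and args: "pcr ea enc c" "pcr ea enc xs"
 shows "pcr ea enc (%x. concat (map (g (c x)) (xs x)))"
proof -
 obtain K where K: "!!c x. length (enc (g c x)) <= (length (enc (c, x)) + 2) ^ K" using pcr_length[OF g] by auto
 have "pcr ea enc (%x. fold ((%c y acc. g c y @ acc) (c x)) (rev (xs x)) [])"
 proof (rule pc_fold_ctx[where K = K])
  show "pc (%p. g (fst p) (fst (snd p)) @ snd (snd p) :: 'b list)"
   by (intro pc_append pc_comp2[where F = g, OF g] pc_fst pc_snd pcr_id)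
  fix c x and acc :: "'b list"
  show "length (enc (g c x @ acc)) <= length (enc acc) + (length (enc c) + length (enc x) + 2) ^ K"
   using K[of c x] length_enc_append[of "g c x" acc] by simp
 qed (intro args pc_rev pcr_const)+
 moreover have "fold (%y acc. g c y @ acc) (rev ys) acc = concat (map (g c) ys) @ acc" for c ys acc
  by (induction ys arbitrary: acc) auto
 ultimately show ?thesis by simp
qed

lemma pc_map:
 fixes g :: "'c::enc => 'a::enc => 'b::enc"
 assumes g: "pc (%p. g (fst p) (snd p))" and args: "pcr ea enc c" "pcr ea enc xs"
 shows "pcr ea enc (%x. map (g (c x)) (xs x))"
proof -
 have "pcr ea enc (%x. concat (map ((%c y. [g c y]) (c x)) (xs x)))"
  by (rule pc_concat_map[OF _ args]) (intro pc_Cons g pcr_const)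
 moreover have "concat (map (%y. [h y]) ys) = map h ys" for h :: "'a => 'b" and ys by (induction ys) auto
 ultimately show ?thesis by simp
qed

lemma pc_filter:
 fixes g :: "'c::enc => 'a::enc => bool"
 assumes g: "pc (%p. g (fst p) (snd p))" and args: "pcr ea enc c" "pcr ea enc xs"
 shows "pcr ea enc (%x. filter (g (c x)) (xs x))"
proof -
 have "pcr ea enc (%x. concat (map ((%c y. if g c y then [y] else []) (c x)) (xs x)))"
  by (rule pc_concat_map[OF _ args]) (intro pc_if pc_Cons g pcr_const pc_snd pcr_id)
 moreover have "concat (map (%y. if h y then [y] else []) ys) = filter h ys" for h :: "'a => bool" and ys by (induction ys) auto
 ultimately show ?thesis by simp
qed

lemma pc_enc: "pcr ea enc f ==> pcr ea enc (%x. enc (f x))"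
 by (erule pcr_comp) (rule pcr_if_pt[OF pt_enc_word], simp add: enc_word_enc)

text \<open>Equality of bit strings: scan the first one while shortening the second one.\<close>

lemma pc_eq:
 fixes f g :: "_ => 'a::enc"
 assumes "pcr ea enc f" "pcr ea enc g"
 shows "pcr ea enc (%x. f x = g x)"
proof -
 define h where "h b p = (fst p & snd p ~= [] & hd (snd p) = b, tl (snd p))" for b :: bool and p :: "bool * bool list"
 have h: "fold h xs (ok, ys) = (r, zs) ==> (r & zs = []) = (ok & xs = ys)" for xs ys ok r zs
 proof (induction xs arbitrary: ok ys)
  case (Cons x xs)
  thus ?case by (cases ys) (auto simp: h_def)
 qed auto
 have "pcr ea enc (%x. fold ((%_::bool. h) True) (enc (f x)) (True, enc (g x)))"
 proof (rule pc_fold_ctx[where K = 1 and c = "%_. True"])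
  have "pc (%p. fst (snd (snd p)) & snd (snd (snd p)) ~= [] & (if hd (snd (snd (snd p))) then fst (snd p) else ~ fst (snd p)))"
   by (intro pc_conj pc_not pc_Nil_iff pc_if pc_hd pc_fst pc_snd pcr_id)
  hence "pc (%p. (fst (snd (snd p)) & snd (snd (snd p)) ~= [] & (if hd (snd (snd (snd p))) then fst (snd p) else ~ fst (snd p)), tl (snd (snd (snd p)))))"
   by (intro pcr_pair pc_tl pc_fst pc_snd pcr_id)
  moreover have "h (fst (snd p)) (snd (snd p)) = (fst (snd (snd p)) & snd (snd (snd p)) ~= [] & (if hd (snd (snd (snd p))) then fst (snd p) else ~ fst (snd p)), tl (snd (snd (snd p))))"
   for p :: "bool * bool * bool * bool list"
   by (auto simp: h_def)
  ultimately show "pc (%p :: bool * bool * bool * bool list. h (fst (snd p)) (snd (snd p)))" by simp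
  fix x and s :: "bool * bool list"
  have "length (enc (tl w)) <= length (enc w)" for w :: "bool list" by (cases w) auto
  thus "length (enc (h x s)) <= length (enc s) + (length (enc c) + length (enc x) + 2) ^ 1" for c :: bool
   by (cases s) (simp add: h_def enc_bool_def le_SucI trans_le_add1)
 qed (intro pc_enc assms pcr_const pcr_pair)+
 hence *: "pcr ea enc (%x. fold h (enc (f x)) (True, enc (g x)))" by simp
 have "pcr ea enc (%x. fst (fold h (enc (f x)) (True, enc (g x))) & snd (fold h (enc (f x)) (True, enc (g x))) = [])"
  by (intro pc_conj pc_Nil_iff pc_fst[OF *] pc_snd[OF *])
 moreover have "(fst (fold h xs (True, ys)) & snd (fold h xs (True, ys)) = []) = (xs = ys)" for xs ys
  using h[of xs True ys] by (cases "fold h xs (True, ys)") auto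
 ultimately show ?thesis by (simp add: inj_eq[OF inj_enc])
qed

lemma pc_length_le:
 fixes xs ys :: "_ => bool list"
 assumes "pcr ea enc xs" "pcr ea enc ys"
 shows "pcr ea enc (%x. length (xs x) <= length (ys x))"
proof -
 have "pcr ea enc (%x. fold ((%_ _. tl) True) (xs x) (True # ys x))"
 proof (rule pc_fold_ctx[where K = 1 and c = "%_. True"])
  fix c :: bool and x :: bool and s :: "bool list"
  show "length (enc (tl s)) <= length (enc s) + (length (enc c) + length (enc x) + 2) ^ 1" by (cases s) auto
 qed (intro assms pc_Cons pcr_const pc_tl pc_snd pcr_id)+
 moreover have "fold (%_. tl) us vs = drop (length us) vs" for us vs :: "bool list"
  by (induction us arbitrary: vs) (auto simp: drop_Suc)
 ultimately have "pcr ea enc (%x. drop (length (xs x)) (True # ys x))" by simp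
 from pc_not[OF pc_Nil_iff[OF this]] show ?thesis by (simp add: less_Suc_eq_le not_le)
qed

lemma pc_nat_bits: "pcr ea enc n ==> pcr ea enc (%x. nat_bits (n x))"
 by (erule pcr_comp) (rule pcr_if_pt[OF pt_id], rule enc_nat_bits)

text \<open>Bits come least significant first, so a later difference overrides the verdict so far.
  There are no leading zeros, hence leftover bits of the second number decide for it.\<close>

lemma pc_le:
 fixes m n :: "_ => nat"
 assumes "pcr ea enc m" "pcr ea enc n"
 shows "pcr ea enc (%x. m x <= n x)"
proof -
 define hf where "hf w = (w ~= [] & hd w)" for w :: "bool list"
 define h where "h b p = (if hf (snd p) = b then fst p else hf (snd p), tl (snd p))" for b :: bool and p :: "bool * bool list"
 have bits: "hf (nat_bits n) = odd n" "tl (nat_bits n) = nat_bits (n div 2)" for n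
  using nat_bits.simps[of n] nat_bits.simps[of 0] by (auto simp: hf_def)
 have h: "(%p. snd p ~= [] | fst p) (fold h (nat_bits m) (r, nat_bits n)) \<longleftrightarrow> m < n | m = n & r" for m n r
 proof (induction m arbitrary: n r rule: less_induct)
  case (less m)
  show ?case
  proof (cases "m = 0")
   case True
   thus ?thesis using nat_bits.simps[of n] nat_bits.simps[of 0] by (auto split: if_splits)
  next
   case False
   define r' where "r' = (if odd n = odd m then r else odd n)"
   have "nat_bits m = odd m # nat_bits (m div 2)" using False nat_bits.simps[of m] by simp
   hence "fold h (nat_bits m) (r, nat_bits n) = fold h (nat_bits (m div 2)) (r', nat_bits (n div 2))"
    by (simp add: h_def bits r'_def)
   moreover have "m div 2 < m" using False by simp
   moreover have "(m div 2 < n div 2 | m div 2 = n div 2 & r') \<longleftrightarrow> m < n | m = n & r" unfolding r'_def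
    by (cases "odd m"; cases "odd n"; cases r; simp only: simp_thms if_True if_False; presburger)
   ultimately show ?thesis using less.IH[of "m div 2" r' "n div 2"] by simp
  qed
 qed
 have "pcr ea enc (%x. fold ((%_::bool. h) True) (nat_bits (m x)) (True, nat_bits (n x)))"
 proof (rule pc_fold_ctx[where K = 1 and c = "%_. True"])
  have hf: "pc (%p :: bool * bool * bool * bool list. hf (snd (snd (snd p))))" unfolding hf_def
   by (intro pc_conj pc_not pc_Nil_iff pc_hd pc_snd pcr_id)
  show "pc (%p :: bool * bool * bool * bool list. h (fst (snd p)) (snd (snd p)))" unfolding h_def
   by (intro pcr_pair pc_if pc_eq hf pc_tl pc_fst pc_snd pcr_id)
  fix x and s :: "bool * bool list"
  have "length (enc (tl w)) <= length (enc w)" for w :: "bool list" by (cases w) auto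
  thus "length (enc (h x s)) <= length (enc s) + (length (enc c) + length (enc x) + 2) ^ 1" for c :: bool
   by (cases s) (simp add: h_def enc_bool_def le_SucI trans_le_add1)
 qed (intro pc_nat_bits assms pcr_const pcr_pair)+
 hence *: "pcr ea enc (%x. fold h (nat_bits (m x)) (True, nat_bits (n x)))" by simp
 have "pcr ea enc (%x. snd (fold h (nat_bits (m x)) (True, nat_bits (n x))) ~= [] | fst (fold h (nat_bits (m x)) (True, nat_bits (n x))))"
  by (intro pc_disj pc_not pc_Nil_iff pc_fst[OF *] pc_snd[OF *])
 thus ?thesis using h by (simp add: le_less)
qed

text \<open>The number whose binary digits are \<open>w\<close> below a leading 1. It turns words
  into numbers injectively by appending one bit, and serves both to name vertices and to write huge
  weights without arithmetic.\<close>

fun num :: "bool list => nat" where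
 "num [] = 1"
| "num (b # w) = of_bool b + 2 * num w"

lemma num_pos: "num w > 0"
 by (induction w) auto

lemma num_ge: "2 ^ length w <= num w"
 by (induction w) auto

lemma nat_bits_num: "nat_bits (num w) = w @ [True]"
proof (induction w)
 case Nil
 show ?case using nat_bits.simps[of 1] nat_bits.simps[of 0] by simp
next
 case (Cons b w)
 thus ?case using nat_bits.simps[of "num (b # w)"] num_pos[of "b # w"] by (cases b) auto
qed

lemma inj_num: "num v = num w ==> v = w"
 using nat_bits_num by (metis append_same_eq)

lemma pc_num: "pcr ea enc w ==> pcr ea enc (%x. num (w x))"
proof -
 assume "pcr ea enc w"
 hence 1: "pcr ea enc (%x. w x @ [True])" by (intro pc_append pcr_const)
 obtain k c where "pruns ea enc (%x. w x @ [True]) k c" using pcrE[OF 1] .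
 hence "pruns ea enc (%x. num (w x)) k c" unfolding pruns_def enc_nat_bits[of "num _"] nat_bits_num .
 thus ?thesis by (auto simp: pcr_def)
qed

text \<open>The gap instance, the number of labels and the permutations are constants of the
  program, so finite tables over them can be wired in.\<close>

lemma pc_table:
 fixes F :: "'a::enc => 'b::enc"
 assumes "finite S"
 shows "pc (%x. if x : S then F x else d)"
 using assms
proof induction
 case (insert a S)
 have "pc (%x. if x = a then F a else if x : S then F x else d)"
  by (intro pc_if pc_eq pcr_id pcr_const insert.IH)
 thus ?case by (rule back_subst[of pc]) auto
qed (simp add: pcr_const)

section \<open>The reduction as a program\<close>

lemma pc_nth: "pcr ea enc f ==> pcr ea enc (%x. hd ((tl ^^ j) (f x)))"
proof (rule pc_hd)
 assume "pcr ea enc f"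
 thus "pcr ea enc (%x. (tl ^^ j) (f x))" by (induction j) (auto intro: pc_tl)
qed

lemma pc_concat_const:
 assumes "!!j. j : set js ==> pcr ea enc (f j)"
 shows "pcr ea enc (%x. concat (map (%j. f j x) js))"
 using assms by (induction js) (auto intro: pcr_const pc_append)

lemma pc_mem:
 fixes f :: "_ => 'a::enc"
 assumes "pcr ea enc f" "pcr ea enc xs"
 shows "pcr ea enc (%x. f x : set (xs x))"
proof -
 have "pcr ea enc (%x. filter ((%a b. a = b) (f x)) (xs x) ~= [])"
  by (intro pc_not pc_Nil_iff pc_filter assms) (intro pc_eq pc_fst pc_snd pcr_id)
 thus ?thesis by (rule back_subst[of "pcr ea enc"]) (auto simp: filter_empty_conv fun_eq_iff)
qed

primrec tuples :: "nat => 'a list => 'a list list" where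
 "tuples 0 xs = [[]]"
| "tuples (Suc n) xs = concat (map (%x. map ((#) x) (tuples n xs)) xs)"

lemma set_tuples: "set (tuples n xs) = {ys. length ys = n & set ys <= set xs}"
proof (induction n)
 case (Suc n)
 show ?case
 proof (intro set_eqI iffI)
  fix ys assume "ys : {ys. length ys = Suc n & set ys <= set xs}"
  then obtain z zs where "ys = z # zs" "z : set xs" "length zs = n" "set zs <= set xs" by (cases ys) auto
  thus "ys : set (tuples (Suc n) xs)" using Suc by auto
 qed (use Suc in auto)
qed auto

lemma length_tuples: "length (tuples n xs) = length xs ^ n"
proof (induction n)
 case (Suc n)
 have "length (concat (map (%x. map ((#) x) zs) ys)) = length ys * length zs" for zs :: "'a list list" and ys
  by (induction ys) auto
 thus ?case using Suc by simp
qed simp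

lemma pc_tuples:
 fixes xs :: "_ => 'a::enc list"
 assumes "pcr ea enc xs"
 shows "pcr ea enc (%x. tuples n (xs x))"
proof (induction n)
 case (Suc n)
 have "pcr ea enc (%x. concat (map ((%ts y. map ((%y t. y # t) y) ts) (tuples n (xs x))) (xs x)))"
  by (rule pc_concat_map[OF _ Suc assms], rule pc_map) (intro pc_Cons pc_fst pc_snd pcr_id)+
 thus ?case by simp
qed (simp add: pcr_const)

text \<open>Pairs the elements of a list with the elements of \<open>os\<close>, which are used cyclically.\<close>

definition cycle_step :: "'b list => 'a => 'b list * ('a \<times> 'b) list => 'b list * ('a \<times> 'b) list" where
 "cycle_step os a s = (let r = (if fst s = [] then os else fst s) in if r = [] then s else (tl r, (a, hd r) # snd s))"

definition cycle_pairs :: "'b list => 'a list => ('a \<times> 'b) list" where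
 "cycle_pairs os as = snd (fold (cycle_step os) as ([], []))"

text \<open>The invariant is the part of \<open>os\<close> not yet used in the current round, empty
  exactly between rounds.\<close>

lemma cycle_pairs_fold:
 assumes "os ~= []"
 shows "fold (cycle_step os) as ([], []) = (if length as mod length os = 0 then [] else drop (length as mod length os) os,
  rev (map (%i. (as ! i, os ! (i mod length os))) [0..<length as]))"
proof (induction as rule: rev_induct)
 case (snoc a as)
 define n d where "n = length as" and "d = length os"
 have d: "0 < d" using assms by (simp add: d_def)
 have r: "(if (if n mod d = 0 then [] else drop (n mod d) os) = [] then os else (if n mod d = 0 then [] else drop (n mod d) os)) = drop (n mod d) os"
  using mod_less_divisor[OF d, of n] by (auto simp: d_def)
 have ne: "drop (n mod d) os ~= []" using mod_less_divisor[OF d, of n] by (simp add: d_def not_le)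
 have tl: "tl (drop (n mod d) os) = (if Suc n mod d = 0 then [] else drop (Suc n mod d) os)"
  using d by (auto simp: mod_Suc d_def drop_Suc tl_drop)
 have hd: "hd (drop (n mod d) os) = os ! (n mod d)" using mod_less_divisor[OF d, of n] by (simp add: d_def hd_drop_conv_nth)
 have "map (%i. ((as @ [a]) ! i, os ! (i mod d))) [0..<Suc n] = map (%i. (as ! i, os ! (i mod d))) [0..<n] @ [(a, os ! (n mod d))]"
  by (auto simp: n_def nth_append)
 moreover have "cycle_step os a (if n mod d = 0 then [] else drop (n mod d) os, acc) = (tl (drop (n mod d) os), (a, hd (drop (n mod d) os)) # acc)" for acc :: "('b \<times> 'a) list"
  unfolding cycle_step_def Let_def fst_conv snd_conv r using ne by (simp only: if_False)
 ultimately show ?case using snoc unfolding tl hd by (simp only: fold_append fold.simps comp_apply id_apply n_def[symmetric] d_def[symmetric] length_append list.size) (simp add: n_def)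
qed simp

lemma set_cycle_pairs:
 assumes "os ~= []"
 shows "set (cycle_pairs os as) = (%i. (as ! i, os ! (i mod length os))) ` {..<length as}"
 by (simp add: cycle_pairs_def cycle_pairs_fold[OF assms] atLeast0LessThan)

lemma length_cycle_pairs: "os ~= [] ==> length (cycle_pairs os as) = length as"
 by (simp add: cycle_pairs_def cycle_pairs_fold)

lemma pc_cycle_pairs:
 fixes os :: "_ => 'b::enc list" and as :: "_ => 'a::enc list"
 assumes "pcr ea enc os" "pcr ea enc as"
 shows "pcr ea enc (%x. cycle_pairs (os x) (as x))"
proof -
 have "pcr ea enc (%x. fold (cycle_step (os x)) (as x) ([], []))"
 proof (rule pc_fold_ctx[where K = 1])
  have r: "pc (%p :: 'b list * 'a \<times> 'b list * ('a \<times> 'b) list. if fst (snd (snd p)) = [] then fst p else fst (snd (snd p)))"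
   by (intro pc_if pc_Nil_iff pc_fst pc_snd pcr_id)
  show "pc (%p :: 'b list * 'a \<times> 'b list * ('a \<times> 'b) list. cycle_step (fst p) (fst (snd p)) (snd (snd p)))"
   unfolding cycle_step_def Let_def
   by (rule pc_if, rule pc_Nil_iff, rule r, intro pc_snd pcr_id, rule pcr_pair, rule pc_tl, rule r, rule pc_Cons, rule pcr_pair)
    (intro pc_fst pc_snd pcr_id pc_hd r)+
  fix c :: "'b list" and a :: 'a and s :: "'b list * ('a \<times> 'b) list"
  obtain r acc where s: "s = (r, acc)" by force
  have "length (enc (tl w)) + length (enc (hd w)) < length (enc w)" if "w ~= []" for w :: "'b list" using that by (cases w) auto
  from this[of r] this[of c] show "length (enc (cycle_step c a s)) <= length (enc s) + (length (enc c) + length (enc a) + 2) ^ 1"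
   by (auto simp: s cycle_step_def Let_def)
 qed (intro assms pcr_const)+
 thus ?thesis unfolding cycle_pairs_def by (rule pc_snd)
qed

text \<open>An element of equal key is replaced, so folding sorts and removes duplicates, in the
  order that \<open>enc_digraph\<close> prescribes.\<close>

definition insert_key :: "('a => 'b::linorder) => 'a => 'a list => 'a list" where
 "insert_key key x ys = filter (%y. key y < key x) ys @ x # filter (%y. key x < key y) ys"

lemma sorted_list_of_set_insert_filter:
 assumes "finite A"
 shows "sorted_list_of_set (insert a A) = filter (%y. y < a) (sorted_list_of_set A) @ a # filter (%y. a < y) (sorted_list_of_set A)"
proof (rule sorted_distinct_set_unique)
 show "sorted (filter (%y. y < a) (sorted_list_of_set A) @ a # filter (%y. a < y) (sorted_list_of_set A))"
  by (auto simp: sorted_append sorted_wrt_filter)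
 show "distinct (filter (%y. y < a) (sorted_list_of_set A) @ a # filter (%y. a < y) (sorted_list_of_set A))" by auto
 have "set (sorted_list_of_set (insert a A)) = insert a A" using assms by (intro set_sorted_list_of_set) simp
 thus "set (sorted_list_of_set (insert a A)) = set (filter (%y. y < a) (sorted_list_of_set A) @ a # filter (%y. a < y) (sorted_list_of_set A))"
  using assms by auto
qed (rule sorted_sorted_list_of_set distinct_sorted_list_of_set)+

lemma fold_insert_key:
 assumes "!!x. x : set xs ==> x = g (key x)" "!!x. key (g x) = x"
 shows "fold (insert_key key) xs [] = map g (sorted_list_of_set (key ` set xs))"
 using assms(1)
proof (induction xs rule: rev_induct)
 case (snoc x xs)
 have x: "x = g (key x)" by (rule snoc.prems) simp
 have f: "filter (%y. P (key y)) (map g zs) = map g (filter P zs)" for P zs by (induction zs) (auto simp: assms(2))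
 have IH: "fold (insert_key key) xs [] = map g (sorted_list_of_set (key ` set xs))" by (rule snoc.IH) (simp add: snoc.prems)
 have "fold (insert_key key) (xs @ [x]) [] = insert_key key x (map g (sorted_list_of_set (key ` set xs)))" using IH by simp
 also have "... = map g (sorted_list_of_set (insert (key x) (key ` set xs)))"
  unfolding insert_key_def sorted_list_of_set_insert_filter[OF finite_imageI[OF finite_set]] f[of "%k. k < key x"] f[of "%k. key x < k"]
  using x by simp
 finally show ?case by simp
qed simp

lemma length_enc_insert_key:
 fixes x :: "'a::enc"
 shows "length (enc (insert_key key x ys)) <= length (enc ys) + length (enc x) + 1"
proof -
 have "length (enc (filter (%y. key y < key x) ys)) + length (enc (filter (%y. key x < key y) ys)) <= length (enc ys) + 1"
  by (induction ys) (auto dest: less_not_sym)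
 thus ?thesis unfolding insert_key_def
  using length_enc_append[of "filter (%y. key y < key x) ys" "x # filter (%y. key x < key y) ys"] by simp
qed

lemma pc_fold_insert_key:
 fixes key :: "'a::enc => 'b::linorder"
 assumes less: "pc (%p. key (fst p) < key (snd p))" and xs: "pcr ea enc xs"
 shows "pcr ea enc (%x. fold (insert_key key) (xs x) [])"
proof -
 have "pcr ea enc (%x. fold ((%_::bool. insert_key key) True) (xs x) [])"
 proof (rule pc_fold_ctx[where K = 1 and c = "%_. True"])
  have "pc (%p :: bool * 'a \<times> 'a list. filter ((%x y. key y < key x) (fst (snd p))) (snd (snd p)) @ fst (snd p) # filter ((%x y. key x < key y) (fst (snd p))) (snd (snd p)))"
   by (intro pc_append pc_Cons pc_filter pc_fst pc_snd pcr_id pc_comp2[where F = "%x y. key x < key y", OF less])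
  thus "pc (%p :: bool * 'a \<times> 'a list. insert_key key (fst (snd p)) (snd (snd p)))" unfolding insert_key_def .
  fix c :: bool and x :: 'a and s
  show "length (enc (insert_key key x s)) <= length (enc s) + (length (enc c) + length (enc x) + 2) ^ 1"
   using length_enc_insert_key[of key x s] by simp
 qed (intro xs pcr_const)+
 thus ?thesis by simp
qed

lemma pc_less_nat: "pcr ea enc m ==> pcr ea enc n ==> pcr ea enc (%x. (m x :: nat) < n x)"
 unfolding not_le[symmetric] by (intro pc_not pc_le)

lemma pc_less_arc:
 fixes e f :: "_ => nat * nat"
 assumes "pcr ea enc e" "pcr ea enc f"
 shows "pcr ea enc (%x. e x < f x)"
proof -
 have "pcr ea enc (%x. fst (e x) < fst (f x) | fst (e x) = fst (f x) & snd (e x) < snd (f x))"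
  by (intro pc_disj pc_conj pc_eq pc_less_nat pc_fst pc_snd assms)
 thus ?thesis by (rule back_subst[of "pcr ea enc"]) (auto simp: less_prod_def' fun_eq_iff)
qed

type_synonym tmpl = "nat * nat * (nat * nat) \<times> nat list"
text \<open>In the input the list is the permutation of a constraint. In the output it is
  \<open>[W e]\<close> for a light arc and empty for a heavy one, whose weight is known only when
  all arcs are.\<close>

type_synonym warc = "(nat * nat) \<times> nat list"
type_synonym center = "(nat * nat) \<times> ((nat * nat) \<times> (nat * nat) \<times> nat list) list"

text \<open>The parameters are constants of the program. \<open>B\<close> lifts vertex codes above
  the names of the terminals, \<open>CB\<close> enlarges the heavy weight, \<open>scale\<close> and
  \<open>thr\<close> form the acceptance threshold, and \<open>tab\<close> lists the arcs at a slot
  for each permutation.\<close>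

locale program =
 fixes B CB t :: nat and VH :: "nat list" and tab :: "nat => nat list => ((tmpl * tmpl) \<times> nat list) list"
  and Ws :: "nat set" and scale thr :: nat and perms :: "nat list set"
 assumes fin_Ws: "finite Ws" and fin_perms: "finite perms"
begin

definition code :: "nat * nat * (nat * nat) list * (nat * nat) \<times> nat list => nat" where
 "code nm = num (replicate B True @ enc nm)"

lemma pc_code: "pcr ea enc f ==> pcr ea enc (%x. code (f x))"
 unfolding code_def by (intro pc_num pc_append pcr_const pc_enc)

lemma code_eq_iff: "code nm = code nm' \<longleftrightarrow> nm = nm'"
proof
 assume "code nm = code nm'"
 hence "replicate B True @ enc nm = replicate B True @ enc nm'" unfolding code_def by (rule inj_num)
 thus "nm = nm'" using inj_enc by (auto dest: injD)
qed simp

lemma code_ge: "2 ^ B <= code nm"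
proof -
 have "(2::nat) ^ B <= 2 ^ length (replicate B True @ enc nm)" by (rule power_increasing) auto
 also have "... <= code nm" unfolding code_def by (rule num_ge)
 finally show ?thesis .
qed

text \<open>Kinds 0 to 3 are \<open>Term\<close>, \<open>Hub\<close>, \<open>Slot\<close> and
  \<open>Leaf\<close>. A leaf stores its vertex \<open>v\<close> as \<open>[(v, v)]\<close> in place
  of the center, so that all names have one type and leaves are shared.\<close>

definition tinst :: "(nat * nat) list * nat => tmpl => nat" where
 "tinst c \<tau> = (if fst \<tau> = 0 then fst (snd \<tau>)
  else code (fst \<tau>, fst (snd \<tau>), (if fst \<tau> = 3 then [(snd c, snd c)] else fst c), fst (snd (snd \<tau>)), snd (snd (snd \<tau>))))"

lemma pc_tinst: "pcr ea enc c ==> pcr ea enc \<tau> ==> pcr ea enc (%x. tinst (c x) (\<tau> x))"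
 unfolding tinst_def by (intro pc_if pc_eq pc_code pcr_pair pc_fst pc_snd pc_Cons pcr_const)

definition out_arcs :: "nat => warc list => warc list" where
 "out_arcs u as = filter (%a. fst (fst a) = u) as"

lemma pc_out_arcs: "pcr ea enc u ==> pcr ea enc as ==> pcr ea enc (%x. out_arcs (u x) (as x))"
 unfolding out_arcs_def by (rule pc_filter) (intro pc_eq pc_fst pc_snd pcr_id)+

definition centers_at :: "warc list => warc => center list" where
 "centers_at as a = map (Pair (fst a)) (tuples t (cycle_pairs (out_arcs (fst (fst a)) as) (map fst as)))"

definition center_list :: "warc list => center list" where
 "center_list as = concat (map (centers_at as) as)"

lemma pc_map_fst: "pcr ea enc xs ==> pcr ea enc (%x. map fst (xs x))"
 by (rule pc_map[where c = "%_. True" and g = "%_. fst"]) (intro pc_fst pc_snd pcr_id pcr_const)+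

lemma pc_center_list: "pcr ea enc as ==> pcr ea enc (%x. center_list (as x))"
 unfolding center_list_def
proof (rule pc_concat_map[where g = centers_at and c = as])
 show "pc (%p. centers_at (fst p) (snd p))" unfolding centers_at_def
  by (rule pc_map[where g = Pair and c = "%p. fst (snd p)"])
   (intro pcr_pair pc_tuples pc_cycle_pairs pc_out_arcs pc_map_fst pc_fst pc_snd pcr_id)+
qed

definition arc_inst :: "(nat * nat) list * nat => (tmpl * tmpl) \<times> nat list => warc" where
 "arc_inst cv a = ((tinst cv (fst (fst a)), tinst cv (snd (fst a))), snd a)"

definition ctab :: "nat => nat list => ((tmpl * tmpl) \<times> nat list) list" where
 "ctab j p = (if p : perms then tab j p else [])"

definition center_slot :: "nat => center => warc" where
 "center_slot j c = snd (hd ((tl ^^ j) (snd c)))"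

definition slot_arcs :: "nat => center => warc list" where
 "slot_arcs j c = map (arc_inst (fst c # map fst (snd c), snd (fst (center_slot j c)))) (ctab j (snd (center_slot j c)))"

definition center_arcs :: "center => warc list" where
 "center_arcs c = concat (map (%j. slot_arcs j c) [0..<t])"

lemma pc_slot_arcs: "pc (slot_arcs j)"
proof -
 have 1: "pc (%p. arc_inst (fst p) (snd p))" unfolding arc_inst_def by (intro pcr_pair pc_tinst pc_fst pc_snd pcr_id)
 have 2: "pc (center_slot j)" unfolding center_slot_def[abs_def] by (intro pc_fst pc_snd pc_nth pcr_id)
 have 3: "pc (ctab j)" unfolding ctab_def[abs_def] by (rule pc_table[OF fin_perms])
 show ?thesis unfolding slot_arcs_def[abs_def]
  by (rule pc_map[where g = arc_inst, OF 1]) (intro pcr_pair pc_Cons pc_map_fst pc_fst pc_snd 2 pcr_id pcr_comp[OF _ 3])+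
qed

lemma pc_center_arcs: "pc center_arcs"
 unfolding center_arcs_def[abs_def] by (intro pc_concat_const pc_slot_arcs)

definition all_arcs :: "warc list => warc list" where
 "all_arcs as = concat (map center_arcs (center_list as))"

lemma pc_all_arcs: "pcr ea enc as ==> pcr ea enc (%x. all_arcs (as x))"
 unfolding all_arcs_def
 by (rule pc_concat_map[where c = "%_. True" and g = "%_. center_arcs", OF pcr_comp[OF _ pc_center_arcs]]) (intro pc_snd pcr_id pcr_const pc_center_list)+

definition arc_set :: "warc list => warc list" where
 "arc_set as = fold (insert_key fst) (all_arcs as) []"

lemma pc_arc_set: "pcr ea enc as ==> pcr ea enc (%x. arc_set (as x))"
 unfolding arc_set_def by (rule pc_fold_insert_key) (intro pc_less_arc pc_fst pc_snd pcr_id pc_all_arcs)+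

text \<open>At least \<open>2 ^ CB\<close> times the number of arcs, obtained by mapping and
  appending lists instead of multiplying.\<close>

definition big :: "warc list => nat" where
 "big as = num (map (%_. True) (all_arcs as) @ replicate CB True)"

lemma pc_big: "pcr ea enc as ==> pcr ea enc (%x. big (as x))"
 unfolding big_def
 by (intro pc_num pc_append pcr_const, rule pc_map[where c = "%_. True" and g = "%_ _. True"]) (intro pcr_const pc_all_arcs)+

definition weighted :: "nat => warc => (nat * nat) \<times> nat * nat" where
 "weighted b a = (fst a, (if snd a = [] then b else hd (snd a)), 1)"

definition vert_list :: "warc list => nat list" where
 "vert_list as = fold (insert_key (%x. x)) (VH @ concat (map (%a. [fst (fst a), snd (fst a)]) (all_arcs as))) []"

lemma pc_vert_list: "pcr ea enc as ==> pcr ea enc (%x. vert_list (as x))"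
 unfolding vert_list_def
proof (rule pc_fold_insert_key)
 assume as: "pcr ea enc as"
 have "pcr ea enc (%x. concat (map (%a. [fst (fst a), snd (fst a)]) (all_arcs (as x))))"
  by (rule pc_concat_map[where c = "%_. True" and g = "%_ a. [fst (fst a), snd (fst a)]"]) (intro pc_Cons pc_fst pc_snd pcr_id pcr_const pc_all_arcs as)+
 thus "pcr ea enc (%x. VH @ concat (map (%a. [fst (fst a), snd (fst a)]) (all_arcs (as x))))"
  by (intro pc_append pcr_const)
qed (intro pc_less_nat pc_fst pc_snd pcr_id)

definition instance_of :: "warc list => nat list * ((nat * nat) \<times> nat * nat) list" where
 "instance_of as = (vert_list as, map (weighted (big as)) (arc_set as))"

lemma pc_instance_of: "pcr ea enc as ==> pcr ea enc (%x. instance_of (as x))"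
 unfolding instance_of_def
proof (intro pcr_pair pc_vert_list)
 assume as: "pcr ea enc as"
 show "pcr ea enc (%x. map (weighted (big (as x))) (arc_set (as x)))"
  by (rule pc_map[where g = weighted], unfold weighted_def)
   (intro pcr_pair pc_fst pc_snd pcr_id pc_if pc_Nil_iff pc_hd pcr_const pc_big pc_arc_set as)+
qed

text \<open>Costs are compared as lengths of words, so no addition or multiplication has to be
  programmed.\<close>

definition unary :: "nat => bool list" where
 "unary w = (if w : Ws then replicate (scale * w) True else [])"

lemma pc_unary: "pcr ea enc w ==> pcr ea enc (%x. unary (w x))"
 by (erule pcr_comp) (unfold unary_def, rule pc_table[OF fin_Ws])

definition heavy_cut :: "(nat * nat) list => warc => bool" where
 "heavy_cut es a \<longleftrightarrow> snd a = [] & fst a : set es"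

definition cut_unary :: "(nat * nat) list => warc => bool list" where
 "cut_unary es a = (if fst a : set es then unary (hd (snd a)) else [])"

text \<open>The decision drawn from an approximate multicut: it must spare the heavy arcs, and its
  light cost per center must not exceed \<open>thr / scale\<close>.\<close>

definition accepts :: "warc list => (nat * nat) list => bool" where
 "accepts as es \<longleftrightarrow> filter (heavy_cut es) (arc_set as) = [] &
  length (concat (map (cut_unary es) (arc_set as))) <= length (concat (map (%_. replicate thr True) (center_list as)))"

lemma pc_accepts: "pcr ea enc as ==> pcr ea enc es ==> pcr ea enc (%x. accepts (as x) (es x))"
 unfolding accepts_def
proof (intro pc_conj pc_Nil_iff pc_length_le)
 assume a: "pcr ea enc as" and e: "pcr ea enc es"
 show "pcr ea enc (%x. filter (heavy_cut (es x)) (arc_set (as x)))"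
  by (rule pc_filter[where g = heavy_cut, OF _ e pc_arc_set[OF a]], unfold heavy_cut_def)
   (intro pc_conj pc_Nil_iff pc_mem pc_fst pc_snd pcr_id)
 show "pcr ea enc (%x. concat (map (cut_unary (es x)) (arc_set (as x))))"
  by (rule pc_concat_map[where g = cut_unary, OF _ e pc_arc_set[OF a]], unfold cut_unary_def)
   (intro pc_if pc_mem pc_unary pc_hd pc_fst pc_snd pcr_id pcr_const)
 show "pcr ea enc (%x. concat (map (%_. replicate thr True) (center_list (as x))))"
  by (rule pc_concat_map[where g = "%_ _. replicate thr True" and c = "%_. True", OF pcr_const pcr_const pc_center_list[OF a]])
qed

end

section \<open>Cyclic sampling of the constraints at a vertex\<close>

definition sl_of :: "(nat * nat) set => nat => nat * nat => nat * nat" where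
 "sl_of E u b = (let os = filter (%e. fst e = u) (sorted_list_of_set E)
  in os ! (the_inv_into {..<card E} ((!) (sorted_list_of_set E)) b mod length os))"

lemma bij_betw_sorted_nth: "finite E ==> bij_betw ((!) (sorted_list_of_set E)) {..<card E} E"
 by (rule bij_betw_nth) auto

lemma sl_of_nth:
 assumes "finite E" "i < card E" "os = filter (%e. fst e = u) (sorted_list_of_set E)"
 shows "sl_of E u (sorted_list_of_set E ! i) = os ! (i mod length os)"
 using assms bij_betw_sorted_nth[OF assms(1)]
 by (simp add: sl_of_def Let_def bij_betw_def the_inv_into_f_f)

text \<open>A residue class has at most \<open>m div d + 1\<close> members, and
  \<open>d <= m\<close> absorbs the 1; this rounding is the factor 2 in
  \<open>balanced\<close>.\<close>

lemma card_residue_class: "0 < d ==> d <= m ==> d * card {i. i < m & i mod d = r} <= 2 * (m::nat)"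
proof -
 assume d: "0 < d" "d <= m"
 have "card {i. i < m & i mod d = r} <= card {..m div d}"
 proof (rule card_inj_on_le[where f = "%i. i div d"])
  show "inj_on (%i. i div d) {i. i < m & i mod d = r}" by (rule inj_onI) (metis (mono_tags, lifting) mem_Collect_eq mult_div_mod_eq)
 qed (auto intro: div_le_mono)
 hence "card {i. i < m & i mod d = r} <= m div d + 1" by simp
 hence "d * card {i. i < m & i mod d = r} <= d * (m div d + 1)" by (rule mult_le_mono2)
 also have "... <= m + d" by simp
 finally show ?thesis using d by simp
qed

lemma sl_of_in:
 assumes "finite E" "a : E" "b : E"
 shows "sl_of E (fst a) b : E & fst (sl_of E (fst a) b) = fst a"
proof -
 define os where "os = filter (%e. fst e = fst a) (sorted_list_of_set E)"
 have "a : set os" using assms by (simp add: os_def)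
 hence "0 < length os" by (cases os) auto
 hence "os ! (n mod length os) : set os" for n by (intro nth_mem mod_less_divisor)
 hence "sl_of E (fst a) b : set os" unfolding sl_of_def Let_def os_def .
 thus ?thesis using assms by (simp add: os_def)
qed

lemma sl_of_balanced:
 assumes E: "finite E" and e: "e : E"
 shows "card {a : E. fst a = fst e} * card {b : E. sl_of E (fst e) b = e} <= 2 * card E"
proof -
 define L os where "L = sorted_list_of_set E" and "os = filter (%a. fst a = fst e) L"
 have dos: "distinct os" "set os = {a : E. fst a = fst e}" using E by (auto simp: os_def L_def)
 have d: "length os = card {a : E. fst a = fst e}" using dos distinct_card by metis
 have "e : set os" using e dos by simp
 then obtain r where r: "r < length os" "os ! r = e" by (auto simp: in_set_conv_nth)
 have "{b : E. sl_of E (fst e) b = e} <= (!) L ` {i. i < card E & i mod length os = r}"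
 proof
  fix b assume b: "b : {b : E. sl_of E (fst e) b = e}"
  then obtain i where i: "i < card E" "b = L ! i" using bij_betw_sorted_nth[OF E] unfolding L_def bij_betw_def by blast
  have "os ! (i mod length os) = e" using sl_of_nth[OF E i(1), of os "fst e"] b i(2) by (simp add: os_def L_def)
  hence "i mod length os = r" using r dos(1) by (metis mod_less_divisor nth_eq_iff_index_eq gr_implies_not0 neq0_conv)
  thus "b : (!) L ` {i. i < card E & i mod length os = r}" using i by blast
 qed
 hence "card {b : E. sl_of E (fst e) b = e} <= card {i. i < card E & i mod length os = r}"
  by (rule surj_card_le[rotated]) simp
 hence "length os * card {b : E. sl_of E (fst e) b = e} <= length os * card {i. i < card E & i mod length os = r}" by simp
 also have "... <= 2 * card E" using r(1) card_mono[OF E, of "{a : E. fst a = fst e}"] unfolding d[symmetric] by (intro card_residue_class) auto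
 finally show ?thesis unfolding d .
qed

text \<open>The arcs of one slot with the center left open, one family for each kind of arc. Only
  the slot number and the permutation enter, so finitely many tables suffice for games of every
  size.\<close>

definition templates :: "(nat * nat) set => (nat * nat) set => (nat * nat => nat) => (nat * nat => nat) => nat => nat => nat => nat list
  => ((tmpl * tmpl) \<times> nat list) set" where
 "templates Fd E0 X W D k j p =
  (%(e, y). (((0, fst e, e, []), (1, 0, e, y)), [])) ` ({e : E0. fst e : fst ` Fd} \<times> cube D k) \<union>
  (%(e, y). (((1, 0, e, y), (2, j, e, y)), [W e])) ` (E0 \<times> cube D k) \<union>
  (%(e, z). (((2, j, e, permute k ((!) p) z), (3, 0, e, z)), [])) ` (E0 \<times> cube D k) \<union>
  (%(e, e', z, y). (((3, 0, e, z), (1, 0, e', y)), [])) ` {(e, e', z, y). e : E0 & e' : E0 & z : cube D k & y : cube D k &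
    snd e = fst e' & compat D (X e) (permute k ((!) p) z) y} \<union>
  (%(e, z). (((3, 0, e, z), (0, snd e, e, [])), [])) ` ({e : E0. snd e : snd ` Fd} \<times> cube D k)"

lemma finite_templates: "finite E0 ==> finite (templates Fd E0 X W D k j p)"
proof -
 assume E0: "finite E0"
 have "finite {(e, e', z, y). e : E0 & e' : E0 & z : cube D k & y : cube D k & snd e = fst e' & compat D (X e) (permute k ((!) p) z) y}"
  by (rule finite_subset[of _ "E0 \<times> E0 \<times> cube D k \<times> cube D k"]) (auto simp: E0 finite_cube)
 thus ?thesis unfolding templates_def by (auto simp: E0 finite_cube)
qed

lemma permute_cong: "(!!r. r < k ==> f r = g r) ==> permute k f z = permute k g z"
 by (simp add: permute_def)

lemma funpow_tl: "(tl ^^ j) xs = drop j xs"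
 by (induction j) (auto simp: drop_Suc tl_drop)

lemma enc_rat_of_nat: "enc_rat (of_nat n) = enc n @ enc (1::nat)"
proof -
 have "quotient_of (of_nat n) = (int n, 1)" using quotient_of_int[of "int n"] by simp
 thus ?thesis by (simp add: enc_rat_def enc_nat_def')
qed

lemma enc_map: "enc (map f xs) = enc_list (%x. enc (f x)) xs"
 by (induction xs) auto

section \<open>The program computes the constructed graph\<close>

locale coded_reduction = reduction Fd E0 X W D k t E \<pi> "sl_of E" +
  program B CB t VH tab "W ` E0" scale thr "{p. length p = k & set p <= {..<k}}"
 for Fd E0 :: "(nat * nat) set" and X W :: "nat * nat => nat" and D k t :: nat and E \<pi> B CB VH tab scale thr +
 assumes tab: "j < t ==> length p = k ==> set p <= {..<k} ==> set (tab j p) = templates Fd E0 X W D k j p"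
  and small: "h : fst ` Fd Un snd ` Fd ==> h < 2 ^ B"
begin

primrec ncode :: "node => nat" where
 "ncode (Term h) = h"
| "ncode (Hub c e y) = code (1, 0, c, e, y)"
| "ncode (Slot c j e y) = code (2, j, c, e, y)"
| "ncode (Leaf v e z) = code (3, 0, [(v, v)], e, z)"

definition acode :: "node * node => nat * nat" where
 "acode a = (ncode (fst a), ncode (snd a))"

definition nodes :: "node set" where
 "nodes = {n. \<forall>h. n = Term h --> h < 2 ^ B}"

lemma inj_ncode: "inj_on ncode nodes"
proof (rule inj_onI)
 fix n n' assume "n : nodes" "n' : nodes" and eq: "ncode n = ncode n'"
 have code: "h < 2 ^ B ==> h ~= code nm" "h < 2 ^ B ==> code nm ~= h" for h nm using code_ge[of nm] by auto
 show "n = n'" using eq \<open>n : nodes\<close> \<open>n' : nodes\<close>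
  by (cases n; cases n') (auto simp: nodes_def code_eq_iff dest: code)
qed

definition graph :: "(node * node) set" where
 "graph = light Un heavy"

definition wlist :: "node * node => nat list" where
 "wlist a = (case a of (Hub c e y, Slot c' j e' y') => [W e] | _ => [])"

lemma light_wlist: "a : light ==> wlist a ~= []" by (auto simp: light_def wlist_def)

lemma heavy_wlist: "a : heavy ==> wlist a = []" by (cases a) (auto simp: wlist_def elim!: heavy.cases)

lemma graph_nodes: "(n, n') : graph ==> n : nodes & n' : nodes"
 unfolding graph_def light_def nodes_def using small by (auto elim!: heavy.cases)

lemma inj_acode: "inj_on acode graph"
proof (rule inj_onI)
 fix a b assume a: "a : graph" and b: "b : graph" and eq: "acode a = acode b"
 have "fst a : nodes" "snd a : nodes" "fst b : nodes" "snd b : nodes"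
  using graph_nodes[of "fst a" "snd a"] graph_nodes[of "fst b" "snd b"] a b by auto
 thus "a = b" using eq inj_onD[OF inj_ncode] by (auto simp: acode_def prod_eq_iff)
qed

definition local_arcs :: "(nat * nat) list => nat => (node * node) set" where
 "local_arcs c j =
  (%(e, y). (Term (fst e), Hub c e y)) ` ({e : E0. fst e : fst ` Fd} \<times> cube D k) \<union>
  (%(e, y). (Hub c e y, Slot c j e y)) ` (E0 \<times> cube D k) \<union>
  (%(e, z). (Slot c j e (permute k (\<pi> (slot c j)) z), Leaf (snd (slot c j)) e z)) ` (E0 \<times> cube D k) \<union>
  (%(e, e', z, y). (Leaf (snd (slot c j)) e z, Hub c e' y)) ` {(e, e', z, y). e : E0 & e' : E0 & z : cube D k & y : cube D k &
    snd e = fst e' & compat D (X e) (permute k (\<pi> (slot c j)) z) y} \<union>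
  (%(e, z). (Leaf (snd (slot c j)) e z, Term (snd e))) ` ({e : E0. snd e : snd ` Fd} \<times> cube D k)"

lemma local_arcs_subset:
 assumes "c : centers" "j < t"
 shows "local_arcs c j <= graph"
 unfolding local_arcs_def graph_def
proof (intro Un_least image_subsetI)
 fix p assume "p : E0 \<times> cube D k"
 then obtain e y where p: "p = (e, y)" "e : E0" "y : cube D k" by blast
 have "(Hub c e y, Slot c j e y) : light" using assms p unfolding light_def by blast
 thus "(case p of (e, y) => (Hub c e y, Slot c j e y)) : light Un heavy" using p(1) by simp
 show "(case p of (e, z) => (Slot c j e (permute k (\<pi> (slot c j)) z), Leaf (snd (slot c j)) e z)) : light Un heavy"
  using heavy.Slot_Leaf[OF assms p(2,3)] p(1) by simp
next
 fix p assume "p : {e : E0. fst e : fst ` Fd} \<times> cube D k"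
 then obtain e y where p: "p = (e, y)" "e : E0" "fst e : fst ` Fd" "y : cube D k" by blast
 show "(case p of (e, y) => (Term (fst e), Hub c e y)) : light Un heavy"
  using heavy.Term_Hub[OF assms(1) p(2,4,3)] p(1) by simp
next
 fix p assume "p : {e : E0. snd e : snd ` Fd} \<times> cube D k"
 then obtain e y where p: "p = (e, y)" "e : E0" "snd e : snd ` Fd" "y : cube D k" by blast
 show "(case p of (e, z) => (Leaf (snd (slot c j)) e z, Term (snd e))) : light Un heavy"
  using heavy.Leaf_Term[OF assms p(2,4,3)] p(1) by simp
next
 fix p assume "p : {(e, e', z, y). e : E0 & e' : E0 & z : cube D k & y : cube D k &
    snd e = fst e' & compat D (X e) (permute k (\<pi> (slot c j)) z) y}"
 then obtain e e' z y where p: "p = (e, e', z, y)" "e : E0" "e' : E0" "z : cube D k" "y : cube D k"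
    "snd e = fst e'" "compat D (X e) (permute k (\<pi> (slot c j)) z) y" by blast
 show "(case p of (e, e', z, y) => (Leaf (snd (slot c j)) e z, Hub c e' y)) : light Un heavy"
  using heavy.Leaf_Hub[OF assms p(2,3,6,4,5,7)] p(1) by simp
qed

text \<open>Arcs out of sources mention no slot and recur at every slot of the center;
  \<open>1 <= t\<close> provides slot 0 for them.\<close>

lemma graph_local_arcs: "graph = (\<Union>c\<in>centers. \<Union>j<t. local_arcs c j)"
proof
 show "(\<Union>c\<in>centers. \<Union>j<t. local_arcs c j) <= graph" using local_arcs_subset by blast
 have mem: "a : (\<Union>c\<in>centers. \<Union>j<t. local_arcs c j)" if "c : centers" "j < t" "a : local_arcs c j" for a c j using that by blast
 show "graph <= (\<Union>c\<in>centers. \<Union>j<t. local_arcs c j)"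
 proof
  fix a assume "a : graph"
  then consider "a : light" | "a : heavy" by (auto simp: graph_def)
  thus "a : (\<Union>c\<in>centers. \<Union>j<t. local_arcs c j)"
  proof cases
   case 1
   then obtain c e y j where a: "a = (Hub c e y, Slot c j e y)" "c : centers" "e : E0" "y : cube D k" "j < t" unfolding light_def by blast
   hence "a : (%(e, y). (Hub c e y, Slot c j e y)) ` (E0 \<times> cube D k)" by (intro image_eqI[of _ _ "(e, y)"]) simp_all
   thus ?thesis by (intro mem[OF a(2,5)]) (simp add: local_arcs_def)
  next
   case 2
   then obtain n n' where "a = (n, n')" "(n, n') : heavy" by (cases a) auto
   from this(2) show ?thesis
   proof cases
    case (Term_Hub c e y)
    hence "a : (%(e, y). (Term (fst e), Hub c e y)) ` ({e : E0. fst e : fst ` Fd} \<times> cube D k)"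
     using \<open>a = (n, n')\<close> by (intro image_eqI[of _ _ "(e, y)"]) simp_all
    thus ?thesis using t by (intro mem[OF Term_Hub(3), of 0]) (simp_all add: local_arcs_def)
   next
    case (Slot_Leaf c j e z)
    hence "a : (%(e, z). (Slot c j e (permute k (\<pi> (slot c j)) z), Leaf (snd (slot c j)) e z)) ` (E0 \<times> cube D k)"
     using \<open>a = (n, n')\<close> by (intro image_eqI[of _ _ "(e, z)"]) simp_all
    thus ?thesis by (intro mem[OF Slot_Leaf(3,4)]) (simp add: local_arcs_def)
   next
    case (Leaf_Hub c j e e' z y)
    hence "a : (%(e, e', z, y). (Leaf (snd (slot c j)) e z, Hub c e' y)) ` {(e, e', z, y). e : E0 & e' : E0 & z : cube D k & y : cube D k &
      snd e = fst e' & compat D (X e) (permute k (\<pi> (slot c j)) z) y}"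
     using \<open>a = (n, n')\<close> by (intro image_eqI[of _ _ "(e, e', z, y)"]) simp_all
    thus ?thesis by (intro mem[OF Leaf_Hub(3,4)]) (simp add: local_arcs_def)
   next
    case (Leaf_Term c j e z)
    hence "a : (%(e, z). (Leaf (snd (slot c j)) e z, Term (snd e))) ` ({e : E0. snd e : snd ` Fd} \<times> cube D k)"
     using \<open>a = (n, n')\<close> by (intro image_eqI[of _ _ "(e, z)"]) simp_all
    thus ?thesis by (intro mem[OF Leaf_Term(3,4)]) (simp add: local_arcs_def)
   qed
  qed
 qed
qed

definition plist :: "nat * nat => nat list" where
 "plist e = map (\<pi> e) [0..<k]"

definition input :: "warc list" where
 "input = map (%e. (e, plist e)) (sorted_list_of_set E)"

lemma arc_inst_templates:
 assumes "c : centers" "j < t"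
 shows "arc_inst (c, snd (slot c j)) ` templates Fd E0 X W D k j (plist (slot c j)) = (%a. (acode a, wlist a)) ` local_arcs c j"
proof -
 have p: "permute k ((!) (plist (slot c j))) z = permute k (\<pi> (slot c j)) z" for z
  by (rule permute_cong) (simp add: plist_def)
 show ?thesis unfolding templates_def local_arcs_def p
  by (simp add: image_Un image_image case_prod_beta arc_inst_def tinst_def acode_def wlist_def)
qed

lemma set_cycle_input:
 assumes "a : E"
 shows "set (cycle_pairs (out_arcs (fst a) input) (map fst input)) = (%b. (b, (sl_of E (fst a) b, plist (sl_of E (fst a) b)))) ` E"
  and "length (cycle_pairs (out_arcs (fst a) input) (map fst input)) = card E"
proof -
 define L os where "L = sorted_list_of_set E" and "os = filter (%e. fst e = fst a) L"
 let ?h = "%e. (e, plist e)"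
 have f: "map fst input = L" by (simp add: input_def L_def comp_def)
 have o: "out_arcs (fst a) input = map ?h os" by (simp add: out_arcs_def input_def os_def L_def filter_map comp_def)
 have "a : set os" using assms fin_E by (simp add: os_def L_def)
 hence ne: "os ~= []" by auto
 hence ne': "map ?h os ~= []" by simp
 have lL: "length L = card E" by (simp add: L_def)
 have "set (cycle_pairs (map ?h os) L) = (%i. (L ! i, map ?h os ! (i mod length (map ?h os)))) ` {..<length L}" by (rule set_cycle_pairs[OF ne'])
 also have "... = (%i. (%b. (b, (sl_of E (fst a) b, plist (sl_of E (fst a) b)))) (L ! i)) ` {..<card E}"
 proof (rule image_cong)
  fix i assume "i : {..<card E}"
  hence "sl_of E (fst a) (L ! i) = os ! (i mod length os)" unfolding L_def by (intro sl_of_nth fin_E) (auto simp: os_def L_def)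
  moreover have "i mod length os < length os" using ne by simp
  ultimately show "(L ! i, map ?h os ! (i mod length (map ?h os))) = (L ! i, (sl_of E (fst a) (L ! i), plist (sl_of E (fst a) (L ! i))))" by simp
 qed (simp add: lL)
 also have "... = (%b. (b, (sl_of E (fst a) b, plist (sl_of E (fst a) b)))) ` ((!) L ` {..<card E})" by (simp only: image_image)
 also have "(!) L ` {..<card E} = E" using bij_betw_sorted_nth[OF fin_E] by (simp add: L_def bij_betw_def)
 finally show "set (cycle_pairs (out_arcs (fst a) input) (map fst input)) = (%b. (b, (sl_of E (fst a) b, plist (sl_of E (fst a) b)))) ` E"
  unfolding f o .
 show "length (cycle_pairs (out_arcs (fst a) input) (map fst input)) = card E" unfolding f o length_cycle_pairs[OF ne'] lL ..
qed

lemma set_input: "set input = (%e. (e, plist e)) ` E"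
 using fin_E by (simp add: input_def)

lemma set_centers_at:
 assumes "e : E"
 shows "set (centers_at input (e, plist e)) = Pair e ` {tup. length tup = t & set tup <= (%b. (b, (sl_of E (fst e) b, plist (sl_of E (fst e) b)))) ` E}"
  and "length (centers_at input (e, plist e)) = card E ^ t"
 by (simp_all add: centers_at_def set_tuples length_tuples set_cycle_input[OF assms])

definition full_center :: "(nat * nat) list => center" where
 "full_center c = (c ! 0, map (%j. (c ! Suc j, (slot c j, plist (slot c j)))) [0..<t])"

lemma set_center_list: "set (center_list input) = full_center ` centers"
proof (intro set_eqI iffI)
 fix x assume "x : set (center_list input)"
 then obtain e tup where e: "e : E" and x: "x = (e, tup)" and tup: "length tup = t"
   "set tup <= (%b. (b, (sl_of E (fst e) b, plist (sl_of E (fst e) b)))) ` E"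
  unfolding center_list_def set_concat set_map set_input image_image using set_centers_at(1) by blast
 define c where "c = e # map fst tup"
 have tj: "\<exists>b\<in>E. tup ! j = (b, (sl_of E (fst e) b, plist (sl_of E (fst e) b)))" if "j < t" for j
 proof -
  have "tup ! j : set tup" using tup(1) that by simp
  hence "tup ! j : (%b. (b, (sl_of E (fst e) b, plist (sl_of E (fst e) b)))) ` E" by (rule subsetD[OF tup(2)])
  thus ?thesis by blast
 qed
 have fE: "fst (tup ! j) : E" if "j < t" for j using tj[OF that] by auto
 have "set (map fst tup) <= E"
 proof
  fix x assume "x : set (map fst tup)"
  then obtain j where "j < length (map fst tup)" "x = map fst tup ! j" by (metis in_set_conv_nth)
  thus "x : E" using fE tup(1) by simp
 qed
 hence "c : centers" using e tup(1) by (simp add: centers_def c_def)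
 moreover have "full_center c = x" unfolding full_center_def x
 proof (intro arg_cong2[where f = Pair] nth_equalityI)
  fix j assume "j < length (map (%j. (c ! Suc j, slot c j, plist (slot c j))) [0..<t])"
  hence j: "j < t" by simp
  thus "map (%j. (c ! Suc j, slot c j, plist (slot c j))) [0..<t] ! j = tup ! j"
   using tj[OF j] tup(1) by (auto simp: slot_def c_def)
 qed (simp_all add: c_def tup(1))
 ultimately show "x : full_center ` centers" by blast
next
 fix x assume "x : full_center ` centers"
 then obtain c where c: "c : centers" "x = full_center c" by blast
 have "c ! 0 : E" using center_nth[OF c(1)] by simp
 moreover have "set (snd x) <= (%b. (b, (sl_of E (fst (c ! 0)) b, plist (sl_of E (fst (c ! 0)) b)))) ` E"
  using center_nth[OF c(1)] by (auto simp: c(2) full_center_def slot_def)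
 ultimately have "x : set (centers_at input (c ! 0, plist (c ! 0)))"
  unfolding set_centers_at(1)[OF \<open>c ! 0 : E\<close>] by (intro image_eqI[of _ _ "snd x"]) (simp_all add: c(2) full_center_def)
 thus "x : set (center_list input)" using \<open>c ! 0 : E\<close> unfolding center_list_def set_concat set_map set_input by blast
qed

lemma length_center_list: "length (center_list input) = card centers"
proof -
 have "length (centers_at input a) = card E ^ t" if "a : set input" for a
  using that set_centers_at(2) unfolding set_input by blast
 hence "map (%a. length (centers_at input a)) input = map (%_. card E ^ t) input" by simp
 hence "length (center_list input) = (\<Sum>a\<leftarrow>input. card E ^ t)"
  unfolding center_list_def length_concat map_map comp_def by (simp only:)
 also have "... = card E * card E ^ t" by (subst sum_list_triv) (simp add: input_def)
 finally show ?thesis by (simp add: card_centers)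
qed

lemma set_all_arcs: "set (all_arcs input) = (%a. (acode a, wlist a)) ` graph"
proof -
 have "set (slot_arcs j (full_center c)) = (%a. (acode a, wlist a)) ` local_arcs c j" if c: "c : centers" and j: "j < t" for c j
 proof -
  have s: "center_slot j (full_center c) = (slot c j, plist (slot c j))"
   using j by (simp add: center_slot_def full_center_def funpow_tl hd_drop_conv_nth)
  have n: "fst (full_center c) # map fst (snd (full_center c)) = c"
   using c by (intro nth_equalityI) (auto simp: full_center_def centers_def comp_def nth_Cons split: nat.split)
  have "\<pi> (slot c j) ` {..<k} = {..<k}" using slot_E[OF c j] bij by (auto simp: bij_betw_def)
  hence p: "length (plist (slot c j)) = k" "set (plist (slot c j)) <= {..<k}" by (auto simp: plist_def)
  show ?thesis unfolding slot_arcs_def s n set_map ctab_def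
   using arc_inst_templates[OF c j] tab[OF j p] p by simp
 qed
 thus ?thesis unfolding all_arcs_def center_arcs_def graph_local_arcs
  by (simp add: set_center_list image_UN atLeast0LessThan)
qed

lemma fin_graph: "finite graph"
proof (rule finite_imageD)
 have "acode ` graph = fst ` set (all_arcs input)" by (simp add: set_all_arcs image_image)
 thus "finite (acode ` graph)" by simp
qed (rule inj_acode)

text \<open>Recovers the weight list from the coded arc alone, as \<open>fold_insert_key\<close>
  demands of data attached to a key.\<close>

definition deco :: "nat * nat => warc" where
 "deco p = (p, wlist (inv_into graph acode p))"

lemma deco_acode: "a : graph ==> deco (acode a) = (acode a, wlist a)"
 by (simp add: deco_def inv_into_f_f[OF inj_acode])

lemma arc_set_input: "arc_set input = map deco (sorted_list_of_set (acode ` graph))"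
proof -
 have "fold (insert_key fst) (all_arcs input) [] = map deco (sorted_list_of_set (fst ` set (all_arcs input)))"
 proof (rule fold_insert_key)
  fix x assume "x : set (all_arcs input)"
  then obtain a where "a : graph" "x = (acode a, wlist a)" by (auto simp: set_all_arcs)
  thus "x = deco (fst x)" using deco_acode by simp
 qed (simp add: deco_def)
 thus ?thesis by (simp add: arc_set_def set_all_arcs image_image)
qed

definition inst_graph :: "nat pair_pre_digraph" where
 "inst_graph = \<lparr>pverts = set VH Un fst ` acode ` graph Un snd ` acode ` graph, parcs = acode ` graph\<rparr>"

definition inst_weight :: "nat * nat => rat" where
 "inst_weight p = of_nat (fst (snd (weighted (big input) (deco p))))"

lemma inst_weight_acode: "a : graph ==> inst_weight (acode a) = of_nat (if wlist a = [] then big input else hd (wlist a))"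
 by (simp add: inst_weight_def weighted_def deco_acode)

text \<open>Bit for bit, the program's output is the word on which the approximation algorithm is
  guaranteed to work.\<close>

lemma enc_instance: "enc (instance_of input) = enc_digraph (%e. enc_rat (inst_weight e)) inst_graph"
proof -
 have "vert_list input = map (%x. x) (sorted_list_of_set ((%x. x) ` set (VH @ concat (map (%a. [fst (fst a), snd (fst a)]) (all_arcs input)))))"
  unfolding vert_list_def by (rule fold_insert_key) simp_all
 also have "(%x. x) ` set (VH @ concat (map (%a. [fst (fst a), snd (fst a)]) (all_arcs input))) = pverts inst_graph"
  by (auto simp: inst_graph_def set_all_arcs image_image)
 finally have v: "vert_list input = sorted_list_of_set (pverts inst_graph)" by simp
 have w: "enc (weighted (big input) (deco p)) = enc_arc p @ enc_rat (inst_weight p)" for p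
  by (cases p) (simp add: weighted_def deco_def inst_weight_def enc_rat_of_nat enc_arc_def enc_nat_def')
 have "enc (map (weighted (big input)) (arc_set input)) = enc_list (%e. enc_arc e @ enc_rat (inst_weight e)) (sorted_list_of_set (parcs inst_graph))"
  unfolding arc_set_input map_map comp_def enc_map w by (simp add: inst_graph_def)
 thus ?thesis by (simp add: instance_of_def enc_digraph_def v enc_list_def' enc_nat_def')
qed

lemma inst_graph_wf: "pair_fin_digraph inst_graph"
 by unfold_locales (auto simp: inst_graph_def fin_graph)

lemma inst_multicut_instance: "pverts H <= set VH ==> multicut_instance H inst_graph (%e. of_rat (inst_weight e))"
 using inst_graph_wf by (auto simp: multicut_instance_def inst_graph_def inst_weight_def)

definition cut_of :: "(nat * nat) set => (node * node) set" where
 "cut_of es = {a : graph. acode a : es}"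

lemma separates_if_multicut:
 assumes H: "pair_digraph H" "parcs H = Fd" "pverts H <= set VH" and es: "multicut H inst_graph es"
 shows "separates (cut_of es)"
 unfolding separates_def
proof (intro ballI, clarify)
 interpret H: pair_digraph H by (rule H(1))
 interpret I: pair_fin_digraph inst_graph by (rule inst_graph_wf)
 fix s d assume sd: "(s, d) : Fd" and r: "(Term s, Term d) : (light Un heavy - cut_of es)\<^sup>*"
 have "(ncode n, ncode n') : (parcs inst_graph - es)\<^sup>*" if "(n, n') : (light Un heavy - cut_of es)\<^sup>*" for n n' using that
 proof (induction rule: rtrancl_induct)
  case (step x y)
  have "(x, y) : graph" "(x, y) ~: cut_of es" using step.hyps by (auto simp: graph_def)
  hence "acode (x, y) : parcs inst_graph - es" by (auto simp: cut_of_def inst_graph_def)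
  hence "(ncode x, ncode y) : parcs inst_graph - es" by (simp add: acode_def)
  thus ?case using step.IH by (rule rtrancl_into_rtrancl[rotated])
 qed simp
 from this[OF r] have "(s, d) : (parcs inst_graph - es)\<^sup>*" by simp
 moreover have "pverts H <= pverts inst_graph" using H(3) by (auto simp: inst_graph_def)
 ultimately show False
  using es sd H(2) multicut_iff_rtrancl[OF I.pair_wf_digraph_axioms _ H.pair_wf_digraph_axioms, of es] by blast
qed

text \<open>A path between coded terminals lifts to the abstract graph, because codes are injective
  on nodes.\<close>

lemma multicut_if_separates:
 assumes H: "pair_digraph H" "parcs H = Fd" "pverts H <= set VH" and K: "K <= graph" "separates K"
 shows "multicut H inst_graph (acode ` K)"
proof -
 interpret H: pair_digraph H by (rule H(1))
 interpret I: pair_fin_digraph inst_graph by (rule inst_graph_wf)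
 have lift: "(p, q) : (acode ` graph - acode ` K)\<^sup>* ==> p = ncode n ==> n : nodes ==> \<exists>n'\<in>nodes. q = ncode n' & (n, n') : (graph - K)\<^sup>*" for p q n
 proof (induction rule: rtrancl_induct)
  case (step q q')
  then obtain n' where n': "n' : nodes" "q = ncode n'" "(n, n') : (graph - K)\<^sup>*" by blast
  obtain x y where xy: "(x, y) : graph" "(q, q') = acode (x, y)" "(x, y) ~: K" using step.hyps(2) by force
  have "ncode x = ncode n'" and q': "q' = ncode y" using xy(2) n'(2) by (simp_all add: acode_def)
  moreover have nd: "x : nodes" "y : nodes" using graph_nodes[OF xy(1)] by blast+
  ultimately have "x = n'" using inj_ncode n'(1) by (meson inj_onD)
  hence "(n', y) : graph - K" using xy by blast
  with n'(3) have "(n, y) : (graph - K)\<^sup>*" by (rule rtrancl_into_rtrancl)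
  thus ?case using q' nd(2) by blast
 qed auto
 have "(s, d) ~: (acode ` graph - acode ` K)\<^sup>*" if sd: "(s, d) : Fd" for s d
 proof
  assume "(s, d) : (acode ` graph - acode ` K)\<^sup>*"
  moreover have sm: "Term s : nodes" "Term d : nodes" using small sd by (force simp: nodes_def)+
  ultimately obtain n' where n': "n' : nodes" "d = ncode n'" "(Term s, n') : (graph - K)\<^sup>*" using lift[of s d "Term s"] by fastforce
  have "ncode n' = ncode (Term d)" using n'(2) by simp
  hence "n' = Term d" using inj_ncode n'(1) sm(2) by (meson inj_onD)
  hence "(Term s, Term d) : (light Un heavy - K)\<^sup>*" using n'(3) by (simp only: graph_def)
  thus False using K(2) sd unfolding separates_def by blast
 qed
 moreover have "pverts H <= pverts inst_graph" using H(3) by (auto simp: inst_graph_def)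
 ultimately show ?thesis using multicut_iff_rtrancl[OF I.pair_wf_digraph_axioms _ H.pair_wf_digraph_axioms, of "acode ` K"] H(2) K(1)
  by (auto simp: inst_graph_def)
qed

lemma sum_wlist:
 assumes "K <= light"
 shows "(\<Sum>a\<in>K. hd (wlist a)) = cost K"
proof -
 let ?f = "%(c, e, j, y). (Hub c e y, Slot c j e y)"
 let ?S = "SIGMA c:centers. SIGMA e:E0. {(j, y). j < t & y : cube D k & (Hub c e y, Slot c j e y) : K}"
 have inj: "inj_on ?f ?S" by (auto simp: inj_on_def)
 have "K = ?f ` ?S"
 proof
  show "K <= ?f ` ?S"
  proof
   fix a assume a: "a : K"
   then obtain c e y j where "a = (Hub c e y, Slot c j e y)" "c : centers" "e : E0" "y : cube D k" "j < t"
    using assms unfolding light_def by blast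
   thus "a : ?f ` ?S" using a by (intro image_eqI[of _ _ "(c, e, j, y)"]) auto
  qed
 qed auto
 hence "(\<Sum>a\<in>K. hd (wlist a)) = (\<Sum>a\<in>?f ` ?S. hd (wlist a))" by simp
 also have "... = (\<Sum>x\<in>?S. hd (wlist (?f x)))" by (subst sum.reindex[OF inj]) simp
 also have "... = (\<Sum>(c, e, j, y)\<in>?S. W e)" by (rule sum.cong) (auto simp: wlist_def)
 also have "... = (\<Sum>c\<in>centers. \<Sum>(e, j, y)\<in>(SIGMA e:E0. {(j, y). j < t & y : cube D k & (Hub c e y, Slot c j e y) : K}). W e)"
  using fin_centers fin_E0 fin_cut by (subst sum.Sigma[symmetric]) auto
 also have "... = (\<Sum>c\<in>centers. \<Sum>e\<in>E0. \<Sum>(j, y)\<in>{(j, y). j < t & y : cube D k & (Hub c e y, Slot c j e y) : K}. W e)"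
  using fin_E0 fin_cut by (intro sum.cong refl) (subst sum.Sigma[symmetric], auto)
 also have "... = cost K" unfolding cost_def ncut_def by (simp add: case_prod_beta mult.commute)
 finally show ?thesis .
qed

lemma cost_light: "cost (K Int light) = cost K"
proof -
 have "ncut (K Int light) c e = ncut K c e" if "c : centers" "e : E0" for c e
  unfolding ncut_def
 proof (rule arg_cong[of _ _ card], rule set_eqI)
  fix p :: "nat * nat list"
  obtain j y where p: "p = (j, y)" by (cases p)
  have "(Hub c e y, Slot c j e y) : light" if "j < t" "y : cube D k" using \<open>c : centers\<close> \<open>e : E0\<close> that unfolding light_def by blast
  thus "p : {(j, y). j < t & y : cube D k & (Hub c e y, Slot c j e y) : K Int light} \<longleftrightarrow> p : {(j, y). j < t & y : cube D k & (Hub c e y, Slot c j e y) : K}"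
   using p by auto
 qed
 thus ?thesis by (simp add: cost_def)
qed

lemma accepts_iff:
 "accepts input es \<longleftrightarrow> cut_of (set es) Int heavy = {} & scale * cost (cut_of (set es)) <= thr * card centers"
proof -
 let ?L = "sorted_list_of_set (acode ` graph)"
 have h: "filter (heavy_cut es) (arc_set input) = [] \<longleftrightarrow> cut_of (set es) Int heavy = {}"
 proof -
  have "filter (heavy_cut es) (arc_set input) = [] \<longleftrightarrow> (\<forall>a\<in>graph. ~ heavy_cut es (deco (acode a)))"
   unfolding arc_set_input filter_empty_conv set_map using fin_graph by auto
  also have "... \<longleftrightarrow> (\<forall>a\<in>graph. ~ (wlist a = [] & acode a : set es))" by (simp add: heavy_cut_def deco_acode)
  also have "... \<longleftrightarrow> cut_of (set es) Int heavy = {}"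
   using light_wlist heavy_wlist unfolding cut_of_def graph_def by blast
  finally show ?thesis .
 qed
 have "length (concat (map (cut_unary es) (arc_set input))) = scale * cost (cut_of (set es))" if nh: "cut_of (set es) Int heavy = {}"
 proof -
  let ?K = "cut_of (set es)"
  have light: "?K <= light" using nh by (auto simp: cut_of_def graph_def)
  have "length (concat (map (cut_unary es) (arc_set input))) = (\<Sum>p\<leftarrow>?L. length (cut_unary es (deco p)))"
   by (simp add: length_concat arc_set_input comp_def)
  also have "... = (\<Sum>p\<in>acode ` graph. length (cut_unary es (deco p)))"
   using fin_graph by (simp add: sum_list_distinct_conv_sum_set)
  also have "... = (\<Sum>a\<in>graph. length (cut_unary es (deco (acode a))))" by (subst sum.reindex[OF inj_acode]) simp
  also have "... = (\<Sum>a\<in>graph. if a : ?K then scale * hd (wlist a) else 0)"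
  proof (rule sum.cong[OF refl])
   fix a assume a: "a : graph"
   have "hd (wlist a) : W ` E0" if "a : ?K" using light that by (auto simp: light_def wlist_def)
   thus "length (cut_unary es (deco (acode a))) = (if a : ?K then scale * hd (wlist a) else 0)"
    using a by (auto simp: cut_unary_def deco_acode unary_def cut_of_def)
  qed
  also have "... = (\<Sum>a\<in>graph \<inter> ?K. scale * hd (wlist a))" using fin_graph by (rule sum.inter_restrict[symmetric])
  also have "graph Int ?K = ?K" by (auto simp: cut_of_def)
  also have "(\<Sum>a\<in>?K. scale * hd (wlist a)) = scale * cost ?K" by (simp add: sum_wlist[OF light] flip: sum_distrib_left)
  finally show ?thesis .
 qed
 moreover have "length (concat (map (%_. replicate thr True) (center_list input))) = thr * card centers"
  by (simp add: length_concat comp_def sum_list_triv length_center_list mult.commute)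
 ultimately show ?thesis unfolding accepts_def h by auto
qed

text \<open>The approximate solution weighs at most \<open>max \<beta> 0\<close> times the cost of
  \<open>K\<close>. This is less than one heavy arc and, by the hypothesis on \<open>thr\<close>,
  within the threshold.\<close>

lemma accept_complete:
 fixes \<beta> :: real
 assumes H: "pair_digraph H" "parcs H = Fd" "pverts H <= set VH"
  and K: "K <= light" "separates K" "real scale * (max \<beta> 0 * real (cost K)) <= real thr * real (card centers)"
  and es: "multicut H inst_graph (set es)"
   "(\<Sum>e\<in>set es. of_rat (inst_weight e)) <= \<beta> * multicut_opt H inst_graph (%e. of_rat (inst_weight e))"
  and CB: "!!e. e : E0 ==> W e <= Wm" "max \<beta> 0 * real Wm <= 2 ^ CB"
 shows "accepts input es"
proof -
 define w where "w a = real (if wlist a = [] then big input else hd (wlist a))" for a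
 have w: "of_rat (inst_weight (acode a)) = w a" if "a : graph" for a by (simp add: inst_weight_acode[OF that] w_def)
 have Kg: "K <= graph" using K(1) by (auto simp: graph_def)
 have finM: "finite {K. multicut H inst_graph K}"
  by (rule finite_subset[of _ "Pow (parcs inst_graph)"]) (auto simp: multicut_def inst_graph_def fin_graph)
 have wl: "w a = real (hd (wlist a))" if "a : light" for a using light_wlist[OF that] by (simp add: w_def)
 have costK: "(\<Sum>e\<in>acode ` K. of_rat (inst_weight e)) = real (cost K)"
 proof -
  have "(\<Sum>e\<in>acode ` K. of_rat (inst_weight e)) = (\<Sum>a\<in>K. of_rat (inst_weight (acode a)) :: real)"
   by (subst sum.reindex) (use inj_acode Kg inj_on_subset in "auto simp: comp_def")
  also have "... = (\<Sum>a\<in>K. real (hd (wlist a)))"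
  proof (rule sum.cong[OF refl])
   fix a assume "a : K"
   hence "a : graph" "a : light" using Kg K(1) by blast+
   thus "of_rat (inst_weight (acode a)) = real (hd (wlist a))" by (simp only: w wl)
  qed
  finally show ?thesis using sum_wlist[OF K(1)] by (metis of_nat_sum)
 qed
 let ?opt = "multicut_opt H inst_graph (%e. of_rat (inst_weight e) :: real)"
 have "?opt <= (\<Sum>e\<in>acode ` K. of_rat (inst_weight e))" unfolding multicut_opt_def
  using finM multicut_if_separates[OF H Kg K(2)] by (intro Min_le) auto
 hence opt: "?opt <= real (cost K)" using costK by simp
 have opt0: "0 <= ?opt" unfolding multicut_opt_def
  using finM multicut_if_separates[OF H Kg K(2)] by (subst Min_ge_iff) (auto simp: inst_weight_def intro!: sum_nonneg)
 have "(\<Sum>e\<in>set es. of_rat (inst_weight e)) <= max \<beta> 0 * ?opt"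
  using es(2) mult_right_mono[of \<beta> "max \<beta> 0", OF _ opt0] by linarith
 also have "... <= max \<beta> 0 * real (cost K)" by (rule mult_left_mono[OF opt]) simp
 finally have sol: "(\<Sum>e\<in>set es. of_rat (inst_weight e)) <= max \<beta> 0 * real (cost K)" .
 let ?K = "cut_of (set es)"
 have "acode ` ?K = set es" using es(1) by (auto simp: cut_of_def multicut_def inst_graph_def)
 moreover have Kg': "?K <= graph" by (auto simp: cut_of_def)
 moreover have inj': "inj_on acode ?K" using inj_acode Kg' by (rule inj_on_subset)
 ultimately have "(\<Sum>e\<in>set es. of_rat (inst_weight e)) = (\<Sum>a\<in>?K. of_rat (inst_weight (acode a)) :: real)"
  using sum.reindex[OF inj', of "%e. of_rat (inst_weight e) :: real"] by (simp add: comp_def)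
 also have "... = (\<Sum>a\<in>?K. w a)" using w Kg' by (intro sum.cong) auto
 finally have sumw: "(\<Sum>a\<in>?K. w a) <= max \<beta> 0 * real (cost K)" using sol by simp
 have finK: "finite ?K" using Kg' fin_graph finite_subset by blast
 have w0: "0 <= w a" for a by (simp add: w_def)
 have "?K Int heavy = {}"
 proof (rule ccontr)
  \<comment> \<open>One heavy arc weighs at least \<open>2 ^ (n + CB)\<close> when \<open>n\<close>
    arcs are listed, which exceeds \<open>max \<beta> 0\<close> times the cost of any set of light
    arcs.\<close>
  assume "?K Int heavy ~= {}"
  then obtain a where a: "a : ?K" "a : heavy" by blast
  have "real (big input) = w a" using heavy_wlist[OF a(2)] by (simp add: w_def)
  also have "... <= (\<Sum>a\<in>?K. w a)" using a(1) finK w0 by (intro member_le_sum) auto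
  also have "... <= max \<beta> 0 * real (cost K)" by (rule sumw)
  finally have b1: "real (big input) <= max \<beta> 0 * real (cost K)" .
  let ?n = "length (all_arcs input)"
  have "cost K = (\<Sum>a\<in>K. hd (wlist a))" by (rule sum_wlist[OF K(1), symmetric])
  also have "... <= (\<Sum>a\<in>K. Wm)" using K(1) CB(1) by (intro sum_mono) (auto simp: light_def wlist_def)
  also have "... = card K * Wm" by simp
  also have "card K <= ?n"
  proof -
   have "card K <= card graph" by (rule card_mono[OF fin_graph Kg])
   also have "... = card (acode ` graph)" by (rule card_image[OF inj_acode, symmetric])
   also have "acode ` graph = fst ` set (all_arcs input)" by (simp add: set_all_arcs image_image)
   also have "card ... <= ?n" using card_image_le[OF finite_set, of fst "all_arcs input"] card_length[of "all_arcs input"] by (rule order_trans)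
   finally show ?thesis .
  qed
  finally have "cost K <= ?n * Wm" by simp
  hence "max \<beta> 0 * real (cost K) <= max \<beta> 0 * real (?n * Wm)" by (intro mult_left_mono of_nat_mono) auto
  also have "... = (max \<beta> 0 * real Wm) * real ?n" by simp
  also have "... <= 2 ^ CB * real ?n" using CB(2) by (intro mult_right_mono) auto
  also have "... < 2 ^ CB * 2 ^ ?n" using of_nat_less_two_power[of ?n, where 'a = real] by simp
  also have "... = real (2 ^ length (map (%_. True) (all_arcs input) @ replicate CB True))" by (simp add: power_add mult.commute)
  also have "... <= real (big input)" unfolding big_def by (rule of_nat_mono[OF num_ge])
  finally show False using b1 by simp
 qed
 moreover have "scale * cost ?K <= thr * card centers"
 proof -
  have "real (cost ?K) = real (cost (?K Int light))" by (simp add: cost_light)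
  also have "... = (\<Sum>a\<in>?K \<inter> light. real (hd (wlist a)))" using sum_wlist[of "?K Int light"] by (metis inf_le2 of_nat_sum)
  also have "... = (\<Sum>a\<in>?K \<inter> light. w a)" by (rule sum.cong) (auto simp: wl)
  also have "... <= (\<Sum>a\<in>?K. w a)" using finK w0 by (intro sum_mono2) auto
  finally have "real (cost ?K) <= max \<beta> 0 * real (cost K)" using sumw by linarith
  hence "real scale * real (cost ?K) <= real scale * (max \<beta> 0 * real (cost K))" by (rule mult_left_mono) simp
  hence "real (scale * cost ?K) <= real (thr * card centers)" using K(3) by simp
  thus ?thesis by (simp only: of_nat_le_iff)
 qed
 ultimately show ?thesis by (simp add: accepts_iff)
qed

end

section \<open>P is contained in NP\<close>

lemma pcr_unquote: "pcr enc (%x. x) (%x :: bool list. x)"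
proof -
 let ?e = "%b :: bool. [b]"
 have "pcr (enc_prod ?e (%x. x)) (%x. x) (%(b, w). b # w)"
  by (rule pcr_if_pt[OF pt_id]) auto
 hence "pcr (enc_prod (enc_list ?e) (%x. x)) (%x. x) (%(xs, st). fold (#) xs st)"
 proof (rule pcr_fold[OF sd_bool, where K = 1])
  fix xs st :: "bool list"
  show "length (fold (#) xs st) <= (length (enc_list ?e xs) + length st + 2) ^ 1"
   using length_le_enc_list[of xs ?e] by (simp add: fold_Cons_rev)
 qed
 moreover have "pcr enc (enc_prod (enc_list ?e) (%x. x)) (%xs. (xs, []))"
  by (rule pcr_if_pt[OF pt_id]) (simp add: enc_list_def' enc_bool_def[abs_def])
 ultimately have "pcr enc (%x. x) (%xs. fold (#) (rev xs) [])"
  using pcr_comp[OF pcr_comp[OF pc_rev[OF pcr_id]]] by fastforce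
 thus ?thesis by (simp add: fold_Cons_rev)
qed

lemma pcr_quote: "pcr (%x. x) enc (%x :: bool list. x)"
 by (rule pcr_if_pt[OF pt_enc_word]) (simp add: enc_word_enc)

text \<open>A total decoder for the first component of a certificate word; the two flags say whether the
 end of the first component has been seen and whether the next bit is a data bit.\<close>

definition decode_step :: "bool => bool * bool * bool list => bool * bool * bool list" where
 "decode_step b s = (if fst s then s else if fst (snd s) then (False, False, b # snd (snd s))
  else if b then (False, True, snd (snd s)) else (True, False, snd (snd s)))"

definition decode :: "bool list => bool list" where
 "decode w = rev (snd (snd (fold decode_step w (False, False, []))))"

lemma decode_enc_word: "decode (enc_word x @ y) = x"
proof -
 have d: "fold decode_step y (True, False, acc) = (True, False, acc)" for acc by (induction y) (auto simp: decode_step_def)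
 have "fold decode_step (enc_word x @ y) (False, False, acc) = (True, False, rev x @ acc)" for acc
  unfolding enc_word_def by (induction x arbitrary: acc) (auto simp: decode_step_def d)
 thus ?thesis by (simp add: decode_def)
qed

lemma pc_decode: "pc decode"
proof -
 have "pc (%w. fold ((%_::bool. decode_step) True) w (False, False, []))"
 proof (rule pc_fold_ctx[where K = 2 and c = "%_. True"])
  show "pc (%p :: bool * bool * bool * bool * bool list. decode_step (fst (snd p)) (snd (snd p)))"
   unfolding decode_step_def by (intro pc_if pcr_pair pc_Cons pc_fst pc_snd pcr_id pcr_const)
  fix c b :: bool and s :: "bool * bool * bool list"
  show "length (enc (decode_step b s)) <= length (enc s) + (length (enc c) + length (enc b) + 2) ^ 2"
   by (cases s) (auto simp: decode_step_def enc_bool_def)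
 qed (intro pcr_id pcr_const)+
 thus ?thesis unfolding decode_def[abs_def] by (intro pc_rev pc_snd) simp
qed

text \<open>The hypothesis is an inequality of classes, so the inclusion of NP in P becomes a
  contradiction only with this converse. The zero polynomial admits the empty certificate only, and
  the verifier just undoes the quotation of \<open>x\<close>.\<close>

lemma P_subset_NP: "class_P <= class_NP"
proof
 fix L assume "L : class_P"
 hence "pt (%x. [x : L])" by (simp add: class_P_def pt_if_polytime)
 hence "pcr (%x. x) (%x. x) (%x. [x : L])" by (rule pcr_if_pt) simp
 hence "pcr (%x. x) (%x. x) (%w. [decode w : L])"
  by (rule pcr_comp[OF pcr_comp[OF pcr_comp[OF pcr_quote pc_decode] pcr_unquote]])
 hence "polytime (%w. [w : {w. decode w : L}])" by (simp add: polytime_if_pt pt_if_pcr)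
 hence R: "{w. decode w : L} : class_P" by (simp add: class_P_def)
 have "\<forall>x. x : L \<longleftrightarrow> (\<exists>y. length y <= poly 0 (length x) & enc_word x @ y : {w. decode w : L})"
  using decode_enc_word by auto
 thus "L : class_NP" unfolding class_NP_def using R by blast
qed

section \<open>Correctness of the reduction\<close>

context coded_reduction
begin

text \<open>\<open>completeness\<close> per center: at most a \<zeta> fraction of the constraints is
  violated, and bad centers contribute the summand with \<zeta>.\<close>

lemma accepts_if_value_high:
 fixes \<beta> \<zeta> :: real
 assumes H: "pair_digraph H" "parcs H = Fd" "pverts H <= set VH"
  and far: "!!s d n. (s, d) : Fd ==> dist_reach E0 X s d n ==> D <= n"
  and l: "!!e. e : E ==> l (fst e) < k" and sat: "(1 - \<zeta>) * real (card E) <= real (card {e : E. \<pi> e (l (fst e)) = l (snd e)})"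
  and es: "multicut H inst_graph (set es)"
   "(\<Sum>e\<in>set es. of_rat (inst_weight e)) <= \<beta> * multicut_opt H inst_graph (%e. of_rat (inst_weight e))"
  and CB: "max \<beta> 0 * real (sum W E0) <= 2 ^ CB"
  and thr: "real scale * (max \<beta> 0 * (real (\<Sum>e\<in>E0. W e * (X e + 1)) / (real D + 1) + 2 * \<zeta> * real t * real (sum W E0)) * (real t * (real D + 1) ^ k)) <= real thr"
 shows "accepts input es"
proof -
 define v where "v = card {e : E. \<pi> e (l (fst e)) ~= l (snd e)}"
 define SX where "SX = (\<Sum>e\<in>E0. W e * (X e + 1))"
 define N where "N = (real D + 1) ^ k"
 have "\<exists>K \<subseteq> light. separates K &
  cost K <= card centers * (t * SX * (D + 1) ^ (k - 1)) + 2 * t * v * card E ^ t * (t * sum W E0 * (D + 1) ^ k)"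
  unfolding SX_def by (rule completeness[where l = l and v = v, OF far l]) (simp_all only: v_def order_refl)
 then obtain K where K: "K <= light" "separates K"
  "cost K <= card centers * (t * SX * (D + 1) ^ (k - 1)) + 2 * t * v * card E ^ t * (t * sum W E0 * (D + 1) ^ k)" by blast
 have "card {e : E. \<pi> e (l (fst e)) = l (snd e)} + v = card E"
 proof -
  have "card ({e : E. \<pi> e (l (fst e)) = l (snd e)} Un {e : E. \<pi> e (l (fst e)) ~= l (snd e)}) = card {e : E. \<pi> e (l (fst e)) = l (snd e)} + v"
   unfolding v_def using fin_E by (intro card_Un_disjoint) auto
  moreover have "{e : E. \<pi> e (l (fst e)) = l (snd e)} Un {e : E. \<pi> e (l (fst e)) ~= l (snd e)} = E" by auto
  ultimately show ?thesis by simp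
 qed
 hence "real (card {e : E. \<pi> e (l (fst e)) = l (snd e)}) + real v = real (card E)" by (metis of_nat_add)
 hence v: "real v <= \<zeta> * real (card E)" using sat by (simp add: algebra_simps)
 have Nk: "(real D + 1) ^ (k - 1) = N / (real D + 1)" unfolding N_def using k by (cases k) (auto simp: field_simps)
 have cc: "real (card centers) = real (card E) * real (card E) ^ t" by (simp add: card_centers)
 have "real (cost K) <= real (card centers * (t * SX * (D + 1) ^ (k - 1)) + 2 * t * v * card E ^ t * (t * sum W E0 * (D + 1) ^ k))"
  by (rule of_nat_mono[OF K(3)])
 also have "... = real (card centers) * (real t * real SX * (real D + 1) ^ (k - 1)) + 2 * real t * real v * real (card E) ^ t * (real t * real (sum W E0) * N)"
  by (simp only: of_nat_add of_nat_mult of_nat_power of_nat_1 of_nat_numeral N_def)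
 also have "... <= real (card centers) * (real t * real SX * (real D + 1) ^ (k - 1)) + 2 * real t * (\<zeta> * real (card E)) * real (card E) ^ t * (real t * real (sum W E0) * N)"
  using v by (intro add_left_mono mult_right_mono mult_left_mono) (auto simp: N_def intro!: mult_nonneg_nonneg sum_nonneg)
 also have "... = real (card centers) * ((real SX / (real D + 1) + 2 * \<zeta> * real t * real (sum W E0)) * (real t * N))"
  unfolding Nk cc by (simp add: algebra_simps)
 finally have c: "real (cost K) <= real (card centers) * ((real SX / (real D + 1) + 2 * \<zeta> * real t * real (sum W E0)) * (real t * N))" .
 have "real scale * (max \<beta> 0 * real (cost K)) <= real scale * (max \<beta> 0 * (real (card centers) * ((real SX / (real D + 1) + 2 * \<zeta> * real t * real (sum W E0)) * (real t * N))))"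
  by (intro mult_left_mono c) auto
 also have "... = (real scale * (max \<beta> 0 * (real SX / (real D + 1) + 2 * \<zeta> * real t * real (sum W E0)) * (real t * N))) * real (card centers)"
  by (simp only: mult.assoc mult.left_commute mult.commute)
 also have "... <= real thr * real (card centers)" using thr unfolding SX_def N_def by (rule mult_right_mono) simp
 finally have K3: "real scale * (max \<beta> 0 * real (cost K)) <= real thr * real (card centers)" .
 have "W e <= sum W E0" if "e : E0" for e using fin_E0 that by (intro member_le_sum) auto
 thus ?thesis by (rule accept_complete[OF H K(1,2) K3 es _ CB])
qed

text \<open>By the choice of \<gamma>, \<open>soundness\<close> loses at most a \<delta> fraction of
  the centers, and the cost at the remaining ones exceeds the threshold.\<close>

lemma not_accepts_if_value_low:
 fixes \<delta> \<gamma> :: real and opt :: nat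
 assumes H: "pair_digraph H" "parcs H = Fd" "pverts H <= set VH"
  and \<delta>: "0 < \<delta>" "3 * \<delta> <= 1" and car: "!!A. A <= cube D k ==> \<delta> * (real D + 1) ^ k <= real (card A) ==> \<exists>L. carries D k tc T A L"
  and big: "real T < \<delta> * real t" and gap: "!!F. F <= E0 ==> (\<forall>(s, d)\<in>Fd. (s, d) ~: (E0 - F)\<^sup>*) ==> opt <= sum W F"
  and V: "finite V" "E <= V \<times> V" and Q: "Q = 2 * (card Fd * card E0 * T) + 1"
  and sat: "!!l. l : V \<rightarrow>\<^sub>E {..<k} ==> real (card {e : E. \<pi> e (l (fst e)) = l (snd e)}) <= \<gamma> * real (card E)"
  and \<gamma>: "2 * real (t * t) * real (Q * Q) * \<gamma> <= \<delta>"
  and es: "multicut H inst_graph (set es)"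
  and thr: "real thr < real scale * ((1 - \<delta>) * (1 - 3 * \<delta>) * real opt) * (real t * (real D + 1) ^ k)"
 shows "~ accepts input es"
proof
 assume acc: "accepts input es"
 let ?K = "cut_of (set es)"
 have K: "?K Int heavy = {}" "scale * cost ?K <= thr * card centers" using acc by (auto simp: accepts_iff)
 have sep: "separates ?K" by (rule separates_if_multicut[OF H es])
 obtain l where l: "l : V \<rightarrow>\<^sub>E {..<k}"
  "(real (card centers) - real (2 * (t * t) * card E ^ t * (Q * Q * card {e : E. \<pi> e (l (fst e)) = l (snd e)}))) *
  ((1 - 3 * \<delta>) * real t * (real D + 1) ^ k * real opt) <= real (cost ?K)"
  using soundness[OF \<delta>(1) car big gap K(1) sep V \<delta>(2) Q] by blast
 let ?s = "card {e : E. \<pi> e (l (fst e)) = l (snd e)}"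
 have cc: "real (card centers) = real (card E) * real (card E) ^ t" by (simp add: card_centers)
 have cpos: "0 < real (card centers)" unfolding cc using card_E_pos by simp
 have "real (2 * (t * t) * card E ^ t * (Q * Q * ?s)) = 2 * real (t * t) * real (Q * Q) * real (card E) ^ t * real ?s" by simp
 also have "... <= 2 * real (t * t) * real (Q * Q) * real (card E) ^ t * (\<gamma> * real (card E))"
  using sat[OF l(1)] by (intro mult_left_mono) auto
 also have "... = (2 * real (t * t) * real (Q * Q) * \<gamma>) * real (card centers)" unfolding cc by (simp only: mult.assoc mult.left_commute mult.commute)
 also have "... <= \<delta> * real (card centers)" by (rule mult_right_mono[OF \<gamma>]) simp
 finally have "(1 - \<delta>) * real (card centers) <= real (card centers) - real (2 * (t * t) * card E ^ t * (Q * Q * ?s))" by (simp add: algebra_simps)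
 hence "(1 - \<delta>) * real (card centers) * ((1 - 3 * \<delta>) * real t * (real D + 1) ^ k * real opt) <= real (cost ?K)"
  using \<delta>(2) by (intro order_trans[OF mult_right_mono l(2)]) (auto intro!: mult_nonneg_nonneg)
 hence "real scale * ((1 - \<delta>) * real (card centers) * ((1 - 3 * \<delta>) * real t * (real D + 1) ^ k * real opt)) <= real scale * real (cost ?K)"
  by (rule mult_left_mono) simp
 also have "... <= real thr * real (card centers)" using of_nat_mono[OF K(2), where 'a = real] by simp
 also have "... < real scale * ((1 - \<delta>) * (1 - 3 * \<delta>) * real opt) * (real t * (real D + 1) ^ k) * real (card centers)"
  using thr cpos by (rule mult_strict_right_mono)
 finally show False by (simp only: mult.assoc mult.left_commute mult.commute)
qed

end

section \<open>Reading the game, choosing the parameters, conclusion\<close>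

lemma ug_encode_eq_enc:
 "ug_encode k G \<pi> = enc (sorted_list_of_set (pverts G), map (%e. (e, map (\<pi> e) [0..<k])) (sorted_list_of_set (parcs G)))"
proof -
 have "enc_list enc_nat xs = enc xs" for xs by (simp add: enc_list_def' enc_nat_def')
 moreover have "enc_arc e = enc e" for e by (simp add: enc_arc_def enc_prod_def' enc_prod_def enc_nat_def')
 ultimately show ?thesis by (simp add: ug_encode_def enc_digraph_def enc_map)
qed

lemma ug_value_geD:
 assumes "ug_instance k G \<pi>" "x <= ug_value k G \<pi>"
 shows "\<exists>l\<in>pverts G \<rightarrow>\<^sub>E {..<k}. x * real (card (parcs G)) <= real (card {e : parcs G. \<pi> e (l (fst e)) = l (snd e)})"
proof -
 interpret pair_digraph G using assms(1) by (simp add: ug_instance_def)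
 let ?f = "%l. real (card {e : parcs G. \<pi> e (l (fst e)) = l (snd e)}) / real (card (parcs G))"
 have "finite (pverts G \<rightarrow>\<^sub>E {..<k})" by (intro finite_PiE pair_finite_verts) simp
 moreover have "0 : {..<k}" using assms(1) by (simp add: ug_instance_def)
 hence "pverts G \<rightarrow>\<^sub>E {..<k} ~= {}" unfolding PiE_eq_empty_iff by blast
 ultimately have "ug_value k G \<pi> : ?f ` (pverts G \<rightarrow>\<^sub>E {..<k})" unfolding ug_value_def by (intro Max_in) auto
 then obtain l where l: "l : pverts G \<rightarrow>\<^sub>E {..<k}" "ug_value k G \<pi> = ?f l" by auto
 have "0 < real (card (parcs G))" using assms(1) pair_finite_arcs by (auto simp: ug_instance_def card_gt_0_iff)
 thus ?thesis using l assms(2) by (intro bexI[of _ l]) (auto simp: field_simps)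
qed

lemma ug_value_leD:
 assumes "ug_instance k G \<pi>" "ug_value k G \<pi> <= x" "l : pverts G \<rightarrow>\<^sub>E {..<k}"
 shows "real (card {e : parcs G. \<pi> e (l (fst e)) = l (snd e)}) <= x * real (card (parcs G))"
proof -
 interpret pair_digraph G using assms(1) by (simp add: ug_instance_def)
 let ?f = "%l. real (card {e : parcs G. \<pi> e (l (fst e)) = l (snd e)}) / real (card (parcs G))"
 have "finite (pverts G \<rightarrow>\<^sub>E {..<k})" by (intro finite_PiE pair_finite_verts) simp
 hence "?f l <= ug_value k G \<pi>" unfolding ug_value_def using assms(3) by (intro Max_ge) auto
 hence le: "?f l <= x" using assms(2) by (rule order_trans)
 have pos: "0 < real (card (parcs G))" using assms(1) pair_finite_arcs by (auto simp: ug_instance_def card_gt_0_iff)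
 show ?thesis using le unfolding pos_divide_le_eq[OF pos] .
qed

text \<open>\<delta> comes from the gap, the core sizes from \<delta>, then enough slots for the
  pigeonhole argument, then \<zeta> small against the number of slots, and last an integer
  threshold. All of them precede \<open>k\<close>.\<close>

lemma parameters_exist:
 fixes b SX SW :: real and D opt :: nat
 assumes D: "1 <= D" and opt: "0 < opt" and b: "0 <= b" "0 <= SX" "0 <= SW" and gap: "b * SX < (real D + 1) * real opt"
 obtains \<delta> \<zeta> :: real and tc T t scale P :: nat where "0 < \<delta>" "3 * \<delta> <= 1" "1 <= t" "real T < \<delta> * real t"
  "\<forall>k A. A <= cube D k & \<delta> * (real D + 1) ^ k <= real (card A) --> (\<exists>L. carries D k tc T A L)" "0 < \<zeta>"
  "real scale * (b * (SX / (real D + 1) + 2 * \<zeta> * real t * SW)) <= real P" "real P < real scale * ((1 - \<delta>) * (1 - 3 * \<delta>) * real opt)"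
proof -
 define r where "r = b * SX / ((real D + 1) * real opt)"
 have pos: "0 < (real D + 1) * real opt" using opt by simp
 have r: "0 <= r" "r < 1" using b gap pos_divide_less_eq[OF pos] by (simp_all add: r_def)
 \<comment> \<open>Now \<open>r\<close> is \<open>1 - 8 * \<delta>\<close>, which stays below
   \<open>(1 - \<delta>) * (1 - 3 * \<delta>)\<close>, since this product is at least
   \<open>1 - 4 * \<delta>\<close>.\<close>
 define \<delta> where "\<delta> = (1 - r) / 8"
 have \<delta>: "0 < \<delta>" "3 * \<delta> <= 1" using r by (auto simp: \<delta>_def)
 have "r < 1 - 4 * \<delta>" using r by (simp add: \<delta>_def field_simps)
 also have "... <= (1 - \<delta>) * (1 - 3 * \<delta>)" by (simp add: algebra_simps)
 finally have "r * real opt < (1 - \<delta>) * (1 - 3 * \<delta>) * real opt" using opt by (intro mult_strict_right_mono) auto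
 moreover have "r * real opt = b * SX / (real D + 1)" unfolding r_def divide_divide_eq_left[symmetric] using opt by simp
 ultimately have lt: "b * SX / (real D + 1) < (1 - \<delta>) * (1 - 3 * \<delta>) * real opt" by simp
 obtain tc T where car: "\<forall>k A. A <= cube D k & \<delta> * (real D + 1) ^ k <= real (card A) --> (\<exists>L. carries D k tc T A L)"
  using carries_exists[OF D \<delta>(1)] by blast
 obtain t0 :: nat where "real T / \<delta> < real t0" using reals_Archimedean2 by blast
 hence t: "real T < \<delta> * real (Suc t0)" using \<delta> by (simp add: field_simps)
 define gp where "gp = (1 - \<delta>) * (1 - 3 * \<delta>) * real opt - b * SX / (real D + 1)"
 have gp: "0 < gp" using lt by (simp add: gp_def)
 define C where "C = 2 * b * real (Suc t0) * SW"
 have C: "0 <= C" using b by (simp add: C_def)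
 define \<zeta> where "\<zeta> = gp / (2 * (C + 1))"
 have \<zeta>: "0 < \<zeta>" using gp C by (simp add: \<zeta>_def)
 have "C * \<zeta> < gp"
 proof -
  have "C * \<zeta> = gp * (C / (2 * (C + 1)))" by (simp add: \<zeta>_def)
  also have "... < gp * 1" using gp C by (intro mult_strict_left_mono) (auto simp: field_simps)
  finally show ?thesis by simp
 qed
 define y where "y = b * (SX / (real D + 1) + 2 * \<zeta> * real (Suc t0) * SW)"
 have "y = b * SX / (real D + 1) + C * \<zeta>" by (simp add: y_def C_def algebra_simps)
 hence y: "y < (1 - \<delta>) * (1 - 3 * \<delta>) * real opt" using \<open>C * \<zeta> < gp\<close> by (simp add: gp_def)
 have y0: "0 <= y" unfolding y_def using b \<zeta> by (intro mult_nonneg_nonneg add_nonneg_nonneg) auto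
 define z where "z = (1 - \<delta>) * (1 - 3 * \<delta>) * real opt"
 \<comment> \<open>Stretching the interval from \<open>y\<close> to \<open>z\<close> to a length
   above 1 puts an integer \<open>P\<close> into it.\<close>
 obtain scale :: nat where "1 / (z - y) < real scale" using reals_Archimedean2 by blast
 hence sc: "1 < real scale * (z - y)" using y by (simp add: z_def field_simps)
 define P where "P = nat \<lceil>real scale * y\<rceil>"
 have "0 <= real scale * y" using y0 by simp
 hence P: "real scale * y <= real P" "real P < real scale * y + 1" unfolding P_def by (simp_all add: of_nat_nat) linarith+
 have "real P < real scale * z" using P(2) sc by (simp add: algebra_simps)
 hence "real P < real scale * ((1 - \<delta>) * (1 - 3 * \<delta>) * real opt)" by (simp only: z_def)
 moreover have "1 <= Suc t0" by simp
 ultimately show thesis using that[OF \<delta> _ t car \<zeta> P(1)[unfolded y_def]] by blast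
qed

theorem theorem2:
  fixes H :: "nat pair_pre_digraph" and \<epsilon> :: real
  assumes "class_P \<noteq> class_NP"
    and "unique_games_conjecture"
    and "pair_digraph H"
    and "directed_bipartite H"
    and "parcs H \<noteq> {}"
    and "\<epsilon> > 0"
  shows "\<not> (\<exists>A. polytime A \<and> multicut_approx_alg H (flow_cut_gap H - \<epsilon>) A)"
proof
 assume "\<exists>A. polytime A & multicut_approx_alg H (flow_cut_gap H - \<epsilon>) A"
 then obtain A where A: "polytime A" "multicut_approx_alg H (flow_cut_gap H - \<epsilon>) A" by blast
 define \<beta> where "\<beta> = flow_cut_gap H - \<epsilon>"
 interpret H: pair_digraph H by (rule assms)
 have "\<beta> < flow_cut_gap H" using assms(6) by (simp add: \<beta>_def)
 from gap_instance_exists[OF assms(3,5) this] obtain E0 X W D opt where E0: "finite E0" "1 <= D" "\<forall>e\<in>E0. X e <= D"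
  and far: "\<forall>s d n. (s, d) : parcs H --> dist_reach E0 X s d n --> D <= n"
  and gap: "\<forall>F. F <= E0 --> (\<forall>(s, d)\<in>parcs H. (s, d) ~: (E0 - F)\<^sup>*) --> opt <= sum W F" and opt: "0 < opt"
  and strict: "max \<beta> 0 * real (\<Sum>e\<in>E0. W e * (X e + 1)) < (real D + 1) * real opt"
  by (elim exE conjE) (rule that; assumption)
 let ?SX = "real (\<Sum>e\<in>E0. W e * (X e + 1))" and ?SW = "real (sum W E0)"
 obtain \<delta> \<zeta> :: real and tc T t scale P :: nat where \<delta>: "0 < \<delta>" "3 * \<delta> <= 1" and t: "1 <= t" "real T < \<delta> * real t"
  and car: "\<forall>k A. A <= cube D k & \<delta> * (real D + 1) ^ k <= real (card A) --> (\<exists>L. carries D k tc T A L)"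
  and \<zeta>: "0 < \<zeta>" and P: "real scale * (max \<beta> 0 * (?SX / (real D + 1) + 2 * \<zeta> * real t * ?SW)) <= real P"
   "real P < real scale * ((1 - \<delta>) * (1 - 3 * \<delta>) * real opt)"
  by (rule parameters_exist[OF E0(2) opt max.cobounded2 of_nat_0_le_iff of_nat_0_le_iff strict])
 define Q where "Q = 2 * (card (parcs H) * card E0 * T) + 1"
 \<comment> \<open>Makes the centers with colliding slots, as bounded in \<open>soundness\<close>,
   at most a \<delta> fraction of all.\<close>
 define \<gamma> where "\<gamma> = \<delta> / (2 * real (t * t) * real (Q * Q))"
 have "0 < Q" by (simp add: Q_def)
 hence "0 < 2 * real (t * t) * real (Q * Q)" using t(1) by simp
 hence \<gamma>: "0 < \<gamma>" "2 * real (t * t) * real (Q * Q) * \<gamma> <= \<delta>" using \<delta>(1) unfolding \<gamma>_def by simp_all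
 obtain k where hard: "NP_hard_to_distinguish
   {ug_encode k G \<pi> |G \<pi>. ug_instance k G \<pi> & ug_value k G \<pi> >= 1 - \<zeta>}
   {ug_encode k G \<pi> |G \<pi>. ug_instance k G \<pi> & ug_value k G \<pi> <= \<gamma>}"
  using assms(2) \<zeta> \<gamma>(1) unfolding unique_games_conjecture_def by blast
 define U where "U = t * (D + 1) ^ k"
 have U: "real U = real t * (real D + 1) ^ k" "0 < real U" using t by (simp_all add: U_def add.commute)
 define thr where "thr = P * U"
 have thr: "real scale * (max \<beta> 0 * (?SX / (real D + 1) + 2 * \<zeta> * real t * ?SW) * (real t * (real D + 1) ^ k)) <= real thr"
  "real thr < real scale * ((1 - \<delta>) * (1 - 3 * \<delta>) * real opt) * (real t * (real D + 1) ^ k)"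
 proof -
  have "real scale * (max \<beta> 0 * (?SX / (real D + 1) + 2 * \<zeta> * real t * ?SW)) * real U <= real P * real U"
   by (rule mult_right_mono[OF P(1)]) simp
  thus "real scale * (max \<beta> 0 * (?SX / (real D + 1) + 2 * \<zeta> * real t * ?SW) * (real t * (real D + 1) ^ k)) <= real thr"
   unfolding thr_def U(1)[symmetric] of_nat_mult by (simp only: mult.assoc)
  have "real P * real U < real scale * ((1 - \<delta>) * (1 - 3 * \<delta>) * real opt) * real U"
   by (rule mult_strict_right_mono[OF P(2) U(2)])
  thus "real thr < real scale * ((1 - \<delta>) * (1 - 3 * \<delta>) * real opt) * (real t * (real D + 1) ^ k)"
   unfolding thr_def U(1)[symmetric] of_nat_mult .
 qed
 obtain B where "\<forall>h\<in>pverts H. h < B" using H.pair_finite_verts finite_nat_set_iff_bounded by blast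
 hence B: "h < 2 ^ B" if "h : pverts H" for h using that less_exp[of B] by (meson less_trans)
 obtain CB :: nat where "max \<beta> 0 * ?SW < real CB" using reals_Archimedean2 by blast
 moreover have "real CB < 2 ^ CB" by (rule of_nat_less_two_power)
 ultimately have CB: "max \<beta> 0 * ?SW <= 2 ^ CB" by linarith
 define VH where "VH = sorted_list_of_set (pverts H)"
 have VH: "pverts H <= set VH" using H.pair_finite_verts by (simp add: VH_def)
 \<comment> \<open>The tables are constants of the program, so any enumeration of the finite set of
   templates will do.\<close>
 define tab where "tab j p = (SOME l. set l = templates (parcs H) E0 X W D k j p)" for j p
 have tab: "set (tab j p) = templates (parcs H) E0 X W D k j p" for j p
  unfolding tab_def by (rule someI_ex) (rule finite_list[OF finite_templates[OF E0(1)]])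
 let ?perms = "{p. length p = k & set p <= {..<k}}"
 have "finite {p. set p <= {..<k} & length p = k}" by (rule finite_lists_length_eq) simp
 hence finperms: "finite ?perms" by (rule back_subst[of finite]) auto
 interpret prog: program B CB t VH tab "W ` E0" scale thr ?perms
  using E0(1) finperms by unfold_locales auto
 have bip: "fst ` parcs H Int snd ` parcs H = {}" using assms(4) unfolding directed_bipartite_def by fastforce
 have coded: "coded_reduction (parcs H) E0 X W D k t (parcs G) \<pi> B tab" if ug: "ug_instance k G \<pi>" for G \<pi>
 proof -
  interpret G: pair_digraph G using ug by (simp add: ug_instance_def)
  have ug': "1 <= k" "parcs G ~= {}" "!!e. e : parcs G ==> bij_betw (\<pi> e) {..<k} {..<k}" using ug by (auto simp: ug_instance_def)
  have sm: "h < 2 ^ B" if "h : fst ` parcs H Un snd ` parcs H" for h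
   using that B H.arc_fst_in_verts H.arc_snd_in_verts by blast
  show ?thesis
  proof unfold_locales
   show "finite (parcs H)" "finite (parcs G)" "finite E0" by (fact H.pair_finite_arcs G.pair_finite_arcs E0(1))+
   show "fst ` parcs H Int snd ` parcs H = {}" by (fact bip)
   show "1 <= D" "1 <= k" "1 <= t" "parcs G ~= {}" by (fact E0(2) ug' t)+
   show "X e <= D" if "e : E0" for e using E0(3) that by blast
   show "fst e ~= snd e" if "e : parcs G" for e by (rule G.pair_no_loops[OF that])
   show "bij_betw (\<pi> e) {..<k} {..<k}" if "e : parcs G" for e by (rule ug'(3)[OF that])
   show "sl_of (parcs G) (fst a) b : parcs G & fst (sl_of (parcs G) (fst a) b) = fst a" if "a : parcs G" "b : parcs G" for a b
    by (rule sl_of_in[OF G.pair_finite_arcs that])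
   show "card {a : parcs G. fst a = fst e} * card {b : parcs G. sl_of (parcs G) (fst e) b = e} <= 2 * card (parcs G)" if "e : parcs G" for e
    by (rule sl_of_balanced[OF G.pair_finite_arcs that])
   show "set (tab j p) = templates (parcs H) E0 X W D k j p" for j p by (rule tab)
   show "h < 2 ^ B" if "h : fst ` parcs H Un snd ` parcs H" for h by (rule sm[OF that])
  qed
 qed
 have "class_NP <= class_P"
 proof
  fix L assume "L : class_NP"
  from bspec[OF hard[unfolded NP_hard_to_distinguish_def] this] obtain f where f: "polytime f"
   "\<forall>x. (x : L --> f x : {ug_encode k G \<pi> |G \<pi>. ug_instance k G \<pi> & ug_value k G \<pi> >= 1 - \<zeta>}) &
    (x ~: L --> f x : {ug_encode k G \<pi> |G \<pi>. ug_instance k G \<pi> & ug_value k G \<pi> <= \<gamma>})"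
   by (elim exE conjE) (rule that; assumption)
  \<comment> \<open>A game coded by \<open>f x\<close> is fixed for every \<open>x\<close> by
    choice; the program sees only the word \<open>f x\<close>.\<close>
  define good where "good x p \<longleftrightarrow> f x = ug_encode k (fst p) (snd p) & ug_instance k (fst p) (snd p) &
   (x : L --> 1 - \<zeta> <= ug_value k (fst p) (snd p)) & (x ~: L --> ug_value k (fst p) (snd p) <= \<gamma>)" for x p
  have "\<exists>p. good x p" for x
  proof (cases "x : L")
   case True
   from spec[OF f(2), of x, THEN conjunct1, THEN mp, OF True] obtain G \<pi>
    where "f x = ug_encode k G \<pi>" "ug_instance k G \<pi>" "1 - \<zeta> <= ug_value k G \<pi>"
    unfolding mem_Collect_eq by (elim exE conjE) (rule that; assumption)
   thus ?thesis using True by (intro exI[of _ "(G, \<pi>)"]) (simp add: good_def)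
  next
   case False
   from spec[OF f(2), of x, THEN conjunct2, THEN mp, OF False] obtain G \<pi>
    where "f x = ug_encode k G \<pi>" "ug_instance k G \<pi>" "ug_value k G \<pi> <= \<gamma>"
    unfolding mem_Collect_eq by (elim exE conjE) (rule that; assumption)
   thus ?thesis using False by (intro exI[of _ "(G, \<pi>)"]) (simp add: good_def)
  qed
  then obtain Gp where Gp: "!!x. good x (Gp x)" by metis
  define G \<pi> where "G x = fst (Gp x)" and "\<pi> x = snd (Gp x)" for x
  have ug: "f x = ug_encode k (G x) (\<pi> x)" "ug_instance k (G x) (\<pi> x)"
   "x : L ==> 1 - \<zeta> <= ug_value k (G x) (\<pi> x)" "x ~: L ==> ug_value k (G x) (\<pi> x) <= \<gamma>" for x
   using Gp[of x] by (simp_all add: good_def G_def \<pi>_def)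
  \<comment> \<open>The constraints with their permutations: the second component of the data coded
    by \<open>f x\<close>, hence available to the program.\<close>
  define as where "as x = map (%e. (e, map (\<pi> x e) [0..<k])) (sorted_list_of_set (parcs (G x)))" for x
  have "pcr (%x. x) enc (%x. (sorted_list_of_set (pverts (G x)), as x))"
   by (rule pcr_if_pt[OF pt_if_polytime[OF f(1)]]) (simp only: ug(1) ug_encode_eq_enc as_def)
  from pc_snd[OF this] have pc_as: "pcr (%x. x) enc as" by simp
  have "pcr (%x. x) (%x. x) (%x. A (enc (prog.instance_of (as x))))"
   by (rule pcr_comp[OF prog.pc_instance_of[OF pc_as] pcr_if_pt[OF pt_if_polytime[OF A(1)]]]) (rule refl)
  hence pt_A: "pt (%x. A (enc (prog.instance_of (as x))))" by (rule pt_if_pcr)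
  have "\<exists>es. A (enc (prog.instance_of (as x))) = enc es & (prog.accepts (as x) es \<longleftrightarrow> x : L)" for x
  proof -
   interpret R: coded_reduction "parcs H" E0 X W D k t "parcs (G x)" "\<pi> x" B CB VH tab scale thr by (rule coded[OF ug(2)])
   interpret G: pair_digraph "G x" using ug(2)[of x] by (simp add: ug_instance_def)
   have inp: "R.input = as x" by (simp add: R.input_def R.plist_def[abs_def] as_def)
   obtain es where es: "A (enc_digraph (%e. enc_rat (R.inst_weight e)) R.inst_graph) = enc_list enc_arc es"
    "multicut H R.inst_graph (set es)"
    "(\<Sum>e\<in>set es. of_rat (R.inst_weight e)) <= \<beta> * multicut_opt H R.inst_graph (%e. of_rat (R.inst_weight e))"
    using A(2) R.inst_multicut_instance[OF VH] unfolding multicut_approx_alg_def \<beta>_def by blast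
   have "enc_arc = enc" by (rule ext) (simp add: enc_arc_def enc_prod_def' enc_prod_def enc_nat_def')
   hence "enc_list enc_arc es = enc es" by (simp add: enc_list_def')
   hence "A (enc (prog.instance_of (as x))) = enc es" using es(1) R.enc_instance inp by simp
   moreover have "prog.accepts (as x) es" if xL: "x : L"
   proof -
    obtain l where l: "l : pverts (G x) \<rightarrow>\<^sub>E {..<k}"
     "(1 - \<zeta>) * real (card (parcs (G x))) <= real (card {e : parcs (G x). \<pi> x e (l (fst e)) = l (snd e)})"
     using ug_value_geD[OF ug(2) ug(3)[OF xL]] by blast
    show ?thesis unfolding inp[symmetric]
    proof (rule R.accepts_if_value_high[where l = l and H = H and \<beta> = \<beta> and \<zeta> = \<zeta>])
     show "D <= n" if "(s, d) : parcs H" "dist_reach E0 X s d n" for s d n using far that by blast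
     show "l (fst e) < k" if "e : parcs (G x)" for e using l(1) G.arc_fst_in_verts[OF that] by auto
    qed (fact assms(3) refl VH l(2) es(2,3) CB thr(1))+
   qed
   moreover have "~ prog.accepts (as x) es" if "x ~: L"
    unfolding inp[symmetric]
   proof (rule R.not_accepts_if_value_low[OF assms(3) refl VH \<delta> _ t(2) _ G.pair_finite_verts _ Q_def _ \<gamma>(2) es(2) thr(2)])
    show "\<exists>L. carries D k tc T A L" if "A <= cube D k" "\<delta> * (real D + 1) ^ k <= real (card A)" for A using car that by blast
    show "opt <= sum W F" if "F <= E0" "\<forall>(s, d)\<in>parcs H. (s, d) ~: (E0 - F)\<^sup>*" for F using gap that by blast
    show "parcs (G x) <= pverts (G x) \<times> pverts (G x)" using G.in_arcsD1 G.in_arcsD2 by auto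
    show "real (card {e : parcs (G x). \<pi> x e (l (fst e)) = l (snd e)}) <= \<gamma> * real (card (parcs (G x)))"
     if "l : pverts (G x) \<rightarrow>\<^sub>E {..<k}" for l by (rule ug_value_leD[OF ug(2) ug(4)[OF \<open>x ~: L\<close>] that])
   qed
   ultimately show ?thesis by blast
  qed
  hence "\<forall>x. \<exists>es. A (enc (prog.instance_of (as x))) = enc es & (prog.accepts (as x) es \<longleftrightarrow> x : L)" by (rule allI)
  from choice[OF this] obtain es where "\<forall>x. A (enc (prog.instance_of (as x))) = enc (es x) & (prog.accepts (as x) (es x) \<longleftrightarrow> x : L)"
   by (elim exE) (rule that)
  hence es: "A (enc (prog.instance_of (as x))) = enc (es x)" "prog.accepts (as x) (es x) \<longleftrightarrow> x : L" for x by simp_all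
  \<comment> \<open>On the instances produced, the algorithm returns the code of an arc list, so its
    answer can be passed on to \<open>accepts\<close> as data.\<close>
  have "pcr (%x. x) enc es" by (rule pcr_if_pt[OF pt_A]) (rule es(1))
  from prog.pc_accepts[OF pc_as this] have "pcr (%x. x) enc (%x. x : L)" by (simp only: es(2))
  moreover have "pcr enc (%x. x) (%b :: bool. enc b)" by (rule pcr_if_pt[OF pt_id]) (rule refl)
  ultimately have "pcr (%x. x) (%x. x) (%x. enc (x : L))" by (rule pcr_comp)
  hence "polytime (%x. [x : L])" unfolding enc_bool_def by (intro polytime_if_pt pt_if_pcr)
  thus "L : class_P" by (simp add: class_P_def)
 qed
 thus False using P_subset_NP assms(1) by blast
qed

end
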